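(* Let $\mathbb{X}=U/K$ be a rank one Riemannian symmetric space of compact type with Laplace-Beltrami operator $\Delta$. For the Schrödinger equation, the Boussinesq equation and the Beam equation, that is, for $$i\frac{\partial u}{\partial t}-\psi\left(\sqrt{-\Delta}\right)u=0,\quad (x,t)\in\mathbb{X}\times[0,2\pi),\qquad u(\cdot,0)=f\ \text{ on }\mathbb{X},$$ with $\psi(r)=r^2$, $\psi(r)=r\sqrt{1+r^2}$ and $\psi(r)=\sqrt{1+r^4}$ respectively, the pointwise convergence of the solution to its initial data, $$\lim_{t\to0+}u(x,t)=f(x),$$ holds for almost every $x\in\mathbb{X}$, whenever $f\in H^\alpha(\mathbb{X})$ is $K$-biinvariant with $\alpha>\tfrac13$.
   Context: The rank one Riemannian symmetric spaces of compact type $\mathbb{X}=U/K$ are, with $d$ the real dimension: the spheres $\mathbb{S}^d$ ($d\ge1$), the real projective spaces $P^d(\mathbb{R})$ ($d\ge2$), the complex projective spaces $P^d(\mathbb{C})$ ($d=4,6,8,\dots$), the quaternionic projective spaces $P^d(\mathbb{H})$ ($d=8,12,16,\dots$) and the Cayley projective plane $P^{16}(Cay)$. The metric is normalized so that the diameter is $\pi$, and the Riemannian measure so that $\mathbb{X}$ has total measure $1$. Fix an origin $o\in\mathbb{X}$; $K$ is the stabilizer of $o$ in $U$. Functions on $\mathbb{X}$ are identified with right $K$-invariant functions on $U$; $K$-biinvariant means both left and right $K$-invariant, and $K$-biinvariant functions are identified with functions on $\mathbb{X}$ that are radial around $o$, i.e. depend only on the geodesic distance $d(o,x)\in[0,\pi]$.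 The eigenvalues of $-\Delta$ are $\lambda_n^2=n(n+\sigma+\tau+1)$, $n=0,1,2,\dots$ ($\lambda_n\ge0$), where $\sigma=\frac{d-2}{2}$ and $\tau=\frac{d-2}{2},-\frac12,0,1,3$ for $\mathbb{S}^d,P^d(\mathbb{R}),P^d(\mathbb{C}),P^d(\mathbb{H}),P^{16}(Cay)$ respectively. The radial functions in the $n$-th eigenspace form a line spanned by $\tilde Z_n$, the $L^2(\mathbb{X})$-normalized positive multiple of $x\mapsto P_n^{(\sigma,\tau)}(\cos d(o,x))$, with $P_n^{(\sigma,\tau)}$ the Jacobi polynomial. A $K$-biinvariant $f\in L^2(\mathbb{X})$ has the expansion $f=\sum_{n\ge0}a_n\tilde Z_n$, and the solution is $u(\cdot,t)=e^{-it\psi(\sqrt{-\Delta})}f=\sum_{n\ge0}e^{-it\psi(\lambda_n)}a_n\tilde Z_n$. For $\alpha\ge0$, $H^\alpha(\mathbb{X})=\{f\in L^2(\mathbb{X}):(I-\Delta)^{\alpha/2}f\in L^2(\mathbb{X})\}$; for $K$-biinvariant $f$ its norm is $\|f\|_{H^\alpha(\mathbb{X})}=\big(\sum_{n=0}^\infty(1+\lambda_n^2)^\alpha|a_n|^2\big)^{1/2}$. *)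

theory Defs
  imports "HOL-Probability.Probability_Measure"
begin

section \<open>Octonions\<close>

text \<open>
  Quaternions and octonions are obtained from the complex numbers by Cayley-Dickson doubling,
  $(a,b)(c,d) = (ac - \bar d b, da + b \bar c)$ and $\overline{(a,b)} = (\bar a, -b)$. As product
  types they carry the Euclidean inner product, which is $\mathrm{Re}(x\bar y)$.
\<close>

type_synonym quat = "complex \<times> complex"
type_synonym oct = "quat \<times> quat"

definition quat_cnj :: "quat \<Rightarrow> quat" where
  "quat_cnj x = (cnj (fst x), - snd x)"

definition quat_mult :: "quat \<Rightarrow> quat \<Rightarrow> quat" where
  "quat_mult x y =
     (fst x * fst y - cnj (snd y) * snd x, snd y * fst x + snd x * cnj (fst y))"

definition oct_cnj :: "oct \<Rightarrow> oct" where
  "oct_cnj x = (quat_cnj (fst x), - snd x)"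

definition oct_mult :: "oct \<Rightarrow> oct \<Rightarrow> oct" where
  "oct_mult x y =
     (quat_mult (fst x) (fst y) - quat_mult (quat_cnj (snd y)) (snd x),
      quat_mult (snd y) (fst x) + quat_mult (snd x) (quat_cnj (fst y)))"

definition oct_one :: oct where
  "oct_one = ((1, 0), 0)"

lemma norm_oct_sq:
  fixes x :: oct
  shows "(norm x)\<^sup>2 = (Re (fst (fst x)))\<^sup>2 + (Im (fst (fst x)))\<^sup>2 +
    (Re (snd (fst x)))\<^sup>2 + (Im (snd (fst x)))\<^sup>2 + (Re (fst (snd x)))\<^sup>2 +
    (Im (fst (snd x)))\<^sup>2 + (Re (snd (snd x)))\<^sup>2 + (Im (snd (snd x)))\<^sup>2"
  by (simp add: norm_prod_def cmod_power2)

lemma oct_mult_cnj: "oct_mult x (oct_cnj x) = (norm x)\<^sup>2 *\<^sub>R oct_one"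
  unfolding norm_oct_sq
  by (simp add: oct_mult_def oct_cnj_def quat_mult_def quat_cnj_def oct_one_def prod_eq_iff
      complex_eq_iff power2_eq_square algebra_simps)

lemma norm_oct_mult: "norm (oct_mult x y) = norm x * norm y"
proof -
  have "(norm (oct_mult x y))\<^sup>2 = (norm x * norm y)\<^sup>2"
    unfolding norm_oct_sq power_mult_distrib
    by (simp add: oct_mult_def quat_mult_def quat_cnj_def power2_eq_square algebra_simps)
  then show ?thesis
    by (simp add: power2_eq_iff_nonneg)
qed

definition oct_R :: "oct set" where
  "oct_R = {((complex_of_real r, 0), 0) | r. True}"

definition oct_C :: "oct set" where
  "oct_C = {((z, 0), 0) | z. True}"

definition oct_H :: "oct set" where
  "oct_H = {(q, 0) | q. True}"

section \<open>The rank one symmetric spaces of compact type\<close>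

text \<open>The numerical argument is always the real dimension $d$.\<close>

datatype rank_one_space = Sphere nat | Proj_R nat | Proj_C nat | Proj_H nat | Proj_Cay

primrec admissible :: "rank_one_space \<Rightarrow> bool" where
  "admissible (Sphere d) = (d \<ge> 1)"
| "admissible (Proj_R d) = (d \<ge> 2)"
| "admissible (Proj_C d) = (d \<ge> 4 \<and> 2 dvd d)"
| "admissible (Proj_H d) = (d \<ge> 8 \<and> 4 dvd d)"
| "admissible Proj_Cay = True"

primrec real_dim :: "rank_one_space \<Rightarrow> nat" where
  "real_dim (Sphere d) = d"
| "real_dim (Proj_R d) = d"
| "real_dim (Proj_C d) = d"
| "real_dim (Proj_H d) = d"
| "real_dim Proj_Cay = 16"

text \<open>
  All spaces are realised inside one type of octonionic matrices, indexed from 0 and padded with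
  zeros: the sphere consists of the real unit column vectors with $d+1$ entries, and the projective
  space over $F$ of the Hermitian idempotents of trace 1 with entries in $F$. For associative $F$
  these are the orthogonal projections $vv^*$ onto the lines of $F^N$; for $3 \times 3$ octonionic
  matrices this is Freudenthal's model of the Cayley plane.
\<close>

type_synonym oct_mat = "nat \<Rightarrow> nat \<Rightarrow> oct"

definition mat_inner :: "nat \<Rightarrow> oct_mat \<Rightarrow> oct_mat \<Rightarrow> real" where
  "mat_inner N A B = (\<Sum>i<N. \<Sum>j<N. A i j \<bullet> B i j)"

definition unit_sphere :: "nat \<Rightarrow> oct_mat set" where
  "unit_sphere N = {A. (\<forall>i j. A i j \<in> oct_R) \<and> (\<forall>i j. i \<ge> N \<or> j \<ge> 1 \<longrightarrow> A i j = 0) \<and>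
     (\<Sum>i<N. (norm (A i 0))\<^sup>2) = 1}"

definition proj_space :: "oct set \<Rightarrow> nat \<Rightarrow> oct_mat set" where
  "proj_space F N = {A. (\<forall>i j. A i j \<in> F) \<and> (\<forall>i j. i \<ge> N \<or> j \<ge> N \<longrightarrow> A i j = 0) \<and>
     (\<forall>i j. A j i = oct_cnj (A i j)) \<and>
     (\<forall>i<N. \<forall>j<N. (\<Sum>k<N. oct_mult (A i k) (A k j)) = A i j) \<and>
     (\<Sum>i<N. A i i) = oct_one}"

primrec mat_size :: "rank_one_space \<Rightarrow> nat" where
  "mat_size (Sphere d) = d + 1"
| "mat_size (Proj_R d) = d + 1"
| "mat_size (Proj_C d) = d div 2 + 1"
| "mat_size (Proj_H d) = d div 4 + 1"
| "mat_size Proj_Cay = 3"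

primrec points :: "rank_one_space \<Rightarrow> oct_mat set" where
  "points (Sphere d) = unit_sphere (mat_size (Sphere d))"
| "points (Proj_R d) = proj_space oct_R (mat_size (Proj_R d))"
| "points (Proj_C d) = proj_space oct_C (mat_size (Proj_C d))"
| "points (Proj_H d) = proj_space oct_H (mat_size (Proj_H d))"
| "points Proj_Cay = proj_space UNIV (mat_size Proj_Cay)"

text \<open>
  Geodesic distance of the metric with diameter $\pi$. On a projective space it is twice the angle
  $\theta$ between lines, and $\langle vv^*, ww^*\rangle = \cos^2\theta = (1 + \cos 2\theta)/2$ for
  unit vectors $v$, $w$.
\<close>

definition geo_dist :: "rank_one_space \<Rightarrow> oct_mat \<Rightarrow> oct_mat \<Rightarrow> real" where
  "geo_dist S x y = (case S of
       Sphere d \<Rightarrow> arccos (mat_inner (mat_size S) x y)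
     | _ \<Rightarrow> arccos (2 * mat_inner (mat_size S) x y - 1))"

definition isometries :: "rank_one_space \<Rightarrow> (oct_mat \<Rightarrow> oct_mat) set" where
  "isometries S = {g. bij_betw g (points S) (points S) \<and>
     (\<forall>x\<in>points S. \<forall>y\<in>points S. geo_dist S (g x) (g y) = geo_dist S x y)}"

text \<open>
  The Riemannian measure of total mass 1 is the unique Borel probability measure on the space that
  is invariant under isometries (the group $U$ already acts transitively by isometries). The
  topology that \<^term>\<open>points S\<close> inherits from the product topology is that of
  \<^term>\<open>geo_dist S\<close>.
\<close>

definition normalized_riemannian_measure :: "rank_one_space \<Rightarrow> oct_mat measure \<Rightarrow> bool" where
  "normalized_riemannian_measure S M \<longleftrightarrow>
     prob_space M \<and> sets M = sets (restrict_space borel (points S)) \<and>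
     (\<forall>g\<in>isometries S. \<forall>A\<in>sets M. emeasure M (g ` A) = emeasure M A)"

section \<open>Spectral data of the Laplacian on radial functions\<close>

definition sigma_par :: "rank_one_space \<Rightarrow> real" where
  "sigma_par S = (real (real_dim S) - 2) / 2"

primrec tau_par :: "rank_one_space \<Rightarrow> real" where
  "tau_par (Sphere d) = (real d - 2) / 2"
| "tau_par (Proj_R d) = - 1 / 2"
| "tau_par (Proj_C d) = 0"
| "tau_par (Proj_H d) = 1"
| "tau_par Proj_Cay = 3"

text \<open>$-\Delta$ has the eigenvalues $\lambda_n^2$.\<close>

definition lam :: "rank_one_space \<Rightarrow> nat \<Rightarrow> real" where
  "lam S n = sqrt (real n * (real n + sigma_par S + tau_par S + 1))"

definition jacobi_poly :: "nat \<Rightarrow> real \<Rightarrow> real \<Rightarrow> real \<Rightarrow> real" where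
  "jacobi_poly n a b x = (\<Sum>s\<le>n. ((real n + a) gchoose (n - s)) * ((real n + b) gchoose s) *
     ((x - 1) / 2) ^ s * ((x + 1) / 2) ^ (n - s))"

definition zonal :: "rank_one_space \<Rightarrow> oct_mat \<Rightarrow> nat \<Rightarrow> oct_mat \<Rightarrow> real" where
  "zonal S p n x = jacobi_poly n (sigma_par S) (tau_par S) (cos (geo_dist S p x))"

definition zonal_normalized ::
    "rank_one_space \<Rightarrow> oct_mat \<Rightarrow> oct_mat measure \<Rightarrow> nat \<Rightarrow> oct_mat \<Rightarrow> real" where
  "zonal_normalized S p M n x = zonal S p n x / sqrt (LINT y|M. (zonal S p n y)\<^sup>2)"

definition fourier_coeff ::
    "rank_one_space \<Rightarrow> oct_mat \<Rightarrow> oct_mat measure \<Rightarrow> (oct_mat \<Rightarrow> complex) \<Rightarrow> nat \<Rightarrow> complex" where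
  "fourier_coeff S p M f n = (LINT x|M. f x * complex_of_real (zonal_normalized S p M n x))"

section \<open>Function spaces and the solution\<close>

definition L2_fun :: "'a measure \<Rightarrow> ('a \<Rightarrow> complex) set" where
  "L2_fun M = {f \<in> borel_measurable M. integrable M (\<lambda>x. (cmod (f x))\<^sup>2)}"

text \<open>
  $K$-biinvariance with $K$ the stabiliser of \<open>p\<close>, read as usual for $L^2$ functions, i.e. up to
  null sets. If \<open>f\<close> is Borel and depends only on the distance to \<open>p\<close> everywhere, then \<open>g\<close> is
  automatically Borel on $[0,\pi]$, being \<open>f\<close> along a geodesic from \<open>p\<close>.
\<close>

definition K_biinvariant ::
    "rank_one_space \<Rightarrow> oct_mat \<Rightarrow> oct_mat measure \<Rightarrow> (oct_mat \<Rightarrow> complex) \<Rightarrow> bool" where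
  "K_biinvariant S p M f \<longleftrightarrow>
     (\<exists>g \<in> borel_measurable borel. AE x in M. f x = g (geo_dist S p x))"

definition sobolev_K_biinvariant ::
    "rank_one_space \<Rightarrow> oct_mat \<Rightarrow> oct_mat measure \<Rightarrow> real \<Rightarrow> (oct_mat \<Rightarrow> complex) set" where
  "sobolev_K_biinvariant S p M \<alpha> = {f \<in> L2_fun M. K_biinvariant S p M f \<and>
     summable (\<lambda>n. (1 + (lam S n)\<^sup>2) powr \<alpha> * (cmod (fourier_coeff S p M f n))\<^sup>2)}"

text \<open>
  A limit in $t$ at fixed $x$ depends on the representatives chosen for the classes $u(\cdot,t)$;
  \<open>u x t\<close> is the pointwise sum of the eigenfunction expansion.
\<close>

definition solution :: "rank_one_space \<Rightarrow> oct_mat \<Rightarrow> oct_mat measure \<Rightarrow> (real \<Rightarrow> real) \<Rightarrow>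
    (oct_mat \<Rightarrow> complex) \<Rightarrow> oct_mat \<Rightarrow> real \<Rightarrow> complex" where
  "solution S p M \<psi> f x t = (\<Sum>n. exp (- \<i> * complex_of_real (t * \<psi> (lam S n))) *
     fourier_coeff S p M f n * complex_of_real (zonal_normalized S p M n x))"

end

theory Submission
  imports Defs "HOL-Probability.Distribution_Functions" "HOL-Computational_Algebra.Primes"
begin

text \<open>
  Under the invariant measure, the variable \<open>u = cos d(p, x)\<close> satisfies the integration by parts identity
  of the Jacobi weight: differentiate the invariance along rotations. This identity is all that is needed
  of the distribution \<open>\<nu>\<close> of \<open>u\<close>. It makes the Jacobi polynomials orthogonal, it bounds \<open>(1 - u\<^sup>2) d\<nu>\<close>
  by a multiple of Lebesgue measure in the angle \<open>\<theta>\<close>, and it excludes mass at the end points.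

  For fixed \<open>0 < \<theta> < \<pi>\<close> the normalised zonal functions are, up to a factor depending on \<open>\<theta>\<close> only and an
  error \<open>O(1/n)\<close>, of the form \<open>a\<^sub>n cos ((n + \<rho>) \<theta>) + b\<^sub>n sin ((n + \<rho>) \<theta>)\<close> with bounded \<open>a\<^sub>n\<close>, \<open>b\<^sub>n\<close>, while
  \<open>\<psi>(\<lambda>\<^sub>n) = n\<^sup>2 + 2 \<rho> n + \<kappa> + O(1/n)\<close>. Both errors are absolutely summable against square summable
  coefficients, so that only sums of terms \<open>c\<^sub>n exp (i (n \<theta> \<plusminus> (n\<^sup>2 + 2 \<rho> n) t))\<close> remain. For frequencies of
  size \<open>N\<close>, Bourgain's periodic \<open>L\<^sup>6\<close> estimate loses \<open>N powr \<epsilon>\<close> and the Sobolev inequality in \<open>t\<close> loses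
  \<open>N powr (1/3)\<close>. Hence for \<open>\<alpha> > 1/3\<close> and almost every \<open>x\<close> the partial sums converge uniformly in \<open>t\<close>;
  the sum is continuous in \<open>t\<close>, and its value at \<open>0\<close> is \<open>f x\<close> by completeness.
\<close>

section \<open>The divisor bound\<close>

text \<open>The measure is given by its invariance under isometries and not by a density, so
  explicit isometries take the place of coordinates. Rotations of two indices with real coefficients
  act on every model, even over the octonions, and yield one identity per index. Multiplications by
  units make the components of a matrix entry interchangeable, which turns squared real parts into
  squared norms. The solution is a pointwise series, so all partial sums at a fixed point have to be
  controlled, not only the supremum over t. Every initial piece of a dyadic block is therefore cut
  into binary intervals, each with its own sixth-power estimate. The cubed energies of disjoint
  intervals add up to at most the cubed energy of the block, so the cost is polynomial in k for the
  block at 2^k. The exponent: for n of size N the phase moves in t with speed N^2, so a derivative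
  in t costs N^2 for the sixth power, that is N^(1/3) for the function. The surplus of \<alpha> over
  1/3 pays for the divisor bound and for the powers of k.\<close>

lemma card_divisors_mult_le:
  fixes m n :: nat
  assumes "m > 0" "n > 0"
  shows "card {d. d dvd m * n} \<le> card {d. d dvd m} * card {d. d dvd n}"
proof -
  have "{d. d dvd m * n} \<subseteq> (\<lambda>(x, y). x * y) ` ({d. d dvd m} \<times> {d. d dvd n})"
  proof
    fix d assume "d \<in> {d. d dvd m * n}"
    then obtain x y where "d = x * y" "x dvd m" "y dvd n"
      using division_decomp[of d m n] by auto
    then show "d \<in> (\<lambda>(x, y). x * y) ` ({d. d dvd m} \<times> {d. d dvd n})" by force
  qed
  then have "card {d. d dvd m * n} \<le> card ({d. d dvd m} \<times> {d. d dvd n})"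
    using assms by (intro surj_card_le) auto
  then show ?thesis by (simp add: card_cartesian_product)
qed

lemma card_divisors_prime_power:
  fixes p k :: nat
  assumes "prime p"
  shows "card {d. d dvd p ^ k} \<le> k + 1"
proof -
  have "{d. d dvd p ^ k} = (\<lambda>i. p ^ i) ` {..k}"
    using divides_primepow_nat[OF assms] by auto
  also have "card \<dots> \<le> card {..k}" by (rule card_image_le) simp
  finally show ?thesis by simp
qed

text \<open>Only the finitely many primes below \<open>2 powr (1/\<epsilon>)\<close> contribute a factor exceeding \<open>p powr (k\<epsilon>)\<close>.\<close>

lemma divisor_bound:
  fixes e :: real
  assumes e: "e > 0"
  obtains C where "C \<ge> 0" "\<And>n::nat. n > 0 \<Longrightarrow> real (card {d. d dvd n}) \<le> C * real n powr e"
proof -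
  \<comment> \<open>Primes p \<ge> K satisfy p^e \<ge> 2, hence k + 1 \<le> 2^k \<le> p^(k e) with
    constant 1.\<close>
  define K where "K = 2 powr (1 / e)"
  have "(\<lambda>k::nat. real k * (2 powr (- e)) ^ k) \<longlonglongrightarrow> 0"
    using e by (intro powser_times_n_limit_0) (simp add: powr_less_one)
  moreover have "(\<lambda>k::nat. (2 powr (- e)) ^ k) \<longlonglongrightarrow> 0"
    using e by (intro LIMSEQ_power_zero) (simp add: powr_less_one)
  ultimately have "(\<lambda>k::nat. real k * (2 powr (- e)) ^ k + (2 powr (- e)) ^ k) \<longlonglongrightarrow> 0 + 0"
    by (rule tendsto_add)
  then have "Bseq (\<lambda>k::nat. real k * (2 powr (- e)) ^ k + (2 powr (- e)) ^ k)"
    by (intro convergent_imp_Bseq) (auto simp: convergent_def)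
  then obtain B where B: "\<And>k::nat. norm (real k * (2 powr (- e)) ^ k + (2 powr (- e)) ^ k) \<le> B"
    unfolding Bseq_def by auto
  define C where "C = max B 1"
  have C1: "C \<ge> 1" by (simp add: C_def)
  have small: "real (k + 1) \<le> C * (real (p ^ k)) powr e" if p: "p \<ge> 2" for p k :: nat
  proof -
    have "(real k + 1) * (2 powr (- e)) ^ k \<le> C" using B[of k] by (simp add: C_def algebra_simps)
    moreover have "(2 powr (- e)) ^ k = 2 powr (- e * k)"
      by (simp add: powr_power mult.commute)
    ultimately have "(real k + 1) * (2 powr (- e * k)) \<le> C" by metis
    then have "(real k + 1) \<le> C * 2 powr (e * k)"
      by (simp add: powr_minus field_simps)
    also have "2 powr (e * k) \<le> (real p ^ k) powr e"
    proof -
      have "2 powr (e * k) = (2 ^ k) powr e"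
        by (simp add: powr_realpow[symmetric] powr_powr mult.commute)
      also have "\<dots> \<le> (real p ^ k) powr e"
        using p e by (intro powr_mono2 power_mono) auto
      finally show ?thesis .
    qed
    finally show ?thesis using C1 by (simp add: mult_left_mono)
  qed
  have large: "real (k + 1) \<le> (real (p ^ k)) powr e" if p: "real p \<ge> K" for p k :: nat
  proof -
    have K0: "K > 0" by (simp add: K_def)
    have "real (k + 1) \<le> 2 ^ k"
      by (metis less_exp of_nat_numeral of_nat_power of_nat_le_iff Suc_eq_plus1 Suc_leI)
    also have "\<dots> = (K powr e) ^ k" using e by (simp add: K_def powr_powr)
    also have "\<dots> = (K ^ k) powr e" using K0
      by (simp add: powr_realpow[symmetric] powr_powr mult.commute)
    also have "\<dots> \<le> (real p ^ k) powr e"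
      using p e K0 by (intro powr_mono2 power_mono) auto
    finally show ?thesis by simp
  qed
  let ?S = "\<lambda>n. {p::nat. prime p \<and> p dvd n \<and> real p < K}"
  have fin: "finite (?S n)" for n
    by (rule finite_subset[of _ "{..nat \<lceil>K\<rceil>}"]) (auto, linarith)
  \<comment> \<open>Strong induction removing the full power of one prime divisor. Only a prime
    below K spends a factor C, and it is then missing from the set in the exponent.\<close>
  have main: "real (card {d. d dvd n}) \<le> C ^ card (?S n) * real n powr e" if "n > 0" for n :: nat
    using that
  proof (induction n rule: less_induct)
    case (less n)
    show ?case
    proof (cases "n = 1")
      case True then show ?thesis using C1 by (simp add: one_le_power)
    next
      case False
      then obtain p where p: "prime p" "p dvd n" using prime_factor_nat by blast
      define k where "k = multiplicity p n"
      obtain m where m: "n = p ^ k * m" "\<not> p dvd m"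
        using multiplicity_decompose'[of n p] less.prems p
        by (metis k_def not_prime_unit bot_nat_0.not_eq_extremum)
      have m0: "m > 0" using m less.prems by (cases m) auto
      have kpos: "k > 0" using m p by (cases k) auto
      have p2: "p \<ge> 2" using p prime_ge_2_nat by blast
      have "m < n"
        using m m0 kpos p2 one_less_power[of p k] by simp
      note IH = less.IH[OF this m0]
      have "card {d. d dvd n} \<le> card {d. d dvd p ^ k} * card {d. d dvd m}"
        unfolding m(1) using m0 p2 by (intro card_divisors_mult_le) auto
      also have "\<dots> \<le> (k + 1) * card {d. d dvd m}"
        using card_divisors_prime_power[OF p(1)] by (intro mult_right_mono) auto
      finally have 1: "real (card {d. d dvd n}) \<le> real (k + 1) * real (card {d. d dvd m})"
        by (metis of_nat_le_iff of_nat_mult)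
      have powr: "real n powr e = real (p ^ k) powr e * real m powr e"
        unfolding m(1) of_nat_mult by (rule powr_mult)
      have sub: "?S m \<subseteq> ?S n" using m(1) by auto
      show ?thesis
      proof (cases "real p < K")
        case True
        have "p \<notin> ?S m" using m by auto
        moreover have "insert p (?S m) \<subseteq> ?S n" using sub True p by auto
        ultimately have card: "Suc (card (?S m)) \<le> card (?S n)"
          using fin by (metis (no_types, lifting) card_insert_disjoint card_mono)
        have "real (k + 1) * real (card {d. d dvd m}) \<le> (C * (real (p ^ k)) powr e) * (C ^ card (?S m) * real m powr e)"
          using small[OF p2, of k] IH C1 by (intro mult_mono) auto
        also have "\<dots> = C ^ Suc (card (?S m)) * real n powr e" by (simp add: powr)
        also have "\<dots> \<le> C ^ card (?S n) * real n powr e"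
          using card C1 by (intro mult_right_mono power_increasing) auto
        finally show ?thesis using 1 by linarith
      next
        case False
        have "real (k + 1) * real (card {d. d dvd m}) \<le> ((real (p ^ k)) powr e) * (C ^ card (?S m) * real m powr e)"
          using large[of p k] False IH C1 by (intro mult_mono) auto
        also have "\<dots> = C ^ card (?S m) * real n powr e" by (simp add: powr)
        also have "\<dots> \<le> C ^ card (?S n) * real n powr e"
          using card_mono[OF fin sub] C1 by (intro mult_right_mono power_increasing) auto
        finally show ?thesis using 1 by linarith
      qed
    qed
  qed
  let ?P = "{p::nat. prime p \<and> real p < K}"
  have finP: "finite ?P"
    by (rule finite_subset[of _ "{..nat \<lceil>K\<rceil>}"]) (auto, linarith)
  show ?thesis
  proof (rule that[of "C ^ card ?P"])
    fix n :: nat assume n: "n > 0"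
    have "C ^ card (?S n) \<le> C ^ card ?P"
      using C1 finP by (intro power_increasing card_mono) auto
    then show "real (card {d. d dvd n}) \<le> C ^ card ?P * real n powr e"
      using main[OF n] by (meson mult_right_mono order_trans powr_ge_zero)
  qed (use C1 in auto)
qed

lemma card_int_divisors:
  fixes P :: int
  assumes "P \<noteq> 0"
  shows "card {d. d dvd P} \<le> 2 * card {d::nat. d dvd nat \<bar>P\<bar>}"
proof -
  let ?N = "{d::nat. d dvd nat \<bar>P\<bar>}"
  have fin: "finite ?N" using assms by (intro finite_divisors_nat) simp
  have "{d. d dvd P} \<subseteq> int ` ?N \<union> (\<lambda>n. - int n) ` ?N"
  proof
    fix d assume "d \<in> {d. d dvd P}"
    then have "nat \<bar>d\<bar> \<in> ?N" by (simp add: nat_dvd_iff)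
    moreover have "d = int (nat \<bar>d\<bar>) \<or> d = - int (nat \<bar>d\<bar>)" by auto
    ultimately show "d \<in> int ` ?N \<union> (\<lambda>n. - int n) ` ?N" by blast
  qed
  then have "card {d. d dvd P} \<le> card (int ` ?N \<union> (\<lambda>n. - int n) ` ?N)"
    using fin by (intro card_mono) auto
  also have "\<dots> \<le> card (int ` ?N) + card ((\<lambda>n. - int n) ` ?N)" by (rule card_Un_le)
  also have "\<dots> \<le> 2 * card ?N" using card_image_le[OF fin, of int] card_image_le[OF fin, of "\<lambda>n. - int n"] by simp
  finally show ?thesis .
qed

section \<open>The periodic Strichartz estimate\<close>

lemma has_integral_cis_int:
  fixes k :: int
  shows "((\<lambda>x. cis (of_int k * x)) has_integral (if k = 0 then 2 * pi else 0)) {0..2 * pi}"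
proof (cases "k = 0")
  case True
  then show ?thesis using has_integral_const_real[of "1::complex" 0 "2*pi"] by (simp add: scaleR_conv_of_real)
next
  case False
  have "((\<lambda>x. cis (of_int k * x)) has_integral (cis (of_int k * (2 * pi)) / (\<i> * of_int k) - cis (of_int k * 0) / (\<i> * of_int k))) {0..2 * pi}"
  proof (intro fundamental_theorem_of_calculus)
    fix x :: real
    have "((\<lambda>z. exp (\<i> * of_int k * z) / (\<i> * of_int k)) has_field_derivative exp (\<i> * of_int k * of_real x)) (at (of_real x))"
      using False by (auto intro!: derivative_eq_intros)
    from has_vector_derivative_real_field[OF this, of "{0..2*pi}"]
    show "((\<lambda>x. cis (of_int k * x) / (\<i> * of_int k)) has_vector_derivative cis (of_int k * x)) (at x within {0..2 * pi})"
      by (simp add: cis_conv_exp mult.assoc)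
  qed simp
  moreover have "cis (of_int k * (2 * pi)) = 1"
    by (metis cis_multiple_2pi Ints_of_int mult.commute mult.left_commute)
  ultimately show ?thesis using False by simp
qed

lemma sum_power2_le_power2_sum:
  fixes f :: "'a \<Rightarrow> real"
  assumes "finite A" "\<And>x. x \<in> A \<Longrightarrow> f x \<ge> 0"
  shows "(\<Sum>x\<in>A. (f x)\<^sup>2) \<le> (\<Sum>x\<in>A. f x)\<^sup>2"
  using assms
proof (induction A rule: finite_induct)
  case (insert x A)
  have "0 \<le> f x * (\<Sum>x\<in>A. f x)" using insert by (intro mult_nonneg_nonneg sum_nonneg) auto
  then show ?case using insert by (simp add: power2_sum)
qed simp

text \<open>Parseval for an indexed family whose frequencies may coincide: indices with the same
  frequency are grouped first. With triples as indices, the fibres on the right side are the sets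
  that have to be counted.\<close>

lemma has_integral_cmod_trig_sum_sq:
  fixes c :: "'a \<Rightarrow> complex" and f :: "'a \<Rightarrow> int"
  assumes fin: "finite T"
  shows "((\<lambda>x. (cmod (\<Sum>s\<in>T. c s * cis (of_int (f s) * x)))\<^sup>2) has_integral
           2 * pi * (\<Sum>k\<in>f ` T. (cmod (\<Sum>s | s \<in> T \<and> f s = k. c s))\<^sup>2)) {0..2 * pi}"
proof -
  define d where "d k = (\<Sum>s | s \<in> T \<and> f s = k. c s)" for k
  let ?K = "f ` T"
  have grp: "(\<Sum>s\<in>T. c s * cis (of_int (f s) * x)) = (\<Sum>k\<in>?K. d k * cis (of_int k * x))" for x
    unfolding d_def sum_distrib_right
    by (subst sum.image_gen[OF fin, where g = f]) (auto intro!: sum.cong)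
  have sq: "complex_of_real ((cmod (\<Sum>k\<in>?K. d k * cis (of_int k * x)))\<^sup>2)
      = (\<Sum>k\<in>?K. \<Sum>l\<in>?K. d k * cnj (d l) * cis (of_int (k - l) * x))" for x
  proof -
    have "(d k * cis (of_int k * x)) * cnj (d l * cis (of_int l * x)) = d k * cnj (d l) * cis (of_int (k - l) * x)" for k l
    proof -
      have "cis (of_int k * x) * cis (- (of_int l * x)) = cis (of_int (k - l) * x)"
        unfolding cis_mult by (simp add: left_diff_distrib)
      then show ?thesis by (simp add: cis_cnj)
    qed
    then show ?thesis
      unfolding complex_norm_square cnj_sum sum_product by (intro sum.cong refl)
  qed
  have "((\<lambda>x. \<Sum>k\<in>?K. \<Sum>l\<in>?K. d k * cnj (d l) * cis (of_int (k - l) * x)) has_integral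
     (\<Sum>k\<in>?K. \<Sum>l\<in>?K. d k * cnj (d l) * (if k - l = 0 then 2 * pi else 0))) {0..2 * pi}"
    by (intro has_integral_sum has_integral_mult_right has_integral_cis_int) (use fin in auto)
  also have "(\<Sum>k\<in>?K. \<Sum>l\<in>?K. d k * cnj (d l) * (if k - l = 0 then 2 * pi else 0)) =
    (\<Sum>k\<in>?K. \<Sum>l\<in>?K. if l = k then d k * cnj (d l) * (2 * pi) else 0)"
    by (intro sum.cong) auto
  also have "\<dots> = complex_of_real (2 * pi * (\<Sum>k\<in>?K. (cmod (d k))\<^sup>2))"
    using fin by (simp add: sum_distrib_left complex_norm_square mult_ac del: of_real_power)
  finally have "((\<lambda>x. complex_of_real ((cmod (\<Sum>k\<in>?K. d k * cis (of_int k * x)))\<^sup>2)) has_integral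
     complex_of_real (2 * pi * (\<Sum>k\<in>?K. (cmod (d k))\<^sup>2))) {0..2 * pi}"
    by (simp only: sq)
  from has_integral_Re[OF this] show ?thesis
    by (simp add: grp d_def)
qed

text \<open>The sign \<open>\<eta>\<close> serves to treat complex conjugates as well.\<close>

definition sch_freq :: "real \<Rightarrow> real \<Rightarrow> nat \<Rightarrow> real" where
  "sch_freq \<eta> \<beta> n = \<eta> * ((real n)\<^sup>2 + \<beta> * real n)"

text \<open>An arbitrary index set \<open>B\<close> lets dyadic blocks, their binary pieces and
  partial sums share one estimate.\<close>

definition sch_sum :: "real \<Rightarrow> real \<Rightarrow> nat set \<Rightarrow> (nat \<Rightarrow> complex) \<Rightarrow> real \<Rightarrow> real \<Rightarrow> complex" where
  "sch_sum \<eta> \<beta> B c \<theta> t = (\<Sum>n\<in>B. c n * cis (real n * \<theta> + sch_freq \<eta> \<beta> n * t))"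

text \<open>Writing \<open>|F|\<^sup>6 = |F F F\<^sup>*|\<^sup>2\<close> one has to count \<open>(m, n, k)\<close> with \<open>m + n - k\<close> and
  \<open>m\<^sup>2 + n\<^sup>2 - k\<^sup>2\<close> prescribed. These determine \<open>(m - k) (n - k)\<close>, so there are few such triples
  unless \<open>m = k\<close> or \<open>n = k\<close>. The linear phase \<open>\<beta>\<close> disappears after the integration in \<open>\<theta>\<close>.\<close>

lemma sch_sum_L6:
  fixes \<eta> :: int and \<beta> :: real and D :: real
  assumes B: "B \<subseteq> {..<K}" and \<eta>: "\<eta> \<noteq> 0"
    and D: "\<And>P::int. P \<noteq> 0 \<Longrightarrow> \<bar>P\<bar> \<le> (int K)\<^sup>2 \<Longrightarrow> real (card {d. d dvd P}) \<le> D" and D0: "D \<ge> 0"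
  shows "integral {0..2*pi} (\<lambda>t. integral {0..2*pi} (\<lambda>\<theta>. (cmod (sch_sum \<eta> \<beta> B c \<theta> t)) ^ 6))
    \<le> (2 * pi)\<^sup>2 * (2 * D + 8) * (\<Sum>n\<in>B. (cmod (c n))\<^sup>2) ^ 3"
proof -
  define S where "S = (\<Sum>n\<in>B. (cmod (c n))\<^sup>2)"
  have finB: "finite B" using B finite_subset by blast
  define T where "T = B \<times> B \<times> B"
  have finT: "finite T" using finB by (simp add: T_def)
  define A :: "nat \<times> nat \<times> nat \<Rightarrow> int" where "A = (\<lambda>(m, n, k). int m + int n - int k)"
  define Q :: "nat \<times> nat \<times> nat \<Rightarrow> int" where "Q = (\<lambda>(m, n, k). \<eta> * ((int m)\<^sup>2 + (int n)\<^sup>2 - (int k)\<^sup>2))"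
  define C where "C = (\<lambda>(m, n, k). c m * c n * cnj (c k))"
  \<comment> \<open>The \<beta>-phase of a triple depends on \<open>A s\<close> only, so it is a
    common unimodular factor on each fibre of \<open>A\<close>.\<close>
  have cube: "(sch_sum \<eta> \<beta> B c \<theta> t) * (sch_sum \<eta> \<beta> B c \<theta> t) * cnj (sch_sum \<eta> \<beta> B c \<theta> t)
     = (\<Sum>s\<in>T. (C s * cis (\<eta> * \<beta> * A s * t) * cis (of_int (Q s) * t)) * cis (of_int (A s) * \<theta>))" for \<theta> t
  proof -
    have "(sch_sum \<eta> \<beta> B c \<theta> t) * (sch_sum \<eta> \<beta> B c \<theta> t) * cnj (sch_sum \<eta> \<beta> B c \<theta> t)
      = (\<Sum>m\<in>B. \<Sum>n\<in>B. \<Sum>k\<in>B. (c m * cis (real m * \<theta> + sch_freq \<eta> \<beta> m * t)) * (c n * cis (real n * \<theta> + sch_freq \<eta> \<beta> n * t)) * (cnj (c k) * cis (- (real k * \<theta> + sch_freq \<eta> \<beta> k * t))))"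
    proof -
      have triple: "(\<Sum>m\<in>B. f m) * (\<Sum>n\<in>B. g n) * (\<Sum>k\<in>B. h k) = (\<Sum>m\<in>B. \<Sum>n\<in>B. \<Sum>k\<in>B. f m * g n * h k)"
        for f g h :: "nat \<Rightarrow> complex"
        unfolding sum_product[of f B g B] by (simp only: sum_distrib_right) (simp only: sum_distrib_left)
      show ?thesis
        unfolding sch_sum_def cnj_sum complex_cnj_mult cis_cnj triple ..
    qed
    also have "\<dots> = (\<Sum>s\<in>T. (C s * cis (\<eta> * \<beta> * A s * t) * cis (of_int (Q s) * t)) * cis (of_int (A s) * \<theta>))"
      unfolding T_def sum.cartesian_product
    proof (intro sum.cong refl, clarify, goal_cases)
      case (1 m n k)
      have "cis (real m * \<theta> + sch_freq \<eta> \<beta> m * t) * cis (real n * \<theta> + sch_freq \<eta> \<beta> n * t) * cis (- (real k * \<theta> + sch_freq \<eta> \<beta> k * t))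
        = cis (\<eta> * \<beta> * A (m, n, k) * t) * cis (of_int (Q (m, n, k)) * t) * cis (of_int (A (m, n, k)) * \<theta>)"
        unfolding cis_mult
        by (rule arg_cong[of _ _ cis]) (simp add: A_def Q_def sch_freq_def algebra_simps)
      note * = arg_cong[OF this, of "\<lambda>w. c m * c n * cnj (c k) * w"]
      show ?case
        using * by (simp only: C_def prod.case mult.assoc mult.left_commute mult.commute)
    qed
    finally show ?thesis .
  qed
  have six: "(cmod z) ^ 6 = (cmod (z * z * cnj z))\<^sup>2" for z
    by (simp add: norm_mult power2_eq_square power_mult_distrib numeral_eq_Suc mult_ac)
  let ?R = "\<lambda>k. {s \<in> T. A s = k}"
  have inner: "integral {0..2*pi} (\<lambda>\<theta>. (cmod (sch_sum \<eta> \<beta> B c \<theta> t)) ^ 6)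
      = 2 * pi * (\<Sum>k\<in>A ` T. (cmod (\<Sum>s\<in>?R k. C s * cis (of_int (Q s) * t)))\<^sup>2)" for t
  proof -
    have "integral {0..2*pi} (\<lambda>\<theta>. (cmod (sch_sum \<eta> \<beta> B c \<theta> t)) ^ 6)
      = 2 * pi * (\<Sum>k\<in>A ` T. (cmod (\<Sum>s\<in>?R k. C s * cis (\<eta> * \<beta> * A s * t) * cis (of_int (Q s) * t)))\<^sup>2)"
      unfolding six cube
      by (intro integral_unique has_integral_cmod_trig_sum_sq finT)
    also have "\<dots> = 2 * pi * (\<Sum>k\<in>A ` T. (cmod (\<Sum>s\<in>?R k. C s * cis (of_int (Q s) * t)))\<^sup>2)"
    proof (intro arg_cong[where f = "\<lambda>x. 2 * pi * x"] sum.cong refl)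
      fix k
      have "(\<Sum>s\<in>?R k. C s * cis (\<eta> * \<beta> * A s * t) * cis (of_int (Q s) * t))
        = cis (\<eta> * \<beta> * k * t) * (\<Sum>s\<in>?R k. C s * cis (of_int (Q s) * t))"
        unfolding sum_distrib_left by (intro sum.cong) auto
      then show "(cmod (\<Sum>s\<in>?R k. C s * cis (\<eta> * \<beta> * A s * t) * cis (of_int (Q s) * t)))\<^sup>2
         = (cmod (\<Sum>s\<in>?R k. C s * cis (of_int (Q s) * t)))\<^sup>2"
        by (simp add: norm_mult)
    qed
    finally show ?thesis .
  qed
  \<comment> \<open>Parseval again, now in t: what remains are the fibres of the pair
    (\<open>A\<close>, \<open>Q\<close>).\<close>
  have outer: "integral {0..2*pi} (\<lambda>t. integral {0..2*pi} (\<lambda>\<theta>. (cmod (sch_sum \<eta> \<beta> B c \<theta> t)) ^ 6))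
     = 2 * pi * (\<Sum>k\<in>A ` T. 2 * pi * (\<Sum>l\<in>Q ` ?R k. (cmod (\<Sum>s | s \<in> ?R k \<and> Q s = l. C s))\<^sup>2))"
    unfolding inner
    by (intro integral_unique has_integral_mult_right has_integral_sum has_integral_cmod_trig_sum_sq)
       (use finT in auto)
  define deg where "deg = (\<lambda>(m::nat, n::nat, k::nat). m = k \<or> n = k)"
  \<comment> \<open>On a fibre the nondegenerate triples are few, and Cauchy-Schwarz costs the
    factor D. The degenerate ones can be many and are summed in absolute value.\<close>
  have bound: "(\<Sum>l\<in>Q ` ?R k. (cmod (\<Sum>s | s \<in> ?R k \<and> Q s = l. C s))\<^sup>2)
     \<le> 2 * D * (\<Sum>s\<in>?R k. (cmod (C s))\<^sup>2) + 2 * (\<Sum>s | s \<in> ?R k \<and> deg s. cmod (C s))\<^sup>2" for k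
  proof -
    have finR: "finite (?R k)" using finT by simp
    let ?N = "\<lambda>l. {s \<in> ?R k. Q s = l \<and> \<not> deg s}" and ?G = "\<lambda>l. {s \<in> ?R k. Q s = l \<and> deg s}"
    have 1: "(cmod (\<Sum>s | s \<in> ?R k \<and> Q s = l. C s))\<^sup>2
       \<le> 2 * (cmod (\<Sum>s\<in>?N l. C s))\<^sup>2 + 2 * (\<Sum>s\<in>?G l. cmod (C s))\<^sup>2" for l
    proof -
      have "{s. s \<in> ?R k \<and> Q s = l} = ?N l \<union> ?G l" by auto
      then have "(\<Sum>s | s \<in> ?R k \<and> Q s = l. C s) = (\<Sum>s\<in>?N l. C s) + (\<Sum>s\<in>?G l. C s)"
        using finR by (simp only:) (rule sum.union_disjoint, auto intro: finite_subset[OF _ finR])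
      then have "cmod (\<Sum>s | s \<in> ?R k \<and> Q s = l. C s) \<le> cmod (\<Sum>s\<in>?N l. C s) + (\<Sum>s\<in>?G l. cmod (C s))"
        by (simp only:) (rule order.trans[OF norm_triangle_ineq add_left_mono[OF norm_sum]])
      then have "(cmod (\<Sum>s | s \<in> ?R k \<and> Q s = l. C s))\<^sup>2 \<le> (cmod (\<Sum>s\<in>?N l. C s) + (\<Sum>s\<in>?G l. cmod (C s)))\<^sup>2"
        by (intro power_mono) auto
      also have "\<dots> \<le> 2 * (cmod (\<Sum>s\<in>?N l. C s))\<^sup>2 + 2 * (\<Sum>s\<in>?G l. cmod (C s))\<^sup>2"
        using sum_squares_bound[of "cmod (\<Sum>s\<in>?N l. C s)" "(\<Sum>s\<in>?G l. cmod (C s))"]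
        by (simp add: power2_sum)
      finally show ?thesis .
    qed
    have cardN: "real (card (?N l)) \<le> D" for l
    proof (cases "?N l = {}")
      case True then show ?thesis using D0 by (simp only: card.empty)
    next
      case False
      then obtain m n k' where s0: "(m, n, k') \<in> ?N l" by force
      \<comment> \<open>For triples with m + n - k' = k one has m^2 + n^2 - k'^2 = k^2 - 2 P. So P
        is the same on the whole fibre, and a triple is recovered from the divisor m - k' of
        P.\<close>
      define P where "P = (int m - int k') * (int n - int k')"
      have P0: "P \<noteq> 0" using s0 by (auto simp: P_def deg_def)
      have kl: "k = int m' + int n' - int j" "l = \<eta> * ((int m')\<^sup>2 + (int n')\<^sup>2 - (int j)\<^sup>2)"
        if "(m', n', j) \<in> ?N l" for m' n' j
        using that by (auto simp: A_def Q_def)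
      have P2: "\<eta> * (k\<^sup>2 - 2 * P) = l"
        unfolding kl[OF s0] P_def by (simp add: power2_eq_square algebra_simps)
      have PK: "\<bar>P\<bar> \<le> (int K)\<^sup>2"
      proof -
        have "m < K" "n < K" "k' < K" using s0 B by (auto simp: T_def)
        then have "\<bar>int m - int k'\<bar> \<le> int K" "\<bar>int n - int k'\<bar> \<le> int K" by auto
        then have "\<bar>int m - int k'\<bar> * \<bar>int n - int k'\<bar> \<le> int K * int K" by (intro mult_mono) auto
        then show ?thesis by (simp add: P_def abs_mult power2_eq_square)
      qed
      have eq: "(int m' - int j) * (int n' - int j) = P" if "(m', n', j) \<in> ?N l" for m' n' j
      proof -
        have "\<eta> * (k\<^sup>2 - 2 * ((int m' - int j) * (int n' - int j))) = l"
          unfolding kl[OF that] by (simp add: power2_eq_square algebra_simps)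
        then have "\<eta> * (k\<^sup>2 - 2 * ((int m' - int j) * (int n' - int j))) = \<eta> * (k\<^sup>2 - 2 * P)"
          using P2 by simp
        then show ?thesis using \<eta> by simp
      qed
      have inj: "inj_on (\<lambda>(m, n, j). int m - int j) (?N l)"
      proof (rule inj_onI, clarsimp, goal_cases)
        case (1 m1 n1 j1 m2 n2 j2)
        have e1: "(int m1 - int j1) * (int n1 - int j1) = P" by (rule eq) (use 1 in auto)
        have e2: "(int m2 - int j2) * (int n2 - int j2) = P" by (rule eq) (use 1 in auto)
        have d: "int m1 - int j1 = int m2 - int j2" using 1 by simp
        then have n: "int n1 - int j1 = int n2 - int j2" using e1 e2 P0 by auto
        have "int m1 + int n1 - int j1 = int m2 + int n2 - int j2" using 1 by (simp add: A_def)
        then show ?case using d n by linarith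
      qed
      have "(\<lambda>(m, n, j). int m - int j) ` ?N l \<subseteq> {d. d dvd P}"
      proof clarify
        fix m' n' j assume "(m', n', j) \<in> T" "k = A (m', n', j)" "l = Q (m', n', j)" "\<not> deg (m', n', j)"
        then have "(int m' - int j) * (int n' - int j) = P" by (intro eq) auto
        then show "(int m' - int j) dvd P" by (metis dvd_triv_left)
      qed
      moreover have "finite {d. d dvd P}" using P0 by simp
      ultimately have "card (?N l) \<le> card {d. d dvd P}"
        using inj card_inj_on_le by blast
      then show ?thesis using D[OF P0 PK] by linarith
    qed
    have 2: "(cmod (\<Sum>s\<in>?N l. C s))\<^sup>2 \<le> D * (\<Sum>s\<in>?N l. (cmod (C s))\<^sup>2)" for l
    proof -
      have "(cmod (\<Sum>s\<in>?N l. C s))\<^sup>2 \<le> (\<Sum>s\<in>?N l. 1 * cmod (C s))\<^sup>2"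
        by (intro power_mono) (auto intro: norm_sum)
      also have "\<dots> \<le> (\<Sum>s\<in>?N l. 1\<^sup>2) * (\<Sum>s\<in>?N l. (cmod (C s))\<^sup>2)"
        by (rule Cauchy_Schwarz_ineq_sum)
      also have "\<dots> \<le> D * (\<Sum>s\<in>?N l. (cmod (C s))\<^sup>2)"
        using cardN[of l] by (intro mult_right_mono sum_nonneg) auto
      finally show ?thesis .
    qed
    have "(\<Sum>l\<in>Q ` ?R k. (cmod (\<Sum>s | s \<in> ?R k \<and> Q s = l. C s))\<^sup>2)
      \<le> (\<Sum>l\<in>Q ` ?R k. 2 * (D * (\<Sum>s\<in>?N l. (cmod (C s))\<^sup>2)) + 2 * (\<Sum>s\<in>?G l. cmod (C s))\<^sup>2)"
      using 1 2 by (intro sum_mono) (meson add_mono mult_left_mono order_refl order_trans zero_le_numeral)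
    also have "\<dots> = 2 * D * (\<Sum>l\<in>Q ` ?R k. \<Sum>s\<in>?N l. (cmod (C s))\<^sup>2) + 2 * (\<Sum>l\<in>Q ` ?R k. (\<Sum>s\<in>?G l. cmod (C s))\<^sup>2)"
      by (simp add: sum.distrib sum_distrib_left mult_ac)
    finally have main: "(\<Sum>l\<in>Q ` ?R k. (cmod (\<Sum>s | s \<in> ?R k \<and> Q s = l. C s))\<^sup>2) \<le> \<dots>" .
    have "(\<Sum>l\<in>Q ` ?R k. \<Sum>s\<in>?N l. (cmod (C s))\<^sup>2) \<le> (\<Sum>l\<in>Q ` ?R k. \<Sum>s | s \<in> ?R k \<and> Q s = l. (cmod (C s))\<^sup>2)"
      using finR by (intro sum_mono sum_mono2) (auto intro: finite_subset[OF _ finR])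
    also have "\<dots> = (\<Sum>s\<in>?R k. (cmod (C s))\<^sup>2)"
      using sum.image_gen[OF finR, of "\<lambda>s. (cmod (C s))\<^sup>2" Q] by simp
    finally have nondeg: "(\<Sum>l\<in>Q ` ?R k. \<Sum>s\<in>?N l. (cmod (C s))\<^sup>2) \<le> (\<Sum>s\<in>?R k. (cmod (C s))\<^sup>2)" .
    have "(\<Sum>l\<in>Q ` ?R k. (\<Sum>s\<in>?G l. cmod (C s))\<^sup>2) \<le> (\<Sum>l\<in>Q ` ?R k. \<Sum>s\<in>?G l. cmod (C s))\<^sup>2"
      by (intro sum_power2_le_power2_sum sum_nonneg) (use finR in auto)
    also have "(\<Sum>l\<in>Q ` ?R k. \<Sum>s\<in>?G l. cmod (C s)) = (\<Sum>s | s \<in> ?R k \<and> deg s. cmod (C s))"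
    proof -
      have "finite {s \<in> ?R k. deg s}" using finR by (rule rev_finite_subset) auto
      from sum.image_gen[OF this, of "\<lambda>s. cmod (C s)" Q]
      have "(\<Sum>s | s \<in> ?R k \<and> deg s. cmod (C s)) =
        (\<Sum>l\<in>Q ` {s \<in> ?R k. deg s}. \<Sum>s | s \<in> {s \<in> ?R k. deg s} \<and> Q s = l. cmod (C s))" .
      also have "\<dots> = (\<Sum>l\<in>Q ` ?R k. \<Sum>s | s \<in> {s \<in> ?R k. deg s} \<and> Q s = l. cmod (C s))"
      proof (intro sum.mono_neutral_left ballI)
        fix l assume "l \<in> Q ` ?R k - Q ` {s \<in> ?R k. deg s}"
        then have "l \<notin> Q ` {s \<in> ?R k. deg s}" by (simp only: Diff_iff not_False_eq_True)
        then have "Q s \<noteq> l" if "s \<in> {s \<in> ?R k. deg s}" for s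
          using imageI[OF that, of Q] by metis
        then have "{s. s \<in> {s \<in> ?R k. deg s} \<and> Q s = l} = {}" by blast
        then show "(\<Sum>s | s \<in> {s \<in> ?R k. deg s} \<and> Q s = l. cmod (C s)) = 0"
          by (simp only: sum.empty)
      qed (use finR in auto)
      also have "\<dots> = (\<Sum>l\<in>Q ` ?R k. \<Sum>s\<in>?G l. cmod (C s))"
        by (intro sum.cong refl) auto
      finally show ?thesis ..
    qed
    finally have "(\<Sum>l\<in>Q ` ?R k. (\<Sum>s\<in>?G l. cmod (C s))\<^sup>2) \<le> (\<Sum>s | s \<in> ?R k \<and> deg s. cmod (C s))\<^sup>2" .
    with main mult_left_mono[OF nondeg, of "2 * D"] D0 show ?thesis by linarith
  qed
  have nondeg: "(\<Sum>k\<in>A ` T. \<Sum>s\<in>?R k. (cmod (C s))\<^sup>2) = S ^ 3"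
  proof -
    have "(\<Sum>k\<in>A ` T. \<Sum>s\<in>?R k. (cmod (C s))\<^sup>2) = (\<Sum>s\<in>T. (cmod (C s))\<^sup>2)"
      using sum.image_gen[OF finT, of "\<lambda>s. (cmod (C s))\<^sup>2" A] by simp
    also have "\<dots> = (\<Sum>m\<in>B. \<Sum>n\<in>B. \<Sum>k\<in>B. (cmod (c m))\<^sup>2 * (cmod (c n))\<^sup>2 * (cmod (c k))\<^sup>2)"
      unfolding T_def sum.cartesian_product
      by (intro sum.cong) (auto simp: C_def norm_mult power_mult_distrib)
    also have "\<dots> = S ^ 3"
      by (simp add: S_def power3_eq_cube sum_distrib_left[symmetric] sum_distrib_right[symmetric])
    finally show ?thesis .
  qed
  \<comment> \<open>A degenerate triple with \<open>A s = int n\<close> is (m, n, m) or (n, m, m),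
    and \<open>C\<close> has modulus |c n| |c m|^2 there.\<close>
  have deg1: "(\<Sum>s | s \<in> ?R (int n) \<and> deg s. cmod (C s)) \<le> 2 * cmod (c n) * S"
 for n
  proof -
    have sub: "{s. s \<in> ?R (int n) \<and> deg s} \<subseteq> (\<lambda>m. (m, n, m)) ` B \<union> (\<lambda>m. (n, m, m)) ` B"
      by (auto simp: A_def deg_def T_def)
    have "(\<Sum>s | s \<in> ?R (int n) \<and> deg s. cmod (C s)) \<le> (\<Sum>s \<in> (\<lambda>m. (m, n, m)) ` B \<union> (\<lambda>m. (n, m, m)) ` B. cmod (C s))"
      using sub finB by (intro sum_mono2) auto
    also have "\<dots> \<le> (\<Sum>s \<in> (\<lambda>m. (m, n, m)) ` B. cmod (C s)) + (\<Sum>s \<in> (\<lambda>m. (n, m, m)) ` B. cmod (C s))"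
      using finB sum.union_inter[of "(\<lambda>m. (m, n, m)) ` B" "(\<lambda>m. (n, m, m)) ` B" "\<lambda>s. cmod (C s)"]
        sum_nonneg[of "(\<lambda>m. (m, n, m)) ` B \<inter> (\<lambda>m. (n, m, m)) ` B" "\<lambda>s. cmod (C s)"] by simp
    also have "(\<Sum>s \<in> (\<lambda>m. (m, n, m)) ` B. cmod (C s)) = (\<Sum>m\<in>B. cmod (C (m, n, m)))"
      by (subst sum.reindex) (auto simp: inj_on_def)
    also have "(\<Sum>s \<in> (\<lambda>m. (n, m, m)) ` B. cmod (C s)) = (\<Sum>m\<in>B. cmod (C (n, m, m)))"
      by (subst sum.reindex) (auto simp: inj_on_def)
    also have "(\<Sum>m\<in>B. cmod (C (m, n, m))) + (\<Sum>m\<in>B. cmod (C (n, m, m))) = 2 * cmod (c n) * S"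
      by (simp add: C_def norm_mult S_def sum_distrib_left sum.distrib[symmetric] power2_eq_square mult_ac)
    finally show "(\<Sum>s | s \<in> ?R (int n) \<and> deg s. cmod (C s)) \<le> 2 * cmod (c n) * S" .
  qed
  have deg_neg: "{s. s \<in> ?R k \<and> deg s} = {}" if "k \<notin> int ` B" for k
    using that by (auto simp: A_def deg_def T_def)
  \<comment> \<open>The factor 4 comes from the two families of degenerate triples; doubled in
    \<open>bound\<close>, it is the 8 of the final constant.\<close>
  have deg_sum: "(\<Sum>k\<in>A ` T. (\<Sum>s | s \<in> ?R k \<and> deg s. cmod (C s))\<^sup>2) \<le> 4 * S ^ 3"
  proof -
    have "(\<Sum>k\<in>A ` T. (\<Sum>s | s \<in> ?R k \<and> deg s. cmod (C s))\<^sup>2)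
      \<le> (\<Sum>k\<in>A ` T \<union> int ` B. (\<Sum>s | s \<in> ?R k \<and> deg s. cmod (C s))\<^sup>2)"
      using finT finB by (intro sum_mono2) auto
    also have "\<dots> = (\<Sum>k\<in>int ` B. (\<Sum>s | s \<in> ?R k \<and> deg s. cmod (C s))\<^sup>2)"
    proof (intro sum.mono_neutral_right ballI)
      fix k assume "k \<in> A ` T \<union> int ` B - int ` B"
      then have "{s. s \<in> ?R k \<and> deg s} = {}" by (intro deg_neg) auto
      then show "(\<Sum>s | s \<in> ?R k \<and> deg s. cmod (C s))\<^sup>2 = 0" by (simp only: sum.empty) simp
    qed (use finT finB in auto)
    also have "\<dots> = (\<Sum>n\<in>B. (\<Sum>s | s \<in> ?R (int n) \<and> deg s. cmod (C s))\<^sup>2)"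
      by (subst sum.reindex) auto
    also have "\<dots> \<le> (\<Sum>n\<in>B. (2 * cmod (c n) * S)\<^sup>2)"
      using deg1 by (intro sum_mono power_mono sum_nonneg) auto
    also have "\<dots> = 4 * S\<^sup>2 * (\<Sum>n\<in>B. (cmod (c n))\<^sup>2)"
      by (simp add: power_mult_distrib sum_distrib_left mult_ac)
    also have "\<dots> = 4 * S ^ 3" by (simp add: S_def power3_eq_cube power2_eq_square)
    finally show ?thesis .
  qed
  have "(\<Sum>k\<in>A ` T. (\<Sum>l\<in>Q ` ?R k. (cmod (\<Sum>s | s \<in> ?R k \<and> Q s = l. C s))\<^sup>2))
    \<le> (\<Sum>k\<in>A ` T. 2 * D * (\<Sum>s\<in>?R k. (cmod (C s))\<^sup>2) + 2 * (\<Sum>s | s \<in> ?R k \<and> deg s. cmod (C s))\<^sup>2)"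
    by (intro sum_mono bound)
  also have "\<dots> = 2 * D * S ^ 3 + 2 * (\<Sum>k\<in>A ` T. (\<Sum>s | s \<in> ?R k \<and> deg s. cmod (C s))\<^sup>2)"
    unfolding sum.distrib sum_distrib_left[symmetric] nondeg ..
  also have "\<dots> \<le> (2 * D + 8) * S ^ 3" using deg_sum by (simp add: algebra_simps)
  finally have fin: "(\<Sum>k\<in>A ` T. (\<Sum>l\<in>Q ` ?R k. (cmod (\<Sum>s | s \<in> ?R k \<and> Q s = l. C s))\<^sup>2)) \<le> (2 * D + 8) * S ^ 3" .
  show ?thesis
    unfolding outer sum_distrib_left[symmetric] S_def[symmetric]
    using mult_left_mono[OF fin, of "(2 * pi)\<^sup>2"] by (simp add: power2_eq_square mult_ac)
qed

section \<open>The maximal estimate in time\<close>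

text \<open>The bound is required for every initial piece of a dyadic block. This makes all partial
  sums uniformly Cauchy, and not just those whose length is a power of 2.\<close>

lemma dyadic_uniformly_convergent:
  fixes x :: "nat \<Rightarrow> 'a \<Rightarrow> complex" and v :: "nat \<Rightarrow> real"
  assumes v: "summable v" "\<And>k. v k \<ge> 0"
    and bound: "\<And>k m t. t \<in> T \<Longrightarrow> 2 ^ k \<le> m \<Longrightarrow> m \<le> 2 ^ Suc k \<Longrightarrow> cmod (\<Sum>n\<in>{2 ^ k..<m}. x n t) \<le> v k"
  shows "uniformly_convergent_on T (\<lambda>N t. \<Sum>n<N. x n t)"
  unfolding uniformly_convergent_eq_Cauchy uniformly_Cauchy_on_def
proof (intro allI impI)
  fix e :: real assume e: "e > 0"
  have "(\<lambda>K. \<Sum>i. v (i + K)) \<longlonglongrightarrow> 0"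
    using v(1) by (rule suminf_exist_split2)
  then obtain K where K: "(\<Sum>i. v (i + K)) < e / 2"
    using e by (metis (mono_tags, lifting) eventually_sequentially half_gt_zero order_tendstoD(2) order_refl)
  have step: "cmod (\<Sum>n\<in>{2 ^ K..<m}. x n t) \<le> (\<Sum>k\<in>{K..L}. v k)"
    if "t \<in> T" "2 ^ L \<le> m" "m \<le> 2 ^ Suc L" "K \<le> L" for t L m
    using that(4,2,3)
  proof (induction L arbitrary: m rule: dec_induct)
    case base then show ?case using bound[OF that(1)] by simp
  next
    case (step L)
    have "(2::nat) ^ K \<le> 2 ^ Suc L" using step by (intro power_increasing) auto
    then have "{2 ^ K..<m} = {2 ^ K..<2 ^ Suc L} \<union> {2 ^ Suc L..<m}"
      using step by (intro ivl_disj_un(17)[symmetric]) auto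
    then have "(\<Sum>n\<in>{2 ^ K..<m}. x n t) = (\<Sum>n\<in>{2 ^ K..<2 ^ Suc L}. x n t) + (\<Sum>n\<in>{2 ^ Suc L..<m}. x n t)"
      by (simp only:) (rule sum.union_disjoint, auto)
    also have "cmod \<dots> \<le> (\<Sum>k\<in>{K..L}. v k) + v (Suc L)"
      using step by (intro norm_triangle_mono step.IH bound[OF that(1)]) auto
    finally show ?case using step by simp
  qed
  have tail: "cmod (\<Sum>n\<in>{2 ^ K..<m}. x n t) < e / 2" if t: "t \<in> T" and m: "2 ^ K \<le> m" for t m
  proof -
    have m0: "m > 0" using m by (meson less_le_trans zero_less_numeral zero_less_power)
    obtain L where L: "2 ^ L \<le> m" "m < 2 ^ Suc L"
      using ex_power_ivl1[of 2 m] m0 by auto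
    have KL: "K \<le> L"
      using m L(2) by (metis le_less_trans less_Suc_eq_le one_less_numeral_iff power_less_imp_less_exp semiring_norm(76))
    have "cmod (\<Sum>n\<in>{2 ^ K..<m}. x n t) \<le> (\<Sum>k\<in>{K..L}. v k)"
      by (rule step) (use t L KL in auto)
    also have "\<dots> = (\<Sum>i\<in>{..L - K}. v (i + K))"
      using KL by (intro sum.reindex_bij_witness[of _ "\<lambda>i. i + K" "\<lambda>i. i - K"]) auto
    also have "\<dots> \<le> (\<Sum>i. v (i + K))"
      using v by (intro sum_le_suminf) (auto simp: summable_iff_shift)
    finally show ?thesis using K by linarith
  qed
  show "\<exists>M. \<forall>t\<in>T. \<forall>m\<ge>M. \<forall>n\<ge>M. dist (\<Sum>n<m. x n t) (\<Sum>n<n. x n t) < e"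
  proof (intro exI[of _ "2 ^ K"] ballI allI impI)
    fix t and m n :: nat assume t: "t \<in> T" and mn: "2 ^ K \<le> m" "2 ^ K \<le> n"
    have split: "(\<Sum>n<m. x n t) = (\<Sum>n<2 ^ K. x n t) + (\<Sum>n\<in>{2 ^ K..<m}. x n t)" if "2 ^ K \<le> m" for m
      using that sum.atLeastLessThan_concat[of 0 "2 ^ K" m "\<lambda>n. x n t"] by (simp add: lessThan_atLeast0)
    have "dist (\<Sum>n<m. x n t) (\<Sum>n<n. x n t) = cmod ((\<Sum>n\<in>{2 ^ K..<m}. x n t) - (\<Sum>n\<in>{2 ^ K..<n}. x n t))"
      unfolding split[OF mn(1)] split[OF mn(2)] dist_norm add_diff_cancel_left ..
    also have "\<dots> \<le> cmod (\<Sum>n\<in>{2 ^ K..<m}. x n t) + cmod (\<Sum>n\<in>{2 ^ K..<n}. x n t)" by (rule norm_triangle_ineq4)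
    also have "\<dots> < e" using tail[OF t mn(1)] tail[OF t mn(2)] by linarith
    finally show "dist (\<Sum>n<m. x n t) (\<Sum>n<n. x n t) < e" .
  qed
qed

text \<open>Binary expansion of the length \<open>m\<close>, as in the Rademacher-Menshov argument:
  an initial piece is a union of at most one dyadic interval of each of the k + 1 lengths. The
  induction either stays in the left half, or takes it whole and continues in the right
  half.\<close>

lemma binary_block_prefix_bound:
  fixes x :: "nat \<Rightarrow> complex"
  assumes "\<And>j l. j \<le> k \<Longrightarrow> l < 2 ^ (k - j) \<Longrightarrow> cmod (\<Sum>n\<in>{s + l * 2 ^ j..<s + (l + 1) * 2 ^ j}. x n) \<le> w"
    and "m \<le> 2 ^ k" and "w \<ge> 0"
  shows "cmod (\<Sum>n\<in>{s..<s + m}. x n) \<le> (real k + 1) * w"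
  using assms
proof (induction k arbitrary: s m)
  case 0
  show ?case
  proof (cases "m = 0")
    case False
    then have "m = 1" using 0 by simp
    then show ?thesis using 0(1)[of 0 0] by simp
  qed (use 0 in simp)
next
  case (Suc k)
  have half: "cmod (\<Sum>n\<in>{s'..<s' + m'}. x n) \<le> (real k + 1) * w"
    if s': "s' = s \<or> s' = s + 2 ^ k" and m': "m' \<le> 2 ^ k" for s' m'
  proof (rule Suc.IH)
    fix j l :: nat assume j: "j \<le> k" and l: "l < 2 ^ (k - j)"
    have pw: "2 ^ k = 2 ^ (k - j) * (2::nat) ^ j" using j by (simp flip: power_add)
    have lt: "l + 2 ^ (k - j) < 2 ^ (Suc k - j)" using l j by (simp add: Suc_diff_le)
    show "cmod (\<Sum>n\<in>{s' + l * 2 ^ j..<s' + (l + 1) * 2 ^ j}. x n) \<le> w"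
      using s'
    proof
      assume "s' = s" then show ?thesis using Suc.prems(1)[of j l] j lt by simp
    next
      assume s': "s' = s + 2 ^ k"
      show ?thesis using Suc.prems(1)[of j "l + 2 ^ (k - j)"] j lt by (simp add: s' pw algebra_simps)
    qed
  qed (use m' Suc.prems in auto)
  show ?case
  proof (cases "m \<le> 2 ^ k")
    case True
    then show ?thesis using half[of s m] Suc.prems(3) by (simp add: algebra_simps)
  next
    case False
    have "(\<Sum>n\<in>{s..<s + m}. x n) = (\<Sum>n\<in>{s..<s + 2 ^ k}. x n) + (\<Sum>n\<in>{s + 2 ^ k..<s + 2 ^ k + (m - 2 ^ k)}. x n)"
      using False sum.atLeastLessThan_concat[of s "s + 2 ^ k" "s + m" x] by simp
    also have "cmod \<dots> \<le> w + (real k + 1) * w"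
      using Suc.prems(1)[of k 0] Suc.prems(2) by (intro norm_triangle_mono half) (auto simp: algebra_simps)
    finally show ?thesis by (simp add: algebra_simps)
  qed
qed

text \<open>For h = |F|^6 the minimum is at most the integral, as the interval is longer than 1, and
  the variation from there is at most the integral of |h'|. The scale \<open>L\<close> balances F
  against its derivative: if L has the size of the frequencies of F, both terms are comparable and
  the price is one factor L.\<close>

lemma sobolev_pow6:
  fixes F F' :: "real \<Rightarrow> complex"
  assumes deriv: "\<And>t. (F has_vector_derivative F' t) (at t)"
    and cont: "continuous_on UNIV F'" and L: "L > 0" and t: "t \<in> {0..2 * pi}"
  shows "(cmod (F t)) ^ 6 \<le> integral {0..2 * pi} (\<lambda>t. (1 + 6 * L) * (cmod (F t)) ^ 6 + 6 * L * (cmod (F' t / L)) ^ 6)"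
proof -
  define h where "h t = (cmod (F t)) ^ 6" for t
  define h' where "h' t = 6 * (cmod (F t)) ^ 4 * (F t \<bullet> F' t)" for t
  define q where "q t = 6 * L * h t + 6 * L * (cmod (F' t / L)) ^ 6" for t
  have contF: "continuous_on A F" for A
    using deriv by (meson continuous_at_imp_continuous_on has_vector_derivative_continuous)
  have contF': "continuous_on A F'" for A using cont continuous_on_subset by blast
  have conth: "continuous_on A h" for A unfolding h_def by (intro continuous_intros contF)
  have contq: "continuous_on A q" for A unfolding q_def using L by (intro continuous_intros contF' conth) auto
  have dh: "(h has_vector_derivative h' t) (at t within A)" for t A
  proof -
    have "h = (\<lambda>t. (F t \<bullet> F t) ^ 3)"
      by (simp add: h_def fun_eq_iff dot_square_norm flip: power_mult)
    moreover have "((\<lambda>t. (F t \<bullet> F t) ^ 3) has_derivative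
        (\<lambda>s. 3 * (F t \<bullet> s *\<^sub>R F' t + s *\<^sub>R F' t \<bullet> F t) * (F t \<bullet> F t) ^ 2)) (at t within A)"
      by (rule derivative_eq_intros refl has_derivative_at_withinI[OF deriv[unfolded has_vector_derivative_def]])+ simp
    moreover have "(\<lambda>s. 3 * (F t \<bullet> s *\<^sub>R F' t + s *\<^sub>R F' t \<bullet> F t) * (F t \<bullet> F t) ^ 2) = (\<lambda>s. s * h' t)"
      by (simp add: h'_def fun_eq_iff inner_commute dot_square_norm flip: power_mult)
    ultimately show ?thesis by (simp add: has_vector_derivative_def)
  qed
  have hq: "\<bar>h' t\<bar> \<le> q t" for t
  proof -
    have "\<bar>h' t\<bar> \<le> 6 * (cmod (F t)) ^ 4 * (cmod (F t) * cmod (F' t))"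
      unfolding h'_def abs_mult by (intro mult_mono Cauchy_Schwarz_ineq2) auto
    also have "\<dots> = 6 * L * ((cmod (F t)) ^ 5 * cmod (F' t / L))"
      using L by (simp add: norm_divide numeral_eq_Suc)
    \<comment> \<open>Replacing both quantities by the larger one does the work of Young's
      inequality.\<close>
    also have "(cmod (F t)) ^ 5 * cmod (F' t / L) \<le> (cmod (F t)) ^ 6 + (cmod (F' t / L)) ^ 6"
    proof (cases "cmod (F t) \<ge> cmod (F' t / L)")
      case True
      then have "(cmod (F t)) ^ 5 * cmod (F' t / L) \<le> (cmod (F t)) ^ 5 * cmod (F t)" by (intro mult_left_mono) auto
      then show ?thesis by (simp add: numeral_eq_Suc mult_ac add_increasing2)
    next
      case False
      then have "(cmod (F t)) ^ 5 * cmod (F' t / L) \<le> (cmod (F' t / L)) ^ 5 * cmod (F' t / L)"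
        by (intro mult_right_mono power_mono) auto
      then show ?thesis by (simp add: numeral_eq_Suc mult_ac add_increasing)
    qed
    finally show ?thesis using L by (simp add: q_def h_def algebra_simps)
  qed
  obtain s where s: "s \<in> {0..2 * pi}" "\<And>t. t \<in> {0..2*pi} \<Longrightarrow> h s \<le> h t"
    using continuous_attains_inf[OF _ _ conth, of "{0..2*pi}"] by auto
  have q0: "q t \<ge> 0" for t using hq[of t] by linarith
  have int: "f integrable_on {a..b}" if "continuous_on {a..b} f" for f :: "real \<Rightarrow> real" and a b
    using that by (rule integrable_continuous_interval)
  have mean: "h s \<le> integral {0..2*pi} h"
  proof -
    have "integral {0..2*pi} (\<lambda>_. h s) \<le> integral {0..2*pi} h"
      by (intro integral_le s(2)) (auto intro!: int conth)
    then have "2 * pi * h s \<le> integral {0..2*pi} h" by simp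
    moreover have "1 * h s \<le> 2 * pi * h s" using pi_gt3 by (intro mult_right_mono) (auto simp: h_def)
    ultimately show ?thesis by simp
  qed
  have osc: "\<bar>h b - h a\<bar> \<le> integral {0..2*pi} q" if "a \<le> b" "a \<ge> 0" "b \<le> 2*pi" for a b
  proof -
    have "(h' has_integral h b - h a) {a..b}"
      using that by (intro fundamental_theorem_of_calculus dh)
    then have "\<bar>h b - h a\<bar> \<le> integral {a..b} q"
      using integral_norm_bound_integral[of h' "{a..b}" q] hq by (auto simp: int contq has_integral_iff)
    also have "\<dots> \<le> integral {0..2*pi} q"
      using that q0 by (intro integral_subset_le) (auto simp: int contq)
    finally show ?thesis .
  qed
  have "h t \<le> h s + integral {0..2*pi} q"
    using osc[of s t] osc[of t s] s(1) t by (cases "s \<le> t") auto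
  also have "\<dots> \<le> integral {0..2*pi} h + integral {0..2*pi} q" using mean by simp
  also have "\<dots> = integral {0..2*pi} (\<lambda>t. h t + q t)"
    by (intro integral_add[symmetric] int conth contq)
  also have "(\<lambda>t. h t + q t) = (\<lambda>t. (1 + 6 * L) * (cmod (F t)) ^ 6 + 6 * L * (cmod (F' t / L)) ^ 6)"
    by (simp add: h_def q_def fun_eq_iff algebra_simps)
  finally show ?thesis by (simp add: h_def)
qed

lemma continuous_on_sch_sum [continuous_intros]:
  assumes "continuous_on A f" "continuous_on A g"
  shows "continuous_on A (\<lambda>x. sch_sum \<eta> \<beta> B c (f x) (g x))"
  unfolding sch_sum_def cis_conv_exp by (intro continuous_intros assms)

lemma sch_sum_has_vector_derivative:
  "((\<lambda>t. sch_sum \<eta> \<beta> B c \<theta> t) has_vector_derivative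
     sch_sum \<eta> \<beta> B (\<lambda>n. \<i> * sch_freq \<eta> \<beta> n * c n) \<theta> t) (at t)"
proof -
  have "((\<lambda>t. c n * cis (real n * \<theta> + sch_freq \<eta> \<beta> n * t)) has_vector_derivative
     (\<i> * sch_freq \<eta> \<beta> n * c n) * cis (real n * \<theta> + sch_freq \<eta> \<beta> n * t)) (at t)" for n
  proof -
    have "((\<lambda>z. c n * exp (\<i> * (real n * \<theta> + sch_freq \<eta> \<beta> n * z))) has_field_derivative
       c n * (exp (\<i> * (real n * \<theta> + sch_freq \<eta> \<beta> n * of_real t)) * (\<i> * sch_freq \<eta> \<beta> n))) (at (of_real t))"
      by (auto intro!: derivative_eq_intros)
    from has_vector_derivative_real_field[OF this, of UNIV] show ?thesis
      by (simp add: cis_conv_exp mult_ac)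
  qed
  then show ?thesis unfolding sch_sum_def by (intro has_vector_derivative_sum)
qed

text \<open>A continuous majorant of the sixth power of the maximal function in time.\<close>

definition sch_sup6 :: "real \<Rightarrow> real \<Rightarrow> real \<Rightarrow> nat set \<Rightarrow> (nat \<Rightarrow> complex) \<Rightarrow> real \<Rightarrow> real" where
  "sch_sup6 L \<eta> \<beta> B c \<theta> = integral {0..2 * pi} (\<lambda>t. (1 + 6 * L) * (cmod (sch_sum \<eta> \<beta> B c \<theta> t)) ^ 6
     + 6 * L * (cmod (sch_sum \<eta> \<beta> B (\<lambda>n. \<i> * sch_freq \<eta> \<beta> n * c n / L) \<theta> t)) ^ 6)"

lemma sch_sum_le_sch_sup6:
  assumes "L > 0" "t \<in> {0..2 * pi}"
  shows "(cmod (sch_sum \<eta> \<beta> B c \<theta> t)) ^ 6 \<le> sch_sup6 L \<eta> \<beta> B c \<theta>"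
proof -
  have "sch_sum \<eta> \<beta> B (\<lambda>n. \<i> * sch_freq \<eta> \<beta> n * c n / L) \<theta> t
     = sch_sum \<eta> \<beta> B (\<lambda>n. \<i> * sch_freq \<eta> \<beta> n * c n) \<theta> t / L" for t
    by (simp add: sch_sum_def sum_divide_distrib)
  then show ?thesis
    unfolding sch_sup6_def
    using sobolev_pow6[OF sch_sum_has_vector_derivative _ assms, of \<eta> \<beta> B c \<theta>]
    by (simp add: continuous_on_sch_sum)
qed

lemma continuous_on_sch_sup6: "continuous_on A (sch_sup6 L \<eta> \<beta> B c)"
proof -
  have "continuous_on UNIV (\<lambda>\<theta>. sch_sup6 L \<eta> \<beta> B c \<theta>)"
    unfolding sch_sup6_def cbox_interval[symmetric]
    by (rule integral_continuous_on_param)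
       (auto simp: split_beta intro!: continuous_intros)
  then show ?thesis using continuous_on_subset by blast
qed

lemma sch_sup6_nonneg: "L > 0 \<Longrightarrow> sch_sup6 L \<eta> \<beta> B c \<theta> \<ge> 0"
  unfolding sch_sup6_def by (intro integral_nonneg integrable_continuous_interval continuous_intros) auto

text \<open>The sixth-power estimate has \<theta> as the inner variable and \<open>sch_sup6\<close>
  has t, hence the exchange of integrals. The second term has coefficients of modulus at most
  \<kappa> |c n|, and cubing the energy turns \<kappa>^2 into \<kappa>^6.\<close>

lemma integral_sch_sup6:
  fixes \<eta> :: int and \<beta> D L \<kappa> :: real
  assumes B: "B \<subseteq> {..<K}" and \<eta>: "\<eta> \<noteq> 0"
    and D: "\<And>P::int. P \<noteq> 0 \<Longrightarrow> \<bar>P\<bar> \<le> (int K)\<^sup>2 \<Longrightarrow> real (card {d. d dvd P}) \<le> D" and D0: "D \<ge> 0"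
    and L: "L > 0" and \<kappa>: "\<And>n. n \<in> B \<Longrightarrow> \<bar>sch_freq \<eta> \<beta> n\<bar> \<le> \<kappa> * L"
  shows "integral {0..2 * pi} (sch_sup6 L \<eta> \<beta> B c)
     \<le> (1 + 6 * L + 6 * L * \<kappa> ^ 6) * ((2 * pi)\<^sup>2 * (2 * D + 8) * (\<Sum>n\<in>B. (cmod (c n))\<^sup>2) ^ 3)"
proof -
  let ?I = "{0..2 * pi}" and ?c = "\<lambda>n. \<i> * sch_freq \<eta> \<beta> n * c n / L"
  let ?E = "(2 * pi)\<^sup>2 * (2 * D + 8)"
  let ?f = "\<lambda>c t. integral ?I (\<lambda>\<theta>. (cmod (sch_sum \<eta> \<beta> B c \<theta> t)) ^ 6)"
  have cont: "continuous_on A (?f c)" for c A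
  proof -
    have "continuous_on UNIV (?f c)"
      unfolding cbox_interval[symmetric]
      by (rule integral_continuous_on_param) (auto simp: split_beta intro!: continuous_intros)
    then show ?thesis using continuous_on_subset by blast
  qed
  have "integral ?I (sch_sup6 L \<eta> \<beta> B c) = integral ?I (\<lambda>\<theta>. integral ?I (\<lambda>t. (1 + 6 * L) * (cmod (sch_sum \<eta> \<beta> B c \<theta> t)) ^ 6
     + 6 * L * (cmod (sch_sum \<eta> \<beta> B ?c \<theta> t)) ^ 6))"
    by (simp add: sch_sup6_def[abs_def])
  also have "\<dots> = integral ?I (\<lambda>t. integral ?I (\<lambda>\<theta>. (1 + 6 * L) * (cmod (sch_sum \<eta> \<beta> B c \<theta> t)) ^ 6
     + 6 * L * (cmod (sch_sum \<eta> \<beta> B ?c \<theta> t)) ^ 6))"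
    unfolding cbox_interval[symmetric]
    by (rule integral_swap_continuous) (auto simp: split_beta intro!: continuous_intros)
  also have "\<dots> = integral ?I (\<lambda>t. (1 + 6 * L) * ?f c t + 6 * L * ?f ?c t)"
    by (subst integral_add) (auto intro!: integrable_continuous_interval continuous_intros)
  also have "\<dots> = (1 + 6 * L) * integral ?I (?f c) + 6 * L * integral ?I (?f ?c)"
    by (subst integral_add) (auto intro!: integrable_continuous_interval continuous_intros cont)
  also have "\<dots> \<le> (1 + 6 * L) * (?E * (\<Sum>n\<in>B. (cmod (c n))\<^sup>2) ^ 3) + 6 * L * (?E * (\<kappa> ^ 6 * (\<Sum>n\<in>B. (cmod (c n))\<^sup>2) ^ 3))"
  proof (intro add_mono mult_left_mono)
    show "integral ?I (?f c) \<le> ?E * (\<Sum>n\<in>B. (cmod (c n))\<^sup>2) ^ 3"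
      by (rule sch_sum_L6[OF B \<eta> D D0])
    have "integral ?I (?f ?c) \<le> ?E * (\<Sum>n\<in>B. (cmod (?c n))\<^sup>2) ^ 3"
      by (rule sch_sum_L6[OF B \<eta> D D0])
    also have "\<dots> \<le> ?E * (\<Sum>n\<in>B. \<kappa>\<^sup>2 * (cmod (c n))\<^sup>2) ^ 3"
    proof (intro mult_left_mono power_mono sum_mono sum_nonneg)
      fix n assume n: "n \<in> B"
      have "\<bar>sch_freq \<eta> \<beta> n\<bar> / L \<le> \<kappa>" using \<kappa>[OF n] L by (simp add: field_simps)
      then have "(\<bar>sch_freq \<eta> \<beta> n\<bar> / L)\<^sup>2 \<le> \<kappa>\<^sup>2" using L by (intro power_mono) auto
      then have "(\<bar>sch_freq \<eta> \<beta> n\<bar> / L)\<^sup>2 * (cmod (c n))\<^sup>2 \<le> \<kappa>\<^sup>2 * (cmod (c n))\<^sup>2" by (intro mult_right_mono) auto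
      then show "(cmod (?c n))\<^sup>2 \<le> \<kappa>\<^sup>2 * (cmod (c n))\<^sup>2"
        using L by (simp add: norm_mult norm_divide power_mult_distrib power_divide)
    qed (use D0 in auto)
    also have "\<dots> = ?E * (\<kappa> ^ 6 * (\<Sum>n\<in>B. (cmod (c n))\<^sup>2) ^ 3)"
      by (simp add: sum_distrib_left[symmetric] power_mult_distrib flip: power_mult)
    finally show "integral ?I (?f ?c) \<le> \<dots>" .
  qed (use L in auto)
  also have "\<dots> = (1 + 6 * L + 6 * L * \<kappa> ^ 6) * (?E * (\<Sum>n\<in>B. (cmod (c n))\<^sup>2) ^ 3)"
    by (simp add: algebra_simps)
  finally show ?thesis .
qed

text \<open>To be applied to the energies of disjoint intervals: a whole level of the binary
  subdivision costs no more than the undivided block.\<close>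

lemma sum_power3_le_power3_sum:
  fixes f :: "'a \<Rightarrow> real"
  assumes "finite A" "\<And>x. x \<in> A \<Longrightarrow> f x \<ge> 0"
  shows "(\<Sum>x\<in>A. f x ^ 3) \<le> (\<Sum>x\<in>A. f x) ^ 3"
proof -
  have "(\<Sum>x\<in>A. f x ^ 3) \<le> (\<Sum>x\<in>A. f x * (\<Sum>x\<in>A. f x)\<^sup>2)"
  proof (intro sum_mono)
    fix x assume x: "x \<in> A"
    have "f x \<le> (\<Sum>x\<in>A. f x)" using assms x by (intro member_le_sum) auto
    then have "(f x)\<^sup>2 \<le> (\<Sum>x\<in>A. f x)\<^sup>2" using assms(2)[OF x] by (intro power_mono)
    then show "f x ^ 3 \<le> f x * (\<Sum>x\<in>A. f x)\<^sup>2"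
      using assms(2)[OF x] by (simp add: power3_eq_cube power2_eq_square mult.assoc mult_left_mono)
  qed
  also have "\<dots> = (\<Sum>x\<in>A. f x) ^ 3" by (simp add: sum_distrib_right[symmetric] power3_eq_cube power2_eq_square)
  finally show ?thesis .
qed

text \<open>Half of the decay is spent on summing the integrals of W k / r^k. The sum of these
  functions is then finite almost everywhere and bounds each of its terms.\<close>

lemma AE_bounded_of_nn_integral_geometric:
  fixes W :: "nat \<Rightarrow> 'a \<Rightarrow> real" and r C :: real
  assumes meas: "\<And>k. W k \<in> borel_measurable \<mu>" and r: "0 < r" "r < 1" and C: "C \<ge> 0"
    and int: "\<And>k. (\<integral>\<^sup>+x. ennreal (W k x) \<partial>\<mu>) \<le> ennreal (C * (real k + 1) * (r ^ k)\<^sup>2)"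
  shows "AE x in \<mu>. \<exists>B\<ge>0. \<forall>k. W k x \<le> B * r ^ k"
proof -
  have r0: "r ^ k > 0" for k using r by simp
  have "(\<integral>\<^sup>+x. (\<Sum>k. ennreal (W k x / r ^ k)) \<partial>\<mu>) = (\<Sum>k. \<integral>\<^sup>+x. ennreal (W k x / r ^ k) \<partial>\<mu>)"
    using meas by (intro nn_integral_suminf) auto
  also have "\<dots> \<le> (\<Sum>k. ennreal (C * (real (Suc k) * r ^ k)))"
  proof (intro suminf_le allI)
    fix k
    have "(\<integral>\<^sup>+x. ennreal (W k x / r ^ k) \<partial>\<mu>) = (\<integral>\<^sup>+x. ennreal (1 / r ^ k) * ennreal (W k x) \<partial>\<mu>)"
      using r0[of k] by (intro nn_integral_cong) (auto simp: ennreal_mult''[symmetric] divide_inverse mult.commute)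
    also have "\<dots> = ennreal (1 / r ^ k) * (\<integral>\<^sup>+x. ennreal (W k x) \<partial>\<mu>)"
      using meas by (intro nn_integral_cmult) auto
    also have "\<dots> \<le> ennreal (1 / r ^ k) * ennreal (C * (real k + 1) * (r ^ k)\<^sup>2)"
      by (intro mult_left_mono int) simp
    also have "\<dots> = ennreal (C * (real (Suc k) * r ^ k))"
      using r0[of k] C by (simp add: ennreal_mult'[symmetric] power2_eq_square field_simps)
    finally show "(\<integral>\<^sup>+x. ennreal (W k x / r ^ k) \<partial>\<mu>) \<le> ennreal (C * (real (Suc k) * r ^ k))" .
  qed auto
  also have "\<dots> = ennreal (\<Sum>k. C * (real (Suc k) * r ^ k))"
    using geometric_deriv_sums[of r] r C
    by (intro suminf_ennreal2 summable_mult mult_nonneg_nonneg) (auto simp: sums_iff)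
  finally have "(\<integral>\<^sup>+x. (\<Sum>k. ennreal (W k x / r ^ k)) \<partial>\<mu>) \<noteq> \<infinity>"
    by (metis ennreal_neq_top infinity_ennreal_def neq_top_trans)
  then have "AE x in \<mu>. (\<Sum>k. ennreal (W k x / r ^ k)) \<noteq> \<infinity>"
    using meas by (intro nn_integral_PInf_AE) auto
  then show ?thesis
  proof eventually_elim
    case (elim x)
    define B where "B = enn2real (\<Sum>k. ennreal (W k x / r ^ k))"
    have B: "ennreal B = (\<Sum>k. ennreal (W k x / r ^ k))"
      using elim by (simp add: B_def less_top)
    have "W k x \<le> B * r ^ k" for k
    proof -
      have "ennreal (W k x / r ^ k) \<le> ennreal B"
        unfolding B using sum_le_suminf[of "\<lambda>k. ennreal (W k x / r ^ k)" "{k}"] by auto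
      then have "W k x / r ^ k \<le> B" by (simp add: B_def ennreal_le_iff)
      then show ?thesis using r0[of k] by (simp add: field_simps)
    qed
    moreover have "B \<ge> 0" by (simp add: B_def)
    ultimately show ?case by blast
  qed
qed

text \<open>The law of the angle enters through \<open>dom\<close>, a comparison with Lebesgue
  measure on continuous functions; the majorants \<open>sch_sup6\<close> are continuous so that it
  can be applied to them.\<close>

theorem AE_uniformly_convergent_sch_sum:
  fixes \<mu> :: "real measure" and \<eta> :: int and \<beta> \<alpha> M C0 :: real and c :: "nat \<Rightarrow> complex"
  assumes sets: "sets \<mu> = sets borel"
    and dom: "\<And>G. continuous_on UNIV G \<Longrightarrow> (\<And>\<theta>. G \<theta> \<ge> 0) \<Longrightarrow>
          (\<integral>\<^sup>+\<theta>. ennreal (G \<theta>) \<partial>\<mu>) \<le> ennreal (C0 * integral {0..2 * pi} G)"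
    and C0: "C0 \<ge> 0" and \<eta>: "\<eta> \<noteq> 0" and \<alpha>: "\<alpha> > 1 / 3" and M: "M \<ge> 0"
    and c: "\<And>k. (\<Sum>n\<in>{2 ^ k..<2 ^ Suc k}. (cmod (c n))\<^sup>2) \<le> M * 2 powr (- 2 * \<alpha> * k)"
  shows "AE \<theta> in \<mu>. uniformly_convergent_on {0..2 * pi} (\<lambda>N t. sch_sum \<eta> \<beta> {..<N} c \<theta> t)"
proof -
  \<comment> \<open>Chosen so that 2 - 6 \<alpha> = - 4 e. The derivative costs 2^(2 k), the divisor
    bound 2^(2 e k), and the cubed energy gives 2^(- 6 \<alpha> k); what is left is 2^(- 2 e k), the
    square of r^k.\<close>
  define e where "e = (6 * \<alpha> - 2) / 4"
  have e: "e > 0" using \<alpha> by (simp add: e_def)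
  define r where "r = 2 powr (- e)"
  have r: "0 < r" "r < 1" using e by (auto simp: r_def powr_less_one)
  have rk: "r ^ k = 2 powr (- e * k)" for k by (simp add: r_def powr_power mult.commute)
  obtain Cd where Cd: "Cd \<ge> 0" "\<And>n::nat. n > 0 \<Longrightarrow> real (card {d. d dvd n}) \<le> Cd * real n powr e"
    using divisor_bound[OF e] by blast
  \<comment> \<open>The 2 accounts for the divisors of either sign; the numbers P that occur are at
    most the square of the right end of the block.\<close>
  define D where "D k = 2 * Cd * (((2::real) ^ Suc k)\<^sup>2) powr e" for k :: nat
  have D0: "D k \<ge> 0" for k using Cd by (simp add: D_def)
  have D: "real (card {d. d dvd P}) \<le> D k" if P: "P \<noteq> 0" "\<bar>P\<bar> \<le> (int (2 ^ Suc k))\<^sup>2" for P :: int and k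
  proof -
    have "real (card {d. d dvd P}) \<le> 2 * real (card {d::nat. d dvd nat \<bar>P\<bar>})"
      using card_int_divisors[OF P(1)] by linarith
    also have "\<dots> \<le> 2 * (Cd * real (nat \<bar>P\<bar>) powr e)"
      using P by (intro mult_left_mono Cd(2)) auto
    also have "\<dots> \<le> 2 * (Cd * (((2::real) ^ Suc k)\<^sup>2) powr e)"
    proof (intro mult_left_mono powr_mono2)
      have "real_of_int \<bar>P\<bar> \<le> real_of_int ((int (2 ^ Suc k))\<^sup>2)" using P(2) by (simp only: of_int_le_iff)
      then show "real (nat \<bar>P\<bar>) \<le> (2 ^ Suc k)\<^sup>2" by simp
    qed (use Cd e in auto)
    finally show ?thesis by (simp add: D_def)
  qed
  \<comment> \<open>For n < 2^(k + 1) one has |n^2 + \<beta> n| \<le> (1 + |\<beta>|) n^2 \<le> 4 (1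
    + |\<beta>|) 4^k, so L = 4^k is the right scale in \<open>sch_sup6\<close>.\<close>
  define \<kappa> where "\<kappa> = \<bar>\<eta>\<bar> * (4 * (1 + \<bar>\<beta>\<bar>))"
  have \<kappa>: "\<bar>sch_freq \<eta> \<beta> n\<bar> \<le> \<kappa> * 4 ^ k" if "n < 2 ^ Suc k" for n k
  proof -
    have n: "real n \<le> (real n)\<^sup>2" by (cases n) (auto simp: power2_eq_square)
    have "real n \<le> 2 ^ Suc k" using that by (metis less_imp_le of_nat_le_iff of_nat_numeral of_nat_power)
    then have n2: "(real n)\<^sup>2 \<le> (2 ^ Suc k)\<^sup>2" by (intro power_mono) auto
    have "\<bar>(real n)\<^sup>2 + \<beta> * real n\<bar> \<le> (real n)\<^sup>2 + \<bar>\<beta>\<bar> * real n"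
      by (intro order.trans[OF abs_triangle_ineq]) (simp add: abs_mult)
    also have "\<dots> \<le> (real n)\<^sup>2 + \<bar>\<beta>\<bar> * (real n)\<^sup>2" using n by (intro add_left_mono mult_left_mono) auto
    also have "\<dots> = (1 + \<bar>\<beta>\<bar>) * (real n)\<^sup>2" by (simp add: algebra_simps)
    also have "\<dots> \<le> (1 + \<bar>\<beta>\<bar>) * (2 ^ Suc k)\<^sup>2" using n2 by (intro mult_left_mono) auto
    also have "((2::real) ^ Suc k)\<^sup>2 = 4 * 4 ^ k" by (simp add: power2_eq_square flip: power_mult_distrib)
    finally have "\<bar>\<eta>\<bar> * \<bar>(real n)\<^sup>2 + \<beta> * real n\<bar> \<le> \<bar>\<eta>\<bar> * ((1 + \<bar>\<beta>\<bar>) * (4 * 4 ^ k))"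
      by (intro mult_left_mono) auto
    then show ?thesis unfolding sch_freq_def \<kappa>_def abs_mult by (simp only: of_int_abs mult_ac)
  qed
  have \<kappa>0: "\<kappa> \<ge> 0" by (simp add: \<kappa>_def)
  define C1 where "C1 = (7 + 6 * \<kappa> ^ 6) * ((2 * pi)\<^sup>2 * (4 * Cd * 4 powr e + 8))"
  have C1: "C1 \<ge> 0" using Cd \<kappa>0 by (simp add: C1_def)
  let ?G = "\<lambda>k B. sch_sup6 (4 ^ k) \<eta> \<beta> B c"
  let ?B = "\<lambda>k j (l::nat). {2 ^ k + l * 2 ^ j..<2 ^ k + (l + 1) * 2 ^ j}"
  have blockint: "integral {0..2 * pi} (?G k B) \<le> C1 * 4 ^ k * 2 powr (2 * e * k) * (\<Sum>n\<in>B. (cmod (c n))\<^sup>2) ^ 3"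
    if B: "B \<subseteq> {..<2 ^ Suc k}" for k B
  proof -
    let ?S = "(\<Sum>n\<in>B. (cmod (c n))\<^sup>2) ^ 3"
    have S: "?S \<ge> 0" by (intro zero_le_power sum_nonneg) auto
    have "integral {0..2 * pi} (?G k B)
      \<le> (1 + 6 * 4 ^ k + 6 * 4 ^ k * \<kappa> ^ 6) * ((2 * pi)\<^sup>2 * (2 * D k + 8) * ?S)"
      using B by (intro integral_sch_sup6[OF B \<eta> D D0]) (auto intro!: \<kappa>)
    also have "\<dots> \<le> ((7 + 6 * \<kappa> ^ 6) * 4 ^ k) * ((2 * pi)\<^sup>2 * ((4 * Cd * 4 powr e + 8) * 2 powr (2 * e * k)) * ?S)"
    proof (intro mult_mono mult_right_mono mult_left_mono)
      show "1 + 6 * 4 ^ k + 6 * 4 ^ k * \<kappa> ^ 6 \<le> (7 + 6 * \<kappa> ^ 6) * 4 ^ k"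
        by (simp add: algebra_simps)
      have "D k = 2 * Cd * 4 powr e * 2 powr (2 * e * k)"
      proof -
        have "((2::real) ^ Suc k) ^ 2 = 4 * 2 powr (2 * real k)"
          by (simp add: powr_realpow[symmetric] power2_eq_square powr_add[symmetric])
        then show ?thesis by (simp add: D_def powr_mult powr_powr mult_ac)
      qed
      moreover have "8 \<le> 8 * 2 powr (2 * e * k)" using e by (simp add: ge_one_powr_ge_zero)
      ultimately show "2 * D k + 8 \<le> (4 * Cd * 4 powr e + 8) * 2 powr (2 * e * k)"
        by (simp add: algebra_simps)
    qed (use S D0[of k] \<kappa>0 Cd(1) in \<open>auto intro!: mult_nonneg_nonneg add_nonneg_nonneg\<close>)
    also have "\<dots> = C1 * 4 ^ k * 2 powr (2 * e * k) * ?S" by (simp add: C1_def mult_ac)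
    finally show ?thesis .
  qed
  \<comment> \<open>The majorants of all binary intervals of all k + 1 lengths together: one
    function that controls every initial piece of the block.\<close>
  define W where "W k \<theta> = (\<Sum>j\<le>k. \<Sum>l<2 ^ (k - j). ?G k (?B k j l) \<theta>)" for k \<theta>
  have sub: "?B k j l \<subseteq> {2 ^ k..<2 ^ Suc k}" if "j \<le> k" "l < 2 ^ (k - j)" for k j l
  proof -
    have "(l + 1) * 2 ^ j \<le> 2 ^ (k - j) * (2::nat) ^ j" using that by (intro mult_right_mono) auto
    also have "\<dots> = 2 ^ k" using that by (simp flip: power_add)
    finally show ?thesis by auto
  qed
  have contW: "continuous_on A (W k)" for A k
    unfolding W_def by (intro continuous_intros continuous_on_sch_sup6)
  have W0: "W k \<theta> \<ge> 0" for k \<theta> unfolding W_def by (intro sum_nonneg sch_sup6_nonneg) auto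
  have "integral {0..2 * pi} (W k) \<le> C1 * M ^ 3 * (real k + 1) * (r ^ k)\<^sup>2" for k
  proof -
    let ?S = "\<Sum>n\<in>{2 ^ k..<2 ^ Suc k}. (cmod (c n))\<^sup>2" and ?A = "C1 * 4 ^ k * 2 powr (2 * e * k)"
    have A: "?A \<ge> 0" using C1 by simp
    have "integral {0..2 * pi} (W k) = (\<Sum>j\<le>k. \<Sum>l<2 ^ (k - j). integral {0..2 * pi} (?G k (?B k j l)))"
      unfolding W_def[abs_def]
      by (subst integral_sum integral_sum; (intro finite_lessThan finite_atMost integrable_sum integrable_continuous_interval continuous_on_sch_sup6 continuous_on_sum)?)+
         (auto intro!: sum.cong integral_sum integrable_continuous_interval continuous_on_sch_sup6)
    also have "\<dots> \<le> (\<Sum>j\<le>k. \<Sum>l<2 ^ (k - j). ?A * (\<Sum>n\<in>?B k j l. (cmod (c n))\<^sup>2) ^ 3)"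
      using sub by (intro sum_mono blockint) fastforce
    also have "\<dots> = ?A * (\<Sum>j\<le>k. \<Sum>l<2 ^ (k - j). (\<Sum>n\<in>?B k j l. (cmod (c n))\<^sup>2) ^ 3)"
      by (simp add: sum_distrib_left)
    also have "\<dots> \<le> ?A * (\<Sum>j\<le>k. ?S ^ 3)"
    proof (intro mult_left_mono[OF _ A] sum_mono)
      fix j assume j: "j \<in> {..k}"
      have "(\<Sum>l<2 ^ (k - j). (\<Sum>n\<in>?B k j l. (cmod (c n))\<^sup>2) ^ 3) \<le> (\<Sum>l<2 ^ (k - j). \<Sum>n\<in>?B k j l. (cmod (c n))\<^sup>2) ^ 3"
        by (intro sum_power3_le_power3_sum sum_nonneg) auto
      also have "(\<Sum>l<2 ^ (k - j). \<Sum>n\<in>?B k j l. (cmod (c n))\<^sup>2) =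
         (\<Sum>l<2 ^ (k - j). \<Sum>n\<in>{l * 2 ^ j..<l * 2 ^ j + 2 ^ j}. (cmod (c (n + 2 ^ k)))\<^sup>2)"
        by (intro sum.cong refl sum.reindex_bij_witness[of _ "\<lambda>n. n + 2 ^ k" "\<lambda>n. n - 2 ^ k"]) auto
      also have "\<dots> = (\<Sum>n<2 ^ (k - j) * 2 ^ j. (cmod (c (n + 2 ^ k)))\<^sup>2)"
        by (rule sum.nat_group)
      also have "2 ^ (k - j) * 2 ^ j = (2::nat) ^ k" using j by (simp flip: power_add)
      also have "(\<Sum>n<2 ^ k. (cmod (c (n + 2 ^ k)))\<^sup>2) = ?S"
        by (intro sum.reindex_bij_witness[of _ "\<lambda>n. n - 2 ^ k" "\<lambda>n. n + 2 ^ k"]) auto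
      finally show "(\<Sum>l<2 ^ (k - j). (\<Sum>n\<in>?B k j l. (cmod (c n))\<^sup>2) ^ 3) \<le> ?S ^ 3" .
    qed
    also have "\<dots> = ?A * (real k + 1) * ?S ^ 3" by simp
    also have "\<dots> \<le> ?A * (real k + 1) * (M * 2 powr (- 2 * \<alpha> * k)) ^ 3"
      using A by (intro mult_left_mono power_mono c sum_nonneg) auto
    also have "\<dots> = C1 * M ^ 3 * (real k + 1) * (4 ^ k * 2 powr (2 * e * k) * (2 powr (- 2 * \<alpha> * k)) ^ 3)"
      by (simp add: power_mult_distrib mult_ac)
    also have "4 ^ k * 2 powr (2 * e * k) * (2 powr (- 2 * \<alpha> * k)) ^ 3 = (r ^ k)\<^sup>2"
    proof -
      have 4: "(4::real) ^ k = 2 powr (2 * k)" by (simp add: powr_realpow[symmetric] powr_powr[symmetric])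
      show ?thesis
      proof -
        have "(4::real) ^ k * 2 powr (2 * e * k) * (2 powr (- 2 * \<alpha> * k)) ^ 3 = 2 powr (2 * real k + 2 * e * k + 3 * (- 2 * \<alpha> * k))"
          unfolding 4 by (simp add: powr_power powr_add[symmetric] algebra_simps)
        moreover have "(r ^ k)\<^sup>2 = 2 powr (2 * (- e * k))" unfolding rk by (simp add: powr_power)
        moreover have "2 * real k + 2 * e * k + 3 * (- 2 * \<alpha> * k) = 2 * (- e * k)"
          by (simp add: e_def field_simps)
        ultimately show ?thesis by metis
      qed
    qed
    finally show ?thesis .
  qed
  note intW = this
  have "(\<integral>\<^sup>+\<theta>. ennreal (W k \<theta>) \<partial>\<mu>) \<le> ennreal ((C0 * (C1 * M ^ 3)) * (real k + 1) * (r ^ k)\<^sup>2)" for k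
  proof -
    have "(\<integral>\<^sup>+\<theta>. ennreal (W k \<theta>) \<partial>\<mu>) \<le> ennreal (C0 * integral {0..2 * pi} (W k))"
      by (rule dom[OF contW W0])
    also have "\<dots> \<le> ennreal ((C0 * (C1 * M ^ 3)) * (real k + 1) * (r ^ k)\<^sup>2)"
      using mult_left_mono[OF intW[of k] C0] by (intro ennreal_leI) (simp add: mult.assoc)
    finally show ?thesis .
  qed
  moreover have "W k \<in> borel_measurable \<mu>" for k
    using borel_measurable_continuous_onI[OF contW] measurable_cong_sets[OF sets refl] by blast
  ultimately have "AE \<theta> in \<mu>. \<exists>B\<ge>0. \<forall>k. W k \<theta> \<le> B * r ^ k"
    using r C0 C1 M by (intro AE_bounded_of_nn_integral_geometric[where C = "C0 * (C1 * M ^ 3)"]) auto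
  then show ?thesis
  proof eventually_elim
    case (elim \<theta>)
    then obtain B where B: "B \<ge> 0" "\<And>k. W k \<theta> \<le> B * r ^ k" by blast
    \<comment> \<open>Sixth roots turn the bound for the sixth powers into geometric decay of the
      sums; the factor k + 1 from the binary pieces leaves \<open>v\<close> summable.\<close>
    define q where "q = root 6 r"
    have q: "0 < q" "q < 1" "q ^ 6 = r" using r by (auto simp: q_def)
    have B6: "root 6 B ^ 6 = B" "root 6 B \<ge> 0" using B(1) by auto
    define v where "v k = (real k + 1) * (root 6 B * q ^ k)" for k
    show ?case
      unfolding sch_sum_def
    proof (rule dyadic_uniformly_convergent)
      have "summable (\<lambda>k. root 6 B * (real (Suc k) * q ^ k))"
        using geometric_deriv_sums[of q] q by (intro summable_mult) (auto simp: sums_iff)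
      then show "summable v" by (simp add: v_def[abs_def] mult_ac add_ac)
      show "v k \<ge> 0" for k using q B6 by (simp add: v_def)
    next
      fix k m :: nat and t :: real
      assume t: "t \<in> {0..2 * pi}" and m: "2 ^ k \<le> m" "m \<le> 2 ^ Suc k"
      let ?x = "\<lambda>n. c n * cis (real n * \<theta> + sch_freq \<eta> \<beta> n * t)"
      have "cmod (\<Sum>n\<in>{2 ^ k..<2 ^ k + (m - 2 ^ k)}. ?x n) \<le> (real k + 1) * (root 6 B * q ^ k)"
      proof (rule binary_block_prefix_bound)
        fix j l :: nat assume jl: "j \<le> k" "l < 2 ^ (k - j)"
        have "(cmod (\<Sum>n\<in>?B k j l. ?x n)) ^ 6 \<le> ?G k (?B k j l) \<theta>"
          using sch_sum_le_sch_sup6[OF _ t, of "4 ^ k" \<eta> \<beta> "?B k j l" c \<theta>] by (simp add: sch_sum_def)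
        also have "\<dots> \<le> (\<Sum>l<2 ^ (k - j). ?G k (?B k j l) \<theta>)"
          using jl by (intro member_le_sum sch_sup6_nonneg) auto
        also have "\<dots> \<le> W k \<theta>"
          unfolding W_def using jl
          by (intro member_le_sum[of j "{..k}" "\<lambda>j. \<Sum>l<2 ^ (k - j). ?G k (?B k j l) \<theta>"] sum_nonneg sch_sup6_nonneg) auto
        also have "\<dots> \<le> B * r ^ k" by (rule B(2))
        also have "\<dots> = (root 6 B * q ^ k) ^ 6"
        proof -
          have "(q ^ k) ^ 6 = (q ^ 6) ^ k" by (simp only: power_mult[symmetric] mult.commute)
          then show ?thesis by (simp only: power_mult_distrib B6(1) q(3))
        qed
        finally have "(cmod (\<Sum>n\<in>?B k j l. ?x n)) ^ 6 \<le> (root 6 B * q ^ k) ^ 6" .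
        then show "cmod (\<Sum>n\<in>?B k j l. ?x n) \<le> root 6 B * q ^ k"
          using B6(2) q(1) by (subst (asm) power_mono_iff) auto
      qed (use m B6 q in auto)
      then show "cmod (\<Sum>n\<in>{2 ^ k..<m}. ?x n) \<le> v k" using m by (simp add: v_def)
    qed
  qed
qed

section \<open>Jacobi polynomials\<close>

text \<open>The ratio of consecutive coefficients of a Jacobi polynomial, cleared of denominators;
  it makes the sums in Jacobi's equation cancel.\<close>

lemma jacobi_coeff_rec:
  fixes a b :: real
  assumes "s < n"
  shows "(real s + 1) * (real s + 1 + a) * (((real n + a) gchoose (n - Suc s)) * ((real n + b) gchoose (Suc s)))
    = real (n - s) * (real (n - s) + b) * (((real n + a) gchoose (n - s)) * ((real n + b) gchoose s))"
proof -
  obtain t where t: "n = s + Suc t" using assms less_iff_Suc_add by auto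
  have 1: "(real n + b gchoose Suc s) * (real s + 1) = (real n + b gchoose s) * (real n + b - real s)"
    using gbinomial_absorb_comp[of "real n + b" s] gbinomial_mult_1[of "real n + b" s] by (simp add: algebra_simps)
  have 2: "(real n + a gchoose Suc t) * (real t + 1) = (real n + a gchoose t) * (real n + a - real t)"
    using gbinomial_mult_1[of "real n + a" t] by (simp add: algebra_simps)
  have "(real s + 1) * (real s + 1 + a) * (((real n + a) gchoose t) * ((real n + b) gchoose (Suc s)))
     = ((real n + b gchoose Suc s) * (real s + 1)) * ((real n + a gchoose t) * (real n + a - real t))"
    by (simp add: t algebra_simps)
  also have "\<dots> = ((real n + b gchoose s) * (real n + b - real s)) * ((real n + a gchoose Suc t) * (real t + 1))"
    by (simp only: 1 2)
  finally show ?thesis by (simp add: t algebra_simps)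
qed

lemma pderiv_sum: "pderiv (\<Sum>x\<in>A. f x) = (\<Sum>x\<in>A. pderiv (f x))"
  by (induction A rule: infinite_finite_induct) (auto simp: pderiv_add)

lemma smult_sum_right: "smult c (\<Sum>x\<in>A. f x) = (\<Sum>x\<in>A. smult c (f x))"
  by (induction A rule: infinite_finite_induct) (auto simp: smult_add_right)

text \<open>The sum \<open>jacobi_poly\<close> as an element of the polynomial ring, where
  derivative, degree and leading coefficient are available.\<close>

definition jpoly :: "real \<Rightarrow> real \<Rightarrow> nat \<Rightarrow> real poly" where
  "jpoly a b n = (\<Sum>s\<le>n. smult (((real n + a) gchoose (n - s)) * ((real n + b) gchoose s))
     ([:-1/2, 1/2:] ^ s * [:1/2, 1/2:] ^ (n - s)))"

lemma jacobi_poly_eq_poly: "jacobi_poly n a b x = poly (jpoly a b n) x"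
  by (simp add: jacobi_poly_def jpoly_def poly_sum mult.assoc field_simps)

text \<open>With X = (x - 1)/2 and Y = (x + 1)/2 the operator sends X^s Y^(n-s) to a combination of
  itself and its two neighbours (\<open>tm\<close>). The contributions to each monomial then cancel
  by \<open>jacobi_coeff_rec\<close>.\<close>

lemma jacobi_ode_poly:
  fixes a b :: real
  defines "X \<equiv> [:-1/2, 1/2:] :: real poly" and "Y \<equiv> [:1/2, 1/2:] :: real poly"
  shows "[:1, 0, -1:] * pderiv (pderiv (jpoly a b n))
    = [:a - b, a + b + 2:] * pderiv (jpoly a b n) - smult (real n * (real n + a + b + 1)) (jpoly a b n)"
proof -
  define c where "c s = ((real n + a) gchoose (n - s)) * ((real n + b) gchoose s)" for s
  have e1: "[:1, 0, -1:] = - (smult 4 (X * Y))" by (simp add: X_def Y_def)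
  have e2: "[:a - b, a + b + 2:] = smult (2 * (b + 1)) X + smult (2 * (a + 1)) Y"
    by (simp add: X_def Y_def field_simps)
  have dX: "pderiv X = [:1/2:]" and dY: "pderiv Y = [:1/2:]" by (simp_all add: X_def Y_def pderiv_pCons)
  define m where "m s t = X ^ s * Y ^ t" for s t
  \<comment> \<open>The factor 2 absorbs the derivative 1/2 of X and Y. The truncated difference s -
    1 does no harm, since its coefficient vanishes for s = 0.\<close>
  have d1: "smult 2 (pderiv (m s t)) = smult (real s) (m (s - 1) t) + smult (real t) (m s (t - 1))" for s t
  proof -
    have "smult 2 (pderiv (X ^ s)) = smult (real s) (X ^ (s - 1))" "smult 2 (pderiv (Y ^ t)) = smult (real t) (Y ^ (t - 1))"
      by (simp_all add: pderiv_power dX dY)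
    moreover have "smult 2 (pderiv (m s t)) = X ^ s * smult 2 (pderiv (Y ^ t)) + Y ^ t * smult 2 (pderiv (X ^ s))"
      by (simp add: m_def pderiv_mult smult_add_right)
    ultimately show ?thesis by (simp add: m_def mult_ac)
  qed
  have two: "2 * p = smult 2 p" for p :: "real poly"
    by (metis mult_2 smult_add_left one_add_one smult_1_left)
  have mXY: "X * m s t = m (Suc s) t" "Y * m s t = m s (Suc t)" for s t
    by (simp_all add: m_def mult_ac)
  have tm: "- (smult 4 (X * Y)) * pderiv (pderiv (m s t)) - (smult (2 * (b + 1)) X + smult (2 * (a + 1)) Y) * pderiv (m s t)
     + smult (real n * (real n + a + b + 1)) (m s t)
    = smult (real s * (real s + a) + real t * (real t + b)) (m s t)
      - smult (real s * (real s + a)) (m (s - 1) (Suc t)) - smult (real t * (real t + b)) (m (Suc s) (t - 1))"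
    if n: "n = s + t" for s t
  proof -
    have "smult 4 (pderiv (pderiv (m s t))) = smult 2 (pderiv (smult 2 (pderiv (m s t))))"
      by (simp add: pderiv_smult)
    also have "\<dots> = smult 2 (pderiv (smult (real s) (m (s - 1) t) + smult (real t) (m s (t - 1))))"
      by (simp only: d1)
    also have "\<dots> = smult (real s) (smult 2 (pderiv (m (s - 1) t))) + smult (real t) (smult 2 (pderiv (m s (t - 1))))"
      by (simp add: pderiv_add pderiv_smult smult_add_right mult_ac)
    also have "\<dots> = smult (real s * real (s - 1)) (m (s - 2) t) + smult (2 * real s * real t) (m (s - 1) (t - 1))
        + smult (real t * real (t - 1)) (m s (t - 2))"
      unfolding d1 by (simp add: smult_add_right numeral_2_eq_2) (simp add: algebra_simps smult_add_left[symmetric])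
    finally have dd: "smult 4 (pderiv (pderiv (m s t))) = \<dots>" .
    have "- (smult 4 (X * Y)) * pderiv (pderiv (m s t)) = - (X * (Y * smult 4 (pderiv (pderiv (m s t)))))"
      by (simp add: mult.assoc)
    also have "\<dots> = - (smult (real s * real (s - 1)) (m (s - 1) (Suc t)) + smult (2 * real s * real t) (m s t)
        + smult (real t * real (t - 1)) (m (Suc s) (t - 1)))"
      unfolding dd by (cases s; cases t; cases "s - 1"; cases "t - 1") (simp_all add: distrib_left mXY)
    finally have A: "- (smult 4 (X * Y)) * pderiv (pderiv (m s t)) = \<dots>" .
    have "(smult (2 * (b + 1)) X + smult (2 * (a + 1)) Y) * pderiv (m s t)
      = smult (b + 1) (X * smult 2 (pderiv (m s t))) + smult (a + 1) (Y * smult 2 (pderiv (m s t)))"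
      by (simp add: algebra_simps)
    also have "\<dots> = smult ((b + 1) * real s + (a + 1) * real t) (m s t) + smult ((b + 1) * real t) (m (Suc s) (t - 1))
       + smult ((a + 1) * real s) (m (s - 1) (Suc t))"
      unfolding d1 by (cases s; cases t) (simp_all add: distrib_left mXY poly_eq_iff, simp_all add: algebra_simps)
    finally have B: "(smult (2 * (b + 1)) X + smult (2 * (a + 1)) Y) * pderiv (m s t) = \<dots>" .
    show ?thesis
      unfolding A B n
      by (cases s; cases t) (simp_all add: poly_eq_iff algebra_simps two)
  qed
  let ?N = "real n * (real n + a + b + 1)"
  have J: "jpoly a b n = (\<Sum>s\<le>n. smult (c s) (m s (n - s)))"
    by (simp add: jpoly_def c_def m_def X_def Y_def)
  have "- (smult 4 (X * Y)) * pderiv (pderiv (jpoly a b n)) - (smult (2 * (b + 1)) X + smult (2 * (a + 1)) Y) * pderiv (jpoly a b n) + smult ?N (jpoly a b n)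
    = (\<Sum>s\<le>n. smult (c s) (- (smult 4 (X * Y)) * pderiv (pderiv (m s (n - s))) - (smult (2 * (b + 1)) X + smult (2 * (a + 1)) Y) * pderiv (m s (n - s))
     + smult ?N (m s (n - s))))"
    unfolding J pderiv_sum pderiv_smult smult_sum_right sum_distrib_left sum_subtractf[symmetric] sum.distrib[symmetric]
    by (intro sum.cong refl) (simp add: smult_add_right smult_diff_right mult.commute)
  also have "\<dots> = (\<Sum>s\<le>n. smult (c s) (smult (real s * (real s + a) + real (n - s) * (real (n - s) + b)) (m s (n - s))
      - smult (real s * (real s + a)) (m (s - 1) (Suc (n - s))) - smult (real (n - s) * (real (n - s) + b)) (m (Suc s) (n - s - 1))))"
    by (intro sum.cong refl arg_cong2[where f = smult] tm) auto
  also have "\<dots> = (\<Sum>s\<le>n. smult (c s * (real s * (real s + a))) (m s (n - s)))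
     + (\<Sum>s\<le>n. smult (c s * (real (n - s) * (real (n - s) + b))) (m s (n - s)))
     - (\<Sum>s\<le>n. smult (c s * (real s * (real s + a))) (m (s - 1) (Suc (n - s))))
     - (\<Sum>s\<le>n. smult (c s * (real (n - s) * (real (n - s) + b))) (m (Suc s) (n - s - 1)))"
    by (simp add: smult_diff_right smult_add_left smult_add_right sum_subtractf sum.distrib distrib_left)
  \<comment> \<open>After an index shift the neighbour sums match the diagonal sums crosswise: the
    one lowering s gives the terms in n - s, the one raising s those in s.\<close>
  also have "(\<Sum>s\<le>n. smult (c s * (real s * (real s + a))) (m (s - 1) (Suc (n - s))))
     = (\<Sum>s\<in>{1..n}. smult (c s * (real s * (real s + a))) (m (s - 1) (Suc (n - s))))"
    by (rule sum.mono_neutral_right) auto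
  also have "\<dots> = (\<Sum>s\<in>{..<n}. smult (c (Suc s) * (real (Suc s) * (real (Suc s) + a))) (m s (n - s)))"
    by (rule sum.reindex_bij_witness[of _ Suc "\<lambda>s. s - 1"]) (auto simp: Suc_diff_le)
  also have "\<dots> = (\<Sum>s\<in>{..<n}. smult (c s * (real (n - s) * (real (n - s) + b))) (m s (n - s)))"
    using jacobi_coeff_rec[of _ n a b] by (intro sum.cong refl arg_cong2[where f = smult]) (simp add: c_def mult_ac add_ac)
  also have "\<dots> = (\<Sum>s\<le>n. smult (c s * (real (n - s) * (real (n - s) + b))) (m s (n - s)))"
    by (rule sum.mono_neutral_left) (auto simp: not_less)
  also have "(\<Sum>s\<le>n. smult (c s * (real (n - s) * (real (n - s) + b))) (m (Suc s) (n - s - 1)))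
     = (\<Sum>s<n. smult (c s * (real (n - s) * (real (n - s) + b))) (m (Suc s) (n - s - 1)))"
    by (rule sum.mono_neutral_right) (auto simp: not_less)
  also have "\<dots> = (\<Sum>s<n. smult (c (Suc s) * (real (Suc s) * (real (Suc s) + a))) (m (Suc s) (n - Suc s)))"
    using jacobi_coeff_rec[of _ n a b] by (intro sum.cong refl arg_cong2[where f = smult]) (simp_all add: c_def mult_ac add_ac)
  also have "\<dots> = (\<Sum>s\<in>{1..n}. smult (c s * (real s * (real s + a))) (m s (n - s)))"
    by (rule sum.reindex_bij_witness[of _ "\<lambda>s. s - 1" Suc]) auto
  also have "\<dots> = (\<Sum>s\<le>n. smult (c s * (real s * (real s + a))) (m s (n - s)))"
    by (rule sum.mono_neutral_left) auto
  finally have "- (smult 4 (X * Y)) * pderiv (pderiv (jpoly a b n)) - (smult (2 * (b + 1)) X + smult (2 * (a + 1)) Y) * pderiv (jpoly a b n) + smult ?N (jpoly a b n) = 0"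
    by simp
  then show ?thesis unfolding e1 e2 by (simp add: algebra_simps eq_diff_eq)
qed

lemma jpoly_at_1: "poly (jpoly a b n) 1 = (real n + a) gchoose n"
proof -
  have "poly (jpoly a b n) 1 = (\<Sum>s\<le>n. if s = 0 then (real n + a) gchoose n else 0)"
    unfolding jpoly_def poly_sum by (intro sum.cong) (auto simp: power_0_left)
  then show ?thesis by simp
qed

lemma jpoly_at_1_pos: "a > -1 \<Longrightarrow> poly (jpoly a b n) 1 > 0"
  by (simp add: jpoly_at_1 gbinomial_pochhammer' pochhammer_pos)

lemma degree_jpoly_le: "degree (jpoly a b n) \<le> n"
proof -
  have "degree ([:-1/2, 1/2:] ^ s * [:1/2, 1/2:] ^ (n - s) :: real poly) \<le> n" if "s \<le> n" for s
  proof -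
    have "degree ([:-1/2, 1/2:] ^ s * [:1/2, 1/2:] ^ (n - s) :: real poly) \<le> 1 * s + 1 * (n - s)"
      by (intro order.trans[OF degree_mult_le] add_mono order.trans[OF degree_power_le]) auto
    then show ?thesis using that by simp
  qed
  then show ?thesis unfolding jpoly_def
    by (intro degree_sum_le order.trans[OF degree_smult_le]) auto
qed

text \<open>All products X^s Y^(n-s) have leading coefficient 2^(-n), so Vandermonde's convolution
  adds up the binomial coefficients.\<close>

lemma coeff_jpoly: "coeff (jpoly a b n) n = ((2 * real n + a + b) gchoose n) / 2 ^ n"
proof -
  have lead: "coeff ([:-1/2, 1/2:] ^ s * [:1/2, 1/2:] ^ (n - s) :: real poly) n = 1 / 2 ^ n" if "s \<le> n" for s
  proof -
    let ?p = "[:-1/2, 1/2:] ^ s :: real poly" and ?q = "[:1/2, 1/2:] ^ (n - s) :: real poly"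
    have "degree ?p = s" "degree ?q = n - s" by (simp_all add: degree_power_eq)
    then have "coeff (?p * ?q) n = lead_coeff ?p * lead_coeff ?q"
      using coeff_mult_degree_sum[of ?p ?q] that by simp
    also have "\<dots> = (1/2) ^ s * (1/2) ^ (n - s)" by (simp add: lead_coeff_power)
    also have "\<dots> = (1/2) ^ n" using that by (simp flip: power_add)
    finally show ?thesis by (simp add: power_one_over)
  qed
  have "coeff (jpoly a b n) n = (\<Sum>s\<le>n. ((real n + b) gchoose s) * ((real n + a) gchoose (n - s)) * (1 / 2 ^ n))"
    unfolding jpoly_def coeff_sum coeff_smult by (intro sum.cong refl) (subst lead, simp_all)
  also have "\<dots> = (\<Sum>s\<le>n. ((real n + b) gchoose s) * ((real n + a) gchoose (n - s))) / 2 ^ n"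
    by (simp add: sum_divide_distrib)
  also have "(\<Sum>s\<le>n. ((real n + b) gchoose s) * ((real n + a) gchoose (n - s))) = ((real n + b) + (real n + a)) gchoose n"
    using gbinomial_Vandermonde[of "real n + b" "real n + a" n] by (simp only: atLeast0AtMost)
  also have "(real n + b) + (real n + a) = 2 * real n + a + b" by simp
  finally show ?thesis .
qed

lemma coeff_jpoly_pos:
  assumes "a + b \<ge> -1"
  shows "coeff (jpoly a b n) n > 0"
proof (cases n)
  case 0 then show ?thesis by (simp add: coeff_jpoly)
next
  case (Suc m)
  have "2 * real n + a + b - real n + 1 > 0" using assms Suc by simp
  then show ?thesis by (simp add: coeff_jpoly gbinomial_pochhammer' pochhammer_pos)
qed

text \<open>Each \<open>jpoly a b k\<close> has degree exactly k, its leading coefficient being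
  positive; so leading terms can be stripped one at a time.\<close>

lemma poly_jpoly_span:
  assumes "a + b \<ge> -1" "degree q \<le> n"
  shows "\<exists>c. q = (\<Sum>k\<le>n. smult (c k) (jpoly a b k))"
  using assms(2)
proof (induction n arbitrary: q)
  case 0
  have "q = [:coeff q 0:]" "jpoly a b 0 = [:coeff (jpoly a b 0) 0:]" using 0 degree_jpoly_le[of a b 0] 
    by (auto elim!: degree_eq_zeroE)
  moreover have "coeff (jpoly a b 0) 0 \<noteq> 0" using coeff_jpoly_pos[OF assms(1), of 0] by simp
  ultimately show ?case
    by (intro exI[of _ "\<lambda>_. coeff q 0 / coeff (jpoly a b 0) 0"])
       (metis (no_types, lifting) atMost_0 empty_iff finite.emptyI mult.right_neutral smult_pCons smult_0_right nonzero_divide_eq_eq sum.empty sum.insert add.right_neutral)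
next
  case (Suc n)
  let ?d = "coeff q (Suc n) / coeff (jpoly a b (Suc n)) (Suc n)"
  let ?r = "q - smult ?d (jpoly a b (Suc n))"
  have "coeff ?r (Suc n) = 0" using coeff_jpoly_pos[OF assms(1), of "Suc n"] by simp
  moreover have "degree ?r \<le> Suc n"
    using Suc.prems degree_jpoly_le[of a b "Suc n"] by (intro degree_diff_le order.trans[OF degree_smult_le]) auto
  ultimately have "degree ?r \<le> n"
    by (metis le_SucE leading_coeff_0_iff degree_0 zero_le)
  then obtain c where c: "?r = (\<Sum>k\<le>n. smult (c k) (jpoly a b k))" using Suc.IH by blast
  have "q = (\<Sum>k\<le>Suc n. smult ((c(Suc n := ?d)) k) (jpoly a b k))"
    using c by (simp add: algebra_simps)
  then show ?case by blast
qed

section \<open>Measures satisfying the Jacobi integration by parts identity\<close>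

lemma weierstrass_poly:
  fixes g :: "real \<Rightarrow> real"
  assumes "continuous_on {c..d} g" "e > 0"
  obtains q :: "real poly" where "\<And>x. x \<in> {c..d} \<Longrightarrow> \<bar>g x - poly q x\<bar> < e"
proof -
  obtain p where p: "real_polynomial_function p" "\<And>x. x \<in> {c..d} \<Longrightarrow> \<bar>g x - p x\<bar> < e"
    using Stone_Weierstrass_real_polynomial_function[OF compact_Icc assms] by auto
  obtain a n where an: "p = (\<lambda>x. \<Sum>i\<le>n. a i * x ^ i)"
    using p(1) unfolding real_polynomial_function_iff_sum by blast
  have "p x = poly (\<Sum>i\<le>n. monom (a i) i) x" for x
    by (simp add: an poly_sum poly_monom)
  then show ?thesis using p(2) that by metis
qed

lemma poly_antiderivative:
  fixes q :: "real poly"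
  obtains Q where "pderiv Q = q" "poly Q x = 0"
proof -
  define R where "R = (\<Sum>i\<le>degree q. monom (coeff q i / real (Suc i)) (Suc i))"
  have "pderiv R = (\<Sum>i\<le>degree q. monom (coeff q i) i)"
    unfolding R_def pderiv_sum by (intro sum.cong) (auto simp: pderiv_monom simp del: of_nat_Suc)
  also have "\<dots> = q" by (rule poly_as_sum_of_monoms)
  finally have R: "pderiv R = q" .
  show ?thesis
    by (rule that[of "R - [:poly R x:]"]) (auto simp: pderiv_diff R)
qed

text \<open>The Jacobi weight \<open>(1 - u) powr a * (1 + u) powr b\<close> enters only through \<open>pearson\<close>.\<close>

locale jacobi_measure = prob_space \<nu> for \<nu> :: "real measure" +
  fixes a b :: real
  assumes sets_nu: "sets \<nu> = sets borel"
    and supp: "AE u in \<nu>. -1 \<le> u \<and> u \<le> 1"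
    and a_ge: "a \<ge> -1/2" and b_ge: "b \<ge> -1/2"
    and pearson: "(\<integral>u. (1 - u\<^sup>2) * poly (pderiv q) u \<partial>\<nu>) = (\<integral>u. ((a + b + 2) * u + (a - b)) * poly q u \<partial>\<nu>)"
begin

lemma borel_meas_nu: "f \<in> borel_measurable borel \<Longrightarrow> f \<in> borel_measurable \<nu>"
  using measurable_cong_sets[OF sets_nu refl] by blast

lemma integrable_bounded:
  fixes f :: "real \<Rightarrow> 'b::{banach, second_countable_topology}"
  assumes "f \<in> borel_measurable borel" "\<And>u. u \<in> {-1..1} \<Longrightarrow> norm (f u) \<le> B"
  shows "integrable \<nu> f"
proof (rule integrable_const_bound[where B = B])
  show "AE x in \<nu>. norm (f x) \<le> B" using supp by eventually_elim (auto intro: assms(2))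
qed (intro borel_meas_nu assms(1))

lemma integrable_cont:
  fixes f :: "real \<Rightarrow> 'b::{banach, second_countable_topology}"
  assumes "continuous_on UNIV f"
  shows "integrable \<nu> f"
proof -
  have "bounded (f ` {-1..1})"
    using assms by (intro compact_imp_bounded compact_continuous_image) (auto intro: continuous_on_subset)
  then obtain B where "\<forall>x\<in>f ` {-1..1}. norm x \<le> B" unfolding bounded_iff by blast
  then have "norm (f u) \<le> B" if "u \<in> {-1..1}" for u using that by blast
  then show ?thesis
    using borel_measurable_continuous_onI[OF assms] by (rule integrable_bounded[rotated]) auto
qed

text \<open>A bound on [-1, 1] for the linear factor on the right side of
  \<open>pearson\<close>.\<close>

definition dom_const :: real where "dom_const = \<bar>a + b + 2\<bar> + \<bar>a - b\<bar>"

text \<open>Suppose G is a polynomial q in u = cos \<theta>. Then \<open>pearson\<close> for an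
  antiderivative Q of q turns the left side into an integral of Q times a linear factor. Moreover Q
  u is, up to sign, the integral of q (cos \<theta>) sin \<theta> over [arccos u, \<pi>], hence
  bounded by the integral of G. Weierstrass approximation covers the general case.\<close>

lemma weighted_integral_le:
  fixes G :: "real \<Rightarrow> real"
  assumes G: "continuous_on UNIV G" "\<And>\<theta>. G \<theta> \<ge> 0"
  shows "(\<integral>u. (1 - u\<^sup>2) * G (arccos (max (-1) (min 1 u))) \<partial>\<nu>) \<le> dom_const * integral {0..pi} G"
proof (rule field_le_epsilon)
  fix e :: real assume e: "e > 0"
  \<comment> \<open>Clamping keeps the argument of \<open>arccos\<close> in [-1, 1], outside of
    which its value is arbitrary, and makes g continuous on the whole line.\<close>
  define g where "g u = G (arccos (max (-1) (min 1 u)))" for u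
  have contg: "continuous_on A g" for A
  proof -
    have "continuous_on A (\<lambda>u. arccos (max (-1) (min 1 u)))" by (intro continuous_intros) auto
    then show ?thesis unfolding g_def by (intro continuous_on_compose2[OF G(1)]) auto
  qed
  \<comment> \<open>The approximation error enters as d itself and, through the bound for Q, as
    \<pi> d times \<open>dom_const\<close>; together they make e.\<close>
  define d where "d = e / (dom_const * pi + 1)"
  have C0: "dom_const \<ge> 0" by (simp add: dom_const_def)
  have den: "dom_const * pi + 1 > 0" using C0 by (simp add: add_nonneg_pos)
  have "dom_const * (pi * d) + d = d * (dom_const * pi + 1)" by (simp add: algebra_simps)
  then have d: "d > 0" "dom_const * (pi * d) + d = e" using e den by (auto simp: d_def)
  obtain q where q: "\<And>x. x \<in> {-1..1} \<Longrightarrow> \<bar>g x - poly q x\<bar> < d"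
    using weierstrass_poly[OF contg d(1)] by blast
  obtain Q where Q: "pderiv Q = q" "poly Q (-1) = 0" using poly_antiderivative by blast
  have Qbound: "\<bar>poly Q u\<bar> \<le> integral {0..pi} G + pi * d" if u: "u \<in> {-1..1}" for u
  proof -
    define t where "t = arccos u"
    have t: "0 \<le> t" "t \<le> pi" "cos t = u" using u arccos_bounded[of u] by (auto simp: t_def)
    have "((\<lambda>\<theta>. - (poly q (cos \<theta>) * sin \<theta>)) has_integral poly Q (cos pi) - poly Q (cos t)) {t..pi}"
    proof (intro fundamental_theorem_of_calculus t(2))
      fix x :: real
      have "((\<lambda>\<theta>. poly Q (cos \<theta>)) has_real_derivative - (poly q (cos x) * sin x)) (at x within {t..pi})"
        using DERIV_chain2[where f = "poly Q" and g = cos, OF poly_DERIV[of Q "cos x"], of "- sin x" "{t..pi}"]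
        by (auto simp: Q(1) DERIV_subset[OF DERIV_cos])
      then show "((\<lambda>\<theta>. poly Q (cos \<theta>)) has_vector_derivative - (poly q (cos x) * sin x)) (at x within {t..pi})"
        by (simp add: has_real_derivative_iff_has_vector_derivative)
    qed
    then have "\<bar>poly Q u\<bar> = \<bar>integral {t..pi} (\<lambda>\<theta>. - (poly q (cos \<theta>) * sin \<theta>))\<bar>"
      using Q(2) t(3) by (simp add: has_integral_iff)
    also have "\<dots> \<le> integral {t..pi} (\<lambda>\<theta>. G \<theta> + d)"
    proof -
      have "norm (integral {t..pi} (\<lambda>\<theta>. - (poly q (cos \<theta>) * sin \<theta>))) \<le> integral {t..pi} (\<lambda>\<theta>. G \<theta> + d)"
      proof (rule integral_norm_bound_integral)
        fix \<theta> assume \<theta>: "\<theta> \<in> {t..pi}"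
        then have \<theta>': "0 \<le> \<theta>" "\<theta> \<le> pi" using t by auto
        have "g (cos \<theta>) = G \<theta>" using \<theta>' by (simp add: g_def arccos_cos)
        then have "\<bar>poly q (cos \<theta>)\<bar> \<le> G \<theta> + d" using q[of "cos \<theta>"] G(2)[of \<theta>] by auto
        moreover have "\<bar>sin \<theta>\<bar> \<le> 1" by simp
        ultimately have "\<bar>poly q (cos \<theta>)\<bar> * \<bar>sin \<theta>\<bar> \<le> (G \<theta> + d) * 1"
          using G(2)[of \<theta>] d by (intro mult_mono) auto
        then show "norm (- (poly q (cos \<theta>) * sin \<theta>)) \<le> G \<theta> + d" by (simp add: abs_mult)
      qed (auto intro!: integrable_continuous_interval continuous_intros continuous_on_subset[OF G(1)])
      then show ?thesis by simp
    qed
    also have "\<dots> \<le> integral {0..pi} (\<lambda>\<theta>. G \<theta> + d)"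
      using t G(2) d by (intro integral_subset_le)
        (auto intro!: integrable_continuous_interval continuous_intros continuous_on_subset[OF G(1)] add_nonneg_nonneg)
    also have "\<dots> = integral {0..pi} G + pi * d"
      by (subst integral_add) (auto intro!: integrable_continuous_interval continuous_intros continuous_on_subset[OF G(1)])
    finally show ?thesis .
  qed
  have sq: "0 \<le> 1 - u\<^sup>2" "1 - u\<^sup>2 \<le> 1" if "u \<in> {-1..1}" for u :: real
    using that by (auto simp: abs_square_le_1 abs_le_iff)
  have "(\<integral>u. (1 - u\<^sup>2) * g u \<partial>\<nu>) \<le> (\<integral>u. (1 - u\<^sup>2) * poly q u + d \<partial>\<nu>)"
  proof (rule integral_mono_AE)
    show "AE u in \<nu>. (1 - u\<^sup>2) * g u \<le> (1 - u\<^sup>2) * poly q u + d"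
      using supp
    proof eventually_elim
      case (elim u)
      then have u: "u \<in> {-1..1}" by simp
      have "(1 - u\<^sup>2) * (g u - poly q u) \<le> (1 - u\<^sup>2) * d"
        using q[OF u] sq[OF u] by (intro mult_left_mono) auto
      also have "\<dots> \<le> 1 * d" using sq[OF u] d by (intro mult_right_mono) auto
      finally have "(1 - u\<^sup>2) * (g u - poly q u) \<le> 1 * d" .
      then show ?case by (simp add: algebra_simps)
    qed
  qed (intro integrable_cont continuous_intros contg)+
  also have "\<dots> = (\<integral>u. (1 - u\<^sup>2) * poly (pderiv Q) u \<partial>\<nu>) + d"
    unfolding Q(1) by (subst Bochner_Integration.integral_add) (auto intro!: integrable_cont continuous_intros simp: prob_space)
  also have "(\<integral>u. (1 - u\<^sup>2) * poly (pderiv Q) u \<partial>\<nu>) = (\<integral>u. ((a + b + 2) * u + (a - b)) * poly Q u \<partial>\<nu>)"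
    by (rule pearson)
  also have "\<dots> \<le> (\<integral>u. dom_const * (integral {0..pi} G + pi * d) \<partial>\<nu>)"
  proof (rule integral_mono_AE)
    show "AE u in \<nu>. ((a + b + 2) * u + (a - b)) * poly Q u \<le> dom_const * (integral {0..pi} G + pi * d)"
      using supp
    proof eventually_elim
      case (elim u)
      then have u: "u \<in> {-1..1}" by simp
      have "\<bar>(a + b + 2) * u + (a - b)\<bar> \<le> \<bar>a + b + 2\<bar> * \<bar>u\<bar> + \<bar>a - b\<bar>"
        by (intro order.trans[OF abs_triangle_ineq]) (simp add: abs_mult)
      also have "\<dots> \<le> dom_const" using u unfolding dom_const_def
        by (intro add_mono) (auto intro!: mult_left_le)
      finally have "\<bar>((a + b + 2) * u + (a - b)) * poly Q u\<bar> \<le> dom_const * (integral {0..pi} G + pi * d)"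
        unfolding abs_mult using Qbound[OF u] by (intro mult_mono) auto
      then show ?case by linarith
    qed
  qed (auto intro!: integrable_cont continuous_intros)
  also have "\<dots> = dom_const * (integral {0..pi} G + pi * d)" by (simp add: prob_space)
  finally show "(\<integral>u. (1 - u\<^sup>2) * G (arccos (max (-1) (min 1 u))) \<partial>\<nu>) \<le> dom_const * integral {0..pi} G + e"
    using d(2) by (simp add: g_def algebra_simps)
qed

text \<open>The law of the angle with the extra weight sin^2 \<theta>, under which
  \<open>weighted_integral_le\<close> compares it with Lebesgue measure.\<close>

definition angle_measure :: "real measure" where
  "angle_measure = distr (density \<nu> (\<lambda>u. ennreal (1 - u\<^sup>2))) borel (\<lambda>u. arccos (max (-1) (min 1 u)))"

lemma measurable_arccos_clamp: "(\<lambda>u. arccos (max (-1) (min 1 u))) \<in> borel_measurable borel"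
  by (intro borel_measurable_continuous_onI continuous_intros) auto

lemma angle_measure_le:
  fixes G :: "real \<Rightarrow> real"
  assumes G: "continuous_on UNIV G" "\<And>\<theta>. G \<theta> \<ge> 0"
  shows "(\<integral>\<^sup>+\<theta>. ennreal (G \<theta>) \<partial>angle_measure) \<le> ennreal (dom_const * integral {0..2 * pi} G)"
proof -
  let ?t = "\<lambda>u. arccos (max (-1) (min 1 u))"
  have Gm[measurable]: "G \<in> borel_measurable borel" by (rule borel_measurable_continuous_onI[OF G(1)])
  have tm: "?t \<in> borel_measurable \<nu>" by (intro borel_meas_nu measurable_arccos_clamp)
  have tm': "?t \<in> measurable (density \<nu> (\<lambda>u. ennreal (1 - u\<^sup>2))) borel" using tm by simp
  have m1: "(\<lambda>u. ennreal (1 - u\<^sup>2)) \<in> borel_measurable \<nu>" by (intro borel_meas_nu) measurable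
  have m2: "(\<lambda>u. ennreal (G (?t u))) \<in> borel_measurable \<nu>"
    using measurable_compose[OF measurable_arccos_clamp Gm] by (intro borel_meas_nu measurable_compose_rev[OF measurable_ennreal]) (simp_all add: comp_def)
  have cont: "continuous_on UNIV (\<lambda>u. (1 - u\<^sup>2) * G (?t u))"
  proof -
    have "continuous_on UNIV ?t" by (intro continuous_intros) auto
    then show ?thesis by (intro continuous_intros continuous_on_compose2[OF G(1)]) auto
  qed
  have "(\<integral>\<^sup>+\<theta>. ennreal (G \<theta>) \<partial>angle_measure) = (\<integral>\<^sup>+u. ennreal (1 - u\<^sup>2) * ennreal (G (?t u)) \<partial>\<nu>)"
    unfolding angle_measure_def
    by (subst nn_integral_distr[OF tm']) (auto intro!: nn_integral_density m1 m2)
  also have "\<dots> = (\<integral>\<^sup>+u. ennreal ((1 - u\<^sup>2) * G (?t u)) \<partial>\<nu>)"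
    by (intro nn_integral_cong) (simp add: ennreal_mult''[OF G(2)])
  also have "\<dots> = ennreal (\<integral>u. (1 - u\<^sup>2) * G (?t u) \<partial>\<nu>)"
  proof (rule nn_integral_eq_integral)
    show "integrable \<nu> (\<lambda>u. (1 - u\<^sup>2) * G (?t u))" by (rule integrable_cont[OF cont])
    show "AE u in \<nu>. 0 \<le> (1 - u\<^sup>2) * G (?t u)"
      using supp by eventually_elim (auto intro!: mult_nonneg_nonneg G(2) simp: abs_square_le_1 abs_le_iff)
  qed
  also have "\<dots> \<le> ennreal (dom_const * integral {0..pi} G)" by (intro ennreal_leI weighted_integral_le G)
  also have "\<dots> \<le> ennreal (dom_const * integral {0..2 * pi} G)"
    using G by (intro ennreal_leI mult_left_mono integral_subset_le integrable_continuous_interval)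
      (auto simp: dom_const_def intro: continuous_on_subset)
  finally show ?thesis .
qed

text \<open>Test \<open>pearson\<close> with the powers v^k, where v = (1 + s u)/2 peaks at s. The
  left side contains k v^k (1 - v), which is bounded and tends to 0. The right side tends to the
  mass at s times the value of the linear factor there, which is 2 (a + 1) or - 2 (b + 1) and so
  nonzero.\<close>

lemma endpoint_null:
  assumes s: "s = 1 \<or> s = -1"
  shows "AE u in \<nu>. u \<noteq> s"
proof -
  define v :: "real \<Rightarrow> real" where "v u = (1 + s * u) / 2" for u
  have v: "0 \<le> v u" "v u \<le> 1" "v u = 1 \<longleftrightarrow> u = s" if "u \<in> {-1..1}" for u
    using s that by (auto simp: v_def)
  define q :: "nat \<Rightarrow> real poly" where "q k = [:1/2, s/2:] ^ k" for k
  have pq: "poly (q k) u = v u ^ k" for k u by (simp add: q_def v_def field_simps)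
  have vv: "(1 - u\<^sup>2) = 4 * v u * (1 - v u)" for u
    using s by (auto simp: v_def power2_eq_square field_simps)
  have dq: "(1 - u\<^sup>2) * poly (pderiv (q k)) u = 2 * s * (real k * v u ^ k * (1 - v u))" for k u
  proof -
    have *: "poly (pderiv (q k)) u = real k * v u ^ (k - 1) * (s / 2)"
      unfolding q_def pderiv_power by (simp add: pderiv_pCons v_def field_simps)
    show ?thesis unfolding vv * by (cases k) (simp_all add: mult_ac)
  qed
  have L: "(\<lambda>k. \<integral>u. (1 - u\<^sup>2) * poly (pderiv (q k)) u \<partial>\<nu>) \<longlonglongrightarrow> (\<integral>u. 0 \<partial>\<nu>)"
  proof (rule integral_dominated_convergence[where w = "\<lambda>_. 2"])
    show "AE u in \<nu>. (\<lambda>k. (1 - u\<^sup>2) * poly (pderiv (q k)) u) \<longlonglongrightarrow> 0"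
      using supp
    proof eventually_elim
      case (elim u)
      then have u: "u \<in> {-1..1}" by simp
      show ?case
      proof (cases "v u = 1")
        case False
        then have "(\<lambda>k. real k * v u ^ k) \<longlonglongrightarrow> 0" using v[OF u] by (intro powser_times_n_limit_0) auto
        then have "(\<lambda>k. 2 * s * (real k * v u ^ k * (1 - v u))) \<longlonglongrightarrow> 2 * s * (0 * (1 - v u))"
          by (intro tendsto_intros)
        then show ?thesis by (simp add: dq)
      qed (simp add: dq)
    qed
    show "AE u in \<nu>. norm ((1 - u\<^sup>2) * poly (pderiv (q k)) u) \<le> 2" for k
      using supp
    proof eventually_elim
      case (elim u)
      then have u: "u \<in> {-1..1}" by simp
      \<comment> \<open>The powers decrease, so k v^k is at most the geometric sum, whose product
        with 1 - v telescopes; this gives the dominating constant.\<close>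
      have "real k * v u ^ k = (\<Sum>i<k. v u ^ k)" by simp
      also have "\<dots> \<le> (\<Sum>i<k. v u ^ i)" using v[OF u] by (intro sum_mono power_decreasing) auto
      finally have "real k * v u ^ k * (1 - v u) \<le> (\<Sum>i<k. v u ^ i) * (1 - v u)"
        using v[OF u] by (intro mult_right_mono) auto
      also have "\<dots> = 1 - v u ^ k" using one_diff_power_eq[of "v u" k] by (simp add: mult.commute)
      also have "\<dots> \<le> 1" using v[OF u] by simp
      finally have "real k * v u ^ k * (1 - v u) \<le> 1" .
      moreover have "real k * v u ^ k * (1 - v u) \<ge> 0" using v[OF u] by simp
      ultimately show ?case using s by (auto simp: dq abs_mult)
    qed
  qed (auto intro!: borel_measurable_integrable integrable_cont continuous_intros)
  have R: "(\<lambda>k. \<integral>u. ((a + b + 2) * u + (a - b)) * poly (q k) u \<partial>\<nu>) \<longlonglongrightarrow> (\<integral>u. ((a + b + 2) * s + (a - b)) * indicator {s} u \<partial>\<nu>)"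
  proof (rule integral_dominated_convergence[where w = "\<lambda>_. dom_const"])
    show "AE u in \<nu>. (\<lambda>k. ((a + b + 2) * u + (a - b)) * poly (q k) u) \<longlonglongrightarrow> ((a + b + 2) * s + (a - b)) * indicator {s} u"
      using supp
    proof eventually_elim
      case (elim u)
      then have u: "u \<in> {-1..1}" by simp
      show ?case
      proof (cases "u = s")
        case True then show ?thesis using v(3)[OF u] by (simp add: pq)
      next
        case False
        then have "(\<lambda>k. v u ^ k) \<longlonglongrightarrow> 0" using v[OF u] by (intro LIMSEQ_power_zero) auto
        then show ?thesis using False by (auto simp: pq intro: tendsto_mult_right_zero)
      qed
    qed
    show "AE u in \<nu>. norm (((a + b + 2) * u + (a - b)) * poly (q k) u) \<le> dom_const" for k
      using supp
    proof eventually_elim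
      case (elim u)
      then have u: "u \<in> {-1..1}" by simp
      have "\<bar>(a + b + 2) * u + (a - b)\<bar> \<le> \<bar>a + b + 2\<bar> * \<bar>u\<bar> + \<bar>a - b\<bar>"
        by (intro order.trans[OF abs_triangle_ineq]) (simp add: abs_mult)
      also have "\<dots> \<le> dom_const" using u unfolding dom_const_def
        by (intro add_mono) (auto intro!: mult_left_le)
      finally have "\<bar>(a + b + 2) * u + (a - b)\<bar> * \<bar>v u ^ k\<bar> \<le> dom_const * 1"
        using v[OF u] by (intro mult_mono) (auto simp: power_le_one dom_const_def)
      then show ?case by (simp add: pq abs_mult)
    qed
    show "(\<lambda>u. ((a + b + 2) * s + (a - b)) * indicator {s} u) \<in> borel_measurable \<nu>"
      by (intro borel_meas_nu) measurable
  qed (auto intro!: borel_measurable_integrable integrable_cont continuous_intros)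
  have "(\<integral>u. ((a + b + 2) * s + (a - b)) * indicator {s} u \<partial>\<nu>) = 0"
    using LIMSEQ_unique[OF R] L by (simp add: pearson)
  then have "((a + b + 2) * s + (a - b)) * prob {s} = 0"
    by (simp add: sets_nu)
  moreover have "(a + b + 2) * s + (a - b) \<noteq> 0" using s a_ge b_ge by auto
  ultimately have "prob {s} = 0" by simp
  then have "{s} \<in> null_sets \<nu>" by (simp add: null_sets_def sets_nu emeasure_eq_measure)
  from AE_not_in[OF this] show ?thesis by simp
qed

lemma AE_interior: "AE u in \<nu>. -1 < u \<and> u < 1"
proof -
  have 1: "AE u in \<nu>. u \<noteq> 1" by (rule endpoint_null) simp
  have 2: "AE u in \<nu>. u \<noteq> -1" by (rule endpoint_null) simp
  show ?thesis using supp 1 2 by eventually_elim auto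
qed

text \<open>The weight 1 - u^2 is positive off the end points, and these are null; so nothing is
  lost in returning from the weighted law to \<nu>.\<close>

lemma AE_angle_measureD:
  assumes "AE \<theta> in angle_measure. P \<theta>"
  shows "AE u in \<nu>. P (arccos u)"
proof -
  have "AE u in density \<nu> (\<lambda>u. ennreal (1 - u\<^sup>2)). P (arccos (max (-1) (min 1 u)))"
  proof (rule AE_distrD[where P = P])
    show "(\<lambda>u. arccos (max (-1) (min 1 u))) \<in> measurable (density \<nu> (\<lambda>u. ennreal (1 - u\<^sup>2))) borel"
      by (simp add: borel_meas_nu measurable_arccos_clamp)
    show "AE \<theta> in distr (density \<nu> (\<lambda>u. ennreal (1 - u\<^sup>2))) borel (\<lambda>u. arccos (max (-1) (min 1 u))). P \<theta>"
      using assms unfolding angle_measure_def .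
  qed
  then have "AE u in \<nu>. 0 < ennreal (1 - u\<^sup>2) \<longrightarrow> P (arccos (max (-1) (min 1 u)))"
    by (subst (asm) AE_density) (auto intro!: borel_meas_nu)
  then show ?thesis
    using AE_interior
  proof eventually_elim
    case (elim u)
    then have "u\<^sup>2 < 1" by (simp add: abs_square_less_1 abs_less_iff)
    then show ?case using elim by simp
  qed
qed

abbreviation "J n \<equiv> jpoly a b n"

definition ev :: "nat \<Rightarrow> real" where "ev n = real n * (real n + a + b + 1)"

definition jnorm2 :: "nat \<Rightarrow> real" where "jnorm2 n = (\<integral>u. (poly (J n) u)\<^sup>2 \<partial>\<nu>)"

text \<open>\<open>pearson\<close> for the product of the derivative of \<open>J n\<close> with q,
  Jacobi's equation replacing the second derivative: the weak form of the eigenvalue equation. Its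
  symmetry gives orthogonality, its diagonal the energy.\<close>

lemma jacobi_green:
  "(\<integral>u. (1 - u\<^sup>2) * (poly (pderiv (J n)) u * poly (pderiv q) u) \<partial>\<nu>) = ev n * (\<integral>u. poly (J n) u * poly q u \<partial>\<nu>)"
proof -
  let ?P = "J n"
  have ode: "(1 - u\<^sup>2) * poly (pderiv (pderiv ?P)) u = ((a + b + 2) * u + (a - b)) * poly (pderiv ?P) u - ev n * poly ?P u" for u
    using arg_cong[OF jacobi_ode_poly[of a b n], of "\<lambda>p. poly p u"]
    by (simp add: ev_def power2_eq_square algebra_simps)
  have "(\<integral>u. (1 - u\<^sup>2) * poly (pderiv (pderiv ?P * q)) u \<partial>\<nu>) = (\<integral>u. ((a + b + 2) * u + (a - b)) * poly (pderiv ?P * q) u \<partial>\<nu>)"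
    by (rule pearson)
  moreover have "(\<integral>u. (1 - u\<^sup>2) * poly (pderiv (pderiv ?P * q)) u \<partial>\<nu>)
      = (\<integral>u. (1 - u\<^sup>2) * (poly (pderiv ?P) u * poly (pderiv q) u) + (((a + b + 2) * u + (a - b)) * poly (pderiv ?P * q) u - ev n * (poly ?P u * poly q u)) \<partial>\<nu>)"
  proof (intro Bochner_Integration.integral_cong refl)
    fix u
    have "(1 - u\<^sup>2) * poly (pderiv (pderiv ?P * q)) u = (1 - u\<^sup>2) * (poly (pderiv ?P) u * poly (pderiv q) u) + ((1 - u\<^sup>2) * poly (pderiv (pderiv ?P)) u) * poly q u"
      by (simp add: pderiv_mult algebra_simps)
    then show "(1 - u\<^sup>2) * poly (pderiv (pderiv ?P * q)) u = (1 - u\<^sup>2) * (poly (pderiv ?P) u * poly (pderiv q) u) + (((a + b + 2) * u + (a - b)) * poly (pderiv ?P * q) u - ev n * (poly ?P u * poly q u))"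
      unfolding ode by (simp add: algebra_simps)
  qed
  also have "\<dots> = (\<integral>u. (1 - u\<^sup>2) * (poly (pderiv ?P) u * poly (pderiv q) u) \<partial>\<nu>) + ((\<integral>u. ((a + b + 2) * u + (a - b)) * poly (pderiv ?P * q) u \<partial>\<nu>) - (\<integral>u. ev n * (poly ?P u * poly q u) \<partial>\<nu>))"
  proof -
    have i: "integrable \<nu> (\<lambda>u. (1 - u\<^sup>2) * (poly (pderiv ?P) u * poly (pderiv q) u))"
      "integrable \<nu> (\<lambda>u. ((a + b + 2) * u + (a - b)) * poly (pderiv ?P * q) u)"
      "integrable \<nu> (\<lambda>u. ev n * (poly ?P u * poly q u))"
      by (intro integrable_cont continuous_intros)+
    show ?thesis
      using Bochner_Integration.integral_add[OF i(1) Bochner_Integration.integrable_diff[OF i(2,3)]]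
        Bochner_Integration.integral_diff[OF i(2,3)] by (simp only:)
  qed
  ultimately show ?thesis by simp
qed

lemma ev_strict_mono: "m < n \<Longrightarrow> ev m < ev n"
proof -
  assume mn: "m < n"
  have "real m * (real m + a + b + 1) \<le> real m * (real n + a + b + 1)" using mn by (intro mult_left_mono) auto
  also have "\<dots> < real n * (real n + a + b + 1)" using mn a_ge b_ge by (intro mult_strict_right_mono) auto
  finally show ?thesis by (simp add: ev_def)
qed

lemma jacobi_orthogonal:
  assumes "m \<noteq> n"
  shows "(\<integral>u. poly (J m) u * poly (J n) u \<partial>\<nu>) = 0"
proof -
  have "ev m * (\<integral>u. poly (J m) u * poly (J n) u \<partial>\<nu>) = ev n * (\<integral>u. poly (J n) u * poly (J m) u \<partial>\<nu>)"
    using jacobi_green[of m "J n"] jacobi_green[of n "J m"] by (simp add: mult.commute)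
  then have "(ev m - ev n) * (\<integral>u. poly (J m) u * poly (J n) u \<partial>\<nu>) = 0" by (simp add: algebra_simps)
  moreover have "ev m \<noteq> ev n" using assms ev_strict_mono[of m n] ev_strict_mono[of n m] by (cases "m < n") auto
  ultimately show ?thesis by simp
qed

lemma jacobi_energy: "(\<integral>u. (1 - u\<^sup>2) * (poly (pderiv (J n)) u)\<^sup>2 \<partial>\<nu>) = ev n * jnorm2 n"
  using jacobi_green[of n "J n"] by (simp add: jnorm2_def power2_eq_square)

end

section \<open>Asymptotics of Jacobi polynomials\<close>

text \<open>A Pruefer-type transformation: for \<open>g'' = -(N\<^sup>2 + Q) g\<close> with bounded \<open>Q\<close>, the amplitudes of
  \<open>g\<close> with respect to \<open>cos (N\<theta>)\<close> and \<open>sin (N\<theta>)\<close> vary only by \<open>O(1/N)\<close>.\<close>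

lemma perturbed_oscillator:
  fixes g dg Q :: "real \<Rightarrow> real" and N M c d :: real
  assumes g: "\<And>x. x \<in> {c..d} \<Longrightarrow> (g has_real_derivative dg x) (at x)"
    and dg: "\<And>x. x \<in> {c..d} \<Longrightarrow> (dg has_real_derivative - (N\<^sup>2 + Q x) * g x) (at x)"
    and Q: "\<And>x. x \<in> {c..d} \<Longrightarrow> \<bar>Q x\<bar> \<le> M" and N: "N \<ge> 1"
  defines "E \<equiv> \<lambda>x. (g x)\<^sup>2 + (dg x / N)\<^sup>2"
    and "A \<equiv> \<lambda>x. g x * cos (N * x) - dg x / N * sin (N * x)"
    and "B \<equiv> \<lambda>x. g x * sin (N * x) + dg x / N * cos (N * x)"
  assumes x: "x \<in> {c..d}" and y: "y \<in> {c..d}"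
  shows "E x \<le> exp (M * (d - c)) * E y"
    and "\<bar>g x - (A y * cos (N * x) + B y * sin (N * x))\<bar>
      \<le> 2 * M * (d - c) * sqrt (exp (M * (d - c)) * E y) / N"
proof -
  have N0: "N > 0" using N by simp
  have M0: "M \<ge> 0" using Q[OF x] by linarith
  have E0: "E z \<ge> 0" for z by (simp add: E_def)
  \<comment> \<open>The N^2 terms cancel; as N \<ge> 1, what remains is at most M E in
    modulus.\<close>
  have dE: "(E has_real_derivative - 2 * Q z * g z * dg z / N\<^sup>2) (at z)" if "z \<in> {c..d}" for z
    unfolding E_def using N0
    by (auto intro!: derivative_eq_intros g[OF that] dg[OF that] simp: power2_eq_square field_simps)
  have dEM: "\<bar>- 2 * Q z * g z * dg z / N\<^sup>2\<bar> \<le> M * E z" if "z \<in> {c..d}" for z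
  proof -
    have "\<bar>2 * g z * (dg z / N)\<bar> \<le> E z"
      using sum_squares_bound[of "\<bar>g z\<bar>" "\<bar>dg z / N\<bar>"]
      by (simp only: E_def abs_mult power2_abs abs_numeral)
    then have "\<bar>Q z\<bar> * \<bar>2 * g z * (dg z / N)\<bar> \<le> M * E z"
      using Q[OF that] by (intro mult_mono) auto
    moreover have "\<bar>Q z\<bar> * \<bar>2 * g z * (dg z / N)\<bar> / N \<le> \<bar>Q z\<bar> * \<bar>2 * g z * (dg z / N)\<bar> / 1"
      using N by (intro divide_left_mono) auto
    moreover have "\<bar>- 2 * Q z * g z * dg z / N\<^sup>2\<bar> = \<bar>Q z\<bar> * \<bar>2 * g z * (dg z / N)\<bar> / N"
      using N0 by (simp add: abs_mult power2_eq_square)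
    ultimately show ?thesis by linarith
  qed
  \<comment> \<open>Gronwall in both directions: E exp (M z) is nondecreasing and E exp (- M z) is
    nonincreasing.\<close>
  have mono: "E s \<le> exp (M * (d - c)) * E t" if s: "s \<in> {c..d}" and t: "t \<in> {c..d}" for s t
  proof -
    have "E s \<le> exp (M * \<bar>s - t\<bar>) * E t"
    proof (cases "s \<le> t")
      case True
      have "E s * exp (M * s) \<le> E t * exp (M * t)"
      proof (rule DERIV_nonneg_imp_nondecreasing[OF True])
        fix z assume "s \<le> z" "z \<le> t"
        then have z: "z \<in> {c..d}" using s t by auto
        have "((\<lambda>z. E z * exp (M * z)) has_real_derivative (- 2 * Q z * g z * dg z / N\<^sup>2 + M * E z) * exp (M * z)) (at z)"
          by (auto intro!: derivative_eq_intros dE[OF z] simp: algebra_simps)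
        moreover have "- 2 * Q z * g z * dg z / N\<^sup>2 + M * E z \<ge> 0" using dEM[OF z] by linarith
        then have "(- 2 * Q z * g z * dg z / N\<^sup>2 + M * E z) * exp (M * z) \<ge> 0"
          by (intro mult_nonneg_nonneg exp_ge_zero)
        ultimately show "\<exists>y. ((\<lambda>z. E z * exp (M * z)) has_real_derivative y) (at z) \<and> 0 \<le> y" by blast
      qed
      then have "E s \<le> E t * (exp (M * t) / exp (M * s))" by (simp add: field_simps)
      then show ?thesis using True by (simp add: exp_diff[symmetric] right_diff_distrib mult.commute)
    next
      case False
      then have ts: "t \<le> s" by simp
      have "E s * exp (- (M * s)) \<le> E t * exp (- (M * t))"
      proof (rule DERIV_nonpos_imp_nonincreasing[OF ts])
        fix z assume "t \<le> z" "z \<le> s"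
        then have z: "z \<in> {c..d}" using s t by auto
        have "((\<lambda>z. E z * exp (- (M * z))) has_real_derivative (- 2 * Q z * g z * dg z / N\<^sup>2 - M * E z) * exp (- (M * z))) (at z)"
          by (auto intro!: derivative_eq_intros dE[OF z] simp: algebra_simps)
        moreover have "- 2 * Q z * g z * dg z / N\<^sup>2 - M * E z \<le> 0" using dEM[OF z] by linarith
        then have "(- 2 * Q z * g z * dg z / N\<^sup>2 - M * E z) * exp (- (M * z)) \<le> 0"
          by (intro mult_nonpos_nonneg exp_ge_zero)
        ultimately show "\<exists>y. ((\<lambda>z. E z * exp (- (M * z))) has_real_derivative y) (at z) \<and> y \<le> 0" by blast
      qed
      then have "E s \<le> E t * (exp (M * s) / exp (M * t))" by (simp add: exp_minus field_simps)
      then show ?thesis using ts by (simp add: exp_diff[symmetric] right_diff_distrib mult.commute)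
    qed
    also have "\<dots> \<le> exp (M * (d - c)) * E t"
      using s t M0 E0 by (intro mult_right_mono) (auto intro!: mult_left_mono)
    finally show ?thesis .
  qed
  show "E x \<le> exp (M * (d - c)) * E y" by (rule mono[OF x y])
  define R where "R = M * sqrt (exp (M * (d - c)) * E y) / N"
  have R0: "R \<ge> 0" using M0 N0 E0 by (simp add: R_def)
  have small: "\<bar>Q z * g z / N\<bar> \<le> R" if z: "z \<in> {c..d}" for z
  proof -
    have "(g z)\<^sup>2 \<le> exp (M * (d - c)) * E y"
      using mono[OF z y] by (simp add: E_def) (smt (verit) zero_le_power2)
    then have "\<bar>g z\<bar> \<le> sqrt (exp (M * (d - c)) * E y)" by (simp add: real_le_rsqrt)
    then have "\<bar>Q z\<bar> * \<bar>g z\<bar> \<le> M * sqrt (exp (M * (d - c)) * E y)"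
      using Q[OF z] by (intro mult_mono) auto
    then show ?thesis using N0 by (simp add: R_def abs_mult divide_right_mono)
  qed
  \<comment> \<open>Variation of constants: the N^2 terms cancel once more and only Q g / N is left,
    so the amplitudes are nearly constant.\<close>
  have dA: "(A has_real_derivative Q z * g z / N * sin (N * z)) (at z)"
    and dB: "(B has_real_derivative - (Q z * g z / N * cos (N * z))) (at z)" if "z \<in> {c..d}" for z
    unfolding A_def B_def using N0
    by (auto intro!: derivative_eq_intros g[OF that] dg[OF that] simp: power2_eq_square field_simps)
  have diff: "\<bar>f x - f y\<bar> \<le> R * (d - c)"
    if f: "\<And>z. z \<in> {c..d} \<Longrightarrow> (f has_real_derivative f' z) (at z)" and f': "\<And>z. z \<in> {c..d} \<Longrightarrow> \<bar>f' z\<bar> \<le> R"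
    for f f' :: "real \<Rightarrow> real"
  proof -
    have "norm (f x - f y) \<le> R * norm (x - y)"
      by (rule field_differentiable_bound[of "{c..d}" f f' R x y])
        (use f f' x y in \<open>auto intro: has_field_derivative_at_within\<close>)
    also have "\<dots> \<le> R * (d - c)" using x y R0 by (intro mult_left_mono) auto
    finally show ?thesis by simp
  qed
  have bd: "\<bar>Q z * g z / N * k\<bar> \<le> R" if "z \<in> {c..d}" "\<bar>k\<bar> \<le> 1" for z k
    unfolding abs_mult[of "Q z * g z / N"] using mult_mono[OF small[OF that(1)] that(2)] R0 by simp
  have A: "\<bar>A x - A y\<bar> \<le> R * (d - c)"
    by (rule diff[OF dA bd]) auto
  have B: "\<bar>B x - B y\<bar> \<le> R * (d - c)"
  proof (rule diff[OF dB])
    fix z assume "z \<in> {c..d}"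
    then show "\<bar>- (Q z * g z / N * cos (N * z))\<bar> \<le> R" unfolding abs_minus_cancel by (rule bd) simp
  qed
  have "g x = A x * cos (N * x) + B x * sin (N * x)"
  proof -
    have "(p * k - q * s) * k + (p * s + q * k) * s = p * (s\<^sup>2 + k\<^sup>2)" for p q s k :: real
      by (simp add: power2_eq_square algebra_simps)
    then show ?thesis unfolding A_def B_def by (simp only: sin_cos_squared_add mult_1_right)
  qed
  then have "g x - (A y * cos (N * x) + B y * sin (N * x)) = (A x - A y) * cos (N * x) + (B x - B y) * sin (N * x)"
    by (simp add: algebra_simps)
  also have "\<bar>\<dots>\<bar> \<le> \<bar>A x - A y\<bar> * \<bar>cos (N * x)\<bar> + \<bar>B x - B y\<bar> * \<bar>sin (N * x)\<bar>"
    by (intro order.trans[OF abs_triangle_ineq]) (simp add: abs_mult)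
  also have "\<dots> \<le> \<bar>A x - A y\<bar> * 1 + \<bar>B x - B y\<bar> * 1"
    by (intro add_mono mult_left_mono) auto
  also have "\<dots> \<le> 2 * (R * (d - c))" using A B by simp
  also have "\<dots> = 2 * M * (d - c) * sqrt (exp (M * (d - c)) * E y) / N" by (simp add: R_def)
  finally show "\<bar>g x - (A y * cos (N * x) + B y * sin (N * x))\<bar> \<le> \<dots>" .
qed

context jacobi_measure
begin

section \<open>Liouville normal form of Jacobi's equation in the angle\<close>

definition rho :: real where "rho = (a + b + 1) / 2"

lemma rho_ge0: "rho \<ge> 0" using a_ge b_ge by (simp add: rho_def)

lemma ev_rho: "ev n = (real n + rho)\<^sup>2 - rho\<^sup>2"
  by (simp add: ev_def rho_def power2_eq_square field_simps)

text \<open>Liouville's factor, the square root of the Jacobi weight in the variable \<theta> up to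
  a constant. Multiplication by it removes the first-order term of Jacobi's equation.\<close>

definition wt :: "real \<Rightarrow> real" where
  "wt \<theta> = sin (\<theta> / 2) powr (a + 1/2) * cos (\<theta> / 2) powr (b + 1/2)"

text \<open>The logarithmic derivative of \<open>wt\<close>; \<open>dkap\<close> is its derivative,
  left in the form of the quotient rule.\<close>

definition kap :: "real \<Rightarrow> real" where
  "kap \<theta> = ((a + b + 1) * cos \<theta> + (a - b)) / (2 * sin \<theta>)"

definition dkap :: "real \<Rightarrow> real" where
  "dkap \<theta> = (- (a + b + 1) * sin \<theta> * (2 * sin \<theta>) - ((a + b + 1) * cos \<theta> + (a - b)) * (2 * cos \<theta>)) / (2 * sin \<theta>)\<^sup>2"

text \<open>What remains of the potential after (n + \<open>rho\<close>)^2 is split off. It is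
  independent of n and continuous inside (0, \<pi>), so it is bounded on compact subintervals
  uniformly in n.\<close>

definition pot :: "real \<Rightarrow> real" where "pot \<theta> = - (kap \<theta>)\<^sup>2 - dkap \<theta> - rho\<^sup>2"

definition jg :: "nat \<Rightarrow> real \<Rightarrow> real" where "jg n \<theta> = wt \<theta> * poly (J n) (cos \<theta>)"

definition jdg :: "nat \<Rightarrow> real \<Rightarrow> real" where
  "jdg n \<theta> = wt \<theta> * (kap \<theta> * poly (J n) (cos \<theta>) - sin \<theta> * poly (pderiv (J n)) (cos \<theta>))"

lemma wt_pos: "0 < \<theta> \<Longrightarrow> \<theta> < pi \<Longrightarrow> wt \<theta> > 0"
  using sin_gt_zero[of "\<theta> / 2"] cos_gt_zero[of "\<theta> / 2"] by (simp add: wt_def)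

lemma wt_deriv:
  assumes "0 < \<theta>" "\<theta> < pi"
  shows "(wt has_real_derivative wt \<theta> * kap \<theta>) (at \<theta>)"
proof -
  define s c where "s = sin (\<theta> / 2)" and "c = cos (\<theta> / 2)"
  have s: "s > 0" and c: "c > 0"
    using assms sin_gt_zero[of "\<theta> / 2"] cos_gt_zero[of "\<theta> / 2"] by (auto simp: s_def c_def)
  have kap: "kap \<theta> = (a + 1/2) * c / (2 * s) - (b + 1/2) * s / (2 * c)"
  proof -
    have "cos \<theta> = c\<^sup>2 - s\<^sup>2" "sin \<theta> = 2 * s * c" "c\<^sup>2 + s\<^sup>2 = 1"
      using cos_double[of "\<theta> / 2"] sin_double[of "\<theta> / 2"] by (simp_all add: s_def c_def)
    then have "(a + b + 1) * cos \<theta> + (a - b) = (2 * a + 1) * c\<^sup>2 - (2 * b + 1) * s\<^sup>2"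
      by algebra
    then have "kap \<theta> = ((2 * a + 1) * c\<^sup>2 - (2 * b + 1) * s\<^sup>2) / (2 * (2 * s * c))"
      using \<open>sin \<theta> = 2 * s * c\<close> by (simp only: kap_def)
    then show ?thesis using s c by (simp add: power2_eq_square field_simps)
  qed
  have pm: "z powr (x - 1) = z powr x / z" if "z > 0" for z x :: real
    using that by (simp add: powr_diff)
  have ds: "((\<lambda>\<theta>. sin (\<theta> / 2)) has_real_derivative c / 2) (at \<theta>)"
    and dc: "((\<lambda>\<theta>. cos (\<theta> / 2)) has_real_derivative - s / 2) (at \<theta>)"
    unfolding s_def c_def by (auto intro!: derivative_eq_intros)
  have 1: "((\<lambda>\<theta>. sin (\<theta> / 2) powr (a + 1/2)) has_real_derivative s powr (a + 1/2) * ((a + 1/2) * c / (2 * s))) (at \<theta>)"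
    using DERIV_chain2[where f = "\<lambda>z. z powr (a + 1/2)", OF has_real_derivative_powr[OF s[unfolded s_def], of "a + 1/2"] ds]
    unfolding s_def[symmetric] pm[OF s] by (simp add: mult_ac)
  have 2: "((\<lambda>\<theta>. cos (\<theta> / 2) powr (b + 1/2)) has_real_derivative c powr (b + 1/2) * (- ((b + 1/2) * s / (2 * c)))) (at \<theta>)"
    using DERIV_chain2[where f = "\<lambda>z. z powr (b + 1/2)", OF has_real_derivative_powr[OF c[unfolded c_def], of "b + 1/2"] dc]
    unfolding c_def[symmetric] pm[OF c] by (simp add: mult_ac)
  have "(wt has_real_derivative s powr (a + 1/2) * ((a + 1/2) * c / (2 * s)) * c powr (b + 1/2)
     + c powr (b + 1/2) * (- ((b + 1/2) * s / (2 * c))) * s powr (a + 1/2)) (at \<theta>)"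
    unfolding wt_def[abs_def] using DERIV_mult[OF 1 2] by (simp add: s_def c_def)
  also have "s powr (a + 1/2) * ((a + 1/2) * c / (2 * s)) * c powr (b + 1/2)
     + c powr (b + 1/2) * (- ((b + 1/2) * s / (2 * c))) * s powr (a + 1/2) = wt \<theta> * kap \<theta>"
    unfolding kap wt_def s_def[symmetric] c_def[symmetric] using s c by (simp add: field_simps)
  finally show ?thesis .
qed

lemma kap_deriv:
  assumes "0 < \<theta>" "\<theta> < pi"
  shows "(kap has_real_derivative dkap \<theta>) (at \<theta>)"
proof -
  have "sin \<theta> > 0" using assms by (simp add: sin_gt_zero)
  have f: "((\<lambda>\<theta>. (a + b + 1) * cos \<theta> + (a - b)) has_real_derivative - (a + b + 1) * sin \<theta>) (at \<theta>)"
    and g: "((\<lambda>\<theta>. 2 * sin \<theta>) has_real_derivative 2 * cos \<theta>) (at \<theta>)"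
    by (auto intro!: derivative_eq_intros simp: algebra_simps)
  show ?thesis unfolding kap_def[abs_def] dkap_def power2_eq_square
    using \<open>sin \<theta> > 0\<close> by (intro DERIV_divide f g) simp
qed

text \<open>In the second derivative the terms with J' cancel, because 2 kap sin \<theta> + cos
  \<theta> is the first-order coefficient of Jacobi's equation. The remaining factor kap^2 + dkap -
  ev n is - ((n + \<open>rho\<close>)^2 + pot).\<close>

lemma jg_deriv:
  assumes t: "0 < \<theta>" "\<theta> < pi"
  shows "(jg n has_real_derivative jdg n \<theta>) (at \<theta>)"
    and "(jdg n has_real_derivative - ((real n + rho)\<^sup>2 + pot \<theta>) * jg n \<theta>) (at \<theta>)"
proof -
  let ?P = "J n" and ?D = "pderiv (J n)" and ?DD = "pderiv (pderiv (J n))"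
  have s: "sin \<theta> > 0" using t by (simp add: sin_gt_zero)
  have chain: "((\<lambda>\<theta>. poly p (cos \<theta>)) has_real_derivative - sin \<theta> * poly (pderiv p) (cos \<theta>)) (at \<theta>)" for p :: "real poly"
    using DERIV_chain2[where f = "poly p" and g = cos, OF poly_DERIV[of p "cos \<theta>"] DERIV_cos[of \<theta>]]
    by (simp add: mult.commute)
  show "(jg n has_real_derivative jdg n \<theta>) (at \<theta>)"
    unfolding jg_def[abs_def] jdg_def
    by (rule derivative_eq_intros wt_deriv[OF t] chain refl)+ (simp add: algebra_simps)
  have ode: "(sin \<theta>)\<^sup>2 * poly ?DD (cos \<theta>) = ((a + b + 2) * cos \<theta> + (a - b)) * poly ?D (cos \<theta>) - ev n * poly ?P (cos \<theta>)"
    using arg_cong[OF jacobi_ode_poly[of a b n], of "\<lambda>p. poly p (cos \<theta>)"]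
    unfolding sin_squared_eq by (simp add: ev_def power2_eq_square algebra_simps)
  have k2: "2 * kap \<theta> * sin \<theta> = (a + b + 1) * cos \<theta> + (a - b)" using s by (simp add: kap_def)
  have "(jdg n has_real_derivative
      wt \<theta> * kap \<theta> * (kap \<theta> * poly ?P (cos \<theta>) - sin \<theta> * poly ?D (cos \<theta>))
      + (dkap \<theta> * poly ?P (cos \<theta>) + kap \<theta> * (- sin \<theta> * poly ?D (cos \<theta>)) - (cos \<theta> * poly ?D (cos \<theta>) + sin \<theta> * (- sin \<theta> * poly ?DD (cos \<theta>)))) * wt \<theta>) (at \<theta>)"
    unfolding jdg_def[abs_def]
    by (rule derivative_eq_intros wt_deriv[OF t] kap_deriv[OF t] chain refl)+ (simp add: algebra_simps)
  also have "wt \<theta> * kap \<theta> * (kap \<theta> * poly ?P (cos \<theta>) - sin \<theta> * poly ?D (cos \<theta>))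
      + (dkap \<theta> * poly ?P (cos \<theta>) + kap \<theta> * (- sin \<theta> * poly ?D (cos \<theta>)) - (cos \<theta> * poly ?D (cos \<theta>) + sin \<theta> * (- sin \<theta> * poly ?DD (cos \<theta>)))) * wt \<theta>
     = wt \<theta> * (((kap \<theta>)\<^sup>2 + dkap \<theta>) * poly ?P (cos \<theta>) - (2 * kap \<theta> * sin \<theta>) * poly ?D (cos \<theta>) - cos \<theta> * poly ?D (cos \<theta>) + (sin \<theta>)\<^sup>2 * poly ?DD (cos \<theta>))"
    by (simp add: power2_eq_square algebra_simps)
  also have "\<dots> = wt \<theta> * (((kap \<theta>)\<^sup>2 + dkap \<theta> - ev n) * poly ?P (cos \<theta>))"
    unfolding ode k2 by (simp add: algebra_simps)
  also have "\<dots> = - ((real n + rho)\<^sup>2 + pot \<theta>) * jg n \<theta>"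
    by (simp add: pot_def ev_rho jg_def algebra_simps)
  finally show "(jdg n has_real_derivative - ((real n + rho)\<^sup>2 + pot \<theta>) * jg n \<theta>) (at \<theta>)" .
qed

lemma cont_interior:
  assumes "0 < c" "d < pi"
  shows "continuous_on {c..d} pot" "continuous_on {c..d} kap" "continuous_on {c..d} wt"
proof -
  have s: "sin x \<noteq> 0" if "x \<in> {c..d}" for x using that assms sin_gt_zero[of x] by auto
  have "sin (x / 2) \<noteq> 0" "cos (x / 2) \<noteq> 0" if "x \<in> {c..d}" for x
    using that assms sin_gt_zero[of "x / 2"] cos_gt_zero[of "x / 2"] by auto
  then show "continuous_on {c..d} wt" unfolding wt_def[abs_def] by (intro continuous_intros) auto
  show "continuous_on {c..d} kap" unfolding kap_def[abs_def] using s by (intro continuous_intros) auto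
  then show "continuous_on {c..d} pot" unfolding pot_def[abs_def] dkap_def using s by (intro continuous_intros) auto
qed

lemma bounded_interior:
  fixes f :: "real \<Rightarrow> real"
  assumes "continuous_on {c..d} f"
  obtains B where "B \<ge> 0" "\<And>x. x \<in> {c..d} \<Longrightarrow> \<bar>f x\<bar> \<le> B"
proof -
  have "bounded (f ` {c..d})" using assms by (intro compact_imp_bounded compact_continuous_image) auto
  then obtain B where B: "\<forall>y\<in>f ` {c..d}. norm y \<le> B" unfolding bounded_iff by blast
  show ?thesis by (rule that[of "max B 0"]) (use B in \<open>auto simp: le_max_iff_disj\<close>)
qed

text \<open>Symmetric compact intervals exhaust (-1, 1), which has full measure because the end
  points are null.\<close>

lemma interior_mass:
  obtains r where "0 \<le> r" "r < 1" "prob {-r..r} > 0"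
proof -
  have "\<exists>k::nat. prob {- (1 - 1 / real (Suc k))..1 - 1 / real (Suc k)} > 0"
  proof (rule ccontr)
    assume "\<not> ?thesis"
    then have "prob {- (1 - 1 / real (Suc k))..1 - 1 / real (Suc k)} = 0" for k
      by (metis measure_nonneg less_eq_real_def)
    then have "{- (1 - 1 / real (Suc k))..1 - 1 / real (Suc k)} \<in> null_sets \<nu>" for k
      by (simp add: null_sets_def sets_nu emeasure_eq_measure)
    then have "AE u in \<nu>. \<forall>k. u \<notin> {- (1 - 1 / real (Suc k))..1 - 1 / real (Suc k)}"
      unfolding AE_all_countable by (intro allI AE_not_in)
    then have "AE u in \<nu>. False"
      using AE_interior
    proof eventually_elim
      case (elim u)
      then have "1 - \<bar>u\<bar> > 0" by auto
      then obtain k where "1 / real (Suc k) < 1 - \<bar>u\<bar>" using nat_approx_posE by metis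
      then have "u \<in> {- (1 - 1 / real (Suc k))..1 - 1 / real (Suc k)}" by auto
      then show ?case using elim by blast
    qed
    then show False by simp
  qed
  then obtain k :: nat where "prob {- (1 - 1 / real (Suc k))..1 - 1 / real (Suc k)} > 0" by blast
  then show ?thesis by (intro that[of "1 - 1 / real (Suc k)"]) auto
qed

text \<open>The energy on a compact interval dominates its value at \<open>\<pi>/2\<close>, and its average against \<open>\<nu>\<close> is
  bounded by the norm, so a lower bound for the density of \<open>\<nu>\<close> is not needed.\<close>

lemma energy_le_norm:
  obtains K where "K \<ge> 0" "\<And>n. n \<ge> 1 \<Longrightarrow> (jg n (pi/2))\<^sup>2 + (jdg n (pi/2) / (real n + rho))\<^sup>2 \<le> K * jnorm2 n"
proof -
  obtain r where r: "0 \<le> r" "r < 1" "prob {-r..r} > 0" by (rule interior_mass)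
  define c where "c = arccos r"
  define d where "d = arccos (-r)"
  have c: "0 < c" "c \<le> pi / 2" using r arccos_le_pi2[of r] arccos_less_arccos[of r 1] by (auto simp: c_def)
  have d: "d < pi" "pi / 2 \<le> d" using c r by (auto simp: d_def c_def arccos_minus)
  obtain M where M: "M \<ge> 0" "\<And>x. x \<in> {c..d} \<Longrightarrow> \<bar>pot x\<bar> \<le> M"
    using bounded_interior[OF cont_interior(1)[OF c(1) d(1)]] by blast
  obtain Kk where Kk: "Kk \<ge> 0" "\<And>x. x \<in> {c..d} \<Longrightarrow> \<bar>kap x\<bar> \<le> Kk"
    using bounded_interior[OF cont_interior(2)[OF c(1) d(1)]] by blast
  obtain W where W: "W \<ge> 0" "\<And>x. x \<in> {c..d} \<Longrightarrow> \<bar>wt x\<bar> \<le> W"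
    using bounded_interior[OF cont_interior(3)[OF c(1) d(1)]] by blast
  define C where "C = exp (M * (d - c)) * (W\<^sup>2 * (2 + 2 * Kk\<^sup>2))"
  have C0: "C \<ge> 0" by (simp add: C_def)
  show ?thesis
  proof (rule that[of "2 * C / prob {-r..r}"])
    show "2 * C / prob {-r..r} \<ge> 0" using C0 by simp
    fix n :: nat assume n: "n \<ge> 1"
    define N where "N = real n + rho"
    have N: "N \<ge> 1" using n rho_ge0 by (simp add: N_def)
    define E where "E x = (jg n x)\<^sup>2 + (jdg n x / N)\<^sup>2" for x
    let ?f = "\<lambda>u. (poly (J n) u)\<^sup>2 + (1 - u\<^sup>2) * (poly (pderiv (J n)) u)\<^sup>2 / N\<^sup>2"
    \<comment> \<open>The energy at \<pi>/2 is at most a constant times the energy at the angle of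
      any u in [-r, r], and the latter is estimated by J^2 and the Dirichlet density (1 - u^2) J'^2
      at u.\<close>
    have pt: "E (pi/2) \<le> C * ?f u" if u: "u \<in> {-r..r}" for u
    proof -
      define x where "x = arccos u"
      have xu: "cos x = u" using u r by (simp add: x_def)
      have x: "x \<in> {c..d}" using u r by (auto simp: x_def c_def d_def intro!: arccos_le_arccos)
      have x0: "0 < z" "z < pi" if "z \<in> {c..d}" for z using that c d by auto
      have "E (pi/2) \<le> exp (M * (d - c)) * E x"
        unfolding E_def
        by (rule perturbed_oscillator(1)[of c d "jg n" "jdg n" N pot M])
           (use jg_deriv[OF x0] M(2) N c d x in \<open>auto simp: N_def\<close>)
      also have "E x \<le> W\<^sup>2 * (2 + 2 * Kk\<^sup>2) * ?f u"
      proof -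
        let ?y = "poly (J n) u" and ?z = "sin x * poly (pderiv (J n)) u"
        have z2: "?z\<^sup>2 = (1 - u\<^sup>2) * (poly (pderiv (J n)) u)\<^sup>2"
          using sin_squared_eq[of x] by (simp add: power_mult_distrib xu)
        have "E x = (wt x)\<^sup>2 * (?y\<^sup>2 + (kap x * ?y - ?z)\<^sup>2 / N\<^sup>2)"
          by (simp add: E_def jg_def jdg_def xu power_mult_distrib power_divide distrib_left)
        also have "\<dots> \<le> W\<^sup>2 * (?y\<^sup>2 + (2 * Kk\<^sup>2 * ?y\<^sup>2 + 2 * (?z\<^sup>2 / N\<^sup>2)))"
        proof (intro mult_mono add_left_mono)
          show "(wt x)\<^sup>2 \<le> W\<^sup>2" using W(2)[OF x] W(1) by (simp add: abs_le_square_iff[symmetric])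
          have "(kap x * ?y - ?z)\<^sup>2 \<le> 2 * (kap x * ?y)\<^sup>2 + 2 * ?z\<^sup>2"
            using sum_squares_bound[of "kap x * ?y" "- ?z"] by (simp add: power2_diff)
          also have "(kap x * ?y)\<^sup>2 \<le> Kk\<^sup>2 * ?y\<^sup>2"
            using Kk(2)[OF x] Kk(1) by (simp add: power_mult_distrib abs_le_square_iff[symmetric] mult_right_mono)
          finally have "(kap x * ?y - ?z)\<^sup>2 / N\<^sup>2 \<le> (2 * (Kk\<^sup>2 * ?y\<^sup>2) + 2 * ?z\<^sup>2) / N\<^sup>2"
            by (simp add: divide_right_mono)
          also have "\<dots> = 2 * (Kk\<^sup>2 * ?y\<^sup>2) / N\<^sup>2 + 2 * (?z\<^sup>2 / N\<^sup>2)" by (simp add: add_divide_distrib)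
          also have "2 * (Kk\<^sup>2 * ?y\<^sup>2) / N\<^sup>2 \<le> 2 * (Kk\<^sup>2 * ?y\<^sup>2) / 1"
            using N by (intro divide_left_mono) auto
          finally show "(kap x * ?y - ?z)\<^sup>2 / N\<^sup>2 \<le> 2 * Kk\<^sup>2 * ?y\<^sup>2 + 2 * (?z\<^sup>2 / N\<^sup>2)" by simp
        qed auto
        also have "\<dots> \<le> W\<^sup>2 * ((2 + 2 * Kk\<^sup>2) * (?y\<^sup>2 + ?z\<^sup>2 / N\<^sup>2))"
        proof (intro mult_left_mono)
          have *: "p + (2 * k * p + 2 * q) \<le> (2 + 2 * k) * (p + q)" if "0 \<le> p" "0 \<le> q" "0 \<le> k" for p q k :: real
            using that mult_nonneg_nonneg[of k q] by (simp add: algebra_simps)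
          show "?y\<^sup>2 + (2 * Kk\<^sup>2 * ?y\<^sup>2 + 2 * (?z\<^sup>2 / N\<^sup>2)) \<le> (2 + 2 * Kk\<^sup>2) * (?y\<^sup>2 + ?z\<^sup>2 / N\<^sup>2)"
            by (rule *) simp_all
        qed simp
        finally show ?thesis unfolding z2 by (simp add: mult.assoc)
      qed
      finally show ?thesis by (simp add: C_def mult.assoc)
    qed
    have f0: "?f u \<ge> 0" if "u \<in> {-1..1}" for u
      using that by (auto intro!: add_nonneg_nonneg divide_nonneg_nonneg mult_nonneg_nonneg simp: abs_square_le_1 abs_le_iff)
    have i: "integrable \<nu> (\<lambda>u. (poly (J n) u)\<^sup>2)" "integrable \<nu> (\<lambda>u. (1 - u\<^sup>2) * (poly (pderiv (J n)) u)\<^sup>2 / N\<^sup>2)"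
      using N by (auto intro!: integrable_cont continuous_intros)
    have "E (pi/2) * prob {-r..r} = (\<integral>u. E (pi/2) * indicator {-r..r} u \<partial>\<nu>)"
      by (simp add: sets_nu)
    also have "\<dots> \<le> (\<integral>u. C * ?f u \<partial>\<nu>)"
    proof (rule integral_mono_AE)
      show "AE u in \<nu>. E (pi/2) * indicator {-r..r} u \<le> C * ?f u"
        using supp
      proof eventually_elim
        case (elim u)
        then have "0 \<le> C * ?f u" using f0[of u] C0 by (intro mult_nonneg_nonneg) auto
        then show ?case using pt[of u] by (auto simp: indicator_def)
      qed
    qed (use i in \<open>auto simp: sets_nu emeasure_eq_measure\<close>)
    \<comment> \<open>The Dirichlet part has the exact mean \<open>ev n * jnorm2 n\<close>, and ev n
      \<le> N^2 compensates the derivative.\<close>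
    also have "\<dots> = C * (jnorm2 n + ev n * jnorm2 n / N\<^sup>2)"
      using i by (simp add: jnorm2_def[symmetric] jacobi_energy)
    also have "\<dots> \<le> C * (jnorm2 n + 1 * jnorm2 n)"
    proof (intro mult_left_mono add_left_mono C0)
      have "ev n \<le> N\<^sup>2" by (simp add: ev_rho N_def)
      then have "ev n / N\<^sup>2 \<le> 1" using N by simp
      moreover have "jnorm2 n \<ge> 0" by (simp add: jnorm2_def)
      ultimately show "ev n * jnorm2 n / N\<^sup>2 \<le> 1 * jnorm2 n"
        using mult_right_mono[of "ev n / N\<^sup>2" 1 "jnorm2 n"] by simp
    qed
    finally have "E (pi/2) * prob {-r..r} \<le> 2 * C * jnorm2 n" by simp
    then show "(jg n (pi/2))\<^sup>2 + (jdg n (pi/2) / (real n + rho))\<^sup>2 \<le> 2 * C / prob {-r..r} * jnorm2 n"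
      using r(3) by (simp add: E_def N_def field_simps)
  qed
qed

text \<open>The amplitudes are taken at the fixed base point \<pi>/2. Thus they depend on n only and
  can be absorbed into the coefficients of sums in which \<theta> varies.\<close>

definition jA :: "nat \<Rightarrow> real" where
  "jA n = jg n (pi/2) * cos ((real n + rho) * (pi/2)) - jdg n (pi/2) / (real n + rho) * sin ((real n + rho) * (pi/2))"

definition jB :: "nat \<Rightarrow> real" where
  "jB n = jg n (pi/2) * sin ((real n + rho) * (pi/2)) + jdg n (pi/2) / (real n + rho) * cos ((real n + rho) * (pi/2))"

lemma jA_jB_bound:
  "\<exists>K\<ge>0. \<forall>n\<ge>1. \<bar>jA n\<bar> \<le> K * sqrt (jnorm2 n) \<and> \<bar>jB n\<bar> \<le> K * sqrt (jnorm2 n)"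
proof -
  obtain K where K: "K \<ge> 0" "\<And>n. n \<ge> 1 \<Longrightarrow> (jg n (pi/2))\<^sup>2 + (jdg n (pi/2) / (real n + rho))\<^sup>2 \<le> K * jnorm2 n"
    using energy_le_norm by blast
  have "(jA n)\<^sup>2 + (jB n)\<^sup>2 = (jg n (pi/2))\<^sup>2 + (jdg n (pi/2) / (real n + rho))\<^sup>2" for n
  proof -
    have "(p * c - q * s)\<^sup>2 + (p * s + q * c)\<^sup>2 = (p\<^sup>2 + q\<^sup>2) * (s\<^sup>2 + c\<^sup>2)" for p q s c :: real
      by (simp add: power2_eq_square algebra_simps)
    then show ?thesis unfolding jA_def jB_def by (simp only: sin_cos_squared_add mult_1_right)
  qed
  then have *: "(jA n)\<^sup>2 + (jB n)\<^sup>2 \<le> K * jnorm2 n" if "n \<ge> 1" for n using K(2)[OF that] by simp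
  show ?thesis
  proof (intro exI[of _ "sqrt K"] conjI allI impI)
    fix n :: nat assume n: "n \<ge> 1"
    have "(jA n)\<^sup>2 \<le> K * jnorm2 n" "(jB n)\<^sup>2 \<le> K * jnorm2 n"
      using *[OF n] zero_le_power2[of "jA n"] zero_le_power2[of "jB n"] by linarith+
    then show "\<bar>jA n\<bar> \<le> sqrt K * sqrt (jnorm2 n)" "\<bar>jB n\<bar> \<le> sqrt K * sqrt (jnorm2 n)"
      by (simp_all add: real_le_rsqrt flip: real_sqrt_mult)
  qed (use K in simp)
qed

text \<open>The oscillator estimate on the interval between \<theta> and \<pi>/2. Its constant
  depends on \<theta> but not on n, which is enough for convergence at a fixed point.\<close>

lemma jg_asymptotics:
  assumes t: "0 < \<theta>" "\<theta> < pi"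
  obtains C where "C \<ge> 0" "\<And>n. n \<ge> 1 \<Longrightarrow>
    \<bar>jg n \<theta> - (jA n * cos ((real n + rho) * \<theta>) + jB n * sin ((real n + rho) * \<theta>))\<bar> \<le> C * sqrt (jnorm2 n) / real n"
proof -
  define c d where "c = min \<theta> (pi/2)" and "d = max \<theta> (pi/2)"
  have c: "0 < c" and d: "d < pi" and cd: "c \<le> d" using t by (auto simp: c_def d_def)
  obtain M where M: "M \<ge> 0" "\<And>x. x \<in> {c..d} \<Longrightarrow> \<bar>pot x\<bar> \<le> M"
    using bounded_interior[OF cont_interior(1)[OF c(1) d(1)]] by blast
  obtain K where K: "K \<ge> 0" "\<And>n. n \<ge> 1 \<Longrightarrow> (jg n (pi/2))\<^sup>2 + (jdg n (pi/2) / (real n + rho))\<^sup>2 \<le> K * jnorm2 n"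
    using energy_le_norm by blast
  define C where "C = 2 * M * (d - c) * sqrt (exp (M * (d - c)) * K)"
  have C0: "C \<ge> 0" using M cd K by (simp add: C_def)
  show ?thesis
  proof (rule that[OF C0])
    fix n :: nat assume n: "n \<ge> 1"
    define N where "N = real n + rho"
    have N: "N \<ge> 1" "N \<ge> real n" using n rho_ge0 by (simp_all add: N_def)
    have x0: "0 < z" "z < pi" if "z \<in> {c..d}" for z using that c d by auto
    have "\<bar>jg n \<theta> - (jA n * cos (N * \<theta>) + jB n * sin (N * \<theta>))\<bar>
       \<le> 2 * M * (d - c) * sqrt (exp (M * (d - c)) * ((jg n (pi/2))\<^sup>2 + (jdg n (pi/2) / N)\<^sup>2)) / N"
      unfolding jA_def jB_def N_def[symmetric]
      by (rule perturbed_oscillator(2)[of c d "jg n" "jdg n" N pot M])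
         (use jg_deriv[OF x0] M(2) N in \<open>auto simp: N_def c_def d_def\<close>)
    also have "\<dots> \<le> 2 * M * (d - c) * sqrt (exp (M * (d - c)) * (K * jnorm2 n)) / N"
      using K(2)[OF n] N M cd by (intro divide_right_mono mult_left_mono real_sqrt_le_mono) (auto simp: N_def)
    also have "\<dots> = C * sqrt (jnorm2 n) / N"
      by (simp add: C_def real_sqrt_mult mult.assoc)
    also have "\<dots> \<le> C * sqrt (jnorm2 n) / real n"
      using N n C0 by (intro divide_left_mono mult_nonneg_nonneg) (auto simp: jnorm2_def)
    finally show "\<bar>jg n \<theta> - (jA n * cos ((real n + rho) * \<theta>) + jB n * sin ((real n + rho) * \<theta>))\<bar> \<le> C * sqrt (jnorm2 n) / real n"
      unfolding N_def .
  qed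
qed

text \<open>Not immediate, since \<nu> might a priori be carried by zeros of \<open>J n\<close>. But
  amplitudes and error are both bounded by the norm; if it vanished, \<open>J n\<close> would vanish
  on (-1, 1) and be the zero polynomial.\<close>

lemma jnorm2_pos: "jnorm2 n > 0"
proof (rule ccontr)
  assume "\<not> jnorm2 n > 0"
  then have z: "jnorm2 n = 0" unfolding jnorm2_def by (simp add: not_less antisym)
  have n: "n \<ge> 1"
  proof (rule ccontr)
    assume "\<not> n \<ge> 1"
    then have n0: "n = 0" by simp
    have "jnorm2 n = (\<integral>u. 1 \<partial>\<nu>)" by (simp add: n0 jnorm2_def jpoly_def)
    then show False using z by (simp add: prob_space)
  qed
  obtain K where K: "\<And>n. n \<ge> 1 \<Longrightarrow> \<bar>jA n\<bar> \<le> K * sqrt (jnorm2 n)" "\<And>n. n \<ge> 1 \<Longrightarrow> \<bar>jB n\<bar> \<le> K * sqrt (jnorm2 n)"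
    using jA_jB_bound by blast
  have AB: "jA n = 0" "jB n = 0" using K[OF n] z by auto
  have "poly (J n) u = 0" if u: "u \<in> {-1<..<1}" for u
  proof -
    define \<theta> where "\<theta> = arccos u"
    have \<theta>: "0 < \<theta>" "\<theta> < pi" "cos \<theta> = u" using u arccos_lt_bounded[of u] by (auto simp: \<theta>_def)
    obtain C where "\<And>n. n \<ge> 1 \<Longrightarrow>
      \<bar>jg n \<theta> - (jA n * cos ((real n + rho) * \<theta>) + jB n * sin ((real n + rho) * \<theta>))\<bar> \<le> C * sqrt (jnorm2 n) / real n"
      using jg_asymptotics[OF \<theta>(1,2)] by blast
    from this[OF n] have "jg n \<theta> = 0" using z AB by simp
    then show ?thesis using wt_pos[OF \<theta>(1,2)] \<theta>(3) by (simp add: jg_def)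
  qed
  then have "{-1<..<1} \<subseteq> {u. poly (J n) u = 0}" by blast
  moreover have "J n \<noteq> 0" using jpoly_at_1_pos[of a b n] a_ge by auto
  ultimately have "finite {-1<..<1::real}" using poly_roots_finite finite_subset by blast
  then show False using infinite_Ioo[of "-1" "1::real"] by simp
qed

end

section \<open>Completeness\<close>

context jacobi_measure
begin

text \<open>Orthogonality passes from polynomials to continuous functions by Weierstrass and to
  indicators of half-lines by dominated convergence. Then the positive and the negative part of k
  are densities of measures with the same distribution function, so they agree almost
  everywhere.\<close>

lemma AE_zero_of_orthogonal_poly:
  fixes k :: "real \<Rightarrow> real"
  assumes km: "k \<in> borel_measurable borel" and ki: "integrable \<nu> k"
    and orth: "\<And>q. (\<integral>u. k u * poly q u \<partial>\<nu>) = 0"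
  shows "AE u in \<nu>. k u = 0"
proof -
  have bi: "integrable \<nu> (\<lambda>u. k u * f u)" if f: "f \<in> borel_measurable borel" "\<And>u. u \<in> {-1..1} \<Longrightarrow> \<bar>f u\<bar> \<le> B" for f B
  proof (rule Bochner_Integration.integrable_bound[of _ "\<lambda>u. B * k u"])
    show "AE x in \<nu>. norm (k x * f x) \<le> norm (B * k x)"
      using supp
    proof eventually_elim
      case (elim x)
      then have "\<bar>f x\<bar> \<le> \<bar>B\<bar>" using f(2)[of x] by auto
      then have "\<bar>f x\<bar> * \<bar>k x\<bar> \<le> \<bar>B\<bar> * \<bar>k x\<bar>" by (rule mult_right_mono) simp
      then show ?case by (simp add: abs_mult mult.commute)
    qed
  qed (use ki km f in \<open>auto intro!: borel_meas_nu\<close>)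
  have cont0: "(\<integral>u. k u * g u \<partial>\<nu>) = 0" if g: "continuous_on UNIV g" for g
  proof (rule ccontr)
    assume "(\<integral>u. k u * g u \<partial>\<nu>) \<noteq> 0"
    \<comment> \<open>The 1 in the denominator makes the approximation error, e times the integral
      of |k|, strictly smaller than the supposed nonzero value.\<close>
    define e where "e = \<bar>\<integral>u. k u * g u \<partial>\<nu>\<bar> / ((\<integral>u. \<bar>k u\<bar> \<partial>\<nu>) + 1)"
    have I0: "(\<integral>u. \<bar>k u\<bar> \<partial>\<nu>) \<ge> 0" by simp
    have e: "e > 0" using \<open>(\<integral>u. k u * g u \<partial>\<nu>) \<noteq> 0\<close> I0 by (simp add: e_def add_nonneg_pos)
    obtain q where q: "\<And>x. x \<in> {-1..1} \<Longrightarrow> \<bar>g x - poly q x\<bar> < e"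
      using weierstrass_poly[OF continuous_on_subset[OF g] e] by blast
    have gm: "g \<in> borel_measurable borel" by (rule borel_measurable_continuous_onI[OF g])
    have pcont: "continuous_on {-1..1} (poly q)" by (intro continuous_intros)
    have pm: "poly q \<in> borel_measurable borel" by (intro borel_measurable_continuous_onI continuous_intros)
    obtain B1 where B1: "\<And>x. x \<in> {-1..1} \<Longrightarrow> \<bar>g x\<bar> \<le> B1"
      using bounded_interior[OF continuous_on_subset[OF g, of "{-1..1}"]] by blast
    obtain B2 where B2: "\<And>x. x \<in> {-1..1} \<Longrightarrow> \<bar>poly q x\<bar> \<le> B2"
      using bounded_interior[OF pcont] by blast
    have "(\<integral>u. k u * g u \<partial>\<nu>) = (\<integral>u. k u * g u - k u * poly q u \<partial>\<nu>)"
      using Bochner_Integration.integral_diff[OF bi[OF gm B1] bi[OF pm B2]] orth[of q] by simp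
    also have "\<bar>\<dots>\<bar> \<le> (\<integral>u. \<bar>k u * g u - k u * poly q u\<bar> \<partial>\<nu>)" by (rule integral_abs_bound)
    also have "\<dots> \<le> (\<integral>u. e * \<bar>k u\<bar> \<partial>\<nu>)"
    proof (rule integral_mono_AE)
      show "AE u in \<nu>. \<bar>k u * g u - k u * poly q u\<bar> \<le> e * \<bar>k u\<bar>"
        using supp
      proof eventually_elim
        case (elim u)
        then have "\<bar>k u\<bar> * \<bar>g u - poly q u\<bar> \<le> \<bar>k u\<bar> * e"
          using q[of u] by (intro mult_left_mono) auto
        then show ?case by (simp only: right_diff_distrib[symmetric] abs_mult mult.commute[of e])
      qed
    qed (use ki bi[OF gm B1] bi[OF pm B2] in auto)
    also have "\<dots> = e * (\<integral>u. \<bar>k u\<bar> \<partial>\<nu>)" by simp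
    also have "\<dots> < e * ((\<integral>u. \<bar>k u\<bar> \<partial>\<nu>) + 1)" using e by simp
    also have "\<dots> = \<bar>\<integral>u. k u * g u \<partial>\<nu>\<bar>"
    proof -
      have "(\<integral>u. \<bar>k u\<bar> \<partial>\<nu>) + 1 \<noteq> 0" using I0 by linarith
      then show ?thesis by (simp add: e_def)
    qed
    finally show False by simp
  qed
  have ind0: "(\<integral>u. k u * indicator {..x} u \<partial>\<nu>) = 0" for x
  proof -
    \<comment> \<open>Continuous ramps that decrease to the indicator of the half-line.\<close>
    define g where "g m u = max 0 (min 1 (1 - real m * (u - x)))" for m u
    have "(\<lambda>m. \<integral>u. k u * g m u \<partial>\<nu>) \<longlonglongrightarrow> (\<integral>u. k u * indicator {..x} u \<partial>\<nu>)"
    proof (rule integral_dominated_convergence[where w = "\<lambda>u. \<bar>k u\<bar>"])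
      show "AE u in \<nu>. (\<lambda>m. k u * g m u) \<longlonglongrightarrow> k u * indicator {..x} u"
      proof (intro AE_I2 tendsto_mult tendsto_const)
        fix u
        show "(\<lambda>m. g m u) \<longlonglongrightarrow> indicator {..x} u"
        proof (cases "u \<le> x")
          case True
          then have "real m * (u - x) \<le> 0" for m by (simp add: mult_nonneg_nonpos)
          then have "g m u = 1" for m by (simp add: g_def)
          then show ?thesis using True by simp
        next
          case False
          then obtain m0 :: nat where m0: "1 / (u - x) < real m0" using reals_Archimedean2 by blast
          have "g m u = 0" if "m \<ge> m0" for m
          proof -
            have "1 / (u - x) < real m" using m0 that by linarith
            then have "1 < real m * (u - x)" using False by (simp add: field_simps)
            then show ?thesis by (simp add: g_def)
          qed
          then have "(\<lambda>m. g m u) \<longlonglongrightarrow> 0"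
            by (intro tendsto_eventually) (auto simp: eventually_sequentially)
          then show ?thesis using False by simp
        qed
      qed
      show "AE u in \<nu>. norm (k u * g m u) \<le> \<bar>k u\<bar>" for m
        by (intro AE_I2) (auto simp: abs_mult g_def intro!: mult_left_le)
      show "(\<lambda>u. k u * g m u) \<in> borel_measurable \<nu>" for m
        unfolding g_def
        by (intro borel_meas_nu borel_measurable_times km borel_measurable_continuous_onI continuous_intros)
      show "(\<lambda>u. k u * indicator {..x} u) \<in> borel_measurable \<nu>"
        by (intro borel_meas_nu borel_measurable_times km borel_measurable_indicator) simp
    qed (use ki in auto)
    moreover have "(\<integral>u. k u * g m u \<partial>\<nu>) = 0" for m
      unfolding g_def by (intro cont0 continuous_intros)
    ultimately show ?thesis by (simp add: LIMSEQ_const_iff)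
  qed
  define P where "P u = max 0 (k u)" for u
  define R where "R u = max 0 (- k u)" for u
  have PR: "k u = P u - R u" "P u \<ge> 0" "R u \<ge> 0" for u by (auto simp: P_def R_def)
  have m: "P \<in> borel_measurable borel" "R \<in> borel_measurable borel"
    unfolding P_def[abs_def] R_def[abs_def] using km by measurable
  have i: "integrable \<nu> P" "integrable \<nu> R"
    unfolding P_def[abs_def] R_def[abs_def] using ki by auto
  have iA: "integrable \<nu> (\<lambda>u. f u * indicator {..x} u)" if "integrable \<nu> f" for f :: "real \<Rightarrow> real" and x
    using that by (intro integrable_real_mult_indicator) (simp_all add: sets_nu)
  have em: "emeasure (density \<nu> (\<lambda>u. ennreal (f u))) {..x} = ennreal (\<integral>u. f u * indicator {..x} u \<partial>\<nu>)"
    if f: "f \<in> borel_measurable borel" "integrable \<nu> f" "\<And>u. f u \<ge> 0" for f x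
  proof -
    have "emeasure (density \<nu> (\<lambda>u. ennreal (f u))) {..x} = (\<integral>\<^sup>+u. ennreal (f u) * indicator {..x} u \<partial>\<nu>)"
      using f by (intro emeasure_density) (auto simp: sets_nu intro: borel_meas_nu)
    also have "\<dots> = (\<integral>\<^sup>+u. ennreal (f u * indicator {..x} u) \<partial>\<nu>)"
      by (intro nn_integral_cong) (auto simp: indicator_def)
    also have "\<dots> = ennreal (\<integral>u. f u * indicator {..x} u \<partial>\<nu>)"
      using f by (intro nn_integral_eq_integral iA AE_I2) auto
    finally show ?thesis .
  qed
  have fb: "finite_borel_measure (density \<nu> (\<lambda>u. ennreal (f u)))"
    if f: "f \<in> borel_measurable borel" "integrable \<nu> f" "\<And>u. f u \<ge> 0" for f
  proof -
    have "finite_measure (density \<nu> (\<lambda>u. ennreal (f u)))"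
    proof (rule finite_measureI)
      have "emeasure (density \<nu> (\<lambda>u. ennreal (f u))) (space \<nu>) = (\<integral>\<^sup>+u. ennreal (f u) * indicator (space \<nu>) u \<partial>\<nu>)"
        using f by (intro emeasure_density) (auto intro: borel_meas_nu)
      also have "\<dots> = (\<integral>\<^sup>+u. ennreal (f u) \<partial>\<nu>)" by (intro nn_integral_cong) auto
      also have "\<dots> = ennreal (\<integral>u. f u \<partial>\<nu>)" using f by (intro nn_integral_eq_integral AE_I2) auto
      finally show "emeasure (density \<nu> (\<lambda>u. ennreal (f u))) (space (density \<nu> (\<lambda>u. ennreal (f u)))) \<noteq> \<infinity>" by simp
    qed
    then show ?thesis
      by (simp add: finite_borel_measure_def finite_borel_measure_axioms_def sets_nu)
  qed
  have "density \<nu> (\<lambda>u. ennreal (P u)) = density \<nu> (\<lambda>u. ennreal (R u))"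
  proof (rule cdf_unique'[OF fb[OF m(1) i(1) PR(2)] fb[OF m(2) i(2) PR(3)]])
    show "cdf (density \<nu> (\<lambda>u. ennreal (P u))) = cdf (density \<nu> (\<lambda>u. ennreal (R u)))"
    proof
      fix x
      have "(\<integral>u. P u * indicator {..x} u \<partial>\<nu>) - (\<integral>u. R u * indicator {..x} u \<partial>\<nu>) = (\<integral>u. k u * indicator {..x} u \<partial>\<nu>)"
        by (subst Bochner_Integration.integral_diff[OF iA[OF i(1)] iA[OF i(2)], symmetric])
           (simp add: PR(1) left_diff_distrib)
      then show "cdf (density \<nu> (\<lambda>u. ennreal (P u))) x = cdf (density \<nu> (\<lambda>u. ennreal (R u))) x"
        using ind0[of x] by (simp add: cdf_def measure_def em[OF m(1) i(1) PR(2)] em[OF m(2) i(2) PR(3)])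
    qed
  qed
  then have "AE u in \<nu>. ennreal (P u) = ennreal (R u)"
    using m by (subst density_unique_iff[symmetric]) (auto intro: borel_meas_nu)
  then show ?thesis
    by eventually_elim (auto simp: PR)
qed

definition Z :: "nat \<Rightarrow> real \<Rightarrow> real" where "Z n u = poly (J n) u / sqrt (jnorm2 n)"

lemma Z_orthonormal: "(\<integral>u. Z m u * Z n u \<partial>\<nu>) = (if m = n then 1 else 0)"
proof -
  have "(\<integral>u. Z m u * Z n u \<partial>\<nu>) = (\<integral>u. poly (J m) u * poly (J n) u / (sqrt (jnorm2 m) * sqrt (jnorm2 n)) \<partial>\<nu>)"
    by (simp add: Z_def)
  also have "\<dots> = (\<integral>u. poly (J m) u * poly (J n) u \<partial>\<nu>) / (sqrt (jnorm2 m) * sqrt (jnorm2 n))" by simp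
  finally show ?thesis
    using jacobi_orthogonal[of m n] jnorm2_pos[of n] by (auto simp: jnorm2_def power2_eq_square)
qed

lemma continuous_on_Z [continuous_intros]: "continuous_on A (Z n)"
  unfolding Z_def[abs_def] using jnorm2_pos[of n] by (intro continuous_intros) auto

lemma Z_measurable [measurable]: "Z n \<in> borel_measurable borel"
  by (intro borel_measurable_continuous_onI continuous_intros)

lemma Z_bounded: "\<exists>B\<ge>0. \<forall>u\<in>{-1..1}. \<bar>Z n u\<bar> \<le> B"
  using bounded_interior[OF continuous_on_Z[of "{-1..1}" n]] by metis

definition psum :: "(nat \<Rightarrow> complex) \<Rightarrow> nat \<Rightarrow> real \<Rightarrow> complex" where
  "psum c N u = (\<Sum>n<N. c n * of_real (Z n u))"

lemma continuous_on_psum [continuous_intros]: "continuous_on A (psum c N)"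
  unfolding psum_def by (intro continuous_intros)

lemma psum_measurable [measurable]: "psum c N \<in> borel_measurable borel"
  by (intro borel_measurable_continuous_onI continuous_intros)

lemma integral_psum_diff_sq:
  assumes "M \<le> N"
  shows "(\<integral>u. (cmod (psum c N u - psum c M u))\<^sup>2 \<partial>\<nu>) = (\<Sum>n\<in>{M..<N}. (cmod (c n))\<^sup>2)"
proof -
  let ?I = "{M..<N}"
  have d: "psum c N u - psum c M u = (\<Sum>n\<in>?I. c n * of_real (Z n u))" for u
    using assms sum.atLeastLessThan_concat[of 0 M N "\<lambda>n. c n * of_real (Z n u)"]
    by (simp add: psum_def lessThan_atLeast0 algebra_simps)
  have sq: "(cmod (psum c N u - psum c M u))\<^sup>2 = (\<Sum>m\<in>?I. \<Sum>n\<in>?I. Re (c m * cnj (c n)) * (Z m u * Z n u))" for u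
  proof -
    have "complex_of_real ((cmod (psum c N u - psum c M u))\<^sup>2) = (\<Sum>m\<in>?I. \<Sum>n\<in>?I. (c m * cnj (c n)) * of_real (Z m u * Z n u))"
      unfolding complex_norm_square d cnj_sum sum_product by (intro sum.cong refl) simp
    from arg_cong[OF this, of Re] show ?thesis by (simp add: Re_sum)
  qed
  have "(\<integral>u. (cmod (psum c N u - psum c M u))\<^sup>2 \<partial>\<nu>) = (\<Sum>m\<in>?I. \<Sum>n\<in>?I. Re (c m * cnj (c n)) * (\<integral>u. Z m u * Z n u \<partial>\<nu>))"
  proof -
    have i: "integrable \<nu> (\<lambda>u. Re (c m * cnj (c n)) * (Z m u * Z n u))" for m n
      by (intro integrable_cont continuous_intros)
    have "(\<integral>u. (\<Sum>m\<in>?I. \<Sum>n\<in>?I. Re (c m * cnj (c n)) * (Z m u * Z n u)) \<partial>\<nu>)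
      = (\<Sum>m\<in>?I. \<Sum>n\<in>?I. \<integral>u. Re (c m * cnj (c n)) * (Z m u * Z n u) \<partial>\<nu>)"
      by (subst Bochner_Integration.integral_sum; (intro Bochner_Integration.integrable_sum i)?)
         (intro sum.cong refl Bochner_Integration.integral_sum i)
    then show ?thesis unfolding sq by simp
  qed
  also have "\<dots> = (\<Sum>m\<in>?I. \<Sum>n\<in>?I. if n = m then (cmod (c m))\<^sup>2 else 0)"
    by (intro sum.cong refl) (auto simp: Z_orthonormal cmod_power2, simp add: power2_eq_square)
  also have "\<dots> = (\<Sum>n\<in>?I. (cmod (c n))\<^sup>2)" by (intro sum.cong refl) (simp add: sum.delta)
  finally show ?thesis .
qed

text \<open>The partial sums converge almost everywhere by assumption, but it remains to identify
  the limit s. By Fatou's lemma its squared distance in L2 from the N-th partial sum is at most the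
  tail \<open>T N\<close>, so s has the coefficients of h. Thus h - s is orthogonal to all
  polynomials and vanishes.\<close>

lemma AE_psum_tendsto:
  fixes h :: "real \<Rightarrow> complex"
  assumes hm[measurable]: "h \<in> borel_measurable borel" and h2: "integrable \<nu> (\<lambda>u. (cmod (h u))\<^sup>2)"
    and c: "\<And>n. c n = (\<integral>u. h u * of_real (Z n u) \<partial>\<nu>)"
    and summ: "summable (\<lambda>n. (cmod (c n))\<^sup>2)"
    and conv: "AE u in \<nu>. convergent (\<lambda>N. psum c N u)"
  shows "AE u in \<nu>. (\<lambda>N. psum c N u) \<longlonglongrightarrow> h u"
proof -
  define s where "s u = lim (\<lambda>N. psum c N u)" for u
  have sm[measurable]: "s \<in> borel_measurable borel" unfolding s_def[abs_def] by measurable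
  have lim: "AE u in \<nu>. (\<lambda>N. psum c N u) \<longlonglongrightarrow> s u"
    using conv by eventually_elim (simp add: s_def convergent_LIMSEQ_iff)
  define T where "T N = (\<Sum>n. (cmod (c (n + N)))\<^sup>2)" for N
  have T0: "T N \<ge> 0" for N unfolding T_def using summable_ignore_initial_segment[OF summ, of N] by (intro suminf_nonneg) auto
  have Tlim: "T \<longlonglongrightarrow> 0" unfolding T_def[abs_def] by (rule suminf_exist_split2[OF summ])
  have fatou: "(\<integral>\<^sup>+u. ennreal ((cmod (s u - psum c N u))\<^sup>2) \<partial>\<nu>) \<le> ennreal (T N)" for N
  proof -
    have "(\<integral>\<^sup>+u. ennreal ((cmod (s u - psum c N u))\<^sup>2) \<partial>\<nu>) = (\<integral>\<^sup>+u. liminf (\<lambda>M. ennreal ((cmod (psum c M u - psum c N u))\<^sup>2)) \<partial>\<nu>)"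
    proof (rule nn_integral_cong_AE)
      show "AE u in \<nu>. ennreal ((cmod (s u - psum c N u))\<^sup>2) = liminf (\<lambda>M. ennreal ((cmod (psum c M u - psum c N u))\<^sup>2))"
        using lim
      proof eventually_elim
        case (elim u)
        have "(\<lambda>M. ennreal ((cmod (psum c M u - psum c N u))\<^sup>2)) \<longlonglongrightarrow> ennreal ((cmod (s u - psum c N u))\<^sup>2)"
          by (intro tendsto_ennrealI tendsto_intros elim)
        from lim_imp_Liminf[OF trivial_limit_sequentially this] show ?case by (rule sym)
      qed
    qed
    also have "\<dots> \<le> liminf (\<lambda>M. \<integral>\<^sup>+u. ennreal ((cmod (psum c M u - psum c N u))\<^sup>2) \<partial>\<nu>)"
      by (intro nn_integral_liminf borel_meas_nu) measurable
    also have "\<dots> \<le> ennreal (T N)"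
    proof (rule Liminf_le)
      show "\<forall>\<^sub>F M in sequentially. (\<integral>\<^sup>+u. ennreal ((cmod (psum c M u - psum c N u))\<^sup>2) \<partial>\<nu>) \<le> ennreal (T N)"
        using eventually_ge_at_top[of N]
      proof eventually_elim
        case (elim M)
        have "(\<integral>\<^sup>+u. ennreal ((cmod (psum c M u - psum c N u))\<^sup>2) \<partial>\<nu>) = ennreal (\<Sum>n\<in>{N..<M}. (cmod (c n))\<^sup>2)"
          unfolding integral_psum_diff_sq[OF elim, symmetric]
          by (intro nn_integral_eq_integral integrable_cont continuous_intros AE_I2) auto
        also have "(\<Sum>n\<in>{N..<M}. (cmod (c n))\<^sup>2) = (\<Sum>n<M - N. (cmod (c (n + N)))\<^sup>2)"
          using elim by (intro sum.reindex_bij_witness[of _ "\<lambda>n. n + N" "\<lambda>n. n - N"]) auto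
        also have "\<dots> \<le> T N" unfolding T_def using summable_ignore_initial_segment[OF summ, of N]
          by (intro sum_le_suminf) auto
        finally show ?case by (simp add: ennreal_leI)
      qed
    qed auto
    finally show ?thesis .
  qed
  have i2: "integrable \<nu> (\<lambda>u. (cmod (s u - psum c N u))\<^sup>2)" and b2: "(\<integral>u. (cmod (s u - psum c N u))\<^sup>2 \<partial>\<nu>) \<le> T N" for N
  proof -
    show "integrable \<nu> (\<lambda>u. (cmod (s u - psum c N u))\<^sup>2)"
      using fatou[of N] by (intro integrableI_bounded borel_meas_nu) (auto simp: less_top[symmetric] top_unique)
    then have "ennreal (\<integral>u. (cmod (s u - psum c N u))\<^sup>2 \<partial>\<nu>) \<le> ennreal (T N)"
      using fatou[of N] by (subst nn_integral_eq_integral[symmetric]) auto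
    then show "(\<integral>u. (cmod (s u - psum c N u))\<^sup>2 \<partial>\<nu>) \<le> T N" using T0 by simp
  qed
  have L1: "integrable \<nu> (\<lambda>u. f u * of_real (g u))"
    if f: "f \<in> borel_measurable borel" "integrable \<nu> (\<lambda>u. (cmod (f u))\<^sup>2)" and g: "g \<in> borel_measurable borel" "\<forall>u\<in>{-1..1}. \<bar>g u\<bar> \<le> B" "B \<ge> 0"
    for f :: "real \<Rightarrow> complex" and g B
  proof (rule Bochner_Integration.integrable_bound[of _ "\<lambda>u. (1 + (cmod (f u))\<^sup>2) * B"])
    show "AE u in \<nu>. norm (f u * of_real (g u)) \<le> norm ((1 + (cmod (f u))\<^sup>2) * B)"
      using supp
    proof eventually_elim
      case (elim u)
      have "cmod (f u) \<le> 1 + (cmod (f u))\<^sup>2"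
        using sum_squares_bound[of 1 "cmod (f u)"] by (simp add: power2_eq_square) (smt (verit) norm_ge_zero)
      then have "cmod (f u) * \<bar>g u\<bar> \<le> (1 + (cmod (f u))\<^sup>2) * B"
        using g elim by (intro mult_mono) auto
      then show ?case using g(3) by (simp add: norm_mult)
    qed
    show "(\<lambda>u. f u * of_real (g u)) \<in> borel_measurable \<nu>"
      using f(1) measurable_compose[OF g(1), of complex_of_real] by (intro borel_meas_nu borel_measurable_times) (auto simp: borel_measurable_continuous_onI)
  qed (use f in auto)
  have is0: "integrable \<nu> (\<lambda>u. (cmod (s u))\<^sup>2)" using i2[of 0] by (simp add: psum_def)
  define k where "k u = h u - s u" for u
  have km[measurable]: "k \<in> borel_measurable borel" unfolding k_def[abs_def] by measurable
  have orthZ: "(\<integral>u. k u * of_real (Z j u) \<partial>\<nu>) = 0" for j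
  proof -
    obtain B where B: "B \<ge> 0" "\<forall>u\<in>{-1..1}. \<bar>Z j u\<bar> \<le> B" using Z_bounded by blast
    note intg = L1[OF _ _ Z_measurable B(2,1)]
    have is_: "integrable \<nu> (\<lambda>u. s u * of_real (Z j u))" by (rule intg[OF sm is0])
    have ih: "integrable \<nu> (\<lambda>u. h u * of_real (Z j u))" by (rule intg[OF hm h2])
    have ip: "integrable \<nu> (\<lambda>u. psum c N u * of_real (Z j u))" for N
      by (intro integrable_cont continuous_intros)
    have pj: "(\<integral>u. psum c N u * of_real (Z j u) \<partial>\<nu>) = c j" if "j < N" for N
    proof -
      have "(\<integral>u. psum c N u * of_real (Z j u) \<partial>\<nu>) = (\<integral>u. (\<Sum>n<N. c n * of_real (Z n u * Z j u)) \<partial>\<nu>)"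
        by (simp add: psum_def sum_distrib_right mult.assoc)
      also have "\<dots> = (\<Sum>n<N. \<integral>u. c n * of_real (Z n u * Z j u) \<partial>\<nu>)"
        by (intro Bochner_Integration.integral_sum integrable_cont continuous_intros)
      also have "\<dots> = (\<Sum>n<N. c n * of_real (\<integral>u. Z n u * Z j u \<partial>\<nu>))"
        by (intro sum.cong refl) (simp only: integral_mult_right_zero integral_complex_of_real)
      also have "\<dots> = (\<Sum>n<N. if n = j then c n else 0)" by (intro sum.cong refl) (simp add: Z_orthonormal)
      also have "\<dots> = c j" using that by simp
      finally show ?thesis .
    qed
    \<comment> \<open>The inequality x \<le> d + x^2 / d stands in for Cauchy-Schwarz; N tends to
      infinity first, then d to 0.\<close>
    have small: "cmod (\<integral>u. k u * of_real (Z j u) \<partial>\<nu>) \<le> B * (d + T N / d) / 1" if N: "N > j" and d: "d > 0" for N d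
    proof -
      have "(\<integral>u. k u * of_real (Z j u) \<partial>\<nu>) = c j - (\<integral>u. s u * of_real (Z j u) \<partial>\<nu>)"
        using Bochner_Integration.integral_diff[OF ih is_] by (simp add: k_def left_diff_distrib c)
      also have "\<dots> = - (\<integral>u. (s u - psum c N u) * of_real (Z j u) \<partial>\<nu>)"
        using Bochner_Integration.integral_diff[OF is_ ip[of N]] pj[OF N] by (simp add: left_diff_distrib)
      also have "cmod \<dots> \<le> (\<integral>u. cmod ((s u - psum c N u) * of_real (Z j u)) \<partial>\<nu>)"
        by (simp only: norm_minus_cancel) (rule integral_norm_bound)
      also have "\<dots> \<le> (\<integral>u. B * (d + (cmod (s u - psum c N u))\<^sup>2 / d) \<partial>\<nu>)"
      proof (rule integral_mono_AE)
        show "AE u in \<nu>. cmod ((s u - psum c N u) * of_real (Z j u)) \<le> B * (d + (cmod (s u - psum c N u))\<^sup>2 / d)"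
          using supp
        proof eventually_elim
          case (elim u)
          let ?x = "cmod (s u - psum c N u)"
          have "2 * (?x * d) \<le> d\<^sup>2 + ?x\<^sup>2" using sum_squares_bound[of d ?x] by (simp add: mult_ac)
          moreover have "0 \<le> ?x * d" using d by simp
          ultimately have "?x * d \<le> d\<^sup>2 + ?x\<^sup>2" by linarith
          then have "?x \<le> d + ?x\<^sup>2 / d" using d by (simp add: field_simps power2_eq_square)
          then have "?x * \<bar>Z j u\<bar> \<le> (d + ?x\<^sup>2 / d) * B" using B elim d by (intro mult_mono) auto
          then show ?case by (simp add: norm_mult mult.commute)
        qed
        show "integrable \<nu> (\<lambda>u. cmod ((s u - psum c N u) * of_real (Z j u)))"
          using is_ ip[of N] by (simp add: left_diff_distrib)
      qed (use i2[of N] in auto)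
      also have "\<dots> = B * (d + (\<integral>u. (cmod (s u - psum c N u))\<^sup>2 \<partial>\<nu>) / d)"
        using i2[of N] by (simp add: prob_space)
      also have "\<dots> \<le> B * (d + T N / d)" using b2[of N] B d by (intro mult_left_mono add_left_mono divide_right_mono) auto
      finally show ?thesis by simp
    qed
    have "cmod (\<integral>u. k u * of_real (Z j u) \<partial>\<nu>) \<le> B * d" if d: "d > 0" for d
    proof (rule LIMSEQ_le_const)
      have "(\<lambda>N. B * (d + T N / d) / 1) \<longlonglongrightarrow> B * (d + 0 / d) / 1" using d by (intro tendsto_intros Tlim) auto
      then show "(\<lambda>N. B * (d + T N / d) / 1) \<longlonglongrightarrow> B * d" by simp
      show "\<exists>N. \<forall>n\<ge>N. cmod (\<integral>u. k u * of_real (Z j u) \<partial>\<nu>) \<le> B * (d + T n / d) / 1"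
        using small d by (intro exI[of _ "Suc j"]) auto
    qed
    then have "cmod (\<integral>u. k u * of_real (Z j u) \<partial>\<nu>) \<le> 0 + e" if "e > 0" for e
    proof -
      have "B * (e / (B + 1)) \<le> e" using that B(1) by (simp add: field_simps)
      moreover have "e / (B + 1) > 0" using that B(1) by simp
      ultimately show ?thesis using \<open>\<And>d. d > 0 \<Longrightarrow> cmod (\<integral>u. k u * of_real (Z j u) \<partial>\<nu>) \<le> B * d\<close>[of "e / (B + 1)"] by linarith
    qed
    then have "cmod (\<integral>u. k u * of_real (Z j u) \<partial>\<nu>) \<le> 0" by (rule field_le_epsilon)
    then show ?thesis by simp
  qed
  have k2: "integrable \<nu> (\<lambda>u. (cmod (k u))\<^sup>2)"
  proof (rule Bochner_Integration.integrable_bound[of _ "\<lambda>u. 2 * (cmod (h u))\<^sup>2 + 2 * (cmod (s u))\<^sup>2"])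
    show "AE u in \<nu>. norm ((cmod (k u))\<^sup>2) \<le> norm (2 * (cmod (h u))\<^sup>2 + 2 * (cmod (s u))\<^sup>2)"
    proof (intro AE_I2)
      fix u
      have "(cmod (k u))\<^sup>2 \<le> (cmod (h u) + cmod (s u))\<^sup>2"
        unfolding k_def by (intro power_mono norm_triangle_ineq4) auto
      also have "\<dots> \<le> 2 * (cmod (h u))\<^sup>2 + 2 * (cmod (s u))\<^sup>2"
        using sum_squares_bound[of "cmod (h u)" "cmod (s u)"] by (simp add: power2_sum)
      finally show "norm ((cmod (k u))\<^sup>2) \<le> norm (2 * (cmod (h u))\<^sup>2 + 2 * (cmod (s u))\<^sup>2)" by simp
    qed
    show "(\<lambda>u. (cmod (k u))\<^sup>2) \<in> borel_measurable \<nu>" by (intro borel_meas_nu) measurable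
  qed (use h2 is0 in auto)
  have ki: "integrable \<nu> k" using L1[OF km k2, of "\<lambda>_. 1" 1] by simp
  have orthq: "(\<integral>u. k u * of_real (poly q u) \<partial>\<nu>) = 0" for q
  proof -
    obtain e where e: "q = (\<Sum>n\<le>degree q. smult (e n) (J n))"
      using poly_jpoly_span[of a b q "degree q"] a_ge b_ge by auto
    have "poly q u = (\<Sum>n\<le>degree q. (e n * sqrt (jnorm2 n)) * Z n u)" for u
    proof -
      have "poly q u = (\<Sum>n\<le>degree q. e n * poly (J n) u)" by (subst e) (simp add: poly_sum)
      also have "\<dots> = (\<Sum>n\<le>degree q. (e n * sqrt (jnorm2 n)) * Z n u)"
        using jnorm2_pos by (intro sum.cong refl) (simp add: Z_def less_imp_neq[symmetric])
      finally show ?thesis .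
    qed
    then have "(\<integral>u. k u * of_real (poly q u) \<partial>\<nu>) = (\<integral>u. (\<Sum>n\<le>degree q. of_real (e n * sqrt (jnorm2 n)) * (k u * of_real (Z n u))) \<partial>\<nu>)"
      by (simp add: sum_distrib_left mult_ac)
    also have "\<dots> = (\<Sum>n\<le>degree q. \<integral>u. of_real (e n * sqrt (jnorm2 n)) * (k u * of_real (Z n u)) \<partial>\<nu>)"
    proof (rule Bochner_Integration.integral_sum)
      fix n
      obtain B where B: "B \<ge> 0" "\<forall>u\<in>{-1..1}. \<bar>Z n u\<bar> \<le> B" using Z_bounded by blast
      show "integrable \<nu> (\<lambda>u. of_real (e n * sqrt (jnorm2 n)) * (k u * of_real (Z n u)))"
        by (intro integrable_mult_right L1[OF km k2 Z_measurable B(2,1)])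
    qed
    also have "\<dots> = 0" by (simp add: orthZ)
    finally show ?thesis .
  qed
  have kpi: "integrable \<nu> (\<lambda>u. k u * of_real (poly q u))" for q
  proof -
    have pcont: "continuous_on {-1..1} (poly q)" by (intro continuous_intros)
    obtain B where "B \<ge> 0" "\<And>x. x \<in> {-1..1} \<Longrightarrow> \<bar>poly q x\<bar> \<le> B"
      using bounded_interior[OF pcont] by blast
    then show ?thesis
      by (intro L1[OF km k2, of _ B]) (auto intro!: borel_measurable_continuous_onI continuous_intros)
  qed
  have "AE u in \<nu>. Re (k u) = 0"
  proof (rule AE_zero_of_orthogonal_poly)
    show "(\<integral>u. Re (k u) * poly q u \<partial>\<nu>) = 0" for q
      using integral_Re[OF kpi[of q]] orthq[of q] by simp
  qed (use ki in \<open>measurable, auto\<close>)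
  moreover have "AE u in \<nu>. Im (k u) = 0"
  proof (rule AE_zero_of_orthogonal_poly)
    show "(\<integral>u. Im (k u) * poly q u \<partial>\<nu>) = 0" for q
      using integral_Im[OF kpi[of q]] orthq[of q] by simp
  qed (use ki in \<open>measurable, auto\<close>)
  ultimately have "AE u in \<nu>. h u = s u" by eventually_elim (simp add: k_def complex_eq_iff)
  with lim show ?thesis by eventually_elim simp
qed

end

section \<open>Convergence of the evolution\<close>

text \<open>Here x is the eigenvalue \<lambda>^2. The constant is 1/2 for the Boussinesq symbol and
  0 for the other two, as multiplication by the conjugate expression shows. It contributes only a
  phase common to all n.\<close>

lemma dispersion_expansion:
  fixes \<psi> :: "real \<Rightarrow> real"
  assumes "\<psi> = (\<lambda>r. r\<^sup>2) \<or> \<psi> = (\<lambda>r. r * sqrt (1 + r\<^sup>2)) \<or> \<psi> = (\<lambda>r. sqrt (1 + r ^ 4))"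
  shows "\<exists>\<kappa>. \<forall>x>0. \<bar>\<psi> (sqrt x) - x - \<kappa>\<bar> \<le> 1 / x"
  using assms
proof (elim disjE)
  assume \<psi>: "\<psi> = (\<lambda>r. r\<^sup>2)"
  show ?thesis by (intro exI[of _ 0]) (simp add: \<psi>)
next
  assume \<psi>: "\<psi> = (\<lambda>r. r * sqrt (1 + r\<^sup>2))"
  have "\<bar>\<psi> (sqrt x) - x - 1/2\<bar> \<le> 1 / x" if x: "x > 0" for x
  proof -
    define y where "y = \<psi> (sqrt x)"
    have y: "y \<ge> 0" "y\<^sup>2 = x\<^sup>2 + x" using x by (auto simp: y_def \<psi> power_mult_distrib power2_eq_square[of x] algebra_simps)
    have "(x + 1/2 - y) * (x + 1/2 + y) = 1/4" using y(2) by (simp add: power2_eq_square algebra_simps)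
    moreover have pos: "x + 1/2 + y > x" "x + 1/2 + y > 0" using x y by auto
    ultimately have "x + 1/2 - y = (1/4) / (x + 1/2 + y)" by (simp add: field_simps)
    moreover have "(1/4) / (x + 1/2 + y) \<le> 1 / x" using pos x by (intro frac_le) auto
    moreover have "(1/4) / (x + 1/2 + y) \<ge> 0" using pos by simp
    ultimately show ?thesis unfolding y_def[symmetric] by linarith
  qed
  then show ?thesis by blast
next
  assume \<psi>: "\<psi> = (\<lambda>r. sqrt (1 + r ^ 4))"
  have "\<bar>\<psi> (sqrt x) - x - 0\<bar> \<le> 1 / x" if x: "x > 0" for x
  proof -
    define y where "y = \<psi> (sqrt x)"
    have "(sqrt x) ^ 4 = ((sqrt x)\<^sup>2)\<^sup>2" by (simp flip: power_mult)
    then have y: "y \<ge> 0" "y\<^sup>2 = 1 + x\<^sup>2" using x by (auto simp: y_def \<psi>)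
    have "(y - x) * (x + y) = 1" using y(2) by (simp add: power2_eq_square algebra_simps)
    moreover have pos: "x + y \<ge> x" "x + y > 0" using x y by auto
    ultimately have "y - x = 1 / (x + y)" by (simp add: field_simps)
    moreover have "1 / (x + y) \<le> 1 / x" using pos x by (intro frac_le) auto
    moreover have "1 / (x + y) \<ge> 0" using pos by simp
    ultimately show ?thesis by (simp add: y_def)
  qed
  then show ?thesis by blast
qed

lemma cmod_cis_minus_1_le: "cmod (cis x - 1) \<le> \<bar>x\<bar>"
proof -
  have "(cmod (cis x - 1))\<^sup>2 = 4 * (sin (x / 2))\<^sup>2"
  proof -
    have "cos x = 1 - 2 * (sin (x / 2))\<^sup>2" using cos_double_sin[of "x / 2"] by simp
    moreover have "(cmod (cis x - 1))\<^sup>2 = 2 - 2 * cos x"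
      using sin_cos_squared_add[of x] unfolding cmod_power2 by (simp add: power2_diff)
    ultimately show ?thesis by simp
  qed
  also have "\<dots> \<le> 4 * (x / 2)\<^sup>2"
    using abs_sin_x_le_abs_x[of "x / 2"] by (simp add: abs_le_square_iff[symmetric])
  also have "\<dots> = \<bar>x\<bar>\<^sup>2" by (simp add: power_divide)
  finally show ?thesis by (rule power2_le_imp_le) simp
qed

text \<open>A Cauchy criterion on increments. They start at index 1 because the asymptotics of the
  zonal functions are stated for n \<ge> 1.\<close>

lemma uniformly_convergent_on_of_increments:
  fixes F f g h :: "nat \<Rightarrow> 'a \<Rightarrow> complex"
  assumes "uniformly_convergent_on T f" "uniformly_convergent_on T g" "uniformly_convergent_on T h"
    and C: "C \<ge> 0" and le: "\<And>m n t. t \<in> T \<Longrightarrow> 1 \<le> m \<Longrightarrow> m \<le> n \<Longrightarrow>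
      cmod (F n t - F m t) \<le> C * (cmod (f n t - f m t) + cmod (g n t - g m t) + cmod (h n t - h m t))"
  shows "uniformly_convergent_on T F"
  unfolding uniformly_convergent_eq_Cauchy
proof (rule uniformly_Cauchy_onI')
  fix e :: real assume e: "e > 0"
  define d where "d = e / (3 * C + 1)"
  have "3 * C + 1 > 0" using C by simp
  then have "d > 0" "d * (3 * C + 1) = e" using e by (simp_all add: d_def)
  moreover have "C * (d + d + d) = d * (3 * C + 1) - d" by (simp add: algebra_simps)
  ultimately have d: "d > 0" "C * (d + d + d) < e" by simp_all
  have "\<exists>M. \<forall>x\<in>T. \<forall>m\<ge>M. \<forall>n\<ge>M. dist (k m x) (k n x) < d" if "uniformly_convergent_on T k" for k :: "nat \<Rightarrow> 'a \<Rightarrow> complex"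
    using that d(1) unfolding uniformly_convergent_eq_Cauchy uniformly_Cauchy_on_def by simp
  from this[OF assms(1)] this[OF assms(2)] this[OF assms(3)] obtain M1 M2 M3 where
    M: "\<forall>x\<in>T. \<forall>m\<ge>M1. \<forall>n\<ge>M1. dist (f m x) (f n x) < d" "\<forall>x\<in>T. \<forall>m\<ge>M2. \<forall>n\<ge>M2. dist (g m x) (g n x) < d"
    "\<forall>x\<in>T. \<forall>m\<ge>M3. \<forall>n\<ge>M3. dist (h m x) (h n x) < d" by blast
  show "\<exists>M. \<forall>x\<in>T. \<forall>m\<ge>M. \<forall>n>m. dist (F m x) (F n x) < e"
  proof (intro exI[of _ "max 1 (max M1 (max M2 M3))"] ballI allI impI)
    fix x m n assume x: "x \<in> T" and m: "max 1 (max M1 (max M2 M3)) \<le> m" and n: "m < n"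
    have "cmod (f n x - f m x) \<le> d" "cmod (g n x - g m x) \<le> d" "cmod (h n x - h m x) \<le> d"
      using M x m n by (auto simp: dist_norm norm_minus_commute intro!: less_imp_le)
    then have "C * (cmod (f n x - f m x) + cmod (g n x - g m x) + cmod (h n x - h m x)) \<le> C * (d + d + d)"
      using C by (intro mult_left_mono) auto
    then show "dist (F m x) (F n x) < e"
      using le[OF x _ less_imp_le[OF n]] m d(2) by (simp add: dist_norm norm_minus_commute)
  qed
qed

context jacobi_measure
begin

lemma ev_ge_square: "ev n \<ge> (real n)\<^sup>2"
  using rho_ge0 by (simp add: ev_rho power2_sum)

lemma ev_nonneg: "ev n \<ge> 0" using ev_ge_square[of n] zero_le_power2[of "real n"] by linarith

text \<open>Multiplied by cis (t \<kappa>) \<open>wt \<theta>\<close>, a factor common to all n, the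
  n-th term is an X-term plus the conjugate of a Y-term, each with a unimodular factor free of n,
  plus an error \<open>R n t\<close>. The X- and Y-sums converge uniformly by the maximal estimate,
  and the errors are dominated by the summable \<open>D n\<close>.\<close>

lemma AE_uniformly_convergent_evolution:
  fixes \<psi> :: "real \<Rightarrow> real" and c :: "nat \<Rightarrow> complex"
  assumes \<psi>: "\<psi> = (\<lambda>r. r\<^sup>2) \<or> \<psi> = (\<lambda>r. r * sqrt (1 + r\<^sup>2)) \<or> \<psi> = (\<lambda>r. sqrt (1 + r ^ 4))"
    and \<alpha>: "\<alpha> > 1 / 3" and summ: "summable (\<lambda>n. (1 + ev n) powr \<alpha> * (cmod (c n))\<^sup>2)"
  shows "AE u in \<nu>. uniformly_convergent_on {0..1}
     (\<lambda>N t. \<Sum>n<N. exp (- \<i> * of_real (t * \<psi> (sqrt (ev n)))) * c n * of_real (Z n u))"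
proof -
  obtain \<kappa> where \<kappa>: "\<And>x. x > 0 \<Longrightarrow> \<bar>\<psi> (sqrt x) - x - \<kappa>\<bar> \<le> 1 / x"
    using dispersion_expansion[OF \<psi>] by blast
  define r where "r n = \<psi> (sqrt (ev n)) - ev n - \<kappa>" for n
  have rn: "\<bar>r n\<bar> \<le> 1 / real n" if n: "n \<ge> 1" for n
  proof -
    have "real n \<le> (real n)\<^sup>2" using n by (simp add: power2_eq_square)
    then have e: "real n \<le> ev n" using ev_ge_square[of n] by linarith
    then have "\<bar>r n\<bar> \<le> 1 / ev n" unfolding r_def using n by (intro \<kappa>) auto
    also have "\<dots> \<le> 1 / real n" using e n by (intro frac_le) auto
    finally show ?thesis .
  qed
  obtain K where K: "K \<ge> 0" "\<And>n. n \<ge> 1 \<Longrightarrow> \<bar>jA n\<bar> \<le> K * sqrt (jnorm2 n) \<and> \<bar>jB n\<bar> \<le> K * sqrt (jnorm2 n)"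
    using jA_jB_bound by blast
  \<comment> \<open>The complex amplitude: A cos x + B sin x is twice the real part of (A - i B)/2
    times cis x.\<close>
  define z where "z n = Complex (jA n) (- jB n) / (2 * sqrt (jnorm2 n))" for n
  have sj: "sqrt (jnorm2 n) > 0" for n using jnorm2_pos by simp
  have zK: "cmod (z n) \<le> K" if n: "n \<ge> 1" for n
  proof -
    have "cmod (Complex (jA n) (- jB n)) \<le> \<bar>jA n\<bar> + \<bar>jB n\<bar>"
      using cmod_le[of "Complex (jA n) (- jB n)"] by simp
    also have "\<dots> \<le> K * (2 * sqrt (jnorm2 n))" using K(2)[OF n] by simp
    finally show ?thesis using sj[of n] by (simp add: z_def norm_divide norm_mult field_simps)
  qed
  have trig: "(jA n * cos x + jB n * sin x) / sqrt (jnorm2 n) = z n * cis x + cnj (z n) * cis (- x)" (is "complex_of_real ?L = _") for n x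
  proof -
    have "z n * cis x + cnj (z n) * cis (- x) = z n * cis x + cnj (z n * cis x)" by (simp add: cis_cnj)
    also have "\<dots> = of_real (2 * Re (z n * cis x))" by (rule complex_add_cnj)
    also have "2 * Re (z n * cis x) = ?L" using sj[of n]
      by (simp add: z_def Re_divide_of_real Im_divide_of_real field_simps)
    finally show ?thesis by simp
  qed
  define S where "S = (\<Sum>n. (1 + ev n) powr \<alpha> * (cmod (c n))\<^sup>2)"
  have S0: "S \<ge> 0" unfolding S_def using summ by (intro suminf_nonneg) auto
  \<comment> \<open>On the block 1 + ev n \<ge> 4^k, so the Sobolev weight gives the decay 2^(- 2
    \<alpha> k) of the energies.\<close>
  have block: "(\<Sum>n\<in>{2 ^ k..<2 ^ Suc k}. (cmod (c n * w n))\<^sup>2) \<le> K\<^sup>2 * S * 2 powr (- 2 * \<alpha> * k)"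
    if w: "\<And>n. n \<ge> 1 \<Longrightarrow> cmod (w n) \<le> K" for w and k :: nat
  proof -
    have "(\<Sum>n\<in>{2 ^ k..<2 ^ Suc k}. (cmod (c n * w n))\<^sup>2)
      \<le> (\<Sum>n\<in>{2 ^ k..<2 ^ Suc k}. K\<^sup>2 * 2 powr (- 2 * \<alpha> * k) * ((1 + ev n) powr \<alpha> * (cmod (c n))\<^sup>2))"
    proof (intro sum_mono)
      fix n :: nat assume n: "n \<in> {2 ^ k..<2 ^ Suc k}"
      have n1: "n \<ge> 1" using n by (metis atLeastLessThan_iff le_trans one_le_numeral one_le_power)
      have "(2::real) ^ k \<le> real n" using n by (metis atLeastLessThan_iff of_nat_le_iff of_nat_numeral of_nat_power)
      then have "((2::real) ^ k)\<^sup>2 \<le> (real n)\<^sup>2" by (intro power_mono) auto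
      also have "\<dots> \<le> 1 + ev n" using ev_ge_square[of n] by simp
      finally have "(((2::real) ^ k)\<^sup>2) powr \<alpha> \<le> (1 + ev n) powr \<alpha>" using \<alpha> by (intro powr_mono2) auto
      moreover have "(((2::real) ^ k)\<^sup>2) powr \<alpha> = 2 powr (2 * \<alpha> * k)"
      proof -
        have "((2::real) ^ k)\<^sup>2 = 2 powr (real (k * 2))" by (subst powr_realpow) (auto simp: power_mult)
        then show ?thesis by (simp add: powr_powr mult_ac)
      qed
      ultimately have "2 powr (- 2 * \<alpha> * k) * 2 powr (2 * \<alpha> * k) \<le> 2 powr (- 2 * \<alpha> * k) * (1 + ev n) powr \<alpha>"
        by (intro mult_left_mono) auto
      then have 1: "1 \<le> 2 powr (- 2 * \<alpha> * k) * (1 + ev n) powr \<alpha>" by (simp add: powr_add[symmetric])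
      have "(cmod (c n * w n))\<^sup>2 \<le> K\<^sup>2 * (cmod (c n))\<^sup>2"
        using mult_right_mono[OF power_mono[OF w[OF n1], of 2], of "(cmod (c n))\<^sup>2"]
        by (simp add: norm_mult power_mult_distrib mult.commute)
      also have "\<dots> \<le> K\<^sup>2 * (cmod (c n))\<^sup>2 * (2 powr (- 2 * \<alpha> * k) * (1 + ev n) powr \<alpha>)"
        using 1 mult_left_mono[OF 1, of "K\<^sup>2 * (cmod (c n))\<^sup>2"] by simp
      finally show "(cmod (c n * w n))\<^sup>2 \<le> K\<^sup>2 * 2 powr (- 2 * \<alpha> * k) * ((1 + ev n) powr \<alpha> * (cmod (c n))\<^sup>2)"
        by (simp add: mult_ac)
    qed
    also have "\<dots> = K\<^sup>2 * 2 powr (- 2 * \<alpha> * k) * (\<Sum>n\<in>{2 ^ k..<2 ^ Suc k}. (1 + ev n) powr \<alpha> * (cmod (c n))\<^sup>2)"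
      by (simp add: sum_distrib_left)
    also have "\<dots> \<le> K\<^sup>2 * 2 powr (- 2 * \<alpha> * k) * S"
      unfolding S_def using summ by (intro mult_left_mono sum_le_suminf) auto
    finally show ?thesis by (simp add: mult_ac)
  qed
  have c2: "summable (\<lambda>n. (cmod (c n))\<^sup>2)"
  proof (rule summable_comparison_test'[OF summ])
    fix n
    have "1 \<le> (1 + ev n) powr \<alpha>" using ev_nonneg[of n] \<alpha> by (intro ge_one_powr_ge_zero) auto
    then have "1 * (cmod (c n))\<^sup>2 \<le> (1 + ev n) powr \<alpha> * (cmod (c n))\<^sup>2" by (intro mult_right_mono) auto
    then show "norm ((cmod (c n))\<^sup>2) \<le> (1 + ev n) powr \<alpha> * (cmod (c n))\<^sup>2" by simp
  qed
  \<comment> \<open>By 2 x y \<le> x^2 + y^2 with y = 1/n. The errors of the asymptotics and of the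
    dispersion relation are both of size |c n| / n.\<close>
  have c1: "summable (\<lambda>n. cmod (c n) / real n)"
  proof (rule summable_comparison_test')
    show "summable (\<lambda>n. (cmod (c n))\<^sup>2 + 1 / (real n)\<^sup>2)"
      using inverse_power_summable[of 2, where ?'a = real] by (intro summable_add c2) (simp add: field_simps)
    fix n :: nat
    have "2 * (cmod (c n) / real n) \<le> (cmod (c n))\<^sup>2 + 1 / (real n)\<^sup>2"
      using sum_squares_bound[of "cmod (c n)" "1 / real n"] by (simp add: power_divide)
    moreover have "norm (cmod (c n) / real n) = cmod (c n) / real n" "0 \<le> cmod (c n) / real n" by simp_all
    ultimately show "norm (cmod (c n) / real n) \<le> (cmod (c n))\<^sup>2 + 1 / (real n)\<^sup>2" by linarith
  qed
  have AE1: "AE u in \<nu>. uniformly_convergent_on {0..2 * pi} (\<lambda>N t. sch_sum (of_int (-1)) (2 * rho) {..<N} (\<lambda>n. c n * z n) (arccos u) t)"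
    by (rule AE_angle_measureD, rule AE_uniformly_convergent_sch_sum[OF _ angle_measure_le _ _ \<alpha> _ block])
       (use zK S0 in \<open>auto simp: angle_measure_def dom_const_def\<close>)
  \<comment> \<open>The part with spatial frequency -n is conjugated: this restores the frequency
    +n, reverses the sign of time, hence \<eta> = 1, and conjugates the coefficients.\<close>
  have AE2: "AE u in \<nu>. uniformly_convergent_on {0..2 * pi} (\<lambda>N t. sch_sum (of_int 1) (2 * rho) {..<N} (\<lambda>n. cnj (c n) * z n) (arccos u) t)"
    by (rule AE_angle_measureD, rule AE_uniformly_convergent_sch_sum[OF _ angle_measure_le _ _ \<alpha> _ , where M = "K\<^sup>2 * S"])
       (use zK S0 block[of z] in \<open>auto simp: angle_measure_def dom_const_def norm_mult\<close>)
  show ?thesis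
    using AE1 AE2 AE_interior
  proof eventually_elim
    case (elim u)
    define \<theta> where "\<theta> = arccos u"
    have \<theta>: "0 < \<theta>" "\<theta> < pi" "cos \<theta> = u" using elim arccos_lt_bounded[of u] by (auto simp: \<theta>_def)
    have w: "wt \<theta> > 0" by (rule wt_pos[OF \<theta>(1,2)])
    obtain C where C: "C \<ge> 0" "\<And>n. n \<ge> 1 \<Longrightarrow>
      \<bar>jg n \<theta> - (jA n * cos ((real n + rho) * \<theta>) + jB n * sin ((real n + rho) * \<theta>))\<bar> \<le> C * sqrt (jnorm2 n) / real n"
      using jg_asymptotics[OF \<theta>(1,2)] by blast
    let ?T = "\<lambda>n t. exp (- \<i> * of_real (t * \<psi> (sqrt (ev n)))) * c n * of_real (Z n u)"
    let ?X = "\<lambda>n t. (c n * z n) * cis (real n * \<theta> + sch_freq (-1) (2 * rho) n * t)"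
    let ?Y = "\<lambda>n t. (cnj (c n) * z n) * cis (real n * \<theta> + sch_freq 1 (2 * rho) n * t)"
    define D where "D n = (C + 2 * K) * (cmod (c n) / real n)" for n
    define R where "R n t = cis (t * \<kappa>) * wt \<theta> * ?T n t - (cis (rho * \<theta>) * ?X n t + cis (- (rho * \<theta>)) * cnj (?Y n t))" for n t
    have ev2: "ev n = (real n)\<^sup>2 + 2 * rho * real n" for n by (simp add: ev_rho power2_sum)
    have Rn: "cmod (R n t) \<le> D n" if n: "n \<ge> 1" and t: "t \<in> {0..1}" for n t
    proof -
      define x where "x = (real n + rho) * \<theta>"
      define err where "err = wt \<theta> * Z n u - (jA n * cos x + jB n * sin x) / sqrt (jnorm2 n)"
      have err: "\<bar>err\<bar> \<le> C / real n"
      proof -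
        have "err = (jg n \<theta> - (jA n * cos x + jB n * sin x)) / sqrt (jnorm2 n)"
          by (simp add: err_def Z_def jg_def \<theta>(3) diff_divide_distrib)
        then have "\<bar>err\<bar> = \<bar>jg n \<theta> - (jA n * cos x + jB n * sin x)\<bar> / sqrt (jnorm2 n)" using sj[of n] by simp
        also have "\<dots> \<le> (C * sqrt (jnorm2 n) / real n) / sqrt (jnorm2 n)"
          using C(2)[OF n] sj[of n] by (intro divide_right_mono) (auto simp: x_def)
        finally show ?thesis using sj[of n] by simp
      qed
      have main: "complex_of_real (wt \<theta> * Z n u) = z n * cis x + cnj (z n) * cis (- x) + of_real err"
        using trig[of n x] by (simp add: err_def)
      have phase: "cis (t * \<kappa>) * exp (- \<i> * of_real (t * \<psi> (sqrt (ev n)))) = cis (- (t * ev n)) * cis (- (t * r n))"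
      proof -
        have "exp (- \<i> * of_real (t * \<psi> (sqrt (ev n)))) = cis (- (t * \<psi> (sqrt (ev n))))"
          by (simp add: cis_conv_exp)
        then show ?thesis by (simp add: cis_mult r_def algebra_simps)
      qed
      have X: "cis (rho * \<theta>) * ?X n t = cis (- (t * ev n)) * c n * (z n * cis x)"
      proof -
        have "cis (rho * \<theta>) * cis (real n * \<theta> + sch_freq (-1) (2 * rho) n * t) = cis (- (t * ev n)) * cis x"
          unfolding cis_mult by (rule arg_cong[of _ _ cis]) (simp add: sch_freq_def ev2 x_def algebra_simps)
        note * = this
        have "cis (rho * \<theta>) * ?X n t = (cis (rho * \<theta>) * cis (real n * \<theta> + sch_freq (-1) (2 * rho) n * t)) * (c n * z n)"
          by (simp only: mult_ac)
        also have "\<dots> = cis (- (t * ev n)) * c n * (z n * cis x)" unfolding * by (simp only: mult_ac)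
        finally show ?thesis .
      qed
      have Y: "cis (- (rho * \<theta>)) * cnj (?Y n t) = cis (- (t * ev n)) * c n * (cnj (z n) * cis (- x))"
      proof -
        have "cis (- (rho * \<theta>)) * cis (- (real n * \<theta> + sch_freq 1 (2 * rho) n * t)) = cis (- (t * ev n)) * cis (- x)"
          unfolding cis_mult by (rule arg_cong[of _ _ cis]) (simp add: sch_freq_def ev2 x_def algebra_simps)
        note * = this
        have "cnj (?Y n t) = c n * cnj (z n) * cis (- (real n * \<theta> + sch_freq 1 (2 * rho) n * t))"
          by (simp add: cis_cnj)
        then have "cis (- (rho * \<theta>)) * cnj (?Y n t) = (cis (- (rho * \<theta>)) * cis (- (real n * \<theta> + sch_freq 1 (2 * rho) n * t))) * (c n * cnj (z n))"
          by (simp only: mult_ac)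
        also have "\<dots> = cis (- (t * ev n)) * c n * (cnj (z n) * cis (- x))" unfolding * by (simp only: mult_ac)
        finally show ?thesis .
      qed
      have "cis (t * \<kappa>) * wt \<theta> * ?T n t = (cis (t * \<kappa>) * exp (- \<i> * of_real (t * \<psi> (sqrt (ev n))))) * c n * of_real (wt \<theta> * Z n u)"
        by (simp add: mult_ac)
      also have "\<dots> = cis (- (t * ev n)) * cis (- (t * r n)) * c n * (z n * cis x + cnj (z n) * cis (- x) + of_real err)"
        unfolding phase main ..
      finally have "R n t = cis (- (t * ev n)) * c n * ((cis (- (t * r n)) - 1) * (z n * cis x + cnj (z n) * cis (- x)) + cis (- (t * r n)) * of_real err)"
        unfolding R_def X Y by (simp add: algebra_simps)
      then have "cmod (R n t) = cmod (c n) * cmod ((cis (- (t * r n)) - 1) * (z n * cis x + cnj (z n) * cis (- x)) + cis (- (t * r n)) * of_real err)"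
        by (simp add: norm_mult)
      also have "\<dots> \<le> cmod (c n) * ((1 / real n) * (K + K) + C / real n)"
      proof (intro mult_left_mono norm_triangle_mono)
        have "cmod (cis (- (t * r n)) - 1) \<le> \<bar>- (t * r n)\<bar>" by (rule cmod_cis_minus_1_le)
        also have "\<dots> \<le> 1 * (1 / real n)" unfolding abs_minus_cancel abs_mult using t rn[OF n] by (intro mult_mono) auto
        finally have a: "cmod (cis (- (t * r n)) - 1) \<le> 1 / real n" by simp
        have b: "cmod (z n * cis x + cnj (z n) * cis (- x)) \<le> K + K"
          using zK[OF n] by (intro norm_triangle_mono) (auto simp: norm_mult)
        show "cmod ((cis (- (t * r n)) - 1) * (z n * cis x + cnj (z n) * cis (- x))) \<le> (1 / real n) * (K + K)"
          unfolding norm_mult by (intro mult_mono a b) auto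
        show "cmod (cis (- (t * r n)) * of_real err) \<le> C / real n" using err by (simp add: norm_mult)
      qed auto
      also have "\<dots> = D n" by (simp add: D_def add_divide_distrib algebra_simps)
      finally show ?thesis .
    qed
    have Dsum: "summable D" unfolding D_def by (intro summable_mult c1)
    have D0: "D n \<ge> 0" for n using C K by (simp add: D_def)

    have unif1: "uniformly_convergent_on {0..1} (\<lambda>N t. \<Sum>n<N. ?X n t)"
      using uniformly_convergent_on_subset[OF elim(1), of "{0..1}"] pi_gt3 by (auto simp: sch_sum_def \<theta>_def)
    have unif2: "uniformly_convergent_on {0..1} (\<lambda>N t. \<Sum>n<N. ?Y n t)"
      using uniformly_convergent_on_subset[OF elim(2), of "{0..1}"] pi_gt3 by (auto simp: sch_sum_def \<theta>_def)
    have unif3: "uniformly_convergent_on {0..1::real} (\<lambda>N t. complex_of_real (\<Sum>n<N. D n))"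
    proof -
      have "(\<lambda>N. complex_of_real (\<Sum>n<N. D n)) \<longlonglongrightarrow> complex_of_real (suminf D)"
        by (intro tendsto_of_real summable_LIMSEQ Dsum)
      then have "uniform_limit {0..1::real} (\<lambda>N t. complex_of_real (\<Sum>n<N. D n)) (\<lambda>_. complex_of_real (suminf D)) sequentially"
        unfolding uniform_limit_iff tendsto_iff by (auto elim: eventually_mono)
      then show ?thesis unfolding uniformly_convergent_on_def by blast
    qed
    show ?case
    proof (rule uniformly_convergent_on_of_increments[OF unif1 unif2 unif3, of "1 / wt \<theta>"])
      show "1 / wt \<theta> \<ge> 0" using w by simp
      fix m n :: nat and t :: real assume t: "t \<in> {0..1}" and mn: "1 \<le> m" "m \<le> n"
      have inc: "(\<Sum>j<n. f j) - (\<Sum>j<m. f j) = (\<Sum>j\<in>{m..<n}. f j)" for f :: "nat \<Rightarrow> complex"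
        using mn(2) sum.atLeastLessThan_concat[of 0 m n f] by (simp add: lessThan_atLeast0 algebra_simps)
      have "wt \<theta> * cmod (\<Sum>j\<in>{m..<n}. ?T j t) = cmod (\<Sum>j\<in>{m..<n}. cis (t * \<kappa>) * wt \<theta> * ?T j t)"
        using w by (simp add: sum_distrib_left[symmetric] norm_mult)
      also have "(\<Sum>j\<in>{m..<n}. cis (t * \<kappa>) * wt \<theta> * ?T j t)
        = cis (rho * \<theta>) * (\<Sum>j\<in>{m..<n}. ?X j t) + cis (- (rho * \<theta>)) * cnj (\<Sum>j\<in>{m..<n}. ?Y j t) + (\<Sum>j\<in>{m..<n}. R j t)"
        unfolding R_def sum_distrib_left cnj_sum sum.distrib[symmetric] by (intro sum.cong refl) simp
      also have "cmod \<dots> \<le> cmod (\<Sum>j\<in>{m..<n}. ?X j t) + cmod (\<Sum>j\<in>{m..<n}. ?Y j t) + (\<Sum>j\<in>{m..<n}. D j)"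
      proof (intro norm_triangle_mono)
        have "cmod (\<Sum>j\<in>{m..<n}. R j t) \<le> (\<Sum>j\<in>{m..<n}. cmod (R j t))" by (rule norm_sum)
        also have "\<dots> \<le> (\<Sum>j\<in>{m..<n}. D j)" using mn t by (intro sum_mono Rn) auto
        finally show "cmod (\<Sum>j\<in>{m..<n}. R j t) \<le> (\<Sum>j\<in>{m..<n}. D j)" .
      qed (simp_all only: norm_mult norm_cis complex_mod_cnj mult_1_left order_refl)
      also have "(\<Sum>j\<in>{m..<n}. D j) = cmod (complex_of_real (\<Sum>j<n. D j) - complex_of_real (\<Sum>j<m. D j))"
      proof -
        have "complex_of_real (\<Sum>j<n. D j) - complex_of_real (\<Sum>j<m. D j) = complex_of_real (\<Sum>j\<in>{m..<n}. D j)"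
          using inc[of "\<lambda>j. complex_of_real (D j)"] by simp
        then show ?thesis using D0 by (simp add: sum_nonneg del: of_real_sum)
      qed
      finally show "cmod ((\<Sum>j<n. ?T j t) - (\<Sum>j<m. ?T j t)) \<le> 1 / wt \<theta> * (cmod ((\<Sum>j<n. ?X j t) - (\<Sum>j<m. ?X j t))
         + cmod ((\<Sum>j<n. ?Y j t) - (\<Sum>j<m. ?Y j t)) + cmod (complex_of_real (\<Sum>j<n. D j) - complex_of_real (\<Sum>j<m. D j)))"
        unfolding inc using w by (simp add: pos_le_divide_eq mult.commute)
    qed
  qed
qed

theorem AE_evolution_tendsto:
  fixes \<psi> :: "real \<Rightarrow> real" and h :: "real \<Rightarrow> complex"
  assumes \<psi>: "\<psi> = (\<lambda>r. r\<^sup>2) \<or> \<psi> = (\<lambda>r. r * sqrt (1 + r\<^sup>2)) \<or> \<psi> = (\<lambda>r. sqrt (1 + r ^ 4))"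
    and \<alpha>: "\<alpha> > 1 / 3" and hm: "h \<in> borel_measurable borel" and h2: "integrable \<nu> (\<lambda>u. (cmod (h u))\<^sup>2)"
    and c: "\<And>n. c n = (\<integral>u. h u * of_real (Z n u) \<partial>\<nu>)"
    and summ: "summable (\<lambda>n. (1 + ev n) powr \<alpha> * (cmod (c n))\<^sup>2)"
  shows "AE u in \<nu>. ((\<lambda>t. \<Sum>n. exp (- \<i> * of_real (t * \<psi> (sqrt (ev n)))) * c n * of_real (Z n u)) \<longlongrightarrow> h u) (at_right 0)"
proof -
  have c2: "summable (\<lambda>n. (cmod (c n))\<^sup>2)"
  proof (rule summable_comparison_test'[OF summ])
    fix n
    have "1 \<le> (1 + ev n) powr \<alpha>" using ev_nonneg[of n] \<alpha> by (intro ge_one_powr_ge_zero) auto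
    then have "1 * (cmod (c n))\<^sup>2 \<le> (1 + ev n) powr \<alpha> * (cmod (c n))\<^sup>2" by (intro mult_right_mono) auto
    then show "norm ((cmod (c n))\<^sup>2) \<le> (1 + ev n) powr \<alpha> * (cmod (c n))\<^sup>2" by simp
  qed
  let ?F = "\<lambda>u N t. \<Sum>n<N. exp (- \<i> * of_real (t * \<psi> (sqrt (ev n)))) * c n * of_real (Z n u)"
  have U: "AE u in \<nu>. uniformly_convergent_on {0..1} (?F u)"
    by (rule AE_uniformly_convergent_evolution[OF \<psi> \<alpha> summ])
  have F0: "?F u N 0 = psum c N u" for u N by (simp add: psum_def)
  \<comment> \<open>At t = 0 the uniform convergence is that of the expansion of h itself, which
    \<open>AE_psum_tendsto\<close> asks for.\<close>
  have "AE u in \<nu>. convergent (\<lambda>N. psum c N u)"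
    using U
  proof eventually_elim
    case (elim u)
    then have "convergent (\<lambda>N. ?F u N 0)" by (rule uniformly_convergent_imp_convergent) simp
    then show ?case unfolding F0 .
  qed
  then have "AE u in \<nu>. (\<lambda>N. psum c N u) \<longlonglongrightarrow> h u"
    by (rule AE_psum_tendsto[OF hm h2 c c2])
  with U show ?thesis
  proof eventually_elim
    case (elim u)
    let ?S = "\<lambda>t. \<Sum>n. exp (- \<i> * of_real (t * \<psi> (sqrt (ev n)))) * c n * of_real (Z n u)"
    obtain L where L: "uniform_limit {0..1} (?F u) L sequentially"
      using elim(1) unfolding uniformly_convergent_on_def by blast
    have "continuous_on {0..1} L"
      by (rule uniform_limit_theorem[OF _ L]) (auto intro!: always_eventually continuous_intros)
    then have "(L \<longlongrightarrow> L 0) (at 0 within {0..1})" by (simp add: continuous_on)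
    then have lim: "(L \<longlongrightarrow> L 0) (at_right 0)"
      using at_within_Icc_at_right[of 0 "1::real"] by simp
    have "(\<lambda>N. ?F u N t) \<longlonglongrightarrow> L t" if "t \<in> {0..1}" for t
      by (rule tendsto_uniform_limitI[OF L that])
    then have LS: "?S t = L t" if "t \<in> {0..1}" for t
      using that by (intro sums_unique[symmetric]) (simp add: sums_def)
    have "L 0 = h u"
      using tendsto_uniform_limitI[OF L, of 0] elim(2) unfolding F0 by (intro LIMSEQ_unique) auto
    moreover have "eventually (\<lambda>t. t \<in> {0<..<1}) (at_right (0::real))" by (rule eventually_at_right_real) simp
    then have "eventually (\<lambda>t. L t = ?S t) (at_right 0)" by eventually_elim (rule LS[symmetric], simp)
    ultimately show ?case using lim by (simp add: tendsto_cong)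
  qed
qed
end

section \<open>Octonion arithmetic\<close>

lemma bilinear_oct_mult: "bilinear oct_mult"
  unfolding bilinear_def
  by (intro conjI allI linearI)
     (simp_all add: oct_mult_def quat_mult_def quat_cnj_def prod_eq_iff complex_eq_iff algebra_simps)

lemmas linear_oct_mult_right = conjunct1[OF bilinear_oct_mult[unfolded bilinear_def], rule_format]
lemmas linear_oct_mult_left = conjunct2[OF bilinear_oct_mult[unfolded bilinear_def], rule_format]

lemma linear_oct_cnj: "linear oct_cnj"
  by (intro linearI) (simp_all add: oct_cnj_def quat_cnj_def prod_eq_iff complex_eq_iff)

lemma oct_cnj_cnj [simp]: "oct_cnj (oct_cnj x) = x"
  by (simp add: oct_cnj_def quat_cnj_def prod_eq_iff)

lemma oct_cnj_mult: "oct_cnj (oct_mult x y) = oct_mult (oct_cnj y) (oct_cnj x)"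
  by (simp add: oct_mult_def quat_mult_def oct_cnj_def quat_cnj_def prod_eq_iff algebra_simps)

lemma norm_oct_cnj [simp]: "norm (oct_cnj x) = norm x"
  by (simp add: norm_prod_def oct_cnj_def quat_cnj_def)

lemma oct_mult_one [simp]: "oct_mult oct_one x = x" "oct_mult x oct_one = x"
  by (simp_all add: oct_mult_def quat_mult_def quat_cnj_def oct_one_def prod_eq_iff)

lemma oct_mult_cnj_left: "oct_mult (oct_cnj x) x = (norm x)\<^sup>2 *\<^sub>R oct_one"
  using oct_mult_cnj[of "oct_cnj x"] by simp

lemma oct_mult_scaleR [simp]:
  "oct_mult (r *\<^sub>R x) y = r *\<^sub>R oct_mult x y" "oct_mult x (r *\<^sub>R y) = r *\<^sub>R oct_mult x y"
  using linear_cmul[OF linear_oct_mult_left] linear_cmul[OF linear_oct_mult_right] by auto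

lemma oct_mult_zero [simp]: "oct_mult 0 x = 0" "oct_mult x 0 = 0"
  using linear_0[OF linear_oct_mult_left] linear_0[OF linear_oct_mult_right] by auto

lemma oct_cnj_one [simp]: "oct_cnj oct_one = oct_one"
  by (simp add: oct_cnj_def quat_cnj_def oct_one_def)

lemma norm_oct_one [simp]: "norm oct_one = 1"
  by (simp add: oct_one_def norm_prod_def)

definition oct_re :: "oct \<Rightarrow> real" where "oct_re x = Re (fst (fst x))"

lemma linear_oct_re: "linear oct_re"
  by (intro linearI) (simp_all add: oct_re_def)

lemma oct_re_one [simp]: "oct_re oct_one = 1" by (simp add: oct_re_def oct_one_def)

lemma oct_re_cnj [simp]: "oct_re (oct_cnj x) = oct_re x"
  by (simp add: oct_re_def oct_cnj_def quat_cnj_def)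

lemma abs_oct_re_le: "\<bar>oct_re x\<bar> \<le> norm x"
proof -
  have "(oct_re x)\<^sup>2 \<le> (norm x)\<^sup>2" unfolding norm_oct_sq oct_re_def by simp
  then show ?thesis by (simp add: abs_le_square_iff[symmetric])
qed

text \<open>Multiplication by the conjugate of a unit e turns the e-component into the real part. In
  this way all components of a matrix entry become comparable.\<close>

lemma oct_re_cnj_mult: "oct_re (oct_mult (oct_cnj x) y) = x \<bullet> y"
  by (simp add: oct_re_def oct_mult_def quat_mult_def oct_cnj_def quat_cnj_def inner_prod_def inner_complex_def algebra_simps)

lemma oct_self_adjoint: "oct_cnj x = x \<Longrightarrow> x = oct_re x *\<^sub>R oct_one"
  by (auto simp: oct_cnj_def quat_cnj_def oct_re_def oct_one_def prod_eq_iff complex_eq_iff)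

text \<open>The Moufang identities that make \<open>(x, y, z) \<mapsto> (a x, y a, a\<^sup>* z a\<^sup>*)\<close> a triality.\<close>

lemma oct_moufang1: "oct_mult (oct_mult a x) (oct_mult y a) = oct_mult a (oct_mult (oct_mult x y) a)"
  by (simp add: oct_mult_def quat_mult_def quat_cnj_def prod_eq_iff algebra_simps)

lemma oct_right_bol: "oct_mult (oct_mult (oct_mult x a) z) a = oct_mult x (oct_mult a (oct_mult z a))"
  by (simp add: oct_mult_def quat_mult_def quat_cnj_def prod_eq_iff algebra_simps)

lemma complex_norm_oct_sq: "complex_of_real ((norm a)\<^sup>2) = fst (fst a) * cnj (fst (fst a)) + snd (fst a) * cnj (snd (fst a))
    + fst (snd a) * cnj (fst (snd a)) + snd (snd a) * cnj (snd (snd a))" for a :: oct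
  unfolding norm_oct_sq by (simp add: complex_mult_cnj add_ac)

text \<open>Alternativity: a and its conjugate cancel although the multiplication is not
  associative.\<close>

lemma oct_mult_right_cnj: "oct_mult (oct_mult x a) (oct_cnj a) = (norm a)\<^sup>2 *\<^sub>R x"
  unfolding prod_eq_iff
  by (simp add: scaleR_conv_of_real complex_norm_oct_sq del: of_real_power)
     (simp add: oct_mult_def quat_mult_def oct_cnj_def quat_cnj_def algebra_simps)

lemma oct_mult_left_cnj: "oct_mult (oct_cnj a) (oct_mult a x) = (norm a)\<^sup>2 *\<^sub>R x"
  unfolding prod_eq_iff
  by (simp add: scaleR_conv_of_real complex_norm_oct_sq del: of_real_power)
     (simp add: oct_mult_def quat_mult_def oct_cnj_def quat_cnj_def algebra_simps)

text \<open>The right Bol identity for the conjugate of a brings it next to y a, where the two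
  cancel.\<close>

lemma oct_moufang2:
  "oct_mult (oct_mult y a) (oct_mult (oct_cnj a) (oct_mult z (oct_cnj a))) = (norm a)\<^sup>2 *\<^sub>R oct_mult (oct_mult y z) (oct_cnj a)"
  unfolding oct_right_bol[symmetric] by (simp add: oct_mult_right_cnj)

lemma oct_mult_assoc_H:
  assumes "x \<in> oct_H" "y \<in> oct_H" "z \<in> oct_H"
  shows "oct_mult (oct_mult x y) z = oct_mult x (oct_mult y z)"
  using assms unfolding oct_H_def
  by (auto simp: oct_mult_def quat_mult_def quat_cnj_def prod_eq_iff algebra_simps)

lemma continuous_on_oct_mult [continuous_intros]:
  assumes "continuous_on A f" "continuous_on A g"
  shows "continuous_on A (\<lambda>x. oct_mult (f x) (g x))"
  unfolding oct_mult_def quat_mult_def quat_cnj_def by (intro continuous_intros assms)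

lemma continuous_on_oct_re [continuous_intros]:
  assumes "continuous_on A f" shows "continuous_on A (\<lambda>x. oct_re (f x))"
  unfolding oct_re_def by (intro continuous_intros assms)

section \<open>Rotations of two indices\<close>

text \<open>Cosine and sine are separate arguments because the rotations that prove transitivity
  come as square roots, not as angles. The entries lie in any real vector space, so rows, columns
  and products of entries are all covered.\<close>

definition vrot :: "nat \<Rightarrow> nat \<Rightarrow> real \<Rightarrow> real \<Rightarrow> (nat \<Rightarrow> 'v::real_vector) \<Rightarrow> nat \<Rightarrow> 'v" where
  "vrot i j c s v k = (if k = i then c *\<^sub>R v i - s *\<^sub>R v j else if k = j then s *\<^sub>R v i + c *\<^sub>R v j else v k)"

lemma vrot_linear: "linear h \<Longrightarrow> h (vrot i j c s v k) = vrot i j c s (\<lambda>k. h (v k)) k"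
  by (simp add: vrot_def linear_add linear_diff linear_cmul)

lemma vrot_sum: "(\<Sum>m\<in>A. vrot i j c s (v m) k) = vrot i j c s (\<lambda>k. \<Sum>m\<in>A. v m k) k"
  by (simp add: vrot_def sum.distrib sum_subtractf scaleR_sum_right)

lemma vrot_cong: "v i = w i \<Longrightarrow> v j = w j \<Longrightarrow> v k = w k \<Longrightarrow> vrot i j c s v k = vrot i j c s w k"
  by (simp add: vrot_def)

lemma vrot_commute:
  "vrot i j c s (\<lambda>k. vrot i j c s (A k) l) k = vrot i j c s (\<lambda>l. vrot i j c s (\<lambda>k. A k l) k) l"
  by (simp add: vrot_def algebra_simps)

lemma vrot_trace:
  fixes X :: "nat \<Rightarrow> nat \<Rightarrow> 'v::real_vector"
  assumes ij: "i \<noteq> j" "i < N" "j < N" and cs: "c\<^sup>2 + s\<^sup>2 = 1"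
  shows "(\<Sum>k<N. vrot i j c s (\<lambda>k'. vrot i j c s (X k') k) k) = (\<Sum>k<N. X k k)"
proof -
  have split: "(\<Sum>k<N. f k) = f i + f j + (\<Sum>k\<in>{..<N} - {i} - {j}. f k)" for f :: "nat \<Rightarrow> 'v"
    using ij by (subst sum.remove[of _ i], simp, simp, subst sum.remove[of _ j]) (auto simp: add.assoc)
  let ?f = "\<lambda>k. vrot i j c s (\<lambda>k'. vrot i j c s (X k') k) k"
  have "?f i + ?f j = (c\<^sup>2 + s\<^sup>2) *\<^sub>R (X i i + X j j)"
    using ij by (simp add: vrot_def power2_eq_square algebra_simps)
  also have "\<dots> = X i i + X j j" by (simp add: cs)
  finally have "?f i + ?f j = X i i + X j j" .
  moreover have "(\<Sum>k\<in>{..<N} - {i} - {j}. ?f k) = (\<Sum>k\<in>{..<N} - {i} - {j}. X k k)"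
    by (intro sum.cong) (auto simp: vrot_def)
  ultimately show ?thesis unfolding split[of ?f] split[of "\<lambda>k. X k k"] by simp
qed

text \<open>Such a sum is the trace of the matrix f (v k) (w l), and conjugation by a rotation keeps
  traces. Octonion products and inner products are the two cases.\<close>

lemma vrot_bilinear_sum:
  assumes f: "bilinear f" and ij: "i \<noteq> j" "i < N" "j < N" and cs: "c\<^sup>2 + s\<^sup>2 = 1"
  shows "(\<Sum>k<N. f (vrot i j c s v k) (vrot i j c s w k)) = (\<Sum>k<N. f (v k) (w k))"
proof -
  have l: "linear (\<lambda>x. f x y)" "linear (f x)" for x y using f by (auto simp: bilinear_def)
  have "f (vrot i j c s v k) (vrot i j c s w k) = vrot i j c s (\<lambda>k'. vrot i j c s (\<lambda>k''. f (v k') (w k'')) k) k" for k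
    unfolding vrot_linear[OF l(1)] unfolding vrot_linear[OF l(2)] ..
  then show ?thesis by (simp add: vrot_trace[OF ij cs])
qed

lemma vrot_inverse:
  assumes "i \<noteq> j" "c\<^sup>2 + s\<^sup>2 = 1"
  shows "vrot i j c (- s) (vrot i j c s v) k = v k"
proof -
  have "c * c + s * s = 1" using assms(2) by (simp add: power2_eq_square)
  then have 1: "(c * c) *\<^sub>R x + (s * s) *\<^sub>R x = x" for x :: 'a by (simp flip: scaleR_left_distrib)
  show ?thesis using assms(1) 1[of "v i"] 1[of "v j"] by (auto simp: vrot_def algebra_simps)
qed

lemma vrot_subspace: "subspace F \<Longrightarrow> (\<And>k. v k \<in> F) \<Longrightarrow> vrot i j c s v k \<in> F"
  by (simp add: vrot_def subspace_add subspace_diff subspace_scale)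

definition rotr :: "nat \<Rightarrow> nat \<Rightarrow> real \<Rightarrow> real \<Rightarrow> oct_mat \<Rightarrow> oct_mat" where
  "rotr i j c s A = (\<lambda>k l. vrot i j c s (\<lambda>k. A k l) k)"

definition rotc :: "nat \<Rightarrow> nat \<Rightarrow> real \<Rightarrow> real \<Rightarrow> oct_mat \<Rightarrow> oct_mat" where
  "rotc i j c s A = (\<lambda>k l. vrot i j c s (A k) l)"

text \<open>Conjugation by a real rotation. Real scalars commute and associate with octonions, so
  this is legitimate over all coefficient algebras.\<close>

definition rot :: "nat \<Rightarrow> nat \<Rightarrow> real \<Rightarrow> real \<Rightarrow> oct_mat \<Rightarrow> oct_mat" where
  "rot i j c s A = rotr i j c s (rotc i j c s A)"

lemma rot_row: "rot i j c s A k l = vrot i j c s (\<lambda>k. rotc i j c s A k l) k"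
  by (simp add: rot_def rotr_def)

lemma rot_col: "rot i j c s A k l = vrot i j c s (rotr i j c s A k) l"
  unfolding rot_def rotr_def rotc_def by (rule vrot_commute)

lemma rotr_inverse: "i \<noteq> j \<Longrightarrow> c\<^sup>2 + s\<^sup>2 = 1 \<Longrightarrow> rotr i j c (- s) (rotr i j c s A) = A"
  by (simp add: rotr_def vrot_inverse[unfolded fun_eq_iff] fun_eq_iff)

lemma rot_inverse:
  assumes "i \<noteq> j" "c\<^sup>2 + s\<^sup>2 = 1"
  shows "rot i j c (- s) (rot i j c s A) = A"
proof -
  have r: "rotc i j c (- s) (rotr i j c t B) = rotr i j c t (rotc i j c (- s) B)" for B t
    by (simp add: rotc_def rotr_def fun_eq_iff vrot_def algebra_simps)
  have "rotc i j c (- s) (rotc i j c s B) = B" for B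
    by (simp add: rotc_def fun_eq_iff vrot_inverse[OF assms])
  then show ?thesis unfolding rot_def r by (simp add: rotr_inverse[OF assms])
qed

lemma continuous_on_rot_entry:
  "continuous_on UNIV (\<lambda>A::oct_mat. A k l)"
proof -
  have "continuous_on UNIV (\<lambda>A::oct_mat. A k)" by (rule continuous_on_product_coordinates)
  from continuous_on_product_then_coordinatewise[OF this] show ?thesis .
qed

lemma continuous_on_vrot [continuous_intros]:
  fixes f :: "'a::topological_space \<Rightarrow> nat \<Rightarrow> oct"
  assumes "\<And>k. continuous_on A (\<lambda>x. f x k)"
  shows "continuous_on A (\<lambda>x. vrot i j c s (f x) k)"
  unfolding vrot_def by (cases "k = i"; cases "k = j") (auto intro!: continuous_intros assms)

section \<open>Isometries and the invariant measure\<close>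

text \<open>Continuity is asked of the entries on the whole matrix type, so that Borel measurability
  follows from the product topology.\<close>

definition good_map :: "rank_one_space \<Rightarrow> (oct_mat \<Rightarrow> oct_mat) \<Rightarrow> bool" where
  "good_map S g \<longleftrightarrow> g \<in> isometries S \<and> (\<forall>k l. continuous_on UNIV (\<lambda>A. g A k l))"

lemma good_mapI:
  assumes "\<And>x. x \<in> points S \<Longrightarrow> g x \<in> points S" "\<And>x. x \<in> points S \<Longrightarrow> h x \<in> points S"
    "\<And>x. x \<in> points S \<Longrightarrow> h (g x) = x" "\<And>x. x \<in> points S \<Longrightarrow> g (h x) = x"
    "\<And>x y. x \<in> points S \<Longrightarrow> y \<in> points S \<Longrightarrow> mat_inner (mat_size S) (g x) (g y) = mat_inner (mat_size S) x y"
    "\<And>k l. continuous_on UNIV (\<lambda>A. g A k l)"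
  shows "good_map S g"
proof -
  have "bij_betw g (points S) (points S)"
    using assms(1-4) by (intro bij_betw_byWitness[where f' = h]) auto
  moreover have "geo_dist S (g x) (g y) = geo_dist S x y" if "x \<in> points S" "y \<in> points S" for x y
    unfolding geo_dist_def by (simp only: assms(5)[OF that])
  ultimately show ?thesis using assms(6) by (simp add: good_map_def isometries_def)
qed

lemma good_map_points: "good_map S g \<Longrightarrow> x \<in> points S \<Longrightarrow> g x \<in> points S"
  by (auto simp: good_map_def isometries_def bij_betw_def)

lemma good_map_continuous: "good_map S g \<Longrightarrow> continuous_on UNIV g"
  unfolding good_map_def by (intro continuous_on_coordinatewise_then_product) auto

lemma good_map_comp:
  assumes f: "good_map S f" and g: "good_map S g"
  shows "good_map S (\<lambda>x. f (g x))"
proof -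
  have "bij_betw (\<lambda>x. f (g x)) (points S) (points S)"
    using bij_betw_trans[of g _ _ f] f g by (auto simp: good_map_def isometries_def comp_def)
  moreover have "continuous_on UNIV (\<lambda>A. f (g A) k l)" for k l
    using f by (intro continuous_on_compose2[OF _ good_map_continuous[OF g], of UNIV "\<lambda>A. f A k l"]) (auto simp: good_map_def)
  moreover have "\<forall>x\<in>points S. \<forall>y\<in>points S. geo_dist S (f (g x)) (f (g y)) = geo_dist S x y"
    using f good_map_points[OF g] g by (simp add: good_map_def isometries_def)
  ultimately show ?thesis by (simp add: good_map_def isometries_def)
qed

lemma good_map_id: "good_map S (\<lambda>x. x)"
  by (rule good_mapI[of _ _ "\<lambda>x. x"]) (auto intro: continuous_on_rot_entry)

locale invariant_measure = prob_space M for M :: "oct_mat measure" +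
  fixes S :: rank_one_space
  assumes normalized: "normalized_riemannian_measure S M"
begin

lemma sets_M: "sets M = sets (restrict_space borel (points S))"
  using normalized by (simp add: normalized_riemannian_measure_def)

lemma space_M: "space M = points S"
  using sets_eq_imp_space_eq[OF sets_M] by (simp add: space_restrict_space)

lemma measurable_M: "continuous_on UNIV f \<Longrightarrow> f \<in> borel_measurable M"
  using measurable_restrict_space1[OF borel_measurable_continuous_onI, of f "points S"]
    measurable_cong_sets[OF sets_M refl] by blast

lemma entry_measurable [measurable]: "(\<lambda>A. A k l) \<in> borel_measurable M"
  by (intro measurable_M continuous_on_rot_entry)

lemma good_map_measurable: "good_map S g \<Longrightarrow> g \<in> measurable M M"
proof -
  assume g: "good_map S g"
  have "g \<in> measurable M (restrict_space borel (points S))"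
    by (intro measurable_restrict_space2 measurable_M good_map_continuous[OF g])
       (auto simp: space_M good_map_points[OF g])
  then show ?thesis using measurable_cong_sets[OF refl sets_M] by blast
qed

text \<open>Invariance is formulated for images of sets, the image measure uses preimages;
  bijectivity makes a set the image of its preimage.\<close>

lemma good_map_distr:
  assumes g: "good_map S g"
  shows "distr M M g = M"
proof (rule measure_eqI)
  fix A assume "A \<in> sets (distr M M g)"
  then have A: "A \<in> sets M" by simp
  have gm: "g \<in> measurable M M" by (rule good_map_measurable[OF g])
  have pre: "g -` A \<inter> space M \<in> sets M" by (rule measurable_sets[OF gm A])
  have bij: "bij_betw g (points S) (points S)" using g by (simp add: good_map_def isometries_def)
  have "A \<subseteq> points S" using sets.sets_into_space[OF A] by (simp add: space_M)
  have "g ` (g -` A \<inter> space M) = A"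
  proof (intro equalityI subsetI)
    fix x assume x: "x \<in> A"
    then have "x \<in> g ` points S" using \<open>A \<subseteq> points S\<close> bij by (auto simp: bij_betw_def)
    then show "x \<in> g ` (g -` A \<inter> space M)" using x unfolding space_M by blast
  qed auto
  moreover have "emeasure M (g ` (g -` A \<inter> space M)) = emeasure M (g -` A \<inter> space M)"
    using normalized g pre by (simp add: normalized_riemannian_measure_def good_map_def)
  ultimately show "emeasure (distr M M g) A = emeasure M A"
    by (simp add: emeasure_distr[OF gm A])
qed simp

lemma good_map_integral:
  fixes F :: "oct_mat \<Rightarrow> real"
  assumes g: "good_map S g" and F: "F \<in> borel_measurable M"
  shows "(\<integral>x. F (g x) \<partial>M) = (\<integral>x. F x \<partial>M)"
  using integral_distr[OF good_map_measurable[OF g] F] by (simp add: good_map_distr[OF g])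

lemma integrable_bdd:
  fixes F :: "oct_mat \<Rightarrow> real"
  assumes "F \<in> borel_measurable M" "\<And>x. x \<in> points S \<Longrightarrow> \<bar>F x\<bar> \<le> B"
  shows "integrable M F"
  using assms by (intro integrable_const_bound[where B = B] AE_I2) (auto simp: space_M)

text \<open>By invariance the integral of F (g s x) does not depend on s; differentiate at s = 0.
  Having the derivative along the whole flow as one bounded function \<open>DF\<close> lets the mean
  value theorem bound the difference quotients, so dominated convergence applies.\<close>

lemma flow_integral_zero:
  fixes F DF :: "oct_mat \<Rightarrow> real" and g :: "real \<Rightarrow> oct_mat \<Rightarrow> oct_mat"
  assumes g: "\<And>s. good_map S (g s)" and g0: "\<And>x. x \<in> points S \<Longrightarrow> g 0 x = x"
    and deriv: "\<And>x s. x \<in> points S \<Longrightarrow> ((\<lambda>s. F (g s x)) has_real_derivative DF (g s x)) (at s)"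
    and F: "F \<in> borel_measurable M" "\<And>x. x \<in> points S \<Longrightarrow> \<bar>F x\<bar> \<le> B"
    and DF: "DF \<in> borel_measurable M" "\<And>x. x \<in> points S \<Longrightarrow> \<bar>DF x\<bar> \<le> B'"
  shows "(\<integral>x. DF x \<partial>M) = 0"
proof -
  define e where "e k = 1 / real (Suc k)" for k
  have e: "e k > 0" for k by (simp add: e_def)
  have e0: "e \<longlonglongrightarrow> 0" unfolding e_def[abs_def] by (rule LIMSEQ_Suc[OF lim_1_over_n])
  have m: "(\<lambda>x. F (g s x)) \<in> borel_measurable M" for s
    using measurable_compose[OF good_map_measurable[OF g] F(1)] .
  have b: "\<bar>F (g s x)\<bar> \<le> B" if "x \<in> points S" for s x using F(2) good_map_points[OF g that] by blast
  have i: "integrable M (\<lambda>x. F (g s x))" for s by (rule integrable_bdd[OF m b])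
  have "(\<lambda>k. \<integral>x. (F (g (e k) x) - F (g 0 x)) / e k \<partial>M) \<longlonglongrightarrow> (\<integral>x. DF x \<partial>M)"
  proof (rule integral_dominated_convergence[where w = "\<lambda>_. B'"])
    show "AE x in M. (\<lambda>k. (F (g (e k) x) - F (g 0 x)) / e k) \<longlonglongrightarrow> DF x"
    proof (intro AE_I2)
      fix x assume "x \<in> space M"
      then have x: "x \<in> points S" by (simp add: space_M)
      have "(\<lambda>h. (F (g (0 + h) x) - F (g 0 x)) / h) \<midarrow>0\<rightarrow> DF (g 0 x)"
        using deriv[OF x, of 0] unfolding DERIV_def .
      moreover have "filterlim e (at 0) sequentially"
        using e0 e by (auto simp: filterlim_at less_imp_neq[symmetric])
      ultimately have "(\<lambda>k. (F (g (0 + e k) x) - F (g 0 x)) / e k) \<longlonglongrightarrow> DF (g 0 x)"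
        by (rule filterlim_compose)
      then show "(\<lambda>k. (F (g (e k) x) - F (g 0 x)) / e k) \<longlonglongrightarrow> DF x" by (simp add: g0[OF x])
    qed
    show "AE x in M. norm ((F (g (e k) x) - F (g 0 x)) / e k) \<le> B'" for k
    proof (intro AE_I2)
      fix x assume "x \<in> space M"
      then have x: "x \<in> points S" by (simp add: space_M)
      obtain z where "F (g (e k) x) - F (g 0 x) = (e k - 0) * DF (g z x)"
        using MVT2[of 0 "e k" "\<lambda>s. F (g s x)" "\<lambda>s. DF (g s x)"] e[of k] deriv[OF x] by blast
      then show "norm ((F (g (e k) x) - F (g 0 x)) / e k) \<le> B'"
        using e[of k] DF(2)[OF good_map_points[OF g x]] by simp
    qed
  qed (use m DF(1) in auto)
  moreover have "(\<integral>x. (F (g (e k) x) - F (g 0 x)) / e k \<partial>M) = 0" for k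
    using Bochner_Integration.integral_diff[OF i i, of "e k" 0] by (simp add: good_map_integral[OF g F(1)] e[THEN less_imp_neq, symmetric])
  ultimately have "(\<lambda>k::nat. 0) \<longlonglongrightarrow> (\<integral>x. DF x \<partial>M)" by (simp only:)
  then show ?thesis by (simp add: LIMSEQ_const_iff)
qed

end

section \<open>Projective spaces\<close>

definition coeff_domain :: "oct set \<Rightarrow> bool" where
  "coeff_domain F \<longleftrightarrow> subspace F \<and> oct_one \<in> F \<and> (\<forall>x\<in>F. \<forall>y\<in>F. oct_mult x y \<in> F) \<and> (\<forall>x\<in>F. oct_cnj x \<in> F)"

lemma proj_spaceD:
  assumes "A \<in> proj_space F N"
  shows "A k l \<in> F" "k \<ge> N \<or> l \<ge> N \<Longrightarrow> A k l = 0" "A l k = oct_cnj (A k l)"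
    "k < N \<Longrightarrow> l < N \<Longrightarrow> (\<Sum>m<N. oct_mult (A k m) (A m l)) = A k l" "(\<Sum>k<N. A k k) = oct_one"
  using assms unfolding proj_space_def by blast+

text \<open>In the product of two rotated matrices the rotations of the summed index cancel by
  \<open>vrot_bilinear_sum\<close>; the rotations of the outer indices come out by
  linearity.\<close>

lemma rot_proj_space:
  assumes F: "subspace F" and A: "A \<in> proj_space F N" and ij: "i \<noteq> j" "i < N" "j < N" and cs: "c\<^sup>2 + s\<^sup>2 = 1"
  shows "rot i j c s A \<in> proj_space F N"
proof -
  have AF: "A k l \<in> F" and A0: "k \<ge> N \<or> l \<ge> N \<Longrightarrow> A k l = 0" and Ah: "A l k = oct_cnj (A k l)"
    and Ai: "k < N \<Longrightarrow> l < N \<Longrightarrow> (\<Sum>m<N. oct_mult (A k m) (A m l)) = A k l" for k l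
    by (fact proj_spaceD[OF A])+
  have At: "(\<Sum>k<N. A k k) = oct_one" by (rule proj_spaceD(5)[OF A])
  show ?thesis
    unfolding proj_space_def
  proof (intro CollectI conjI allI impI)
    fix k l
    show "rot i j c s A k l \<in> F"
      unfolding rot_def rotr_def rotc_def by (intro vrot_subspace F AF)
    show "rot i j c s A l k = oct_cnj (rot i j c s A k l)"
      unfolding rot_def rotr_def rotc_def vrot_linear[OF linear_oct_cnj] Ah[symmetric] by (rule vrot_commute)
  next
    fix k l assume "k \<ge> N \<or> l \<ge> N"
    then show "rot i j c s A k l = 0"
      using ij A0 by (auto simp: rot_def rotr_def rotc_def vrot_def)
  next
    fix k l assume kl: "k < N" "l < N"
    have "(\<Sum>m<N. oct_mult (rot i j c s A k m) (rot i j c s A m l))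
      = (\<Sum>m<N. oct_mult (vrot i j c s (rotr i j c s A k) m) (vrot i j c s (\<lambda>m. rotc i j c s A m l) m))"
      by (simp add: rot_col[of _ _ _ _ _ k] rot_row[of _ _ _ _ _ _ l])
    also have "\<dots> = (\<Sum>m<N. oct_mult (rotr i j c s A k m) (rotc i j c s A m l))"
      by (rule vrot_bilinear_sum[OF bilinear_oct_mult ij cs])
    also have "\<dots> = (\<Sum>m<N. vrot i j c s (\<lambda>k. vrot i j c s (\<lambda>l. oct_mult (A k m) (A m l)) l) k)"
      unfolding rotr_def rotc_def vrot_linear[OF linear_oct_mult_left] unfolding vrot_linear[OF linear_oct_mult_right] ..
    also have "\<dots> = vrot i j c s (\<lambda>k. vrot i j c s (\<lambda>l. \<Sum>m<N. oct_mult (A k m) (A m l)) l) k"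
      unfolding vrot_sum ..
    also have "\<dots> = vrot i j c s (\<lambda>k. vrot i j c s (\<lambda>l. A k l) l) k"
      by (intro vrot_cong) (use kl ij Ai in auto)
    finally show "(\<Sum>m<N. oct_mult (rot i j c s A k m) (rot i j c s A m l)) = rot i j c s A k l"
      by (simp add: rot_def rotr_def rotc_def)
  next
    have "(\<Sum>k<N. rot i j c s A k k) = (\<Sum>k<N. A k k)"
      unfolding rot_def rotr_def rotc_def by (rule vrot_trace[OF ij cs])
    then show "(\<Sum>k<N. rot i j c s A k k) = oct_one" using At by simp
  qed
qed

lemma rot_mat_inner:
  assumes ij: "i \<noteq> j" "i < N" "j < N" and cs: "c\<^sup>2 + s\<^sup>2 = 1"
  shows "mat_inner N (rot i j c s A) (rot i j c s B) = mat_inner N A B"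
proof -
  have bil: "bilinear ((\<bullet>) :: oct \<Rightarrow> oct \<Rightarrow> real)"
    unfolding bilinear_def
    by (intro conjI allI linearI) (simp_all only: inner_add_left inner_add_right inner_scaleR_left inner_scaleR_right real_scaleR_def)
  have "mat_inner N (rot i j c s A) (rot i j c s B) = (\<Sum>k<N. \<Sum>l<N. rotr i j c s A k l \<bullet> rotr i j c s B k l)"
    unfolding mat_inner_def rot_col by (intro sum.cong refl vrot_bilinear_sum[OF bil ij cs])
  also have "\<dots> = (\<Sum>l<N. \<Sum>k<N. rotr i j c s A k l \<bullet> rotr i j c s B k l)" by (rule sum.swap)
  also have "\<dots> = (\<Sum>l<N. \<Sum>k<N. A k l \<bullet> B k l)"
    unfolding rotr_def by (intro sum.cong refl vrot_bilinear_sum[OF bil ij cs])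
  also have "\<dots> = mat_inner N A B" unfolding mat_inner_def by (rule sum.swap)
  finally show ?thesis .
qed

lemma good_map_rot_proj:
  assumes S: "points S = proj_space F N" "mat_size S = N" and F: "subspace F"
    and ij: "i \<noteq> j" "i < N" "j < N" "c\<^sup>2 + s\<^sup>2 = 1"
  shows "good_map S (rot i j c s)"
proof (rule good_mapI[of _ _ "rot i j c (- s)"])
  have cs: "c\<^sup>2 + (- s)\<^sup>2 = 1" using ij(4) by simp
  show "rot i j c (- s) (rot i j c s x) = x" "rot i j c s (rot i j c (- s) x) = x" for x
    using rot_inverse[OF ij(1,4)] rot_inverse[OF ij(1) cs] by simp_all
  show "rot i j c s x \<in> points S" "rot i j c (- s) x \<in> points S" if "x \<in> points S" for x
    using rot_proj_space[OF F _ ij] rot_proj_space[OF F _ ij(1-3) cs] that by (auto simp: S)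
  show "continuous_on UNIV (\<lambda>A. rot i j c s A k l)" for k l
    unfolding rot_def rotr_def rotc_def by (intro continuous_intros continuous_on_rot_entry)
qed (simp add: S(2) rot_mat_inner[OF ij])

text \<open>\<open>unit_map\<close> isolates what is proved differently for associative coefficients
  and for octonions: a unit may be multiplied to the entry (0, j) by an isometry that keeps the
  diagonal. \<open>Bs\<close> plays the part of an orthonormal basis of F, and m that of the real
  dimension of F.\<close>

locale proj_model =
  fixes S :: rank_one_space and F :: "oct set" and N m :: nat and Bs :: "oct set"
  assumes points: "points S = proj_space F N" and size: "mat_size S = N" and N2: "N \<ge> 2"
    and geo: "geo_dist S x y = arccos (2 * mat_inner N x y - 1)"
    and F: "coeff_domain F"
    and unit_map: "a \<in> F \<Longrightarrow> norm a = 1 \<Longrightarrow> 1 \<le> j \<Longrightarrow> j < N \<Longrightarrow>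
      \<exists>g. good_map S g \<and> (\<forall>A\<in>points S. (\<forall>k. g A k k = A k k) \<and> g A 0 j = oct_mult a (A 0 j))"
    and Bs: "Bs \<subseteq> F" "finite Bs" "card Bs = m" "m > 0" "\<And>e. e \<in> Bs \<Longrightarrow> norm e = 1"
      "\<And>x. x \<in> F \<Longrightarrow> (norm x)\<^sup>2 = (\<Sum>e\<in>Bs. (e \<bullet> x)\<^sup>2)"
begin

lemma subspace_F: "subspace F" and F_one: "oct_one \<in> F" and F_mult: "x \<in> F \<Longrightarrow> y \<in> F \<Longrightarrow> oct_mult x y \<in> F"
  and F_cnj: "x \<in> F \<Longrightarrow> oct_cnj x \<in> F"
  using F by (auto simp: coeff_domain_def)

lemma good_map_rot:
  assumes "i \<noteq> j" "i < N" "j < N" "c\<^sup>2 + s\<^sup>2 = 1"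
  shows "good_map S (rot i j c s)"
  by (rule good_map_rot_proj[OF points size subspace_F assms])

abbreviation "rr A k \<equiv> oct_re (A k k)"

section \<open>The entries of a point of a projective space\<close>

context
  fixes A :: oct_mat assumes A: "A \<in> points S"
begin

lemma entry_F: "A k l \<in> F" and entry_zero: "k \<ge> N \<or> l \<ge> N \<Longrightarrow> A k l = 0" and entry_herm: "A l k = oct_cnj (A k l)"
  and entry_idem: "k < N \<Longrightarrow> l < N \<Longrightarrow> (\<Sum>m<N. oct_mult (A k m) (A m l)) = A k l"
  and entry_trace: "(\<Sum>k<N. A k k) = oct_one"
  using proj_spaceD[OF A[unfolded points]] by blast+

lemma diag_real: "A k k = rr A k *\<^sub>R oct_one"
  by (rule oct_self_adjoint) (rule entry_herm[symmetric])

text \<open>Idempotency on the diagonal, with column k being the conjugate of row k.\<close>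

lemma row_norm: "k < N \<Longrightarrow> (\<Sum>l<N. (norm (A k l))\<^sup>2) = rr A k"
proof -
  assume k: "k < N"
  have "A k k = (\<Sum>l<N. oct_mult (A k l) (oct_cnj (A k l)))"
    unfolding entry_idem[OF k k, symmetric]
    by (intro sum.cong refl arg_cong2[where f = oct_mult]) (rule entry_herm)
  also have "\<dots> = (\<Sum>l<N. (norm (A k l))\<^sup>2) *\<^sub>R oct_one" by (simp add: oct_mult_cnj scaleR_left.sum)
  finally show ?thesis by (simp add: linear_cmul[OF linear_oct_re])
qed

lemma trace_one: "(\<Sum>k<N. rr A k) = 1"
  using entry_trace linear_sum[OF linear_oct_re, of "\<lambda>k. A k k" "{..<N}"] by simp

lemma rr_nonneg: "rr A k \<ge> 0"
proof (cases "k < N")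
  case True
  have "0 \<le> (\<Sum>l<N. (norm (A k l))\<^sup>2)" by (intro sum_nonneg) auto
  then show ?thesis using row_norm[OF True] by simp
qed (simp add: entry_zero linear_0[OF linear_oct_re])

lemma rr_le_1: "rr A k \<le> 1"
proof (cases "k < N")
  case True
  have "rr A k \<le> (\<Sum>k<N. rr A k)" using True rr_nonneg by (intro member_le_sum) auto
  then show ?thesis by (simp add: trace_one)
qed (simp add: entry_zero linear_0[OF linear_oct_re])

text \<open>Cauchy-Schwarz gives \<open>\<le>\<close>, and both sides sum to \<open>1\<close>.\<close>

lemma entry_norm:
  assumes kl: "k < N" "l < N"
  shows "(norm (A k l))\<^sup>2 = rr A k * rr A l"
proof -
  have le: "(norm (A k l))\<^sup>2 \<le> rr A k * rr A l" if kl: "k < N" "l < N" for k l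
  proof -
    have "norm (A k l) = norm (\<Sum>m<N. oct_mult (A k m) (A m l))" using entry_idem[OF kl] by simp
    also have "\<dots> \<le> (\<Sum>m<N. norm (oct_mult (A k m) (A m l)))" by (rule norm_sum)
    also have "\<dots> = (\<Sum>m<N. norm (A k m) * norm (A l m))"
    proof (intro sum.cong refl)
      fix m
      have "norm (A m l) = norm (A l m)" using entry_herm[where k = m and l = l] by simp
      then show "norm (oct_mult (A k m) (A m l)) = norm (A k m) * norm (A l m)" by (simp add: norm_oct_mult)
    qed
    finally have "(norm (A k l))\<^sup>2 \<le> (\<Sum>m<N. norm (A k m) * norm (A l m))\<^sup>2" by (intro power_mono) auto
    also have "\<dots> \<le> (\<Sum>m<N. (norm (A k m))\<^sup>2) * (\<Sum>m<N. (norm (A l m))\<^sup>2)" by (rule Cauchy_Schwarz_ineq_sum)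
    finally show ?thesis by (simp add: row_norm kl)
  qed
  let ?I = "{..<N} \<times> {..<N}"
  have "(\<Sum>(k, l)\<in>?I. (norm (A k l))\<^sup>2) = (\<Sum>(k, l)\<in>?I. rr A k * rr A l)"
    by (simp add: sum.cartesian_product[symmetric] row_norm trace_one sum_distrib_left[symmetric])
  from sum_mono_inv[OF this, of "(k, l)"] show ?thesis using le kl by auto
qed

lemma rot_entries:
  assumes "0 \<noteq> j"
  shows "rr (rot 0 j c s A) 0 = c\<^sup>2 * rr A 0 - 2 * c * s * oct_re (A 0 j) + s\<^sup>2 * rr A j"
    "rr (rot 0 j c s A) j = s\<^sup>2 * rr A 0 + 2 * c * s * oct_re (A 0 j) + c\<^sup>2 * rr A j"
    "oct_re (rot 0 j c s A 0 j) = c * s * rr A 0 + (c\<^sup>2 - s\<^sup>2) * oct_re (A 0 j) - c * s * rr A j"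
    "k \<noteq> 0 \<Longrightarrow> k \<noteq> j \<Longrightarrow> rot 0 j c s A k k = A k k"
proof -
  note lin = linear_add[OF linear_oct_re] linear_diff[OF linear_oct_re] linear_cmul[OF linear_oct_re]
  have h: "oct_re (A j 0) = oct_re (A 0 j)"
    using arg_cong[OF entry_herm[where l = j and k = 0], of oct_re] by simp
  have "rot 0 j c s A 0 0 = c *\<^sub>R (c *\<^sub>R A 0 0 - s *\<^sub>R A 0 j) - s *\<^sub>R (c *\<^sub>R A j 0 - s *\<^sub>R A j j)"
    using assms by (auto simp: rot_def rotr_def rotc_def vrot_def)
  then show "rr (rot 0 j c s A) 0 = c\<^sup>2 * rr A 0 - 2 * c * s * oct_re (A 0 j) + s\<^sup>2 * rr A j"
    by (simp only: lin h real_scaleR_def) (simp add: power2_eq_square algebra_simps)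
  have "rot 0 j c s A j j = s *\<^sub>R (s *\<^sub>R A 0 0 + c *\<^sub>R A 0 j) + c *\<^sub>R (s *\<^sub>R A j 0 + c *\<^sub>R A j j)"
    using assms by (auto simp: rot_def rotr_def rotc_def vrot_def)
  then show "rr (rot 0 j c s A) j = s\<^sup>2 * rr A 0 + 2 * c * s * oct_re (A 0 j) + c\<^sup>2 * rr A j"
    by (simp only: lin h real_scaleR_def) (simp add: power2_eq_square algebra_simps)
  have "rot 0 j c s A 0 j = c *\<^sub>R (s *\<^sub>R A 0 0 + c *\<^sub>R A 0 j) - s *\<^sub>R (s *\<^sub>R A j 0 + c *\<^sub>R A j j)"
    using assms by (auto simp: rot_def rotr_def rotc_def vrot_def)
  then show "oct_re (rot 0 j c s A 0 j) = c * s * rr A 0 + (c\<^sup>2 - s\<^sup>2) * oct_re (A 0 j) - c * s * rr A j"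
    by (simp only: lin h real_scaleR_def) (simp add: power2_eq_square algebra_simps)
  show "rot 0 j c s A k k = A k k" if "k \<noteq> 0" "k \<noteq> j"
    using that by (auto simp: rot_def rotr_def rotc_def vrot_def)
qed

end

definition E00 :: oct_mat where "E00 = (\<lambda>k l. if k = 0 \<and> l = 0 then oct_one else 0)"

text \<open>A unit makes the entry (0, j) real and nonnegative. The indices 0 and j then span a real
  block of rank one, and a rotation moves its whole trace to index 0.\<close>

lemma annihilate_entry:
  assumes A: "A \<in> points S" and j: "1 \<le> j" "j < N" and nz: "rr A j \<noteq> 0"
  obtains g where "good_map S g" "rr (g A) j = 0" "\<And>k. 1 \<le> k \<Longrightarrow> k \<noteq> j \<Longrightarrow> rr (g A) k = rr A k"
proof -
  \<comment> \<open>The unit that makes the entry equal to its norm; a zero entry already is, and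
    \<open>oct_one\<close> serves as a default.\<close>
  define a where "a = (if A 0 j = 0 then oct_one else (1 / norm (A 0 j)) *\<^sub>R oct_cnj (A 0 j))"
  have aF: "a \<in> F" using F_one subspace_scale[OF subspace_F F_cnj[OF entry_F[OF A]]] by (simp add: a_def)
  have an: "norm a = 1" by (simp add: a_def)
  have aA: "oct_mult a (A 0 j) = norm (A 0 j) *\<^sub>R oct_one"
    by (simp add: a_def oct_mult_cnj_left power2_eq_square)
  obtain g1 where g1: "good_map S g1" "\<And>A k. A \<in> points S \<Longrightarrow> g1 A k k = A k k" "\<And>A. A \<in> points S \<Longrightarrow> g1 A 0 j = oct_mult a (A 0 j)"
    using unit_map[OF aF an j] by blast
  define B where "B = g1 A"
  have B: "B \<in> points S" using good_map_points[OF g1(1) A] by (simp add: B_def)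
  have Bd: "rr B k = rr A k" for k using g1(2)[OF A] by (simp add: B_def)
  define \<alpha> \<beta> q where "\<alpha> = rr A 0" and "\<beta> = rr A j" and "q = norm (A 0 j)"
  have Bq: "oct_re (B 0 j) = q" using g1(3)[OF A] aA by (simp add: B_def q_def linear_cmul[OF linear_oct_re])
  have ab: "\<alpha> \<ge> 0" "\<beta> > 0" using rr_nonneg[OF A] nz by (auto simp: \<alpha>_def \<beta>_def less_le)
  have q: "q\<^sup>2 = \<alpha> * \<beta>" using entry_norm[OF A, of 0 j] j by (simp add: q_def \<alpha>_def \<beta>_def)
  then have q': "q = sqrt \<alpha> * sqrt \<beta>"
    using real_sqrt_unique[OF q] by (simp add: q_def real_sqrt_mult)
  define T where "T = sqrt (\<alpha> + \<beta>)"
  have T: "T > 0" "T\<^sup>2 = \<alpha> + \<beta>" using ab by (auto simp: T_def)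
  \<comment> \<open>The block is the projection onto (sqrt \<alpha>, sqrt \<beta>) times \<alpha> +
    \<beta>; this rotation carries that vector to the first axis.\<close>
  define c s where "c = sqrt \<alpha> / T" and "s = - sqrt \<beta> / T"
  have cs: "c\<^sup>2 + s\<^sup>2 = 1" using ab T by (simp add: c_def s_def power_divide add_divide_distrib[symmetric])
  let ?g = "\<lambda>x. rot 0 j c s (g1 x)"
  show ?thesis
  proof (rule that[of ?g])
    show "good_map S ?g" using j cs by (intro good_map_comp[where f = "rot 0 j c s" and g = g1] good_map_rot g1(1)) auto
    have "rr (?g A) j = s\<^sup>2 * \<alpha> + 2 * c * s * q + c\<^sup>2 * \<beta>"
      using rot_entries(2)[OF B, where j = j and c = c and s = s] j Bd Bq by (simp add: B_def \<alpha>_def \<beta>_def)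
    also have "\<dots> = 0"
    proof -
      have "s\<^sup>2 = \<beta> / T\<^sup>2" "c\<^sup>2 = \<alpha> / T\<^sup>2" using ab by (simp_all add: c_def s_def power_divide)
      moreover have "2 * c * s * q = - (2 * (\<alpha> * \<beta>) / T\<^sup>2)"
        using ab by (simp add: c_def s_def q' power2_eq_square) (simp add: field_simps)
      ultimately show ?thesis by (simp add: field_simps)
    qed
    finally show "rr (?g A) j = 0" .
    show "rr (?g A) k = rr A k" if "1 \<le> k" "k \<noteq> j" for k
      using rot_entries(4)[OF B, where j = j and k = k and c = c and s = s] j that Bd[of k] by (simp add: B_def)
  qed
qed

text \<open>Induction on the number of nonzero diagonal entries off index 0. When none is left, the
  trace puts 1 at (0, 0) and \<open>entry_norm\<close> kills all other entries.\<close>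

lemma transitive:
  assumes "A \<in> points S"
  shows "\<exists>g. good_map S g \<and> g A = E00"
  using assms
proof (induction "card {j\<in>{1..<N}. rr A j \<noteq> 0}" arbitrary: A rule: less_induct)
  case less
  show ?case
  proof (cases "\<exists>j\<in>{1..<N}. rr A j \<noteq> 0")
    case True
    then obtain j where j: "1 \<le> j" "j < N" "rr A j \<noteq> 0" by auto
    obtain g where g: "good_map S g" "rr (g A) j = 0" "\<And>k. 1 \<le> k \<Longrightarrow> k \<noteq> j \<Longrightarrow> rr (g A) k = rr A k"
      using annihilate_entry[OF less.prems j] by blast
    have "{k\<in>{1..<N}. rr (g A) k \<noteq> 0} \<subset> {k\<in>{1..<N}. rr A k \<noteq> 0}"
    proof (intro psubsetI subsetI)
      fix k assume "k \<in> {k\<in>{1..<N}. rr (g A) k \<noteq> 0}"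
      then show "k \<in> {k\<in>{1..<N}. rr A k \<noteq> 0}" using g(2) g(3)[of k] by (cases "k = j") auto
    qed (use j g(2) in auto)
    then have "card {k\<in>{1..<N}. rr (g A) k \<noteq> 0} < card {k\<in>{1..<N}. rr A k \<noteq> 0}"
      by (intro psubset_card_mono) auto
    then obtain h where "good_map S h" "h (g A) = E00"
      using less.hyps[of "g A"] good_map_points[OF g(1) less.prems] by blast
    then show ?thesis using good_map_comp[of S h g] g(1) by blast
  next
    case False
    then have z: "rr A k = 0" if "k \<noteq> 0" for k
      using that entry_zero[OF less.prems, of k k] by (cases "k < N") (auto simp: linear_0[OF linear_oct_re])
    have "(\<Sum>k<N. rr A k) = rr A 0 + (\<Sum>k\<in>{..<N} - {0}. rr A k)"
      using N2 by (intro sum.remove) auto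
    also have "(\<Sum>k\<in>{..<N} - {0}. rr A k) = 0" using z by (intro sum.neutral) auto
    finally have r0: "rr A 0 = 1" using trace_one[OF less.prems] by simp
    have "A k l = E00 k l" for k l
    proof (cases "k < N \<and> l < N")
      case True
      then have "(norm (A k l))\<^sup>2 = rr A k * rr A l" using entry_norm[OF less.prems] by blast
      then show ?thesis using z[of k] z[of l] diag_real[OF less.prems, of 0] r0 by (auto simp: E00_def)
    next
      case False
      then show ?thesis using entry_zero[OF less.prems, of k l] N2 by (auto simp: E00_def)
    qed
    then have "A = E00" by (simp add: fun_eq_iff)
    then show ?thesis using good_map_id by blast
  qed
qed

lemma mat_inner_E00: "mat_inner N E00 x = oct_re (x 0 0)"
proof -
  have "mat_inner N E00 x = (\<Sum>i<N. \<Sum>j<N. if j = 0 then (if i = 0 then oct_one \<bullet> x 0 0 else 0) else 0)"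
    unfolding mat_inner_def E00_def by (intro sum.cong refl) auto
  also have "\<dots> = oct_one \<bullet> x 0 0" using N2 by simp
  also have "\<dots> = oct_re (x 0 0)" using oct_re_cnj_mult[of oct_one "x 0 0"] by simp
  finally show ?thesis .
qed

lemma cos_geo_dist_E00: "x \<in> points S \<Longrightarrow> cos (geo_dist S E00 x) = 2 * rr x 0 - 1"
  using rr_nonneg[of x 0] rr_le_1[of x 0] by (simp add: geo mat_inner_E00 cos_arccos)

end

section \<open>Integration by parts on the projective spaces\<close>

locale proj_measure = proj_model S F N m Bs + invariant_measure M S for M S F N m Bs
begin

lemma rr_measurable [measurable]: "(\<lambda>A. oct_re (A k l)) \<in> borel_measurable M"
  by (intro measurable_M continuous_intros continuous_on_rot_entry)

lemma poly_rr_measurable [measurable]: "(\<lambda>A. poly q (rr A k)) \<in> borel_measurable M"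
  by (intro measurable_M continuous_intros continuous_on_rot_entry)

lemma poly_rr_bounded: "\<exists>B\<ge>0. \<forall>x\<in>points S. \<bar>poly q (rr x k)\<bar> \<le> B"
proof -
  have "bounded (poly q ` {0..1})" by (intro compact_imp_bounded compact_continuous_image continuous_intros) auto
  then obtain B where B: "\<forall>y\<in>poly q ` {0..1}. norm y \<le> B" unfolding bounded_iff by blast
  have "\<bar>poly q (rr x k)\<bar> \<le> max B 0" if "x \<in> points S" for x
    using B rr_nonneg[OF that, of k] rr_le_1[OF that, of k] by (auto simp: le_max_iff_disj)
  then show ?thesis by (intro exI[of _ "max B 0"]) auto
qed

lemma entry_norm_le_1: "x \<in> points S \<Longrightarrow> norm (x k l) \<le> 1"
proof (cases "k < N \<and> l < N")
  case True
  assume x: "x \<in> points S"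
  have "(norm (x k l))\<^sup>2 \<le> 1 * 1"
    using entry_norm[OF x, of k l] True rr_nonneg[OF x] rr_le_1[OF x] by (simp add: mult_le_one)
  then show ?thesis by (simp add: power_le_one_iff abs_square_le_1)
next
  case False
  assume "x \<in> points S"
  then show ?thesis using False entry_zero[of x k l] by auto
qed

lemma bounded_product:
  fixes f :: "oct_mat \<Rightarrow> real"
  assumes f: "\<And>x. x \<in> points S \<Longrightarrow> \<bar>f x\<bar> \<le> C"
  shows "\<exists>B. \<forall>x\<in>points S. \<bar>f x * poly q (rr x 0)\<bar> \<le> B"
proof -
  obtain B where B: "B \<ge> 0" "\<forall>x\<in>points S. \<bar>poly q (rr x 0)\<bar> \<le> B" using poly_rr_bounded by blast
  have "\<bar>f x * poly q (rr x 0)\<bar> \<le> C * B" if "x \<in> points S" for x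
    unfolding abs_mult using f[OF that] B that by (intro mult_mono) auto
  then show ?thesis by blast
qed

lemma integrable_product:
  fixes f :: "oct_mat \<Rightarrow> real"
  assumes "f \<in> borel_measurable M" "\<And>x. x \<in> points S \<Longrightarrow> \<bar>f x\<bar> \<le> C"
  shows "integrable M (\<lambda>x. f x * poly q (rr x 0))"
proof -
  obtain B where "\<forall>x\<in>points S. \<bar>f x * poly q (rr x 0)\<bar> \<le> B" using bounded_product[where f = f and q = q, OF assms(2)] by blast
  then show ?thesis using assms(1) by (intro integrable_bdd) auto
qed

lemma re_entry_le_1: "x \<in> points S \<Longrightarrow> \<bar>oct_re (x k l)\<bar> \<le> 1"
  using abs_oct_re_le[of "x k l"] entry_norm_le_1[of x k l] by linarith

text \<open>The flow identity for Re (x 0 j) q (r 0), with r k the diagonal entries: along the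
  rotation of 0 and j the derivative of r 0 is - 2 Re (x 0 j), and at the current point that of Re
  (x 0 j) is r 0 - r j.\<close>

lemma rotation_identity:
  assumes j: "1 \<le> j" "j < N"
  shows "(\<integral>x. (rr x 0 - rr x j) * poly q (rr x 0) \<partial>M) = 2 * (\<integral>x. (oct_re (x 0 j))\<^sup>2 * poly (pderiv q) (rr x 0) \<partial>M)"
proof -
  let ?F = "\<lambda>x. oct_re (x 0 j) * poly q (rr x 0)"
  let ?D = "\<lambda>x. (rr x 0 - rr x j) * poly q (rr x 0) - 2 * ((oct_re (x 0 j))\<^sup>2 * poly (pderiv q) (rr x 0))"
  have b1: "\<bar>rr x 0 - rr x j\<bar> \<le> 1" if "x \<in> points S" for x
    using rr_nonneg[OF that] rr_le_1[OF that] by (smt (verit))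
  have b2: "\<bar>(oct_re (x 0 j))\<^sup>2\<bar> \<le> 1" if "x \<in> points S" for x
    using re_entry_le_1[OF that, of 0 j] by (simp add: abs_square_le_1)
  have "\<exists>B. \<forall>x\<in>points S. \<bar>?F x\<bar> \<le> B" by (rule bounded_product[where C = 1], rule re_entry_le_1)
  then obtain B0 where B0: "\<forall>x\<in>points S. \<bar>?F x\<bar> \<le> B0" by blast
  have "\<exists>B. \<forall>x\<in>points S. \<bar>(rr x 0 - rr x j) * poly q (rr x 0)\<bar> \<le> B" by (rule bounded_product[where C = 1], rule b1)
  then obtain B1 where B1: "\<forall>x\<in>points S. \<bar>(rr x 0 - rr x j) * poly q (rr x 0)\<bar> \<le> B1" by blast
  have "\<exists>B. \<forall>x\<in>points S. \<bar>(oct_re (x 0 j))\<^sup>2 * poly (pderiv q) (rr x 0)\<bar> \<le> B" by (rule bounded_product[where C = 1], rule b2)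
  then obtain B2 where B2: "\<forall>x\<in>points S. \<bar>(oct_re (x 0 j))\<^sup>2 * poly (pderiv q) (rr x 0)\<bar> \<le> B2" by blast
  have m1: "(\<lambda>x. rr x 0 - rr x j) \<in> borel_measurable M" and m2: "(\<lambda>x. (oct_re (x 0 j))\<^sup>2) \<in> borel_measurable M"
    by measurable
  have "(\<integral>x. ?D x \<partial>M) = 0"
  proof (rule flow_integral_zero[where F = ?F and g = "\<lambda>s. rot 0 j (cos s) (sin s)"])
    show "good_map S (rot 0 j (cos s) (sin s))" for s using j by (intro good_map_rot) auto
    show "rot 0 j (cos 0) (sin 0) x = x" for x
      by (simp add: rot_def rotr_def rotc_def vrot_def fun_eq_iff)
    fix x s assume x: "x \<in> points S"
    let ?\<alpha> = "rr x 0" and ?\<beta> = "rr x j" and ?\<gamma> = "oct_re (x 0 j)"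
    note e = rot_entries[OF x, of j]
    have j0: "0 \<noteq> j" using j by simp
    note e = e[OF j0]
    have dg: "((\<lambda>s. cos s * sin s * ?\<alpha> + ((cos s)\<^sup>2 - (sin s)\<^sup>2) * ?\<gamma> - cos s * sin s * ?\<beta>) has_real_derivative
       (((cos s)\<^sup>2 - (sin s)\<^sup>2) * (?\<alpha> - ?\<beta>) - 4 * cos s * sin s * ?\<gamma>)) (at s)"
      by (auto intro!: derivative_eq_intros simp: power2_eq_square algebra_simps)
    have da: "((\<lambda>s. (cos s)\<^sup>2 * ?\<alpha> - 2 * cos s * sin s * ?\<gamma> + (sin s)\<^sup>2 * ?\<beta>) has_real_derivative
       (- 2 * (cos s * sin s * ?\<alpha> + ((cos s)\<^sup>2 - (sin s)\<^sup>2) * ?\<gamma> - cos s * sin s * ?\<beta>))) (at s)"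
      by (auto intro!: derivative_eq_intros simp: power2_eq_square algebra_simps)
    show "((\<lambda>s. ?F (rot 0 j (cos s) (sin s) x)) has_real_derivative ?D (rot 0 j (cos s) (sin s) x)) (at s)"
      unfolding e
      by (rule DERIV_cong[OF DERIV_mult[OF dg DERIV_chain2[where f = "poly q", OF poly_DERIV da]]])
         (simp add: power2_eq_square algebra_simps)
  qed (use B0 B1 B2 in \<open>measurable, auto intro!: order.trans[OF abs_triangle_ineq4, of _ _ "B1 + 2 * B2"] add_mono simp: abs_mult\<close>)
  moreover have i1: "integrable M (\<lambda>x. (rr x 0 - rr x j) * poly q (rr x 0))"
    by (rule integrable_product[OF m1], rule b1)
  moreover have i2: "integrable M (\<lambda>x. (oct_re (x 0 j))\<^sup>2 * poly (pderiv q) (rr x 0))"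
    by (rule integrable_product[OF m2], rule b2)
  ultimately show ?thesis
    using Bochner_Integration.integral_diff[OF i1 integrable_mult_right[OF i2, of 2]] by simp
qed

text \<open>A unit map carries the component along e into the real part and keeps the diagonal, so
  all m components have the same second moment against functions of the diagonal.\<close>

lemma component_identity:
  assumes j: "1 \<le> j" "j < N"
  shows "(\<integral>x. (norm (x 0 j))\<^sup>2 * poly q (rr x 0) \<partial>M) = real m * (\<integral>x. (oct_re (x 0 j))\<^sup>2 * poly q (rr x 0) \<partial>M)"
proof -
  let ?G = "\<lambda>x. (oct_re (x 0 j))\<^sup>2 * poly q (rr x 0)"
  have e: "(\<integral>x. (e \<bullet> x 0 j)\<^sup>2 * poly q (rr x 0) \<partial>M) = (\<integral>x. ?G x \<partial>M)" if e: "e \<in> Bs" for e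
  proof -
    have "oct_cnj e \<in> F" "norm (oct_cnj e) = 1"
      using F_cnj[OF subsetD[OF Bs(1) e]] Bs(5)[OF e] by (simp_all del: split_paired_All)
    then obtain g where g: "good_map S g" "\<And>A k. A \<in> points S \<Longrightarrow> g A k k = A k k" "\<And>A. A \<in> points S \<Longrightarrow> g A 0 j = oct_mult (oct_cnj e) (A 0 j)"
      using unit_map[OF _ _ j] by blast
    have "(\<integral>x. ?G x \<partial>M) = (\<integral>x. ?G (g x) \<partial>M)"
      by (rule good_map_integral[OF g(1), symmetric]) measurable
    also have "\<dots> = (\<integral>x. (e \<bullet> x 0 j)\<^sup>2 * poly q (rr x 0) \<partial>M)"
      by (intro Bochner_Integration.integral_cong refl) (simp add: space_M g oct_re_cnj_mult)
    finally show ?thesis ..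
  qed
  have em: "(\<lambda>x. (e \<bullet> x 0 j)\<^sup>2) \<in> borel_measurable M" for e :: oct
    by (intro measurable_M continuous_intros continuous_on_rot_entry)
  have eb: "\<bar>(e \<bullet> x 0 j)\<^sup>2\<bar> \<le> 1" if "x \<in> points S" "e \<in> Bs" for e x
    using Cauchy_Schwarz_ineq2[of e "x 0 j"] entry_norm_le_1[OF that(1), of 0 j] Bs(5)[OF that(2)] by (simp add: abs_square_le_1)
  have "(\<integral>x. (norm (x 0 j))\<^sup>2 * poly q (rr x 0) \<partial>M) = (\<integral>x. (\<Sum>e\<in>Bs. (e \<bullet> x 0 j)\<^sup>2 * poly q (rr x 0)) \<partial>M)"
    by (intro Bochner_Integration.integral_cong refl) (simp only: space_M Bs(6)[OF entry_F] sum_distrib_right)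
  also have "\<dots> = (\<Sum>e\<in>Bs. \<integral>x. (e \<bullet> x 0 j)\<^sup>2 * poly q (rr x 0) \<partial>M)"
  proof (rule Bochner_Integration.integral_sum)
    fix e assume e: "e \<in> Bs"
    show "integrable M (\<lambda>x. (e \<bullet> x 0 j)\<^sup>2 * poly q (rr x 0))"
      by (rule integrable_product[OF em], rule eb[OF _ e])
  qed
  also have "\<dots> = real m * (\<integral>x. ?G x \<partial>M)" by (simp add: e Bs(3))
  finally show ?thesis .
qed

text \<open>Sum of the rotation identities over j. With r k the diagonal entries, the terms r 0 - r
  j add up to N (r 0) - 1 since the trace is 1, and the squared norms of the entries (0, j) add up
  to r 0 (1 - r 0).\<close>

lemma pearson_E00:
  "(\<integral>x. rr x 0 * (1 - rr x 0) * poly (pderiv q) (rr x 0) \<partial>M) = real m / 2 * (\<integral>x. (real N * rr x 0 - 1) * poly q (rr x 0) \<partial>M)"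
proof -
  let ?J = "{1..<N}"
  have b1: "\<bar>rr x 0 - rr x j\<bar> \<le> 1" if "x \<in> points S" for x j
    using rr_nonneg[OF that] rr_le_1[OF that] by (smt (verit))
  have b3: "\<bar>(norm (x 0 j))\<^sup>2\<bar> \<le> 1" if "x \<in> points S" for x j
    using entry_norm_le_1[OF that, of 0 j] by (simp add: abs_square_le_1)
  have nm: "(\<lambda>x. (norm (x 0 j))\<^sup>2) \<in> borel_measurable M" for j by measurable
  have split: "(\<Sum>k<N. f k) = f 0 + (\<Sum>k\<in>?J. f k)" for f :: "nat \<Rightarrow> real"
    using N2 by (simp add: lessThan_atLeast0 sum.atLeast_Suc_lessThan)
  have s1: "(\<Sum>j\<in>?J. rr x 0 - rr x j) = real N * rr x 0 - 1" if "x \<in> points S" for x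
    using trace_one[OF that] split[of "\<lambda>k. rr x k"] N2 by (simp add: sum_subtractf of_nat_diff algebra_simps)
  have s2: "(\<Sum>j\<in>?J. (norm (x 0 j))\<^sup>2) = rr x 0 * (1 - rr x 0)" if "x \<in> points S" for x
    using row_norm[OF that, of 0] split[of "\<lambda>l. (norm (x 0 l))\<^sup>2"] entry_norm[OF that, of 0 0] N2
    by (simp add: algebra_simps power2_eq_square)
  have "real m * (\<integral>x. (real N * rr x 0 - 1) * poly q (rr x 0) \<partial>M) = real m * (\<integral>x. (\<Sum>j\<in>?J. (rr x 0 - rr x j) * poly q (rr x 0)) \<partial>M)"
    by (intro arg_cong[of _ _ "\<lambda>z. real m * z"] Bochner_Integration.integral_cong refl) (simp add: space_M s1[symmetric] sum_distrib_right)
  also have "\<dots> = (\<Sum>j\<in>?J. real m * (\<integral>x. (rr x 0 - rr x j) * poly q (rr x 0) \<partial>M))"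
  proof -
    have m1: "(\<lambda>x. rr x 0 - rr x j) \<in> borel_measurable M" for j by measurable
    have "integrable M (\<lambda>x. (rr x 0 - rr x j) * poly q (rr x 0))" for j
      by (rule integrable_product[OF m1], rule b1)
    then show ?thesis by (subst Bochner_Integration.integral_sum) (simp_all only: sum_distrib_left)
  qed
  also have "\<dots> = (\<Sum>j\<in>?J. 2 * (\<integral>x. (norm (x 0 j))\<^sup>2 * poly (pderiv q) (rr x 0) \<partial>M))"
    by (intro sum.cong refl) (simp add: rotation_identity component_identity)
  also have "\<dots> = 2 * (\<integral>x. (\<Sum>j\<in>?J. (norm (x 0 j))\<^sup>2 * poly (pderiv q) (rr x 0)) \<partial>M)"
  proof -
    have "integrable M (\<lambda>x. (norm (x 0 j))\<^sup>2 * poly (pderiv q) (rr x 0))" for j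
      by (rule integrable_product[OF nm], rule b3)
    then show ?thesis by (subst Bochner_Integration.integral_sum) (simp_all only: sum_distrib_left)
  qed
  also have "\<dots> = 2 * (\<integral>x. rr x 0 * (1 - rr x 0) * poly (pderiv q) (rr x 0) \<partial>M)"
    by (intro arg_cong[of _ _ "\<lambda>z. 2 * z"] Bochner_Integration.integral_cong refl) (simp add: space_M s2[symmetric] sum_distrib_right)
  finally show ?thesis by simp
qed

text \<open>An isometry moves p to \<open>E00\<close>, where the cosine of the distance is 2 r - 1
  with r the first diagonal entry. Substituting this in \<open>pearson_E00\<close> determines a and
  b from the dimension m of the coefficients and the size N.\<close>

lemma jacobi_measure_proj:
  assumes p: "p \<in> points S" and a: "2 * (a + 1) = real m * (real N - 1)" and b: "2 * (b + 1) = real m"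
  shows "jacobi_measure (distr M borel (\<lambda>x. cos (geo_dist S p x))) a b"
proof -
  obtain g where g: "good_map S g" "g p = E00" using transitive[OF p] by blast
  let ?u = "\<lambda>x. 2 * rr x 0 - 1"
  have up: "cos (geo_dist S p x) = ?u (g x)" if "x \<in> points S" for x
  proof -
    have "geo_dist S p x = geo_dist S (g p) (g x)"
      using g(1) p that by (simp add: good_map_def isometries_def)
    then show ?thesis using g(2) cos_geo_dist_E00[OF good_map_points[OF g(1) that]] by simp
  qed
  have um: "?u \<in> borel_measurable M" by measurable
  have "distr M borel (\<lambda>x. cos (geo_dist S p x)) = distr M borel (\<lambda>x. ?u (g x))"
    by (intro distr_cong refl) (simp add: space_M up)
  also have "\<dots> = distr (distr M M g) borel ?u"
    using distr_distr[OF um good_map_measurable[OF g(1)]] by (simp add: comp_def)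
  also have "\<dots> = distr M borel ?u" by (simp add: good_map_distr[OF g(1)])
  finally have d: "distr M borel (\<lambda>x. cos (geo_dist S p x)) = distr M borel ?u" .
  have m1: "real m \<ge> 1" using Bs(4) by simp
  show ?thesis
    unfolding d
  proof (intro jacobi_measure.intro jacobi_measure_axioms.intro)
    show "prob_space (distr M borel ?u)" by (rule prob_space_distr[OF um])
    show "sets (distr M borel ?u) = sets borel" by simp
    show "AE u in distr M borel ?u. - 1 \<le> u \<and> u \<le> 1"
      using um by (subst AE_distr_iff) (auto simp: space_M rr_nonneg rr_le_1 intro!: AE_I2)
    show "b \<ge> -1/2" using b m1 by simp
    have "real m * (real N - 1) \<ge> 1 * 1" using m1 N2 by (intro mult_mono) auto
    then show "a \<ge> -1/2" using a by simp
    fix q :: "real poly"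
    let ?q = "pcompose q [:-1, 2:]"
    have q: "poly ?q r = poly q (2 * r - 1)" "poly (pderiv ?q) r = 2 * poly (pderiv q) (2 * r - 1)" for r
      by (simp_all add: poly_pcompose pderiv_pcompose pderiv_pCons algebra_simps)
    have cm: "(\<lambda>u. (1 - u\<^sup>2) * poly (pderiv q) u) \<in> borel_measurable borel" "(\<lambda>u. ((a + b + 2) * u + (a - b)) * poly q u) \<in> borel_measurable borel"
      by (intro borel_measurable_continuous_onI continuous_intros)+
    have ab: "(a + b + 2) * (2 * r - 1) + (a - b) = real m * (real N * r - 1)" for r
    proof -
      have "2 * ((a + b + 2) * (2 * r - 1) + (a - b)) = (2 * (a + 1) + 2 * (b + 1)) * (2 * r - 1) + (2 * (a + 1) - 2 * (b + 1))"
        by (simp add: algebra_simps)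
      also have "\<dots> = 2 * (real m * (real N * r - 1))" unfolding a b by (simp add: algebra_simps)
      finally show ?thesis by simp
    qed
    have "(\<integral>u. (1 - u\<^sup>2) * poly (pderiv q) u \<partial>distr M borel ?u) = (\<integral>x. (1 - (?u x)\<^sup>2) * poly (pderiv q) (?u x) \<partial>M)"
      by (rule integral_distr[OF um cm(1)])
    also have "\<dots> = (\<integral>x. 2 * (rr x 0 * (1 - rr x 0) * poly (pderiv ?q) (rr x 0)) \<partial>M)"
      unfolding q by (intro Bochner_Integration.integral_cong refl) (simp add: power2_eq_square algebra_simps)
    also have "\<dots> = 2 * (\<integral>x. rr x 0 * (1 - rr x 0) * poly (pderiv ?q) (rr x 0) \<partial>M)" by simp
    also have "\<dots> = real m * (\<integral>x. (real N * rr x 0 - 1) * poly ?q (rr x 0) \<partial>M)" unfolding pearson_E00 by simp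
    also have "\<dots> = (\<integral>x. real m * ((real N * rr x 0 - 1) * poly ?q (rr x 0)) \<partial>M)" by simp
    also have "\<dots> = (\<integral>x. ((a + b + 2) * ?u x + (a - b)) * poly q (?u x) \<partial>M)"
      unfolding ab q by (simp add: mult.assoc)
    also have "\<dots> = (\<integral>u. ((a + b + 2) * u + (a - b)) * poly q u \<partial>distr M borel ?u)"
      by (rule integral_distr[OF um cm(2), symmetric])
    finally show "(\<integral>u. (1 - u\<^sup>2) * poly (pderiv q) u \<partial>distr M borel ?u) = (\<integral>u. ((a + b + 2) * u + (a - b)) * poly q u \<partial>distr M borel ?u)" .
  qed
qed

end

section \<open>Multiplication by units\<close>

lemma inner_oct_mult_left: "oct_mult a x \<bullet> oct_mult a y = (norm a)\<^sup>2 * (x \<bullet> y)"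
  unfolding dot_norm linear_add[OF linear_oct_mult_right, symmetric] norm_oct_mult
  by (simp add: power_mult_distrib right_diff_distrib diff_divide_distrib)

lemma inner_oct_mult_right: "oct_mult x a \<bullet> oct_mult y a = (norm a)\<^sup>2 * (x \<bullet> y)"
  unfolding dot_norm linear_add[OF linear_oct_mult_left, symmetric] norm_oct_mult
  by (simp add: power_mult_distrib left_diff_distrib right_diff_distrib diff_divide_distrib mult.commute)

lemma oct_flexible: "oct_mult (oct_mult a x) a = oct_mult a (oct_mult x a)"
  by (simp add: oct_mult_def quat_mult_def quat_cnj_def prod_eq_iff algebra_simps)

text \<open>The adjoint of the equation at (k, l) is the equation at (l, k), which halves the cases
  for the octonionic map.\<close>

lemma idempotent_cnj:
  assumes "\<And>k l. A l k = oct_cnj (A k l)" "(\<Sum>m<N. oct_mult (A k m) (A m l)) = A k l"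
  shows "(\<Sum>m<N. oct_mult (A l m) (A m k)) = A l k"
proof -
  have "(\<Sum>m<N. oct_mult (A l m) (A m k)) = (\<Sum>m<N. oct_cnj (oct_mult (A k m) (A m l)))"
  proof (intro sum.cong refl)
    fix m
    have "A l m = oct_cnj (A m l)" "A m k = oct_cnj (A k m)" by (rule assms(1))+
    then show "oct_mult (A l m) (A m k) = oct_cnj (oct_mult (A k m) (A m l))" by (simp only: oct_cnj_mult)
  qed
  also have "\<dots> = oct_cnj (A k l)" by (simp only: linear_sum[OF linear_oct_cnj, symmetric] assms(2))
  also have "\<dots> = A l k" by (rule assms(1)[symmetric])
  finally show ?thesis .
qed

text \<open>Conjugation by diag (a, 1, ..., 1); the entry (0, 0) of a point is real, so it
  stays.\<close>

definition dmap :: "oct \<Rightarrow> oct_mat \<Rightarrow> oct_mat" where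
  "dmap a A = (\<lambda>k l. if k = 0 \<and> l \<noteq> 0 then oct_mult a (A k l)
     else if k \<noteq> 0 \<and> l = 0 then oct_mult (A k l) (oct_cnj a) else A k l)"

text \<open>In the products of entries an inner pair of a and its conjugate cancels by
  associativity, and an outer factor is pulled out of the sum.\<close>

lemma dmap_proj_space:
  assumes F: "coeff_domain F"
    and assoc: "\<And>x y z. x \<in> F \<Longrightarrow> y \<in> F \<Longrightarrow> z \<in> F \<Longrightarrow> oct_mult (oct_mult x y) z = oct_mult x (oct_mult y z)"
    and a: "a \<in> F" "norm a = 1" and A: "A \<in> proj_space F N"
  shows "dmap a A \<in> proj_space F N"
proof -
  have F_mult: "x \<in> F \<Longrightarrow> y \<in> F \<Longrightarrow> oct_mult x y \<in> F" and F_cnj: "x \<in> F \<Longrightarrow> oct_cnj x \<in> F" for x y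
    using F by (auto simp: coeff_domain_def)
  note D = proj_spaceD[OF A]
  have AF: "A k l \<in> F" for k l by (rule D(1))
  define r where "r = oct_re (A 0 0)"
  have A00: "A 0 0 = r *\<^sub>R oct_one" unfolding r_def by (rule oct_self_adjoint, rule D(3)[symmetric])
  have herm: "dmap a A l k = oct_cnj (dmap a A k l)" for k l
    using D(3)[where k = k and l = l] unfolding dmap_def by (simp add: oct_cnj_mult) (metis D(3))
  show ?thesis
    unfolding proj_space_def
  proof (intro CollectI conjI allI impI)
    fix k l
    show "dmap a A k l \<in> F" unfolding dmap_def using AF a F_mult F_cnj by simp
    show "dmap a A l k = oct_cnj (dmap a A k l)" by (rule herm)
  next
    fix k l assume "k \<ge> N \<or> l \<ge> N"
    then show "dmap a A k l = 0" using D(2)[of k l] by (auto simp: dmap_def)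
  next
    fix k l assume kl: "k < N" "l < N"
    note idem = D(4)[OF kl]
    consider "k = 0" "l = 0" | "k = 0" "l \<noteq> 0" | "k \<noteq> 0" "l = 0" | "k \<noteq> 0" "l \<noteq> 0" by blast
    then show "(\<Sum>m<N. oct_mult (dmap a A k m) (dmap a A m l)) = dmap a A k l"
    proof cases
      case 1
      have "oct_mult (dmap a A k m) (dmap a A m l) = oct_mult (A k m) (A m l)" for m
      proof -
        have "dmap a A m l = oct_cnj (dmap a A k m)" "A m l = oct_cnj (A k m)" unfolding 1 by (rule herm, rule D(3))
        moreover have "norm (dmap a A k m) = norm (A k m)" using a(2) 1 by (simp add: dmap_def norm_oct_mult)
        ultimately show ?thesis by (simp add: oct_mult_cnj)
      qed
      then show ?thesis using idem 1 by (simp add: dmap_def)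
    next
      case 2
      have "oct_mult (dmap a A k m) (dmap a A m l) = oct_mult a (oct_mult (A k m) (A m l))" for m
        using 2 assoc[OF a(1) AF AF] by (cases "m = 0") (simp_all add: dmap_def A00)
      then show ?thesis using idem 2 by (simp add: dmap_def linear_sum[OF linear_oct_mult_right, symmetric])
    next
      case 3
      have "oct_mult (dmap a A k m) (dmap a A m l) = oct_mult (oct_mult (A k m) (A m l)) (oct_cnj a)" for m
        using 3 assoc[OF AF AF F_cnj[OF a(1)]] by (cases "m = 0") (simp_all add: dmap_def A00)
      then show ?thesis using idem 3 by (simp add: dmap_def linear_sum[OF linear_oct_mult_left, symmetric])
    next
      case 4
      have "oct_mult (oct_mult x (oct_cnj a)) (oct_mult a y) = oct_mult x y" if "x \<in> F" "y \<in> F" for x y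
        using assoc[OF that(1) F_cnj[OF a(1)] F_mult[OF a(1) that(2)]] a(2) by (simp add: oct_mult_left_cnj)
      then have "oct_mult (dmap a A k m) (dmap a A m l) = oct_mult (A k m) (A m l)" for m
        using 4 AF by (cases "m = 0") (simp_all add: dmap_def)
      then show ?thesis using idem 4 by (simp add: dmap_def)
    qed
  next
    have "(\<Sum>k<N. dmap a A k k) = (\<Sum>k<N. A k k)" by (intro sum.cong refl) (auto simp: dmap_def)
    then show "(\<Sum>k<N. dmap a A k k) = oct_one" using D(5) by simp
  qed
qed

lemma good_map_dmap:
  assumes S: "points S = proj_space F N" "mat_size S = N" and F: "coeff_domain F"
    and assoc: "\<And>x y z. x \<in> F \<Longrightarrow> y \<in> F \<Longrightarrow> z \<in> F \<Longrightarrow> oct_mult (oct_mult x y) z = oct_mult x (oct_mult y z)"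
    and a: "a \<in> F" "norm a = 1"
  shows "good_map S (dmap a)"
proof (rule good_mapI[of _ _ "dmap (oct_cnj a)"])
  have a': "oct_cnj a \<in> F" "norm (oct_cnj a) = 1" using F a by (auto simp: coeff_domain_def)
  show "dmap a x \<in> points S" "dmap (oct_cnj a) x \<in> points S" if "x \<in> points S" for x
    using dmap_proj_space[OF F assoc] a a' that by (auto simp: S)
  have inv: "dmap (oct_cnj b) (dmap b x) = x" if "norm b = 1" for b x
    using that oct_mult_right_cnj[of _ "oct_cnj b"] by (simp add: dmap_def fun_eq_iff oct_mult_left_cnj)
  show "dmap (oct_cnj a) (dmap a x) = x" "dmap a (dmap (oct_cnj a) x) = x" for x
    using inv[OF a(2)] inv[OF a'(2)] by simp_all
  show "mat_inner (mat_size S) (dmap a x) (dmap a y) = mat_inner (mat_size S) x y" for x y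
    unfolding mat_inner_def dmap_def
    by (intro sum.cong refl) (simp add: inner_oct_mult_left inner_oct_mult_right a(2))
  show "continuous_on UNIV (\<lambda>A. dmap a A k l)" for k l
    unfolding dmap_def by (cases "k = 0"; cases "l = 0") (auto intro!: continuous_intros continuous_on_rot_entry)
qed

text \<open>The substitute for \<open>dmap\<close> where associativity fails: the entries x, y, z at
  (0, 1), (1, 2), (2, 0) undergo the triality of the Moufang identities, and the transposed entries
  its conjugate.\<close>

definition tmap :: "oct \<Rightarrow> oct_mat \<Rightarrow> oct_mat" where
  "tmap a A = (\<lambda>k l. if k = 0 \<and> l = 1 then oct_mult a (A k l) else if k = 1 \<and> l = 0 then oct_mult (A k l) (oct_cnj a)
     else if k = 1 \<and> l = 2 then oct_mult (A k l) a else if k = 2 \<and> l = 1 then oct_mult (oct_cnj a) (A k l)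
     else if k = 0 \<and> l = 2 then oct_mult a (oct_mult (A k l) a)
     else if k = 2 \<and> l = 0 then oct_mult (oct_cnj a) (oct_mult (A k l) (oct_cnj a)) else A k l)"

text \<open>The diagonal equations involve only norms of entries. Each of the equations at (0, 1),
  (1, 2), (0, 2) is one Moufang identity, as the diagonal entries are real; the rest are
  adjoints.\<close>

lemma tmap_proj_space:
  assumes a: "norm a = 1" and A: "A \<in> proj_space UNIV 3"
  shows "tmap a A \<in> proj_space UNIV 3"
proof -
  note D = proj_spaceD[OF A]
  have real: "A k k = oct_re (A k k) *\<^sub>R oct_one" for k by (rule oct_self_adjoint, rule D(3)[symmetric])
  have h: "oct_cnj (A k l) = A l k" for k l by (rule D(3)[symmetric])
  have herm: "tmap a A l k = oct_cnj (tmap a A k l)" for k l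
    by (simp add: tmap_def oct_cnj_mult h oct_flexible)
  have sum3: "(\<Sum>m<3. f m) = f 0 + f 1 + f (2::nat)" for f :: "nat \<Rightarrow> oct"
    by (simp add: eval_nat_numeral)
  have diag: "(\<Sum>m<3. oct_mult (tmap a A k m) (tmap a A m k)) = tmap a A k k" if "k < 3" for k
  proof -
    have "oct_mult (tmap a A k m) (tmap a A m k) = oct_mult (A k m) (A m k)" for m
    proof -
      have "norm (tmap a A k m) = norm (A k m)" using a by (simp add: tmap_def norm_oct_mult)
      moreover have "tmap a A m k = oct_cnj (tmap a A k m)" "A m k = oct_cnj (A k m)" by (rule herm, rule D(3))
      ultimately show ?thesis by (simp add: oct_mult_cnj)
    qed
    moreover have "tmap a A k k = A k k" by (auto simp: tmap_def)
    ultimately show ?thesis using D(4)[OF that that] by (simp only:)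
  qed
  have m2: "oct_mult (oct_mult y b) (oct_mult (oct_cnj b) (oct_mult z (oct_cnj b))) = oct_mult (oct_mult y z) (oct_cnj b)" if "norm b = 1" for y z b
    using oct_moufang2[of y b z] that by simp
  have i01: "(\<Sum>m<3. oct_mult (tmap a A 0 m) (tmap a A m 1)) = tmap a A 0 1"
  proof -
    \<comment> \<open>The adjoint of \<open>m2\<close>, used for the product of the entries (1, 2)
      and (2, 0).\<close>
    have "oct_mult (oct_mult a (oct_mult (A 0 2) a)) (oct_mult (oct_cnj a) (A 2 1)) = oct_mult a (oct_mult (A 0 2) (A 2 1))"
      using arg_cong[OF m2[OF a, of "A 1 2" "A 2 0"], of oct_cnj] by (simp add: oct_cnj_mult h oct_flexible)
    then have "(\<Sum>m<3. oct_mult (tmap a A 0 m) (tmap a A m 1)) = oct_mult a (\<Sum>m<3. oct_mult (A 0 m) (A m 1))"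
      unfolding sum3 using real[of 0] real[of 1]
      by (simp add: tmap_def linear_add[OF linear_oct_mult_right]) (metis oct_mult_one oct_mult_scaleR)
    then show ?thesis using D(4)[of 0 1] by (simp add: tmap_def)
  qed
  have i12: "(\<Sum>m<3. oct_mult (tmap a A 1 m) (tmap a A m 2)) = tmap a A 1 2"
  proof -
    have "oct_mult (oct_mult (A 1 0) (oct_cnj a)) (oct_mult a (oct_mult (A 0 2) a)) = oct_mult (oct_mult (A 1 0) (A 0 2)) a"
      using m2[of "oct_cnj a" "A 1 0" "A 0 2"] a by simp
    then have "(\<Sum>m<3. oct_mult (tmap a A 1 m) (tmap a A m 2)) = oct_mult (\<Sum>m<3. oct_mult (A 1 m) (A m 2)) a"
      unfolding sum3 using real[of 1] real[of 2]
      by (simp add: tmap_def linear_add[OF linear_oct_mult_left]) (metis oct_mult_one oct_mult_scaleR)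
    then show ?thesis using D(4)[of 1 2] by (simp add: tmap_def)
  qed
  have i02: "(\<Sum>m<3. oct_mult (tmap a A 0 m) (tmap a A m 2)) = tmap a A 0 2"
  proof -
    have "(\<Sum>m<3. oct_mult (tmap a A 0 m) (tmap a A m 2)) = oct_mult a (oct_mult (\<Sum>m<3. oct_mult (A 0 m) (A m 2)) a)"
      unfolding sum3 using real[of 0] real[of 2]
      by (simp add: tmap_def linear_add[OF linear_oct_mult_left] linear_add[OF linear_oct_mult_right] oct_moufang1) (metis oct_mult_one oct_mult_scaleR)
    then show ?thesis using D(4)[of 0 2] by (simp add: tmap_def)
  qed
  show ?thesis
    unfolding proj_space_def
  proof (intro CollectI conjI allI impI)
    fix k l
    show "tmap a A l k = oct_cnj (tmap a A k l)" by (rule herm)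
  next
    fix k l :: nat assume "k \<ge> 3 \<or> l \<ge> 3"
    then show "tmap a A k l = 0" using D(2)[of k l] by (auto simp: tmap_def)
  next
    fix k l :: nat assume "k < 3" "l < 3"
    then have "k = l \<or> (k = 0 \<and> l = 1) \<or> (k = 1 \<and> l = 0) \<or> (k = 1 \<and> l = 2) \<or> (k = 2 \<and> l = 1) \<or> (k = 0 \<and> l = 2) \<or> (k = 2 \<and> l = 0)"
      by presburger
    then consider "k = l" | "k = 0" "l = 1" | "k = 1" "l = 0" | "k = 1" "l = 2" | "k = 2" "l = 1" | "k = 0" "l = 2" | "k = 2" "l = 0"
      by blast
    then show "(\<Sum>m<3. oct_mult (tmap a A k m) (tmap a A m l)) = tmap a A k l"
    proof cases
      case 1
      then show ?thesis using diag[OF \<open>k < 3\<close>] by (simp only:)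
    next
      case 2
      show ?thesis unfolding 2 by (rule i01)
    next
      case 3
      show ?thesis unfolding 3 by (rule idempotent_cnj[of "tmap a A", OF herm i01])
    next
      case 4
      show ?thesis unfolding 4 by (rule i12)
    next
      case 5
      show ?thesis unfolding 5 by (rule idempotent_cnj[of "tmap a A", OF herm i12])
    next
      case 6
      show ?thesis unfolding 6 by (rule i02)
    next
      case 7
      show ?thesis unfolding 7 by (rule idempotent_cnj[of "tmap a A", OF herm i02])
    qed
  next
    have "(\<Sum>k<3. tmap a A k k) = (\<Sum>k<3. A k k)" by (intro sum.cong refl) (auto simp: tmap_def)
    then show "(\<Sum>k<3. tmap a A k k) = oct_one" using D(5) by simp
  qed auto
qed

lemma good_map_tmap:
  assumes a: "norm a = 1"
  shows "good_map Proj_Cay (tmap a)"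
proof (rule good_mapI[of _ _ "tmap (oct_cnj a)"])
  have a': "norm (oct_cnj a) = 1" using a by simp
  show "tmap a x \<in> points Proj_Cay" "tmap (oct_cnj a) x \<in> points Proj_Cay" if "x \<in> points Proj_Cay" for x
    using tmap_proj_space[OF a] tmap_proj_space[OF a'] that by auto
  have inv: "tmap (oct_cnj b) (tmap b x) = x" if b: "norm b = 1" for b x
  proof -
    have l: "oct_mult (oct_cnj b) (oct_mult b y) = y" "oct_mult b (oct_mult (oct_cnj b) y) = y"
      "oct_mult (oct_mult y b) (oct_cnj b) = y" "oct_mult (oct_mult y (oct_cnj b)) b = y" for y
      using oct_mult_left_cnj[of b y] oct_mult_left_cnj[of "oct_cnj b" y] oct_mult_right_cnj[of y b] oct_mult_right_cnj[of y "oct_cnj b"] b by simp_all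

    have e1: "oct_mult (oct_cnj b) (oct_mult (oct_mult b (oct_mult y b)) (oct_cnj b)) = y" for y
      by (simp only: oct_flexible[symmetric, of b] l)
    have e2: "oct_mult b (oct_mult (oct_mult (oct_cnj b) (oct_mult y (oct_cnj b))) b) = y" for y
      by (simp only: oct_flexible[symmetric, of "oct_cnj b"] l)
    show ?thesis
    proof (intro ext)
      fix k j
      show "tmap (oct_cnj b) (tmap b x) k j = x k j"
      proof -
        have "k = 0 \<or> k = 1 \<or> k = 2 \<or> k > 2" "j = 0 \<or> j = 1 \<or> j = 2 \<or> j > 2" by linarith+
        then show ?thesis
          by (elim disjE; simp only: tmap_def oct_cnj_cnj; simp add: l e1 e2)
      qed
    qed
  qed
  show "tmap (oct_cnj a) (tmap a x) = x" "tmap a (tmap (oct_cnj a) x) = x" for x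
    using inv[OF a] inv[OF a'] by simp_all
  show "mat_inner (mat_size Proj_Cay) (tmap a x) (tmap a y) = mat_inner (mat_size Proj_Cay) x y" for x y
    unfolding mat_inner_def tmap_def
    by (intro sum.cong refl) (simp add: inner_oct_mult_left inner_oct_mult_right a)
  show "continuous_on UNIV (\<lambda>A. tmap a A k l)" for k l
  proof -
    have c: "continuous_on UNIV (\<lambda>A. if P then f A else g A)" if "continuous_on UNIV f" "continuous_on UNIV g" for P and f g :: "oct_mat \<Rightarrow> oct"
      using that by (cases P) simp_all
    show ?thesis unfolding tmap_def by (intro c continuous_intros continuous_on_rot_entry)
  qed
qed

lemma unit_map_Cay:
  assumes a: "norm a = 1" and j: "1 \<le> j" "j < (3::nat)"
  shows "\<exists>g. good_map Proj_Cay g \<and> (\<forall>A\<in>points Proj_Cay. (\<forall>k. g A k k = A k k) \<and> g A 0 j = oct_mult a (A 0 j))"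
proof -
  consider "j = 1" | "j = 2" using j by linarith
  then show ?thesis
  proof cases
    case 1
    then show ?thesis by (intro exI[of _ "tmap a"] conjI good_map_tmap[OF a]) (auto simp: tmap_def)
  next
    case 2
    \<comment> \<open>A quarter turn exchanges the indices 1 and 2 up to a sign, which the inverse
      turn cancels; so j = 2 is reduced to j = 1.\<close>
    let ?g = "\<lambda>A. rot 1 2 0 (-1) (tmap a (rot 1 2 0 1 A))"
    have r: "good_map Proj_Cay (rot 1 2 0 s)" if "s\<^sup>2 = 1" for s
      using that by (intro good_map_rot_proj[of _ UNIV 3]) auto
    have "good_map Proj_Cay ?g"
      by (intro good_map_comp[of _ "rot 1 2 0 (-1)" "\<lambda>A. tmap a (rot 1 2 0 1 A)"] good_map_comp[of _ "tmap a" "rot 1 2 0 1"] r good_map_tmap a) auto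
    moreover have "?g A 0 2 = oct_mult a (A 0 2)" for A
      using linear_neg[OF linear_oct_mult_right] by (simp add: rot_def rotr_def rotc_def vrot_def tmap_def)
    moreover have "?g A k k = A k k" for A k
      by (simp add: rot_def rotr_def rotc_def vrot_def tmap_def)
    ultimately show ?thesis using 2 by blast
  qed
qed

lemma coeff_domain_std: "coeff_domain oct_R" "coeff_domain oct_C" "coeff_domain oct_H" "coeff_domain UNIV"
  by (auto simp: coeff_domain_def subspace_def oct_R_def oct_C_def oct_H_def oct_one_def oct_mult_def oct_cnj_def
      quat_mult_def quat_cnj_def zero_prod_def scaleR_conv_of_real simp flip: of_real_add of_real_mult)

lemma oct_assoc_std: 
  assumes "F = oct_R \<or> F = oct_C \<or> F = oct_H" "x \<in> F" "y \<in> F" "z \<in> F"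
  shows "oct_mult (oct_mult x y) z = oct_mult x (oct_mult y z)"
proof -
  have "oct_R \<subseteq> oct_H" "oct_C \<subseteq> oct_H" by (auto simp: oct_R_def oct_C_def oct_H_def)
  then show ?thesis using assms oct_mult_assoc_H[of x y z] by auto
qed

section \<open>Orthonormal bases of the coefficient algebras, and the four projective models\<close>

definition octB_R :: "oct set" where "octB_R = {((1, 0), 0)}"
definition octB_C :: "oct set" where "octB_C = {((1, 0), 0), ((\<i>, 0), 0)}"
definition octB_H :: "oct set" where "octB_H = {((1, 0), 0), ((\<i>, 0), 0), ((0, 1), 0), ((0, \<i>), 0)}"
definition octB_O :: "oct set" where "octB_O = {((1, 0), 0), ((\<i>, 0), 0), ((0, 1), 0), ((0, \<i>), 0),
   (0, (1, 0)), (0, (\<i>, 0)), (0, (0, 1)), (0, (0, \<i>))}"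

lemmas octB_defs = octB_R_def octB_C_def octB_H_def octB_O_def oct_R_def oct_C_def oct_H_def

lemma octB_sub: "octB_R \<subseteq> oct_R" "octB_C \<subseteq> oct_C" "octB_H \<subseteq> oct_H"
  by (auto simp: octB_defs zero_prod_def)

lemma octB_fin: "finite octB_R" "finite octB_C" "finite octB_H" "finite octB_O"
  by (auto simp: octB_defs)

lemma octB_card: "card octB_R = 1" "card octB_C = 2" "card octB_H = 4" "card octB_O = 8"
  by (auto simp: octB_defs complex_eq_iff zero_prod_def)

lemma octB_norm: "e \<in> octB_R \<or> e \<in> octB_C \<or> e \<in> octB_H \<or> e \<in> octB_O \<Longrightarrow> norm e = 1"
  by (auto simp: octB_defs norm_prod_def)

lemma octB_expand:
  "x \<in> oct_R \<Longrightarrow> (norm x)\<^sup>2 = (\<Sum>e\<in>octB_R. (e \<bullet> x)\<^sup>2)"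
  "x \<in> oct_C \<Longrightarrow> (norm x)\<^sup>2 = (\<Sum>e\<in>octB_C. (e \<bullet> x)\<^sup>2)"
  "x \<in> oct_H \<Longrightarrow> (norm x)\<^sup>2 = (\<Sum>e\<in>octB_H. (e \<bullet> x)\<^sup>2)"
  "(norm x)\<^sup>2 = (\<Sum>e\<in>octB_O. (e \<bullet> x)\<^sup>2)"
  unfolding norm_oct_sq
  by (auto simp: octB_defs complex_eq_iff zero_prod_def inner_prod_def inner_complex_def)

lemma proj_model_assoc:
  assumes S: "points S = proj_space F N" "mat_size S = N" "N \<ge> 2" "\<And>x y. geo_dist S x y = arccos (2 * mat_inner N x y - 1)"
    and F: "F = oct_R \<or> F = oct_C \<or> F = oct_H"
    and B: "Bs \<subseteq> F" "finite Bs" "card Bs = m" "m > 0" "\<And>e. e \<in> Bs \<Longrightarrow> norm e = 1" "\<And>x. x \<in> F \<Longrightarrow> (norm x)\<^sup>2 = (\<Sum>e\<in>Bs. (e \<bullet> x)\<^sup>2)"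
  shows "proj_model S F N m Bs"
proof
  show Fd: "coeff_domain F" using F coeff_domain_std by auto
  fix a and j :: nat assume a: "a \<in> F" "norm a = 1" and j: "1 \<le> j" "j < N"
  show "\<exists>g. good_map S g \<and> (\<forall>A\<in>points S. (\<forall>k. g A k k = A k k) \<and> g A 0 j = oct_mult a (A 0 j))"
    using j by (intro exI[of _ "dmap a"] conjI good_map_dmap[OF S(1,2) Fd oct_assoc_std[OF F] a]) (auto simp: dmap_def)
qed (use S B in auto)

lemma proj_model_R: "d \<ge> 2 \<Longrightarrow> proj_model (Proj_R d) oct_R (d + 1) 1 octB_R"
  by (rule proj_model_assoc) (use octB_sub octB_fin octB_card octB_norm octB_expand in \<open>auto simp: geo_dist_def\<close>)

lemma proj_model_C: "d \<ge> 4 \<Longrightarrow> proj_model (Proj_C d) oct_C (d div 2 + 1) 2 octB_C"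
  by (rule proj_model_assoc) (use octB_sub octB_fin octB_card octB_norm octB_expand in \<open>auto simp: geo_dist_def\<close>)

lemma proj_model_H: "d \<ge> 8 \<Longrightarrow> proj_model (Proj_H d) oct_H (d div 4 + 1) 4 octB_H"
  by (rule proj_model_assoc) (use octB_sub octB_fin octB_card octB_norm octB_expand in \<open>auto simp: geo_dist_def\<close>)

lemma proj_model_Cay: "proj_model Proj_Cay UNIV 3 8 octB_O"
  by standard (use unit_map_Cay octB_fin octB_card octB_norm octB_expand coeff_domain_std in \<open>auto simp: geo_dist_def\<close>)


section \<open>The sphere\<close>

locale sphere_measure = invariant_measure M "Sphere d" for M d +
  assumes d: "d \<ge> 1"
begin

abbreviation "r x k \<equiv> oct_re (x k 0)"

lemma sphere_entry:
  assumes x: "x \<in> points (Sphere d)"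
  shows "x k 0 = r x k *\<^sub>R oct_one" "l \<ge> 1 \<Longrightarrow> x k l = 0" "(\<Sum>k<d + 1. (r x k)\<^sup>2) = 1" "\<bar>r x k\<bar> \<le> 1"
proof -
  show 1: "x k 0 = r x k *\<^sub>R oct_one" for k
  proof -
    have "x k 0 \<in> oct_R" using x by (simp add: unit_sphere_def)
    then show ?thesis by (auto simp: oct_R_def oct_re_def oct_one_def zero_prod_def scaleR_conv_of_real)
  qed
  show "l \<ge> 1 \<Longrightarrow> x k l = 0" using x by (simp add: unit_sphere_def)
  have n: "norm (x k 0) = \<bar>r x k\<bar>" for k by (subst 1) simp
  show s: "(\<Sum>k<d + 1. (r x k)\<^sup>2) = 1" using x by (simp add: unit_sphere_def n)
  show "\<bar>r x k\<bar> \<le> 1"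
  proof (cases "k < d + 1")
    case True
    have "(r x k)\<^sup>2 \<le> (\<Sum>k<d + 1. (r x k)\<^sup>2)" using True by (intro member_le_sum) auto
    then show ?thesis using s by (simp add: abs_square_le_1)
  next
    case False
    then have "x k 0 = 0" using x by (simp add: unit_sphere_def)
    then show ?thesis by (simp add: linear_0[OF linear_oct_re])
  qed
qed

lemma sphere_inner:
  assumes "x \<in> points (Sphere d)" "y \<in> points (Sphere d)"
  shows "mat_inner (d + 1) x y = (\<Sum>k<d + 1. r x k * r y k)"
proof -
  have "(\<Sum>j<d + 1. x k j \<bullet> y k j) = r x k * r y k" for k
  proof -
    have "(\<Sum>j<d + 1. x k j \<bullet> y k j) = (\<Sum>j<d + 1. if j = 0 then x k 0 \<bullet> y k 0 else 0)"
      using sphere_entry(2)[OF assms(1)] by (intro sum.cong) auto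
    also have "\<dots> = x k 0 \<bullet> y k 0" by simp
    also have "\<dots> = r x k * r y k"
      using arg_cong2[OF sphere_entry(1)[OF assms(1), of k] sphere_entry(1)[OF assms(2), of k], of "(\<bullet>)"]
      by (simp add: dot_square_norm)
    finally show ?thesis .
  qed
  then show ?thesis unfolding mat_inner_def by simp
qed

lemma good_map_rotr:
  assumes ij: "i \<noteq> j" "i < d + 1" "j < d + 1" and cs: "c\<^sup>2 + s\<^sup>2 = 1"
  shows "good_map (Sphere d) (rotr i j c s)"
proof -
  have bil: "bilinear ((\<bullet>) :: oct \<Rightarrow> oct \<Rightarrow> real)"
    unfolding bilinear_def
    by (intro conjI allI linearI) (simp_all only: inner_add_left inner_add_right inner_scaleR_left inner_scaleR_right real_scaleR_def)
  have sub: "subspace oct_R" using coeff_domain_std(1) by (simp add: coeff_domain_def)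
  have pts: "rotr i j c s x \<in> points (Sphere d)" if cs: "c\<^sup>2 + s\<^sup>2 = 1" and x: "x \<in> points (Sphere d)" for c s x
  proof -
    have x': "x k l \<in> oct_R" "k \<ge> d + 1 \<or> l \<ge> 1 \<Longrightarrow> x k l = 0" "(\<Sum>k<d + 1. x k 0 \<bullet> x k 0) = 1" for k l
      using x by (auto simp: unit_sphere_def dot_square_norm)
    have "(\<Sum>k<d + 1. rotr i j c s x k 0 \<bullet> rotr i j c s x k 0) = 1"
      unfolding rotr_def using vrot_bilinear_sum[OF bil ij cs, of "\<lambda>k. x k 0" "\<lambda>k. x k 0"] x'(3) by simp
    moreover have "rotr i j c s x k l \<in> oct_R" for k l
      unfolding rotr_def by (intro vrot_subspace sub x')
    moreover have "rotr i j c s x k l = 0" if "k \<ge> d + 1 \<or> l \<ge> 1" for k l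
      using that ij x'(2) by (auto simp: rotr_def vrot_def)
    ultimately show ?thesis by (simp add: unit_sphere_def dot_square_norm)
  qed
  have cs': "c\<^sup>2 + (- s)\<^sup>2 = 1" using cs by simp
  show ?thesis
  proof (rule good_mapI[of _ _ "rotr i j c (- s)"])
    show "rotr i j c (- s) (rotr i j c s x) = x" "rotr i j c s (rotr i j c (- s) x) = x" for x
      using rotr_inverse[OF ij(1) cs] rotr_inverse[OF ij(1) cs'] by simp_all
    show "continuous_on UNIV (\<lambda>A. rotr i j c s A k l)" for k l
      unfolding rotr_def by (intro continuous_intros continuous_on_rot_entry)
    fix x y :: oct_mat
    have "mat_inner (d + 1) (rotr i j c s x) (rotr i j c s y) = (\<Sum>l<d + 1. \<Sum>k<d + 1. rotr i j c s x k l \<bullet> rotr i j c s y k l)"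
      unfolding mat_inner_def by (rule sum.swap)
    also have "\<dots> = (\<Sum>l<d + 1. \<Sum>k<d + 1. x k l \<bullet> y k l)"
      unfolding rotr_def by (intro sum.cong refl vrot_bilinear_sum[OF bil ij cs])
    also have "\<dots> = mat_inner (d + 1) x y" unfolding mat_inner_def by (rule sum.swap)
    finally show "mat_inner (mat_size (Sphere d)) (rotr i j c s x) (rotr i j c s y) = mat_inner (mat_size (Sphere d)) x y" by simp
  qed (auto intro: pts cs cs' simp del: points.simps)
qed

lemma r_measurable [measurable]: "(\<lambda>x. r x k) \<in> borel_measurable M"
  by (intro measurable_M continuous_intros continuous_on_rot_entry)

section \<open>The cosine of the distance on the sphere, and its integration by parts\<close>

context
  fixes p assumes p: "p \<in> points (Sphere d)"
begin

definition u :: "oct_mat \<Rightarrow> real" where "u x = (\<Sum>k<d + 1. r p k * r x k)"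

lemma u_measurable [measurable]: "u \<in> borel_measurable M"
  unfolding u_def by measurable

lemma u_bound: "x \<in> points (Sphere d) \<Longrightarrow> \<bar>u x\<bar> \<le> 1"
proof -
  assume x: "x \<in> points (Sphere d)"
  have "(u x)\<^sup>2 \<le> (\<Sum>k<d + 1. (r p k)\<^sup>2) * (\<Sum>k<d + 1. (r x k)\<^sup>2)"
    unfolding u_def by (rule Cauchy_Schwarz_ineq_sum)
  then show ?thesis unfolding sphere_entry(3)[OF x] sphere_entry(3)[OF p] by (simp add: abs_square_le_1)
qed

lemma cos_geo_dist_sphere: "x \<in> points (Sphere d) \<Longrightarrow> cos (geo_dist (Sphere d) p x) = u x"
  using u_bound[of x] sphere_inner[OF p, of x] by (simp add: geo_dist_def u_def cos_arccos_abs)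

lemma poly_u_bounded: "\<exists>B\<ge>0. \<forall>x\<in>points (Sphere d). \<bar>poly q (u x)\<bar> \<le> B"
proof -
  have "bounded (poly q ` {-1..1})" by (intro compact_imp_bounded compact_continuous_image continuous_intros) auto
  then obtain B where B: "\<forall>y\<in>poly q ` {-1..1}. norm y \<le> B" unfolding bounded_iff by blast
  have "\<bar>poly q (u x)\<bar> \<le> max B 0" if "x \<in> points (Sphere d)" for x
    using B u_bound[OF that] by (auto simp: le_max_iff_disj abs_le_iff)
  then show ?thesis by (intro exI[of _ "max B 0"]) auto
qed

lemma poly_u_measurable [measurable]: "(\<lambda>x. poly q (u x)) \<in> borel_measurable M"
proof -
  have "poly q \<in> borel_measurable borel" by (intro borel_measurable_continuous_onI continuous_intros)
  from measurable_compose[OF u_measurable this] show ?thesis .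
qed

text \<open>Minus the derivative of \<open>u\<close> along the rotation of the indices i and
  j.\<close>

definition w :: "nat \<Rightarrow> nat \<Rightarrow> oct_mat \<Rightarrow> real" where "w i j x = r p i * r x j - r p j * r x i"

lemma r_rotr:
  assumes "i \<noteq> j"
  shows "r (rotr i j c s x) i = c * r x i - s * r x j" "r (rotr i j c s x) j = s * r x i + c * r x j"
    "k \<noteq> i \<Longrightarrow> k \<noteq> j \<Longrightarrow> r (rotr i j c s x) k = r x k"
  using assms by (simp_all add: rotr_def vrot_def linear_add[OF linear_oct_re] linear_diff[OF linear_oct_re] linear_cmul[OF linear_oct_re])

lemma u_rotr:
  assumes ij: "i \<noteq> j" "i < d + 1" "j < d + 1"
  shows "u (rotr i j c s x) = r p i * (c * r x i - s * r x j) + r p j * (s * r x i + c * r x j) + (\<Sum>k\<in>{..<d + 1} - {i} - {j}. r p k * r x k)"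
proof -
  have split: "(\<Sum>k<d + 1. f k) = f i + f j + (\<Sum>k\<in>{..<d + 1} - {i} - {j}. f k)" for f :: "nat \<Rightarrow> real"
    using ij by (subst sum.remove[of _ i], simp, simp, subst sum.remove[of _ j]) (auto simp: add.assoc)
  show ?thesis unfolding u_def split by (simp add: r_rotr[OF ij(1)])
qed

text \<open>The flow identity for w q (u), along the rotation under which u has derivative - w.
  Since p is arbitrary here, transitivity is bypassed.\<close>

lemma sphere_flow:
  assumes ij: "i \<noteq> j" "i < d + 1" "j < d + 1"
  shows "(\<integral>x. (r p i * r x i + r p j * r x j) * poly q (u x) - (w i j x)\<^sup>2 * poly (pderiv q) (u x) \<partial>M) = 0"
proof -
  let ?P = "points (Sphere d)"
  obtain B where B: "B \<ge> 0" "\<forall>x\<in>?P. \<bar>poly q (u x)\<bar> \<le> B" using poly_u_bounded by blast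
  obtain B' where B': "B' \<ge> 0" "\<forall>x\<in>?P. \<bar>poly (pderiv q) (u x)\<bar> \<le> B'" using poly_u_bounded by blast
  have pr: "\<bar>r p k * r x l\<bar> \<le> 1" if "x \<in> ?P" for k l x
    unfolding abs_mult using sphere_entry(4)[OF p, of k] sphere_entry(4)[OF that, of l] by (intro mult_le_one) auto
  have wb: "\<bar>w i j x\<bar> \<le> 2" if "x \<in> ?P" for x
    unfolding w_def using pr[OF that, of i j] pr[OF that, of j i] by linarith
  show ?thesis
  proof (rule flow_integral_zero[where F = "\<lambda>x. w i j x * poly q (u x)" and g = "\<lambda>s. rotr i j (cos s) (sin s)"])
    show "good_map (Sphere d) (rotr i j (cos s) (sin s))" for s using ij by (intro good_map_rotr) auto
    show "rotr i j (cos 0) (sin 0) x = x" for x by (simp add: rotr_def vrot_def fun_eq_iff)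
    show "(\<lambda>x. w i j x * poly q (u x)) \<in> borel_measurable M" unfolding w_def by measurable
    show "(\<lambda>x. (r p i * r x i + r p j * r x j) * poly q (u x) - (w i j x)\<^sup>2 * poly (pderiv q) (u x)) \<in> borel_measurable M"
      unfolding w_def by measurable
    fix x assume x: "x \<in> ?P"
    show "\<bar>w i j x * poly q (u x)\<bar> \<le> 2 * B" unfolding abs_mult using wb[OF x] B x by (intro mult_mono) auto
    have "(w i j x)\<^sup>2 \<le> 2\<^sup>2" using wb[OF x] by (subst abs_le_square_iff[symmetric]) simp
    then have 1: "\<bar>(w i j x)\<^sup>2 * poly (pderiv q) (u x)\<bar> \<le> 4 * B'" unfolding abs_mult using B' x by (intro mult_mono) auto
    have "\<bar>r p i * r x i + r p j * r x j\<bar> \<le> 2" using pr[OF x, of i i] pr[OF x, of j j] by linarith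
    then have 2: "\<bar>(r p i * r x i + r p j * r x j) * poly q (u x)\<bar> \<le> 2 * B" unfolding abs_mult using B x by (intro mult_mono) auto
    show "\<bar>(r p i * r x i + r p j * r x j) * poly q (u x) - (w i j x)\<^sup>2 * poly (pderiv q) (u x)\<bar> \<le> 2 * B + 4 * B'"
      using 1 2 by linarith
    fix s :: real
    define K where "K = (\<Sum>k\<in>{..<d + 1} - {i} - {j}. r p k * r x k)"
    have dw: "((\<lambda>s. r p i * (sin s * r x i + cos s * r x j) - r p j * (cos s * r x i - sin s * r x j)) has_real_derivative
        (r p i * (cos s * r x i - sin s * r x j) + r p j * (sin s * r x i + cos s * r x j))) (at s)"
      by (auto intro!: derivative_eq_intros simp: algebra_simps)
    have du: "((\<lambda>s. r p i * (cos s * r x i - sin s * r x j) + r p j * (sin s * r x i + cos s * r x j) + K) has_real_derivative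
        - (r p i * (sin s * r x i + cos s * r x j) - r p j * (cos s * r x i - sin s * r x j))) (at s)"
      by (auto intro!: derivative_eq_intros simp: algebra_simps)
    show "((\<lambda>s. w i j (rotr i j (cos s) (sin s) x) * poly q (u (rotr i j (cos s) (sin s) x))) has_real_derivative
       (r p i * r (rotr i j (cos s) (sin s) x) i + r p j * r (rotr i j (cos s) (sin s) x) j) * poly q (u (rotr i j (cos s) (sin s) x))
        - (w i j (rotr i j (cos s) (sin s) x))\<^sup>2 * poly (pderiv q) (u (rotr i j (cos s) (sin s) x))) (at s)"
      unfolding w_def u_rotr[OF ij] r_rotr(1,2)[OF ij(1)] K_def[symmetric]
      by (rule DERIV_cong[OF DERIV_mult[OF dw DERIV_chain2[where f = "poly q", OF poly_DERIV du]]])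
         (simp add: power2_eq_square algebra_simps)
  qed
qed

text \<open>Sum over all ordered pairs of distinct indices. Each product p k x k occurs 2 d times,
  and Lagrange's identity for unit vectors gives 2 (1 - u^2) for the sum of the w^2.\<close>

lemma pearson_sphere:
  "(\<integral>x. (1 - (u x)\<^sup>2) * poly (pderiv q) (u x) \<partial>M) = (\<integral>x. real d * u x * poly q (u x) \<partial>M)"
proof -
  let ?I = "{..<d + 1}" and ?P = "points (Sphere d)"
  let ?f = "\<lambda>i j x. (r p i * r x i + r p j * r x j) * poly q (u x) - (w i j x)\<^sup>2 * poly (pderiv q) (u x)"
  have sum: "(\<Sum>i\<in>?I. \<Sum>j\<in>?I - {i}. ?f i j x) = 2 * (real d * u x * poly q (u x)) - 2 * ((1 - (u x)\<^sup>2) * poly (pderiv q) (u x))"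
    if x: "x \<in> ?P" for x
  proof -
    have a: "(\<Sum>i\<in>?I. \<Sum>j\<in>?I - {i}. r p i * r x i + r p j * r x j) = 2 * (real d * u x)"
    proof -
      have "(\<Sum>i\<in>?I. \<Sum>j\<in>?I - {i}. r p i * r x i + r p j * r x j) = (\<Sum>i\<in>?I. real d * (r p i * r x i) + (u x - r p i * r x i))"
        by (intro sum.cong refl) (simp add: sum.distrib u_def sum_diff1)
      also have "\<dots> = real d * u x + (real (d + 1) * u x - u x)"
        by (simp only: sum.distrib sum_subtractf sum_distrib_left[symmetric] u_def[symmetric] sum_constant card_lessThan)
      finally show ?thesis by (simp add: algebra_simps)
    qed
    have b: "(\<Sum>i\<in>?I. \<Sum>j\<in>?I - {i}. (w i j x)\<^sup>2) = 2 * (1 - (u x)\<^sup>2)"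
    proof -
      have "(\<Sum>i\<in>?I. \<Sum>j\<in>?I - {i}. (w i j x)\<^sup>2) = (\<Sum>i\<in>?I. \<Sum>j\<in>?I. (w i j x)\<^sup>2)"
        by (intro sum.cong refl sum.mono_neutral_left) (auto simp: w_def)
      also have "\<dots> = (\<Sum>i\<in>?I. \<Sum>j\<in>?I. (r p i)\<^sup>2 * (r x j)\<^sup>2 + (r x i)\<^sup>2 * (r p j)\<^sup>2 - 2 * ((r p i * r x i) * (r p j * r x j)))"
        by (intro sum.cong refl) (simp add: w_def power2_eq_square algebra_simps)
      also have "\<dots> = (\<Sum>i\<in>?I. (r p i)\<^sup>2) * (\<Sum>j\<in>?I. (r x j)\<^sup>2) + (\<Sum>i\<in>?I. (r x i)\<^sup>2) * (\<Sum>j\<in>?I. (r p j)\<^sup>2) - 2 * ((\<Sum>i\<in>?I. r p i * r x i) * (\<Sum>j\<in>?I. r p j * r x j))"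
        by (simp only: sum.distrib sum_subtractf sum_distrib_left[symmetric] sum_distrib_right[symmetric])
      finally show ?thesis
        unfolding sphere_entry(3)[OF x] sphere_entry(3)[OF p] u_def[symmetric] by (simp add: power2_eq_square algebra_simps)
    qed
    have "(\<Sum>i\<in>?I. \<Sum>j\<in>?I - {i}. ?f i j x) = (\<Sum>i\<in>?I. \<Sum>j\<in>?I - {i}. r p i * r x i + r p j * r x j) * poly q (u x) - (\<Sum>i\<in>?I. \<Sum>j\<in>?I - {i}. (w i j x)\<^sup>2) * poly (pderiv q) (u x)"
      by (simp only: sum_subtractf sum_distrib_right)
    then show ?thesis unfolding a b by (simp only: mult.assoc)
  qed
  obtain B where B: "B \<ge> 0" "\<forall>x\<in>?P. \<bar>poly q (u x)\<bar> \<le> B" using poly_u_bounded by blast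
  obtain B' where B': "B' \<ge> 0" "\<forall>x\<in>?P. \<bar>poly (pderiv q) (u x)\<bar> \<le> B'" using poly_u_bounded by blast
  have pr: "\<bar>r p k * r x l\<bar> \<le> 1" if "x \<in> ?P" for k l x
    unfolding abs_mult using sphere_entry(4)[OF p, of k] sphere_entry(4)[OF that, of l] by (intro mult_le_one) auto
  have i: "integrable M (?f i j)" for i j
  proof (rule integrable_bdd)
    show "?f i j \<in> borel_measurable M" unfolding w_def by measurable
    fix x assume x: "x \<in> ?P"
    have "\<bar>w i j x\<bar> \<le> 2" unfolding w_def using pr[OF x, of i j] pr[OF x, of j i] by linarith
    then have "(w i j x)\<^sup>2 \<le> 2\<^sup>2" by (subst abs_le_square_iff[symmetric]) simp
    then have 1: "\<bar>(w i j x)\<^sup>2 * poly (pderiv q) (u x)\<bar> \<le> 4 * B'" unfolding abs_mult using B' x by (intro mult_mono) auto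
    have "\<bar>r p i * r x i + r p j * r x j\<bar> \<le> 2" using pr[OF x, of i i] pr[OF x, of j j] by linarith
    then have 2: "\<bar>(r p i * r x i + r p j * r x j) * poly q (u x)\<bar> \<le> 2 * B" unfolding abs_mult using B x by (intro mult_mono) auto
    show "\<bar>?f i j x\<bar> \<le> 2 * B + 4 * B'" using 1 2 by linarith
  qed
  have "0 = (\<Sum>i\<in>?I. \<Sum>j\<in>?I - {i}. \<integral>x. ?f i j x \<partial>M)"
  proof -
    have "(\<Sum>i\<in>?I. \<Sum>j\<in>?I - {i}. \<integral>x. ?f i j x \<partial>M) = 0"
      by (intro sum.neutral ballI sphere_flow) auto
    then show ?thesis ..
  qed
  also have "\<dots> = (\<integral>x. (\<Sum>i\<in>?I. \<Sum>j\<in>?I - {i}. ?f i j x) \<partial>M)"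
    by (subst Bochner_Integration.integral_sum; (intro Bochner_Integration.integrable_sum i)?)
       (intro sum.cong refl Bochner_Integration.integral_sum[symmetric] i)
  also have "\<dots> = (\<integral>x. 2 * (real d * u x * poly q (u x)) - 2 * ((1 - (u x)\<^sup>2) * poly (pderiv q) (u x)) \<partial>M)"
    by (intro Bochner_Integration.integral_cong refl sum) (simp add: space_M)
  also have "\<dots> = 2 * (\<integral>x. real d * u x * poly q (u x) \<partial>M) - 2 * (\<integral>x. (1 - (u x)\<^sup>2) * poly (pderiv q) (u x) \<partial>M)"
  proof -
    have "integrable M (\<lambda>x. real d * u x * poly q (u x))"
    proof (rule integrable_bdd)
      fix x assume x: "x \<in> ?P"
      show "\<bar>real d * u x * poly q (u x)\<bar> \<le> (real d * 1) * B"
        unfolding abs_mult using u_bound[OF x] B x by (intro mult_mono) auto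
    qed measurable
    moreover have "integrable M (\<lambda>x. (1 - (u x)\<^sup>2) * poly (pderiv q) (u x))"
    proof (rule integrable_bdd)
      fix x assume x: "x \<in> ?P"
      have "(u x)\<^sup>2 \<le> 1" using u_bound[OF x] by (simp add: abs_square_le_1)
      then have "\<bar>1 - (u x)\<^sup>2\<bar> \<le> 1" using zero_le_power2[of "u x"] by linarith
      then show "\<bar>(1 - (u x)\<^sup>2) * poly (pderiv q) (u x)\<bar> \<le> 1 * B'"
        unfolding abs_mult using B' x by (intro mult_mono) auto
    qed measurable
    ultimately show ?thesis by simp
  qed
  finally show ?thesis by simp
qed

lemma jacobi_measure_sphere:
  "jacobi_measure (distr M borel (\<lambda>x. cos (geo_dist (Sphere d) p x))) ((real d - 2) / 2) ((real d - 2) / 2)"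
proof -
  have eq: "distr M borel (\<lambda>x. cos (geo_dist (Sphere d) p x)) = distr M borel u"
    by (intro distr_cong refl) (simp add: space_M cos_geo_dist_sphere del: points.simps)
  show ?thesis
    unfolding eq
  proof (intro jacobi_measure.intro jacobi_measure_axioms.intro)
    show "prob_space (distr M borel u)" by (rule prob_space_distr[OF u_measurable])
    show "AE v in distr M borel u. - 1 \<le> v \<and> v \<le> 1"
    proof (subst AE_distr_iff[OF u_measurable])
      show "AE x in M. - 1 \<le> u x \<and> u x \<le> 1"
        by (intro AE_I2) (use u_bound in \<open>simp add: space_M abs_le_iff minus_le_iff del: points.simps\<close>)
    qed simp
    fix q :: "real poly"
    have cm: "(\<lambda>v. (1 - v\<^sup>2) * poly (pderiv q) v) \<in> borel_measurable borel"
      "(\<lambda>v. (((real d - 2) / 2 + (real d - 2) / 2 + 2) * v + ((real d - 2) / 2 - (real d - 2) / 2)) * poly q v) \<in> borel_measurable borel"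
      by (intro borel_measurable_continuous_onI continuous_intros)+
    show "(\<integral>v. (1 - v\<^sup>2) * poly (pderiv q) v \<partial>distr M borel u) = (\<integral>v. (((real d - 2) / 2 + (real d - 2) / 2 + 2) * v + ((real d - 2) / 2 - (real d - 2) / 2)) * poly q v \<partial>distr M borel u)"
      unfolding integral_distr[OF u_measurable cm(1)] integral_distr[OF u_measurable cm(2)] pearson_sphere
      by simp
  qed (use d in auto)
qed

end

end

section \<open>The theorem\<close>

text \<open>Outside [-1, 1] no angle qualifies, so the definite description has one and the same
  arbitrary value there. With this the distance is measurable as a composition, whatever the range
  of \<open>mat_inner\<close>.\<close>

lemma borel_measurable_arccos: "arccos \<in> borel_measurable borel"
proof -
  have "arccos y = (if y \<in> {-1..1} then arccos (max (-1) (min 1 y)) else (THE x. False))" for y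
  proof (cases "y \<in> {-1..1}")
    case False
    then have "(\<lambda>x. 0 \<le> x \<and> x \<le> pi \<and> cos x = y) = (\<lambda>x. False)"
      using cos_le_one cos_ge_minus_one by (auto simp: fun_eq_iff)
    then show ?thesis using False by (simp only: arccos_def if_False)
  qed simp
  then have "arccos = (\<lambda>y. if y \<in> {-1..1} then arccos (max (-1) (min 1 y)) else (THE x. False))" by (rule ext)
  moreover have "(\<lambda>y. arccos (max (-1) (min 1 y))) \<in> borel_measurable borel"
    by (intro borel_measurable_continuous_onI continuous_intros) auto
  then have "(\<lambda>y. if y \<in> {-1..1} then arccos (max (-1) (min 1 y)) else (THE x. False)) \<in> borel_measurable borel"
    by (intro measurable_If_set) auto
  ultimately show ?thesis by (simp only:)
qed

text \<open>With m = 1, 2, 4, 8 the projective models have real dimension m (N - 1), so that 2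
  (\<sigma> + 1) = m (N - 1) and 2 (\<tau> + 1) = m.\<close>

lemma jacobi_measure_rank_one:
  assumes S: "admissible S" and p: "p \<in> points S" and M: "normalized_riemannian_measure S M"
  shows "jacobi_measure (distr M borel (\<lambda>x. cos (geo_dist S p x))) (sigma_par S) (tau_par S)"
proof -
  have prob: "prob_space M" using M by (simp add: normalized_riemannian_measure_def)
  have inv: "invariant_measure M S"
    using prob M by (simp add: invariant_measure_def invariant_measure_axioms_def)
  show ?thesis
  proof (cases S)
    case (Sphere d)
    then interpret sphere_measure M d
      using inv S by (simp add: sphere_measure_def sphere_measure_axioms_def)
    show ?thesis using jacobi_measure_sphere p by (simp add: Sphere sigma_par_def)
  next
    case (Proj_R d)
    then interpret proj_measure M S oct_R "d + 1" 1 octB_R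
      using inv S proj_model_R by (simp add: proj_measure_def)
    show ?thesis using p by (intro jacobi_measure_proj) (simp_all add: Proj_R sigma_par_def field_simps)
  next
    case (Proj_C d)
    then interpret proj_measure M S oct_C "d div 2 + 1" 2 octB_C
      using inv S proj_model_C by (simp add: proj_measure_def)
    have "real d = 2 * real (d div 2)" using S Proj_C by (simp add: real_of_nat_div)
    then show ?thesis using p by (intro jacobi_measure_proj) (simp_all add: Proj_C sigma_par_def field_simps)
  next
    case (Proj_H d)
    then interpret proj_measure M S oct_H "d div 4 + 1" 4 octB_H
      using inv S proj_model_H by (simp add: proj_measure_def)
    have "real d = 4 * real (d div 4)" using S Proj_H by (simp add: real_of_nat_div)
    then show ?thesis using p by (intro jacobi_measure_proj) (simp_all add: Proj_H sigma_par_def field_simps)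
  next
    case Proj_Cay
    then interpret proj_measure M S UNIV 3 8 octB_O
      using inv S proj_model_Cay by (simp add: proj_measure_def)
    show ?thesis using p by (intro jacobi_measure_proj) (simp_all add: Proj_Cay sigma_par_def)
  qed
qed

text \<open>The profile of a biinvariant function is a function of the distance, the law \<nu> is
  that of its cosine. The distance can be recovered because the argument of \<open>arccos\<close>
  lies in [-1, 1]: by Cauchy-Schwarz on the sphere, and by moving p to \<open>E00\<close> on a
  projective space.\<close>

lemma geo_dist_eq_arccos_cos:
  assumes S: "admissible S" and p: "p \<in> points S" and M: "normalized_riemannian_measure S M"
    and x: "x \<in> points S"
  shows "geo_dist S p x = arccos (cos (geo_dist S p x))"
proof -
  have prob: "prob_space M" using M by (simp add: normalized_riemannian_measure_def)
  have inv: "invariant_measure M S"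
    using prob M by (simp add: invariant_measure_def invariant_measure_axioms_def)
  have proj: "0 \<le> geo_dist S p x \<and> geo_dist S p x \<le> pi" if "proj_model S F N m Bs" for F N m Bs
  proof -
    interpret proj_model S F N m Bs by fact
    obtain g where g: "good_map S g" "g p = E00" using transitive[OF p] by blast
    have y: "g x \<in> points S" by (rule good_map_points[OF g(1) x])
    have "geo_dist S p x = geo_dist S (g p) (g x)"
      using g(1) p x by (simp add: good_map_def isometries_def)
    also have "\<dots> = arccos (2 * rr (g x) 0 - 1)" by (simp add: geo g(2) mat_inner_E00)
    finally show ?thesis
      using rr_nonneg[OF y, of 0] rr_le_1[OF y, of 0] arccos_bounded[of "2 * rr (g x) 0 - 1"] by simp
  qed
  have "0 \<le> geo_dist S p x \<and> geo_dist S p x \<le> pi"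
  proof (cases S)
    case (Sphere d)
    then interpret sphere_measure M d
      using inv S by (simp add: sphere_measure_def sphere_measure_axioms_def)
    have px: "p \<in> points (Sphere d)" "x \<in> points (Sphere d)" using p x Sphere by auto
    have "geo_dist S p x = arccos (\<Sum>k<d + 1. r p k * r x k)"
      using sphere_inner[OF px] by (simp add: geo_dist_def Sphere)
    then show ?thesis using u_bound[OF px] arccos_bounded[of "u p x"] by (simp add: u_def[OF px(1)] abs_le_iff)
  next
    case (Proj_R d)
    then show ?thesis using S proj[of oct_R "d + 1" 1 octB_R] proj_model_R by simp
  next
    case (Proj_C d)
    then show ?thesis using S proj[of oct_C "d div 2 + 1" 2 octB_C] proj_model_C by simp
  next
    case (Proj_H d)
    then show ?thesis using S proj[of oct_H "d div 4 + 1" 4 octB_H] proj_model_H by simp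
  next
    case Proj_Cay
    then show ?thesis using proj[of UNIV 3 8 octB_O] proj_model_Cay by simp
  qed
  then show ?thesis by (simp add: arccos_cos)
qed

text \<open>Zonal functions and data depend on x through v x = cos d(p, x), the data up to a null
  set. So norms, coefficients and the evolution are those of the law of v on the line, and null sets
  pull back along v.\<close>

theorem theorem1p5:
  fixes S :: rank_one_space and p :: oct_mat and M :: "oct_mat measure"
    and \<psi> :: "real \<Rightarrow> real" and f :: "oct_mat \<Rightarrow> complex" and \<alpha> :: real
  assumes "admissible S"
    and "p \<in> points S"
    and "normalized_riemannian_measure S M"
    and "\<psi> = (\<lambda>r. r\<^sup>2) \<or> \<psi> = (\<lambda>r. r * sqrt (1 + r\<^sup>2)) \<or> \<psi> = (\<lambda>r. sqrt (1 + r ^ 4))"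
    and "\<alpha> > 1 / 3"
    and "f \<in> sobolev_K_biinvariant S p M \<alpha>"
  shows "AE x in M. ((\<lambda>t. solution S p M \<psi> f x t) \<longlongrightarrow> f x) (at_right 0)"
proof -
  define v where "v x = cos (geo_dist S p x)" for x
  interpret J: jacobi_measure "distr M borel v" "sigma_par S" "tau_par S"
    unfolding v_def[abs_def] by (rule jacobi_measure_rank_one[OF assms(1-3)])
  interpret I: invariant_measure M S
    using assms(3) by (simp add: invariant_measure_def invariant_measure_axioms_def normalized_riemannian_measure_def)
  have spM: "space M = points S" by (rule I.space_M)
  have vm: "v \<in> borel_measurable M"
  proof -
    have i: "(\<lambda>x. mat_inner N p x) \<in> borel_measurable M" for N
      unfolding mat_inner_def by (intro I.measurable_M continuous_intros continuous_on_rot_entry)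
    have "cos \<in> borel_measurable (borel :: real measure)" "(\<lambda>y. 2 * y - 1) \<in> borel_measurable (borel :: real measure)"
      by (intro borel_measurable_continuous_onI continuous_intros)+
    from measurable_compose[OF borel_measurable_arccos this(1)]
      measurable_compose[OF measurable_compose[OF this(2) borel_measurable_arccos] this(1)]
    have "(\<lambda>y. cos (arccos y)) \<in> borel_measurable borel" "(\<lambda>y. cos (arccos (2 * y - 1))) \<in> borel_measurable borel" .
    from measurable_compose[OF i this(1)] measurable_compose[OF i this(2)] show ?thesis
      unfolding v_def[abs_def] geo_dist_def by (cases S) simp_all
  qed
  obtain g where g: "g \<in> borel_measurable borel" "AE x in M. f x = g (geo_dist S p x)"
    using assms(6) by (auto simp: sobolev_K_biinvariant_def K_biinvariant_def)
  have fm: "f \<in> borel_measurable M" and f2: "integrable M (\<lambda>x. (cmod (f x))\<^sup>2)"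
    and fs: "summable (\<lambda>n. (1 + (lam S n)\<^sup>2) powr \<alpha> * (cmod (fourier_coeff S p M f n))\<^sup>2)"
    using assms(6) by (auto simp: sobolev_K_biinvariant_def L2_fun_def)
  \<comment> \<open>The profile as a function of the cosine, with the clamp making it Borel on the
    whole line.\<close>
  define h where "h u = g (arccos (max (-1) (min 1 u)))" for u
  have hm: "h \<in> borel_measurable borel"
    unfolding h_def[abs_def] by (rule measurable_compose[OF J.measurable_arccos_clamp g(1)])
  have fh: "AE x in M. f x = h (v x)"
    using g(2) AE_space
  proof eventually_elim
    case (elim x)
    then have "geo_dist S p x = arccos (v x)"
      unfolding v_def by (intro geo_dist_eq_arccos_cos[OF assms(1-3)]) (simp add: spM)
    moreover have "max (-1) (min 1 (v x)) = v x" by (simp add: v_def)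
    ultimately show ?case using elim by (simp add: h_def)
  qed
  have lam: "lam S n = sqrt (J.ev n)" for n by (simp add: lam_def J.ev_def)
  have zon: "zonal S p n x = poly (jpoly (sigma_par S) (tau_par S) n) (v x)" for n x
    by (simp add: zonal_def v_def jacobi_poly_eq_poly)
  have pm: "poly q \<in> borel_measurable borel" for q :: "real poly"
    by (intro borel_measurable_continuous_onI continuous_intros)
  have "(LINT y|M. (zonal S p n y)\<^sup>2) = J.jnorm2 n" for n
    unfolding J.jnorm2_def zon by (subst integral_distr[OF vm]) (auto intro!: borel_measurable_power pm)
  then have zn: "zonal_normalized S p M n x = J.Z n (v x)" for n x
    by (simp add: zonal_normalized_def J.Z_def zon)
  have fc: "fourier_coeff S p M f n = (\<integral>u. h u * complex_of_real (J.Z n u) \<partial>distr M borel v)" for n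
  proof -
    have m: "(\<lambda>u. h u * complex_of_real (J.Z n u)) \<in> borel_measurable borel"
      using hm measurable_compose[OF J.Z_measurable borel_measurable_of_real] by (intro borel_measurable_times)
    have "fourier_coeff S p M f n = (\<integral>x. h (v x) * complex_of_real (J.Z n (v x)) \<partial>M)"
      unfolding fourier_coeff_def zn
    proof (rule integral_cong_AE)
      show "(\<lambda>x. f x * complex_of_real (J.Z n (v x))) \<in> borel_measurable M"
        by (intro borel_measurable_times fm measurable_compose[OF vm] measurable_compose[OF J.Z_measurable borel_measurable_of_real])
      show "(\<lambda>x. h (v x) * complex_of_real (J.Z n (v x))) \<in> borel_measurable M"
        by (rule measurable_compose[OF vm m])
      show "AE x in M. f x * complex_of_real (J.Z n (v x)) = h (v x) * complex_of_real (J.Z n (v x))"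
        using fh by eventually_elim simp
    qed
    also have "\<dots> = (\<integral>u. h u * complex_of_real (J.Z n u) \<partial>distr M borel v)"
      by (rule integral_distr[OF vm m, symmetric])
    finally show ?thesis .
  qed
  have h2: "integrable (distr M borel v) (\<lambda>u. (cmod (h u))\<^sup>2)"
  proof -
    have m: "(\<lambda>u. (cmod (h u))\<^sup>2) \<in> borel_measurable borel" using hm by measurable
    have "integrable M (\<lambda>x. (cmod (h (v x)))\<^sup>2)"
    proof (rule integrable_cong_AE_imp[OF f2])
      show "(\<lambda>x. (cmod (h (v x)))\<^sup>2) \<in> borel_measurable M" by (rule measurable_compose[OF vm m])
      show "AE x in M. (cmod (f x))\<^sup>2 = (cmod (h (v x)))\<^sup>2" using fh by eventually_elim simp
    qed
    then show ?thesis using integrable_distr_eq[OF vm m] by simp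
  qed
  have hs: "summable (\<lambda>n. (1 + J.ev n) powr \<alpha> * (cmod (fourier_coeff S p M f n))\<^sup>2)"
    using fs by (simp add: lam J.ev_nonneg)
  have "AE u in distr M borel v. ((\<lambda>t. \<Sum>n. exp (- \<i> * of_real (t * \<psi> (sqrt (J.ev n)))) * fourier_coeff S p M f n * of_real (J.Z n u)) \<longlongrightarrow> h u) (at_right 0)"
    by (rule J.AE_evolution_tendsto[OF assms(4,5) hm h2 fc hs])
  from AE_distrD[OF vm this]
  have "AE x in M. ((\<lambda>t. \<Sum>n. exp (- \<i> * of_real (t * \<psi> (sqrt (J.ev n)))) * fourier_coeff S p M f n * of_real (J.Z n (v x))) \<longlongrightarrow> h (v x)) (at_right 0)" .
  then show ?thesis
    using fh by eventually_elim (simp add: solution_def lam zn)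
qed

end
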